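(* Let $M_1$ and $M_2$ be smooth manifolds with specified cohomology classes $\mathfrak{l}_1 \in H^1(M_1;\mathbb{R})$ and $\mathfrak{l}_2 \in H^1(M_2;\mathbb{R})$. Let $\pi_j \colon M_1\times M_2 \to M_j$ be the projections. Then there exists a smooth manifold $M_1 \boxplus M_2$ (depending on $\mathfrak{l}_1$ and $\mathfrak{l}_2$) together with a covering map $r \colon M_1 \boxplus M_2 \to M_1 \times M_2$, canonical up to deck transformations, satisfying the following properties. (1) $(\pi_1 \circ r)^*\mathfrak{l}_1 = (\pi_2 \circ r)^*\mathfrak{l}_2$ in $H^1(M_1 \boxplus M_2;\mathbb{R})$. In fact, $r$ is the minimal covering of $M_1\times M_2$ with this property. (2) Given any smooth map $\phi \colon M_1 \to M_2$ such that $\phi^*\mathfrak{l}_2 = \mathfrak{l}_1$, there is a smooth embedding $\Gamma(\phi) \colon M_1 \to M_1 \boxplus M_2$, canonical up to the deck group action of $r$, which lifts the usual graph $\Gamma_0(\phi) \colon M_1 \to M_1 \times M_2$, $x \mapsto (x,\phi(x))$, i.e. $\Gamma_0(\phi) = r \circ \Gamma(\phi)$. (3) If $(M_1,\mathfrak{l}_1) = (M_2,\mathfrak{l}_2) =: (M,\mathfrak{l})$, then the covering map $r$ is canonical. In this case, given any smooth family of diffeomorphisms $\phi_t \in \mathrm{Diff}(M)$, $t\in[0,1]$, with $\phi_0 = \mathrm{Id}$, the lifts $\Gamma(\phi_t)$ may be chosen canonically, and there is a canonical smooth family of diffeomorphisms $\psi_t \in \mathrm{Diff}(M \boxplus M)$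 lifting $\mathrm{Id} \times \phi_t \in \mathrm{Diff}(M \times M)$ such that $\Gamma(\phi_t) = \psi_t \circ \Gamma(\mathrm{Id})$. Furthermore, the intersection points of the images of $\Gamma(\mathrm{Id})$ and $\Gamma(\phi_1)$ are in bijective correspondence with those fixed points $x \in \mathrm{Fix}(\phi_1)$ such that $\langle \mathfrak{l}, [\phi_t(x)] \rangle = 0$, where $[\phi_t(x)]$ denotes the class of the loop $t \mapsto \phi_t(x)$, $t \in [0,1]$; and an intersection point is transverse if and only if the corresponding fixed point of $\phi_1$ is non-degenerate.
   Context: A fixed point $x$ of a diffeomorphism $\phi$ is non-degenerate if $1$ is not an eigenvalue of $d\phi_x$. Construction of $M_1 \boxplus M_2$. For connected $M$ and $\mathfrak{l}\in H^1(M;\mathbb{R})$, regarded as a homomorphism $\rho_{\mathfrak{l}}\colon \pi_1(M)\to\mathbb{R}$, a trivializing cover is a connected covering $q\colon \widetilde M\to M$ corresponding to a normal subgroup $N\le \ker\rho_{\mathfrak{l}}$ of $\pi_1(M)$ (so $q^*\mathfrak{l}=0$); its deck group is $\Gamma=\pi_1(M)/N$, and $\rho_{\mathfrak{l}}$ induces $\overline\rho_{\mathfrak{l}}\colon\Gamma\to\mathbb{R}$. For connected $M_1,M_2$ with trivializing covers $\widetilde M_i\to M_i$ with deck groups $\Gamma_i$ and homomorphisms $\overline\rho_i \colon \Gamma_i\to\mathbb{R}$, set $\Gamma_{12}=\{(g_1,g_2)\in\Gamma_1\times\Gamma_2 : \overline\rho_1(g_1)=\overline\rho_2(g_2)\}$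 and $M_1\boxplus M_2 = (\widetilde M_1\times\widetilde M_2)/\Gamma_{12}$, with $r$ the induced covering of $M_1\times M_2$. For disconnected manifolds one takes the disjoint union of $A\boxplus B$ over all components $A$ of $M_1$ and $B$ of $M_2$. Meaning of terms. "Minimal" in (1): the preimage under $r$ of each component of $M_1\times M_2$ is connected, and every covering $p\colon N\to C$ with $N$ connected and $C$ a component of $M_1\times M_2$, such that $(\pi_1\circ p)^*\mathfrak{l}_1=(\pi_2\circ p)^*\mathfrak{l}_2$, factors through $r$. "Canonical up to deck transformations": any two such $r$ are isomorphic as coverings of $M_1\times M_2$, the isomorphism being well defined up to deck transformations; likewise any two choices of $\Gamma(\phi)$ differ by a deck transformation of $r$. "Canonical" for $r$ in (3): one uses the same trivializing cover $q\colon\widetilde M\to M$ for both factors, and the diagonal $\widetilde M\to\widetilde M\times\widetilde M$ descends to a distinguished lift $\Gamma(\mathrm{Id})\colon M\to M\boxplus M$ of the diagonal of $M\times M$; any two such pairs $(r,\Gamma(\mathrm{Id}))$ are related by an isomorphism of coverings over $M\times M$ matching the distinguished lifts, which is unique if $M$ is connected. "Canonical" for $\psi_t$ in (3): $\psi_t$ is the unique smooth family of lifts of $\mathrm{Id}\times\phi_t$ with $\psi_0=\mathrm{Id}$. *)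

theory Defs
  imports "HOL-Analysis.Analysis" "HOL-Homology.Homology" "HOL-Algebra.Coset"
begin

section \<open>Smooth manifolds\<close>

text \<open>
  Here \<open>V\<close> spans the admissible directions and \<open>U\<close> is the domain. The set \<open>U\<close> is relatively open
  in a linear subspace \<open>V\<close>, or in \<open>[0,1] \<times> V'\<close> with \<open>V = \<real> \<times> V'\<close>; in the second case the
  derivatives at the endpoints are one-sided. A function is \<open>C\<close>-(k+1) iff it is continuous and its
  derivatives in all directions exist and are \<open>C\<close>-k.
\<close>

primrec Ck_on :: "nat \<Rightarrow> 'e set \<Rightarrow> 'e set \<Rightarrow> ('e::real_normed_vector \<Rightarrow> 'f::real_normed_vector) \<Rightarrow> bool" where
  "Ck_on 0 V U f = continuous_on U f"
| "Ck_on (Suc k) V U f =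
     (continuous_on U f \<and>
      (\<forall>v\<in>V. \<exists>g. (\<forall>x\<in>U. ((\<lambda>s. f (x + s *\<^sub>R v)) has_vector_derivative g x)
                        (at 0 within {s. x + s *\<^sub>R v \<in> U})) \<and> Ck_on k V U g))"

definition smooth_on :: "'e set \<Rightarrow> 'e set \<Rightarrow> ('e::real_normed_vector \<Rightarrow> 'f::real_normed_vector) \<Rightarrow> bool" where
  "smooth_on V U f \<longleftrightarrow> (\<forall>k. Ck_on k V U f)"

text \<open>
  The model of a manifold is a linear subspace of a Euclidean space (rather than the whole type), so
  that every dimension, including 0, is covered. The atlas need not be maximal.
\<close>

record ('a, 'e) mfd =
  mtop :: "'a topology"
  model :: "'e set"
  atlas :: "('a set \<times> ('a \<Rightarrow> 'e)) set"

abbreviation mspc :: "('a, 'e) mfd \<Rightarrow> 'a set" where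
  "mspc M \<equiv> topspace (mtop M)"

definition smooth_manifold :: "('a, 'e::euclidean_space) mfd \<Rightarrow> bool" where
  "smooth_manifold M \<longleftrightarrow>
     Hausdorff_space (mtop M) \<and> second_countable (mtop M) \<and> subspace (model M) \<and>
     (\<forall>(U, \<xi>)\<in>atlas M. openin (mtop M) U \<and> openin (top_of_set (model M)) (\<xi> ` U) \<and>
        homeomorphic_map (subtopology (mtop M) U) (top_of_set (\<xi> ` U)) \<xi>) \<and>
     \<Union>(fst ` atlas M) = mspc M \<and>
     (\<forall>(U, \<xi>)\<in>atlas M. \<forall>(W, \<psi>)\<in>atlas M.
        smooth_on (model M) (\<xi> ` (U \<inter> W)) (\<psi> \<circ> inv_into U \<xi>))"

definition smooth_map ::
  "('a, 'e::euclidean_space) mfd \<Rightarrow> ('b, 'f::euclidean_space) mfd \<Rightarrow> ('a \<Rightarrow> 'b) \<Rightarrow> bool" where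
  "smooth_map M N f \<longleftrightarrow>
     continuous_map (mtop M) (mtop N) f \<and>
     (\<forall>(U, \<xi>)\<in>atlas M. \<forall>(W, \<psi>)\<in>atlas N.
        smooth_on (model M) (\<xi> ` {x\<in>U. f x \<in> W}) (\<psi> \<circ> f \<circ> inv_into U \<xi>))"

definition diffeo ::
  "('a, 'e::euclidean_space) mfd \<Rightarrow> ('b, 'f::euclidean_space) mfd \<Rightarrow> ('a \<Rightarrow> 'b) \<Rightarrow> bool" where
  "diffeo M N f \<longleftrightarrow>
     smooth_map M N f \<and>
     (\<exists>g. smooth_map N M g \<and> (\<forall>x\<in>mspc M. g (f x) = x) \<and> (\<forall>y\<in>mspc N. f (g y) = y))"

definition smooth_family ::
  "('a, 'e::euclidean_space) mfd \<Rightarrow> ('b, 'f::euclidean_space) mfd \<Rightarrow> (real \<Rightarrow> 'a \<Rightarrow> 'b) \<Rightarrow> bool" where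
  "smooth_family M N F \<longleftrightarrow>
     continuous_map (prod_topology (top_of_set {0..1}) (mtop M)) (mtop N) (\<lambda>(t, x). F t x) \<and>
     (\<forall>(U, \<xi>)\<in>atlas M. \<forall>(W, \<psi>)\<in>atlas N.
        smooth_on (UNIV \<times> model M)
          {(t, u). t \<in> {0..1} \<and> u \<in> \<xi> ` U \<and> F t (inv_into U \<xi> u) \<in> W}
          (\<lambda>(t, u). \<psi> (F t (inv_into U \<xi> u))))"

definition prod_mfd :: "('a, 'e) mfd \<Rightarrow> ('b, 'f) mfd \<Rightarrow> ('a \<times> 'b, 'e \<times> 'f) mfd" where
  "prod_mfd M N =
     \<lparr> mtop = prod_topology (mtop M) (mtop N), model = model M \<times> model N,
       atlas = {(U \<times> W, map_prod \<xi> \<psi>) | U \<xi> W \<psi>. (U, \<xi>) \<in> atlas M \<and> (W, \<psi>) \<in> atlas N} \<rparr>"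

definition open_submfd :: "('a, 'e) mfd \<Rightarrow> 'a set \<Rightarrow> ('a, 'e) mfd" where
  "open_submfd M S =
     \<lparr> mtop = subtopology (mtop M) S, model = model M,
       atlas = (\<lambda>(U, \<xi>). (U \<inter> S, \<xi>)) ` atlas M \<rparr>"

text \<open>The directional derivative, at \<open>x\<close>, of the expression of \<open>f\<close> in the charts \<open>(U, \<xi>)\<close> and
  \<open>\<psi>\<close>, that is, the differential of \<open>f\<close> at \<open>x\<close> in these charts.\<close>

definition chart_deriv ::
  "'a set \<Rightarrow> ('a \<Rightarrow> 'e::euclidean_space) \<Rightarrow> ('b \<Rightarrow> 'f::euclidean_space) \<Rightarrow> ('a \<Rightarrow> 'b) \<Rightarrow> 'a \<Rightarrow> 'e \<Rightarrow> 'f" where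
  "chart_deriv U \<xi> \<psi> f x v =
     vector_derivative (\<lambda>s. \<psi> (f (inv_into U \<xi> (\<xi> x + s *\<^sub>R v)))) (at 0)"

definition immersion ::
  "('a, 'e::euclidean_space) mfd \<Rightarrow> ('b, 'f::euclidean_space) mfd \<Rightarrow> ('a \<Rightarrow> 'b) \<Rightarrow> bool" where
  "immersion M N f \<longleftrightarrow>
     smooth_map M N f \<and>
     (\<forall>(U, \<xi>)\<in>atlas M. \<forall>(W, \<psi>)\<in>atlas N. \<forall>x\<in>U. f x \<in> W \<longrightarrow>
        inj_on (chart_deriv U \<xi> \<psi> f x) (model M))"

definition smooth_embedding ::
  "('a, 'e::euclidean_space) mfd \<Rightarrow> ('b, 'f::euclidean_space) mfd \<Rightarrow> ('a \<Rightarrow> 'b) \<Rightarrow> bool" where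
  "smooth_embedding M N f \<longleftrightarrow> immersion M N f \<and> embedding_map (mtop M) (mtop N) f"

text \<open>The fixed point \<open>x\<close> of \<open>\<phi>\<close> is non-degenerate: \<open>1\<close> is not an eigenvalue of the differential.\<close>

definition nondegenerate_at :: "('a, 'e::euclidean_space) mfd \<Rightarrow> ('a \<Rightarrow> 'a) \<Rightarrow> 'a \<Rightarrow> bool" where
  "nondegenerate_at M \<phi> x \<longleftrightarrow>
     (\<forall>(U, \<xi>)\<in>atlas M. x \<in> U \<longrightarrow>
        \<not> (\<exists>v\<in>model M. v \<noteq> 0 \<and> chart_deriv U \<xi> \<xi> \<phi> x v = v))"

text \<open>For embeddings \<open>f\<close> and \<open>g\<close> the tangent spaces of the images are the images of the
  differentials; at a transverse intersection point they span the tangent space of \<open>X\<close>.\<close>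

definition transverse_at ::
  "('a, 'e::euclidean_space) mfd \<Rightarrow> ('b, 'f::euclidean_space) mfd \<Rightarrow> ('x, 'g::euclidean_space) mfd
     \<Rightarrow> ('a \<Rightarrow> 'x) \<Rightarrow> ('b \<Rightarrow> 'x) \<Rightarrow> 'x \<Rightarrow> bool" where
  "transverse_at M N X f g p \<longleftrightarrow>
     (\<forall>x\<in>mspc M. \<forall>y\<in>mspc N. f x = p \<and> g y = p \<longrightarrow>
       (\<forall>(U, \<xi>)\<in>atlas M. \<forall>(U', \<xi>')\<in>atlas N. \<forall>(W, \<psi>)\<in>atlas X.
          x \<in> U \<and> y \<in> U' \<and> p \<in> W \<longrightarrow>
          {chart_deriv U \<xi> \<psi> f x u + chart_deriv U' \<xi>' \<psi> g y v | u v. u \<in> model M \<and> v \<in> model N}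
            = model X))"

section \<open>Coverings\<close>

definition covering_map :: "'a topology \<Rightarrow> 'b topology \<Rightarrow> ('a \<Rightarrow> 'b) \<Rightarrow> bool" where
  "covering_map T X q \<longleftrightarrow>
     continuous_map T X q \<and> q ` topspace T = topspace X \<and>
     (\<forall>x\<in>topspace X. \<exists>U \<V>. openin X U \<and> x \<in> U \<and> \<Union>\<V> = {y\<in>topspace T. q y \<in> U} \<and>
        pairwise disjnt \<V> \<and>
        (\<forall>V\<in>\<V>. openin T V \<and> homeomorphic_map (subtopology T V) (subtopology X U) q))"

definition smooth_covering ::
  "('a, 'e::euclidean_space) mfd \<Rightarrow> ('b, 'f::euclidean_space) mfd \<Rightarrow> ('a \<Rightarrow> 'b) \<Rightarrow> bool" where
  "smooth_covering X M r \<longleftrightarrow>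
     smooth_map X M r \<and> r ` mspc X = mspc M \<and>
     (\<forall>x\<in>mspc M. \<exists>U \<V>. openin (mtop M) U \<and> x \<in> U \<and> \<Union>\<V> = {y\<in>mspc X. r y \<in> U} \<and>
        pairwise disjnt \<V> \<and>
        (\<forall>V\<in>\<V>. openin (mtop X) V \<and> diffeo (open_submfd X V) (open_submfd M U) r))"

text \<open>Isomorphisms of smooth coverings of the same manifold; for \<open>X' = X\<close>, \<open>r' = r\<close> these are the
  deck transformations of \<open>r\<close>.\<close>

definition cover_iso ::
  "('a, 'e::euclidean_space) mfd \<Rightarrow> ('a \<Rightarrow> 'c) \<Rightarrow> ('b, 'f::euclidean_space) mfd \<Rightarrow> ('b \<Rightarrow> 'c)
     \<Rightarrow> ('a \<Rightarrow> 'b) \<Rightarrow> bool" where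
  "cover_iso X r X' r' f \<longleftrightarrow> diffeo X X' f \<and> (\<forall>p\<in>mspc X. r' (f p) = r p)"

section \<open>First cohomology with real coefficients\<close>

text \<open>Singular cochains are real functions on the singular simplices, set to 0 elsewhere; a
  cohomology class is a coset of cocycles modulo coboundaries.\<close>

type_synonym 'a cochain = "((nat \<Rightarrow> real) \<Rightarrow> 'a) \<Rightarrow> real"

definition cochain :: "nat \<Rightarrow> 'a topology \<Rightarrow> 'a cochain \<Rightarrow> bool" where
  "cochain p X c \<longleftrightarrow> (\<forall>\<sigma>. \<not> singular_simplex p X \<sigma> \<longrightarrow> c \<sigma> = 0)"

definition cochain_eval :: "'a cochain \<Rightarrow> 'a chain \<Rightarrow> real" where
  "cochain_eval c \<xi> = (\<Sum>\<sigma>\<in>Poly_Mapping.keys \<xi>. of_int (Poly_Mapping.lookup \<xi> \<sigma>) * c \<sigma>)"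

definition coboundary :: "nat \<Rightarrow> 'a topology \<Rightarrow> 'a cochain \<Rightarrow> 'a cochain" where
  "coboundary p X c = (\<lambda>\<sigma>. if singular_simplex (Suc p) X \<sigma>
     then cochain_eval c (chain_boundary (Suc p) (frag_of \<sigma>)) else 0)"

definition H1_class :: "'a topology \<Rightarrow> 'a cochain \<Rightarrow> 'a cochain set" where
  "H1_class X z = {(\<lambda>\<sigma>. z \<sigma> + coboundary 0 X b \<sigma>) | b. cochain 0 X b}"

definition H1 :: "'a topology \<Rightarrow> 'a cochain set set" where
  "H1 X = H1_class X ` {z. cochain 1 X z \<and> coboundary 1 X z = (\<lambda>_. 0)}"

definition H1_pullback :: "'b topology \<Rightarrow> ('b \<Rightarrow> 'a) \<Rightarrow> 'a cochain set \<Rightarrow> 'b cochain set" where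
  "H1_pullback Y f l =
     (\<Union>z\<in>l. H1_class Y (\<lambda>\<sigma>. if singular_simplex 1 Y \<sigma> then z (simplex_map 1 f \<sigma>) else 0))"

text \<open>The value of a class on a loop \<open>\<gamma>\<close> parametrized by \<open>[0,1]\<close>, regarded as a singular
  1-simplex; for a loop it does not depend on the cocycle \<open>z\<close>.\<close>

definition H1_eval :: "'a cochain set \<Rightarrow> (real \<Rightarrow> 'a) \<Rightarrow> real" where
  "H1_eval l \<gamma> = (THE v. \<exists>z\<in>l. v = z (restrict (\<lambda>u. \<gamma> (u 1)) (standard_simplex 1)))"

section \<open>Fundamental group and trivializing covers\<close>

definition path_class :: "'a topology \<Rightarrow> (real \<Rightarrow> 'a) \<Rightarrow> (real \<Rightarrow> 'a) set" where
  "path_class X \<gamma> =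
     {\<delta>. homotopic_with (\<lambda>\<eta>. \<eta> 0 = \<gamma> 0 \<and> \<eta> 1 = \<gamma> 1) (top_of_set {0..1}) X \<gamma> \<delta>}"

definition path_join :: "(real \<Rightarrow> 'a) \<Rightarrow> (real \<Rightarrow> 'a) \<Rightarrow> real \<Rightarrow> 'a" where
  "path_join \<gamma> \<delta> = (\<lambda>t. if t \<le> 1/2 then \<gamma> (2 * t) else \<delta> (2 * t - 1))"

definition fundamental_group :: "'a topology \<Rightarrow> 'a \<Rightarrow> (real \<Rightarrow> 'a) set monoid" where
  "fundamental_group X x =
     \<lparr> carrier = path_class X ` {\<gamma>. pathin X \<gamma> \<and> \<gamma> 0 = x \<and> \<gamma> 1 = x},
       monoid.mult = (\<lambda>a b. \<Union>\<gamma>\<in>a. \<Union>\<delta>\<in>b. path_class X (path_join \<gamma> \<delta>)),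
       one = path_class X (\<lambda>_. x) \<rparr>"

definition pi1_map :: "('b \<Rightarrow> 'a) \<Rightarrow> 'a topology \<Rightarrow> (real \<Rightarrow> 'b) set \<Rightarrow> (real \<Rightarrow> 'a) set" where
  "pi1_map q X a = (\<Union>\<gamma>\<in>a. path_class X (q \<circ> \<gamma>))"

text \<open>The homomorphism from the fundamental group to the reals given by the class \<open>l\<close>.\<close>

definition pi1_hom :: "'a cochain set \<Rightarrow> (real \<Rightarrow> 'a) set \<Rightarrow> real" where
  "pi1_hom l a = (THE v. \<exists>\<gamma>\<in>a. v = H1_eval l \<gamma>)"

text \<open>For a disconnected base a trivializing cover is the disjoint union of trivializing covers of
  the components.\<close>

definition trivializing_cover ::
  "'a topology \<Rightarrow> 'a cochain set \<Rightarrow> 't topology \<Rightarrow> ('t \<Rightarrow> 'a) \<Rightarrow> bool" where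
  "trivializing_cover X l T q \<longleftrightarrow>
     covering_map T X q \<and>
     (\<forall>A\<in>connected_components_of X. connectedin T {y\<in>topspace T. q y \<in> A}) \<and>
     (\<forall>y\<in>topspace T.
        let N = pi1_map q X ` carrier (fundamental_group T y)
        in N \<lhd> fundamental_group X (q y) \<and> (\<forall>a\<in>N. pi1_hom l a = 0))"

text \<open>The part of the covering lying over the component \<open>A\<close> of the base.\<close>

definition cover_over :: "'t topology \<Rightarrow> ('t \<Rightarrow> 'a) \<Rightarrow> 'a set \<Rightarrow> 't topology" where
  "cover_over T q A = subtopology T {y\<in>topspace T. q y \<in> A}"

definition deck_group :: "'t topology \<Rightarrow> ('t \<Rightarrow> 'a) \<Rightarrow> 'a set \<Rightarrow> ('t \<Rightarrow> 't) set" where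
  "deck_group T q A =
     {g. homeomorphic_map (cover_over T q A) (cover_over T q A) g \<and>
         (\<forall>y\<in>topspace (cover_over T q A). q (g y) = q y)}"

text \<open>The induced homomorphism on the deck group: \<open>g\<close> corresponds to the classes of the loops
  \<open>q \<circ> \<gamma>\<close>, where \<open>\<gamma>\<close> is a path upstairs from a point \<open>y\<close> to \<open>g y\<close>.\<close>

definition deck_hom :: "'a cochain set \<Rightarrow> 't topology \<Rightarrow> ('t \<Rightarrow> 'a) \<Rightarrow> 'a set \<Rightarrow> ('t \<Rightarrow> 't) \<Rightarrow> real" where
  "deck_hom l T q A g =
     (THE v. \<exists>\<gamma>. pathin (cover_over T q A) \<gamma> \<and> \<gamma> 1 = g (\<gamma> 0) \<and> v = H1_eval l (q \<circ> \<gamma>))"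

section \<open>The box sum of two manifolds with cohomology classes\<close>

definition deck12 ::
  "'a cochain set \<Rightarrow> 't topology \<Rightarrow> ('t \<Rightarrow> 'a) \<Rightarrow> 'a set
     \<Rightarrow> 'b cochain set \<Rightarrow> 's topology \<Rightarrow> ('s \<Rightarrow> 'b) \<Rightarrow> 'b set \<Rightarrow> (('t \<Rightarrow> 't) \<times> ('s \<Rightarrow> 's)) set" where
  "deck12 l1 T1 q1 A l2 T2 q2 B =
     {(g1, g2). g1 \<in> deck_group T1 q1 A \<and> g2 \<in> deck_group T2 q2 B \<and>
        deck_hom l1 T1 q1 A g1 = deck_hom l2 T2 q2 B g2}"

definition box_orbit ::
  "'a topology \<Rightarrow> 'a cochain set \<Rightarrow> 't topology \<Rightarrow> ('t \<Rightarrow> 'a)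
     \<Rightarrow> 'b topology \<Rightarrow> 'b cochain set \<Rightarrow> 's topology \<Rightarrow> ('s \<Rightarrow> 'b) \<Rightarrow> 't \<times> 's \<Rightarrow> ('t \<times> 's) set" where
  "box_orbit X1 l1 T1 q1 X2 l2 T2 q2 = (\<lambda>(x, y).
     {(g1 x, g2 y) | g1 g2. (g1, g2) \<in>
        deck12 l1 T1 q1 (connected_component_of_set X1 (q1 x))
               l2 T2 q2 (connected_component_of_set X2 (q2 y))})"

definition quotient_topology :: "'a topology \<Rightarrow> ('a \<Rightarrow> 'b) \<Rightarrow> 'b topology" where
  "quotient_topology X h =
     topology (\<lambda>U. U \<subseteq> h ` topspace X \<and> openin X {x\<in>topspace X. h x \<in> U})"

text \<open>The smooth structure on \<open>X\<close> for which the local homeomorphism \<open>r\<close> is a local diffeomorphism.\<close>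

definition pullback_mfd :: "'x topology \<Rightarrow> ('x \<Rightarrow> 'a) \<Rightarrow> ('a, 'e) mfd \<Rightarrow> ('x, 'e) mfd" where
  "pullback_mfd X r M =
     \<lparr> mtop = X, model = model M,
       atlas = {(V, \<xi> \<circ> r) | V U \<xi>. openin X V \<and> (U, \<xi>) \<in> atlas M \<and> r ` V \<subseteq> U \<and>
         openin (mtop M) (r ` V) \<and>
         homeomorphic_map (subtopology X V) (subtopology (mtop M) (r ` V)) r} \<rparr>"

text \<open>The covering \<open>r\<close>; both coverings are constant on orbits, so the choice is immaterial.\<close>

definition box_proj :: "('t \<Rightarrow> 'a) \<Rightarrow> ('s \<Rightarrow> 'b) \<Rightarrow> ('t \<times> 's) set \<Rightarrow> 'a \<times> 'b" where
  "box_proj q1 q2 P = map_prod q1 q2 (SOME z. z \<in> P)"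

definition boxplus ::
  "('a, 'e) mfd \<Rightarrow> 'a cochain set \<Rightarrow> 't topology \<Rightarrow> ('t \<Rightarrow> 'a)
     \<Rightarrow> ('b, 'f) mfd \<Rightarrow> 'b cochain set \<Rightarrow> 's topology \<Rightarrow> ('s \<Rightarrow> 'b) \<Rightarrow> (('t \<times> 's) set, 'e \<times> 'f) mfd" where
  "boxplus M1 l1 T1 q1 M2 l2 T2 q2 =
     pullback_mfd
       (quotient_topology (prod_topology T1 T2) (box_orbit (mtop M1) l1 T1 q1 (mtop M2) l2 T2 q2))
       (box_proj q1 q2) (prod_mfd M1 M2)"

text \<open>The map that the diagonal of the product of \<open>T\<close> with itself induces on \<open>M\<close>.\<close>

definition diag_lift ::
  "('a, 'e) mfd \<Rightarrow> 'a cochain set \<Rightarrow> 't topology \<Rightarrow> ('t \<Rightarrow> 'a) \<Rightarrow> 'a \<Rightarrow> ('t \<times> 't) set" where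
  "diag_lift M l T q x =
     (let y = (SOME y. y \<in> topspace T \<and> q y = x)
      in box_orbit (mtop M) l T q (mtop M) l T q (y, y))"

section \<open>Properties of coverings of the product\<close>

definition equalizes ::
  "'a cochain set \<Rightarrow> 'b cochain set \<Rightarrow> 'n topology \<Rightarrow> ('n \<Rightarrow> 'a \<times> 'b) \<Rightarrow> bool" where
  "equalizes l1 l2 N p \<longleftrightarrow> H1_pullback N (fst \<circ> p) l1 = H1_pullback N (snd \<circ> p) l2"

text \<open>The type argument is the type of the points of the competing coverings \<open>N\<close>, over which one
  cannot quantify inside the logic.\<close>

definition minimal_equalizing ::
  "'n itself \<Rightarrow> 'a topology \<Rightarrow> 'a cochain set \<Rightarrow> 'b topology \<Rightarrow> 'b cochain set
     \<Rightarrow> 'x topology \<Rightarrow> ('x \<Rightarrow> 'a \<times> 'b) \<Rightarrow> bool" where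
  "minimal_equalizing _ X1 l1 X2 l2 X r \<longleftrightarrow>
     (\<forall>C\<in>connected_components_of (prod_topology X1 X2). connectedin X {y\<in>topspace X. r y \<in> C}) \<and>
     (\<forall>C\<in>connected_components_of (prod_topology X1 X2). \<forall>(N :: 'n topology) p.
        connected_space N \<and> covering_map N (subtopology (prod_topology X1 X2) C) p \<and>
        equalizes l1 l2 N p \<longrightarrow>
        (\<exists>f. covering_map N (subtopology X {y\<in>topspace X. r y \<in> C}) f \<and>
             (\<forall>n\<in>topspace N. r (f n) = p n)))"

definition graph_lift ::
  "('a, 'e::euclidean_space) mfd \<Rightarrow> ('x, 'g::euclidean_space) mfd \<Rightarrow> ('x \<Rightarrow> 'a \<times> 'b)
     \<Rightarrow> ('a \<Rightarrow> 'b) \<Rightarrow> ('a \<Rightarrow> 'x) \<Rightarrow> bool" where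
  "graph_lift M1 X r \<phi> G \<longleftrightarrow> smooth_embedding M1 X G \<and> (\<forall>x\<in>mspc M1. r (G x) = (x, \<phi> x))"

text \<open>A smooth family of self-maps of \<open>X\<close> starting at the identity and lifting \<open>Id \<times> \<phi>\<^sub>t\<close>.\<close>

definition family_lift ::
  "('x, 'g::euclidean_space) mfd \<Rightarrow> ('x \<Rightarrow> 'a \<times> 'b) \<Rightarrow> (real \<Rightarrow> 'b \<Rightarrow> 'b) \<Rightarrow> (real \<Rightarrow> 'x \<Rightarrow> 'x) \<Rightarrow> bool" where
  "family_lift X r \<phi> \<psi> \<longleftrightarrow>
     smooth_family X X \<psi> \<and> (\<forall>p\<in>mspc X. \<psi> 0 p = p) \<and>
     (\<forall>t\<in>{0..1}. \<forall>p\<in>mspc X. r (\<psi> t p) = map_prod id (\<phi> t) (r p))"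

end

theory Submission
  imports Defs
begin

text \<open>
  A covering is determined by which paths in it are closed. For a trivializing cover these are the paths whose
  projection is a loop on which the class vanishes; for the box sum they are the paths whose projection to
  \<open>M1 \<times> M2\<close> is a loop on whose two components the classes take the same value. The covering properties of the
  box sum (uniqueness, minimality, lifts of graphs) follow from this by path lifting, and the smooth statements
  hold because its charts are those of the product. At a fixed point \<open>x\<close> the two tangent spaces are the graphs of
  the identity and of \<open>d\<phi>\<close>; they span iff \<open>d\<phi> - id\<close> is onto, hence iff it is injective.
\<close>

section \<open>Paths\<close>

text \<open>Paths are preferred to subgroups of fundamental groups because the manifolds may be
  disconnected: a condition on paths involves no base points and treats all components at once.
  Normality of the subgroup enters through one fact: whether a lift of a path is closed does not
  depend on where in the fibre it starts. This yields deck transformations between any two points of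
  a fibre. Hence two points of the product of the covers lie in one orbit iff they have the same
  image and the two classes take the same value along a path between them; reversing and joining
  paths make this an equivalence relation. A cocycle is fixed in each class because its values are
  additive on all paths, while its values on loops determine the class. A trivializing cover is
  built with the whole kernel of the class as its subgroup, out of paths modulo equality of ends and
  value. Smoothness is defined by iterated directional derivatives, so the chain rule first requires
  a Frechet derivative. The lifted diffeomorphisms are inverted by lifting the family run backwards
  in time.\<close>

abbreviation "I01 \<equiv> top_of_set {0..1::real}"

lemma pathin_cong: "(\<And>t. t \<in> {0..1} \<Longrightarrow> f t = g t) \<Longrightarrow> pathin X f \<longleftrightarrow> pathin X g"
  unfolding pathin_def by (rule iffI; erule continuous_map_eq; simp)

lemma pathin_reparam:
  assumes "pathin X f" "continuous_on {0..1} h" "h ` {0..1} \<subseteq> {0..1}"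
  shows "pathin X (\<lambda>t. f (h t))"
proof -
  have "continuous_map I01 I01 h"
    using assms by (simp add: image_subset_iff_funcset)
  with assms(1) have "continuous_map I01 X (f \<circ> h)"
    unfolding pathin_def by (rule continuous_map_compose[rotated])
  thus ?thesis by (simp add: pathin_def comp_def)
qed

lemma pathin_reverse: "pathin X f \<Longrightarrow> pathin X (\<lambda>t. f (1 - t))"
  by (rule pathin_reparam) (simp_all add: image_subset_iff continuous_on_diff)

lemma pathin_initial_segment:
  assumes "pathin X f" "0 \<le> s" "s \<le> 1"
  shows "pathin X (\<lambda>t. f (s * t))"
proof (rule pathin_reparam[OF assms(1)])
  show "(*) s ` {0..1} \<subseteq> {0..1}" using assms(2,3) by (simp add: image_subset_iff mult_le_one)
qed (intro continuous_intros)

lemma pathin_subset: "pathin X f \<Longrightarrow> t \<in> {0..1} \<Longrightarrow> f t \<in> topspace X"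
  unfolding pathin_def continuous_map_def by auto

lemma path_join_ends [simp]:
  "path_join f g 0 = f 0" "path_join f g 1 = g 1" by (auto simp: path_join_def)

lemma path_join_comp: "h \<circ> path_join f g = path_join (h \<circ> f) (h \<circ> g)" by (auto simp: path_join_def)

lemma pathin_path_join:
  assumes f: "pathin X f" and g: "pathin X g" and "f 1 = g 0"
  shows "pathin X (path_join f g)"
  unfolding pathin_def path_join_def
proof (rule continuous_map_cases_le)
  have eq1: "subtopology I01 {x \<in> topspace I01. x \<le> 1/2} = top_of_set {0..1/2::real}"
    and eq2: "subtopology I01 {x \<in> topspace I01. 1/2 \<le> x} = top_of_set {1/2..1::real}"
    unfolding subtopology_subtopology by (rule arg_cong[of _ _ top_of_set], force)+
  have "continuous_map (top_of_set {0..1/2}) X (f \<circ> (\<lambda>t. 2 * t))"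
    by (rule continuous_map_compose[OF _ f[unfolded pathin_def]])
       (simp add: continuous_map_in_subtopology Pi_iff continuous_on_mult)
  thus "continuous_map (subtopology I01 {x \<in> topspace I01. x \<le> 1/2}) X (\<lambda>t. f (2 * t))"
    unfolding eq1 by (simp add: comp_def)
  have "continuous_map (top_of_set {1/2..1}) X (g \<circ> (\<lambda>t. 2 * t - 1))"
    by (rule continuous_map_compose[OF _ g[unfolded pathin_def]])
       (simp add: continuous_map_in_subtopology Pi_iff continuous_on_mult continuous_on_diff)
  thus "continuous_map (subtopology I01 {x \<in> topspace I01. 1/2 \<le> x}) X (\<lambda>t. g (2 * t - 1))"
    unfolding eq2 by (simp add: comp_def)
  show "f (2 * t) = g (2 * t - 1)" if "t = 1/2" for t
  proof -
    have "2 * t = 1" "2 * t - 1 = 0" using that by auto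
    thus ?thesis using assms by metis
  qed
qed simp_all

lemma path_join_lift:
  assumes "\<forall>t\<in>{0..1}. q (f t) = f' t" "\<forall>t\<in>{0..1}. q (g t) = g' t"
  shows "\<forall>t\<in>{0..1}. q (path_join f g t) = path_join f' g' t"
  using assms by (auto simp: path_join_def)

lemma connected_space_unit_interval: "connected_space I01"
  using connectedin_absolute[of "euclideanreal" "{0..1::real}"] connected_Icc[of 0 "1::real"]
  by (simp add: connectedin_def)

section \<open>Coverings\<close>

lemma continuous_map_locally:
  assumes "\<And>x. x \<in> topspace X \<Longrightarrow> \<exists>U. openin X U \<and> x \<in> U \<and> continuous_map (subtopology X U) Y f"
  shows "continuous_map X Y f"
proof -
  obtain U where U: "\<And>x. x \<in> topspace X \<Longrightarrow> openin X (U x) \<and> x \<in> U x \<and> continuous_map (subtopology X (U x)) Y f"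
    using assms by metis
  show ?thesis by (rule pasting_lemma[where I="topspace X" and T=U and f="\<lambda>_. f"]) (use U in auto)
qed

text \<open>\<open>V y\<close> is the sheet over \<open>U\<close> through the point \<open>y\<close>.\<close>

definition sheets :: "'t topology \<Rightarrow> 'a topology \<Rightarrow> ('t \<Rightarrow> 'a) \<Rightarrow> 'a set \<Rightarrow> ('t \<Rightarrow> 't set) \<Rightarrow> bool" where
  "sheets T X q U V \<longleftrightarrow> openin X U \<and>
     (\<forall>y\<in>topspace T. q y \<in> U \<longrightarrow> y \<in> V y \<and> openin T (V y) \<and>
        homeomorphic_map (subtopology T (V y)) (subtopology X U) q \<and> (\<forall>z\<in>V y. V z = V y))"

text \<open>Indexing the sheets by their points lets later proofs pick the sheet through a given
  point without carrying the disjoint family; pairwise disjointness becomes the equation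
  \<open>V z = V y\<close> for \<open>z\<close> in \<open>V y\<close>.\<close>

lemma covering_map_sheets:
  "covering_map T X q \<longleftrightarrow> continuous_map T X q \<and> q ` topspace T = topspace X \<and>
     (\<forall>x\<in>topspace X. \<exists>U V. x \<in> U \<and> sheets T X q U V)"
proof -
  have "\<exists>V. sheets T X q U V"
    if "openin X U" "\<Union>\<V> = {y\<in>topspace T. q y \<in> U}" "pairwise disjnt \<V>"
       "\<forall>V\<in>\<V>. openin T V \<and> homeomorphic_map (subtopology T V) (subtopology X U) q" for U \<V>
  proof -
    define V where "V y = (THE V. V \<in> \<V> \<and> y \<in> V)" for y
    have *: "V y = W" if "W \<in> \<V>" "y \<in> W" for y W
      unfolding V_def
    proof (rule the_equality)
      show "W' = W" if "W' \<in> \<V> \<and> y \<in> W'" for W'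
        using \<open>pairwise disjnt \<V>\<close> that \<open>W \<in> \<V>\<close> \<open>y \<in> W\<close> unfolding pairwise_def disjnt_iff by blast
    qed (use that in blast)
    have **: "V y \<in> \<V> \<and> y \<in> V y" if "y \<in> topspace T" "q y \<in> U" for y
    proof -
      have "y \<in> \<Union>\<V>" unfolding \<open>\<Union>\<V> = _\<close> using that by simp
      then obtain W where "W \<in> \<V>" "y \<in> W" by blast
      thus ?thesis using *[of W y] by simp
    qed
    have "sheets T X q U V"
      unfolding sheets_def
    proof (intro conjI ballI impI)
      fix y assume y: "y \<in> topspace T" "q y \<in> U"
      show "y \<in> V y" "openin T (V y)" "homeomorphic_map (subtopology T (V y)) (subtopology X U) q"
        using **[OF y] that(4) by blast+
      show "V z = V y" if "z \<in> V y" for z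
        using *[OF _ that] **[OF y] by blast
    qed (fact that(1))
    thus ?thesis by blast
  qed
  moreover have "\<exists>\<V>. openin X U \<and> \<Union>\<V> = {y\<in>topspace T. q y \<in> U} \<and> pairwise disjnt \<V> \<and>
     (\<forall>V\<in>\<V>. openin T V \<and> homeomorphic_map (subtopology T V) (subtopology X U) q)"
    if "sheets T X q U V" for U V
  proof (intro exI conjI)
    show "\<Union>(V ` {y\<in>topspace T. q y \<in> U}) = {y\<in>topspace T. q y \<in> U}"
    proof -
      have "z \<in> topspace T" "q z \<in> U" if "z \<in> V y" "y \<in> topspace T" "q y \<in> U" for y z
      proof -
        have o: "openin T (V y)" "homeomorphic_map (subtopology T (V y)) (subtopology X U) q"
          using \<open>sheets T X q U V\<close> that unfolding sheets_def by blast+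
        thus z: "z \<in> topspace T" using that openin_subset by blast
        have "q ` (topspace T \<inter> V y) = topspace X \<inter> U"
          using homeomorphic_imp_surjective_map[OF o(2)] by simp
        thus "q z \<in> U" using z that by blast
      qed
      moreover have "y \<in> V y" if "y \<in> topspace T" "q y \<in> U" for y
        using \<open>sheets T X q U V\<close> that unfolding sheets_def by blast
      ultimately show ?thesis by blast
    qed
    show "pairwise disjnt (V ` {y\<in>topspace T. q y \<in> U})"
    proof (rule pairwiseI)
      fix A B assume "A \<in> V ` {y\<in>topspace T. q y \<in> U}" "B \<in> V ` {y\<in>topspace T. q y \<in> U}" "A \<noteq> B"
      moreover from this(1,2) have "V z = A" if "z \<in> A" for z
        using \<open>sheets T X q U V\<close> that unfolding sheets_def by blast
      moreover from calculation(1,2) have "V z = B" if "z \<in> B" for z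
        using \<open>sheets T X q U V\<close> that unfolding sheets_def by blast
      ultimately show "disjnt A B"
        unfolding disjnt_iff by metis
    qed
    show "openin X U" using that unfolding sheets_def by blast
    show "\<forall>W\<in>V ` {y\<in>topspace T. q y \<in> U}. openin T W \<and> homeomorphic_map (subtopology T W) (subtopology X U) q"
      using that unfolding sheets_def by blast
  qed
  ultimately have "(\<exists>U \<V>. openin X U \<and> x \<in> U \<and> \<Union>\<V> = {y\<in>topspace T. q y \<in> U} \<and>
        pairwise disjnt \<V> \<and>
        (\<forall>V\<in>\<V>. openin T V \<and> homeomorphic_map (subtopology T V) (subtopology X U) q)) \<longleftrightarrow>
      (\<exists>U V. x \<in> U \<and> sheets T X q U V)" for x by meson
  thus ?thesis
    unfolding covering_map_def by simp
qed

lemma covering_map_sheetsE: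
  assumes "covering_map T X q" "x \<in> topspace X"
  obtains U V where "x \<in> U" "sheets T X q U V"
proof -
  have "\<exists>U V. x \<in> U \<and> sheets T X q U V"
    using assms covering_map_sheets[of T X q] by simp
  thus ?thesis using that by blast
qed

lemma covering_map_continuous: "covering_map T X q \<Longrightarrow> continuous_map T X q" by (simp add: covering_map_def)

lemma covering_map_surj: "covering_map T X q \<Longrightarrow> q ` topspace T = topspace X" by (simp add: covering_map_def)

lemma covering_map_in: "covering_map T X q \<Longrightarrow> y \<in> topspace T \<Longrightarrow> q y \<in> topspace X"
  using covering_map_surj by blast

context
  fixes T :: "'t topology" and X :: "'a topology" and q U V
  assumes sh: "sheets T X q U V"
begin

lemma sheets_open_base: "openin X U"
  using sh unfolding sheets_def by (rule conjunct1)

lemma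
  assumes "y \<in> topspace T" "q y \<in> U"
  shows sheets_self: "y \<in> V y"
    and sheets_open: "openin T (V y)"
    and sheets_homeo: "homeomorphic_map (subtopology T (V y)) (subtopology X U) q"
    and sheets_eq: "z \<in> V y \<Longrightarrow> V z = V y"
proof -
  have *: "y \<in> V y \<and> openin T (V y) \<and>
        homeomorphic_map (subtopology T (V y)) (subtopology X U) q \<and> (\<forall>z\<in>V y. V z = V y)"
    using sh[unfolded sheets_def] assms by (elim conjE) (drule (1) bspec, erule (1) mp)
  thus "y \<in> V y" by (rule conjunct1)
  from * show "openin T (V y)" by (elim conjE)
  from * show "homeomorphic_map (subtopology T (V y)) (subtopology X U) q" by (elim conjE)
  from * show "z \<in> V y \<Longrightarrow> V z = V y" by (elim conjE) (erule (1) bspec)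
qed

lemma sheets_in: "y \<in> topspace T \<Longrightarrow> q y \<in> U \<Longrightarrow> z \<in> V y \<Longrightarrow> z \<in> topspace T"
  using sheets_open openin_subset by blast

lemma sheets_image: "y \<in> topspace T \<Longrightarrow> q y \<in> U \<Longrightarrow> q ` V y = U"
  using homeomorphic_imp_surjective_map[OF sheets_homeo] sheets_open[THEN openin_subset]
    sheets_open_base[THEN openin_subset] by (simp add: Int_absorb1)

lemma sheets_inj: "y \<in> topspace T \<Longrightarrow> q y \<in> U \<Longrightarrow> z \<in> V y \<Longrightarrow> z' \<in> V y \<Longrightarrow> q z = q z' \<Longrightarrow> z = z'"
  using homeomorphic_imp_injective_map[OF sheets_homeo] sheets_open[THEN openin_subset]
  by (simp add: Int_absorb1 inj_on_def)

lemma sheets_section: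
  assumes "y \<in> topspace T" "q y \<in> U"
  obtains s where "continuous_map (subtopology X U) T s"
    "\<And>u. u \<in> U \<Longrightarrow> s u \<in> V y \<and> q (s u) = u" "\<And>z. z \<in> V y \<Longrightarrow> s (q z) = z"
    "homeomorphic_maps (subtopology T (V y)) (subtopology X U) q s"
proof -
  obtain s where s: "homeomorphic_maps (subtopology T (V y)) (subtopology X U) q s"
    using sheets_homeo[OF assms] homeomorphic_map_maps by blast
  have [simp]: "topspace (subtopology T (V y)) = V y" "topspace (subtopology X U) = U"
    using sheets_open[OF assms, THEN openin_subset] sheets_open_base[THEN openin_subset] by auto
  show ?thesis
  proof (rule that[of s])
    show "continuous_map (subtopology X U) T s"
      using s continuous_map_in_subtopology unfolding homeomorphic_maps_def by blast
    show "s u \<in> V y \<and> q (s u) = u" if "u \<in> U" for u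
      using s that sheets_open_base[THEN openin_subset]
      unfolding homeomorphic_maps_def continuous_map_in_subtopology by fastforce
    show "s (q z) = z" if "z \<in> V y" for z
      using s that sheets_in[OF assms] unfolding homeomorphic_maps_def by simp
    show "homeomorphic_maps (subtopology T (V y)) (subtopology X U) q s" by (rule s)
  qed
qed

lemma sheets_open_image:
  assumes "y \<in> topspace T" "q y \<in> U" "openin T W" "W \<subseteq> V y"
  shows "openin X (q ` W)"
proof -
  have "open_map (subtopology T (V y)) (subtopology X U) q"
    using sheets_homeo[OF assms(1,2)] homeomorphic_imp_open_map by blast
  moreover have "openin (subtopology T (V y)) W"
    using assms by (auto simp: openin_subtopology)
  ultimately show ?thesis
    using sheets_open_base openin_trans_full unfolding open_map_def by blast
qed

lemma sheets_subset:
  assumes "openin X U'" "U' \<subseteq> U" "continuous_map T X q"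
  shows "sheets T X q U' (\<lambda>y. {z \<in> V y. q z \<in> U'})"
  unfolding sheets_def
proof (intro conjI ballI impI)
  fix y assume y: "y \<in> topspace T" "q y \<in> U'"
  hence y': "q y \<in> U" using assms by auto
  have eq: "{z \<in> V y. q z \<in> U'} = V y \<inter> {z \<in> topspace T. q z \<in> U'}"
    using sheets_in y y' by auto
  show "openin T {z \<in> V y. q z \<in> U'}"
    unfolding eq using assms sheets_open y y' openin_continuous_map_preimage by blast
  show "homeomorphic_map (subtopology T {z \<in> V y. q z \<in> U'}) (subtopology X U') q"
  proof -
    have "homeomorphic_map (subtopology (subtopology T (V y)) {z \<in> V y. q z \<in> U'})
            (subtopology (subtopology X U) U') q"
      using sheets_in[OF y(1) y'] assms openin_subset
      by (intro homeomorphic_map_subtopologies_alt[OF sheets_homeo[OF y(1) y']]) auto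
    thus ?thesis
      using assms(2) by (simp add: subtopology_subtopology Int_absorb1 subset_iff)
  qed
  show "y \<in> {z \<in> V y. q z \<in> U'}" using y y' sheets_self by auto
  show "{w \<in> V z. q w \<in> U'} = {z \<in> V y. q z \<in> U'}" if "z \<in> {z \<in> V y. q z \<in> U'}" for z
    using sheets_eq[OF y(1) y', of z] that by simp
qed (fact assms(1))

end

lemma covering_map_open_map:
  assumes "covering_map T X q"
  shows "open_map T X q"
  unfolding open_map_def
proof (intro allI impI)
  fix W assume W: "openin T W"
  show "openin X (q ` W)"
    unfolding openin_subopen[of X "q ` W"]
  proof safe
    fix y assume y: "y \<in> W"
    hence yT: "y \<in> topspace T" using W openin_subset by blast
    obtain U V where UV: "q y \<in> U" "sheets T X q U V"
      using assms yT covering_map_in covering_map_sheetsE by metis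
    have "openin X (q ` (W \<inter> V y))"
      using UV yT W by (intro sheets_open_image[OF UV(2) yT]) (auto simp: sheets_open)
    thus "\<exists>U. openin X U \<and> q y \<in> U \<and> U \<subseteq> q ` W"
      using y sheets_self[OF UV(2) yT UV(1)] by (intro exI[of _ "q ` (W \<inter> V y)"]) auto
  qed
qed

section \<open>Unique lifting and homotopy lifting\<close>

lemma lift_unique:
  assumes "covering_map T X q" "connected_space Y" "continuous_map Y T f" "continuous_map Y T g"
    and q: "\<And>y. y \<in> topspace Y \<Longrightarrow> q (f y) = q (g y)"
    and "y0 \<in> topspace Y" "f y0 = g y0" "y \<in> topspace Y"
  shows "f y = g y"
proof -
  define A where "A = {y \<in> topspace Y. f y = g y}"
  have fT: "f y \<in> topspace T" "g y \<in> topspace T" if "y \<in> topspace Y" for y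
    using assms that by (auto simp: continuous_map_def)
  \<comment> \<open>Near \<open>y\<close> each of the two lifts stays in one sheet, so the truth
    value of \<open>f y = g y\<close> is locally constant; connectedness makes it constant.\<close>
  have N: "\<exists>N. openin Y N \<and> y \<in> N \<and> N \<subseteq> {y' \<in> topspace Y. (f y' = g y') = (f y = g y)}"
    if y: "y \<in> topspace Y" for y
  proof -
    obtain U V where UV: "q (f y) \<in> U" "sheets T X q U V"
      using assms(1) fT[OF y] covering_map_in covering_map_sheetsE by metis
    let ?N = "{y' \<in> topspace Y. f y' \<in> V (f y)} \<inter> {y' \<in> topspace Y. g y' \<in> V (g y)}"
    have gU: "q (g y) \<in> U" using UV q y by simp
    show ?thesis
    proof (intro exI[of _ ?N] conjI)
      show "openin Y ?N"
        using sheets_open[OF UV(2)] fT[OF y] UV(1) gU assms openin_continuous_map_preimage by blast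
      show "y \<in> ?N" using sheets_self[OF UV(2)] fT[OF y] UV(1) gU y by auto
      show "?N \<subseteq> {y' \<in> topspace Y. (f y' = g y') = (f y = g y)}"
      proof
        fix y' assume y': "y' \<in> ?N"
        have V: "V (f y') = V (f y)" "V (g y') = V (g y)"
          using y' sheets_eq[OF UV(2) fT(1)[OF y] UV(1), of "f y'"]
            sheets_eq[OF UV(2) fT(2)[OF y] gU, of "g y'"] by simp_all
        have "f y' = g y'" if "f y = g y"
          using sheets_inj[OF UV(2) fT(1)[OF y] UV(1)] y' q that by auto
        moreover have "f y = g y" if "f y' = g y'"
          using sheets_inj[OF UV(2) fT(1)[OF y] UV(1)] V that sheets_self[OF UV(2)] fT[OF y] UV(1) gU q[OF y]
          by metis
        ultimately show "y' \<in> {y' \<in> topspace Y. (f y' = g y') = (f y = g y)}" using y' by auto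
      qed
    qed
  qed
  have "openin Y {y \<in> topspace Y. (f y = g y) = b}" for b
  proof (subst openin_subopen, clarify)
    fix y assume y: "y \<in> topspace Y"
    obtain N where "openin Y N" "y \<in> N" "N \<subseteq> {y' \<in> topspace Y. (f y' = g y') = (f y = g y)}"
      using N[OF y] by blast
    thus "\<exists>N. openin Y N \<and> y \<in> N \<and> N \<subseteq> {y' \<in> topspace Y. (f y' = g y') = (f y = g y)}" by blast
  qed
  from this[of True] this[of False] have "openin Y A" "openin Y (topspace Y - A)"
    unfolding A_def by (simp_all add: set_diff_eq cong: conj_cong)
  hence "A = {} \<or> A = topspace Y"
    using assms(2) unfolding connected_space_clopen_in closedin_def A_def by blast
  thus ?thesis using assms unfolding A_def by blast
qed

lemma path_lift_unique:
  assumes "covering_map T X q" "pathin T f" "pathin T g" "\<And>t. t \<in> {0..1} \<Longrightarrow> q (f t) = q (g t)"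
    "s \<in> {0..1}" "f s = g s" "t \<in> {0..1}"
  shows "f t = g t"
  using assms lift_unique[OF assms(1) connected_space_unit_interval, of f g s t] by (auto simp: pathin_def)

lemma sheets_section_ex:
  assumes "sheets T X q U V" "y \<in> topspace T" "q y \<in> U"
  shows "\<exists>s. continuous_map (subtopology X U) T s \<and> (\<forall>u\<in>U. s u \<in> V y \<and> q (s u) = u) \<and>
    (\<forall>z\<in>V y. s (q z) = z) \<and> homeomorphic_maps (subtopology T (V y)) (subtopology X U) q s"
proof (rule sheets_section[OF assms])
  fix s assume "continuous_map (subtopology X U) T s" "\<And>u. u \<in> U \<Longrightarrow> s u \<in> V y \<and> q (s u) = u"
    "\<And>z. z \<in> V y \<Longrightarrow> s (q z) = z" "homeomorphic_maps (subtopology T (V y)) (subtopology X U) q s"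
  thus ?thesis by (intro exI[of _ s] conjI ballI) simp_all
qed

text \<open>Bisection of the time interval: the property that lifts prescribed at time
  \<open>a\<close> extend up to time \<open>b\<close> over a neighbourhood of \<open>y0\<close> is
  inherited by the union of adjacent intervals, and it holds for short intervals, where
  \<open>H\<close> stays in one evenly covered set. The neighbourhood may shrink at every
  concatenation.\<close>

lemma homotopy_lift_local:
  assumes cov: "covering_map T X q"
    and H: "continuous_map (prod_topology I01 Y) X H"
    and f: "continuous_map Y T f" and f0: "\<And>y. y \<in> topspace Y \<Longrightarrow> q (f y) = H (0, y)"
    and y0: "y0 \<in> topspace Y"
  obtains N G where "openin Y N" "y0 \<in> N"
    "continuous_map (prod_topology I01 (subtopology Y N)) T G"
    "\<And>y. y \<in> N \<Longrightarrow> G (0, y) = f y" "\<And>t y. t \<in> {0..1} \<Longrightarrow> y \<in> N \<Longrightarrow> q (G (t, y)) = H (t, y)"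
proof -
  \<comment> \<open>With the whole real line as time axis all slabs are subtopologies of one space,
    so that lifts over adjacent time intervals can be pasted.\<close>
  define E where "E = prod_topology euclideanreal Y"
  have E: "subtopology E (S \<times> N) = prod_topology (top_of_set S) (subtopology Y N)" for S N
    by (simp add: E_def subtopology_Times)
  have H': "continuous_map (subtopology E ({0..1} \<times> topspace Y)) X H"
    using H by (simp add: E)
  define good where "good a b M g N G \<longleftrightarrow> openin Y N \<and> y0 \<in> N \<and> N \<subseteq> M \<and>
      continuous_map (subtopology E ({a..b} \<times> N)) T G \<and> (\<forall>y\<in>N. G (a, y) = g y) \<and>
      (\<forall>t\<in>{a..b}. \<forall>y\<in>N. q (G (t, y)) = H (t, y))" for a b M g N G
  \<comment> \<open>Quantifying over the neighbourhood \<open>M\<close> and the initial lift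
    \<open>g\<close> makes the property composable: the end of the first lift is the initial lift of
    the second.\<close>
  define P where "P a b \<longleftrightarrow> (0 \<le> a \<longrightarrow> b \<le> 1 \<longrightarrow> (\<forall>M g. openin Y M \<longrightarrow> y0 \<in> M \<longrightarrow>
      continuous_map (subtopology Y M) T g \<longrightarrow> (\<forall>y\<in>M. q (g y) = H (a, y)) \<longrightarrow> (\<exists>N G. good a b M g N G)))"
    for a b
  have "P 0 1"
  proof (rule Bolzano)
    fix a b c assume ab: "P a b" and bc: "P b c" and le: "a \<le> b" "b \<le> c"
    show "P a c"
      unfolding P_def
    proof (intro impI allI)
      fix M g assume a: "0 \<le> a" "c \<le> 1" and M: "openin Y M" "y0 \<in> M"
        "continuous_map (subtopology Y M) T g" "\<forall>y\<in>M. q (g y) = H (a, y)"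
      obtain N1 G1 where "good a b M g N1 G1"
        using ab a M le unfolding P_def by (meson order_trans)
      hence 1: "openin Y N1" "y0 \<in> N1" "N1 \<subseteq> M" "continuous_map (subtopology E ({a..b} \<times> N1)) T G1"
        "\<And>y. y \<in> N1 \<Longrightarrow> G1 (a, y) = g y" "\<And>t y. t \<in> {a..b} \<Longrightarrow> y \<in> N1 \<Longrightarrow> q (G1 (t, y)) = H (t, y)"
        unfolding good_def by auto
      have "continuous_map (subtopology Y N1) (subtopology E ({a..b} \<times> N1)) (\<lambda>y. (b, y))"
        unfolding E using le by (intro continuous_map_pairedI) auto
      hence "continuous_map (subtopology Y N1) T (G1 \<circ> (\<lambda>y. (b, y)))"
        using 1(4) continuous_map_compose by blast
      moreover have "\<forall>y\<in>N1. q ((G1 \<circ> (\<lambda>y. (b, y))) y) = H (b, y)" using 1(6) le by simp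
      ultimately obtain N2 G2 where "good b c N1 (G1 \<circ> (\<lambda>y. (b, y))) N2 G2"
        using bc a 1(1,2) le unfolding P_def by (meson order_trans)
      hence 2: "openin Y N2" "y0 \<in> N2" "N2 \<subseteq> N1" "continuous_map (subtopology E ({b..c} \<times> N2)) T G2"
        "\<And>y. y \<in> N2 \<Longrightarrow> G2 (b, y) = G1 (b, y)" "\<And>t y. t \<in> {b..c} \<Longrightarrow> y \<in> N2 \<Longrightarrow> q (G2 (t, y)) = H (t, y)"
        unfolding good_def by auto
      define G where "G = (\<lambda>p. if fst p \<le> b then G1 p else G2 p)"
      have "continuous_map (subtopology E ({a..c} \<times> N2)) T G"
        unfolding G_def
      proof (rule continuous_map_cases_le)
        show "continuous_map (subtopology E ({a..c} \<times> N2)) euclideanreal fst"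
          unfolding E_def by (intro continuous_map_from_subtopology continuous_map_fst)
        have "{a..c} \<times> N2 \<inter> {x \<in> topspace (subtopology E ({a..c} \<times> N2)). fst x \<le> b} \<subseteq> {a..b} \<times> N1"
          using 2(3) by auto
        thus "continuous_map (subtopology (subtopology E ({a..c} \<times> N2)) {x \<in> topspace (subtopology E ({a..c} \<times> N2)). fst x \<le> b}) T G1"
          unfolding subtopology_subtopology by (rule continuous_map_from_subtopology_mono[OF 1(4)])
        have "{a..c} \<times> N2 \<inter> {x \<in> topspace (subtopology E ({a..c} \<times> N2)). b \<le> fst x} \<subseteq> {b..c} \<times> N2" by auto
        thus "continuous_map (subtopology (subtopology E ({a..c} \<times> N2)) {x \<in> topspace (subtopology E ({a..c} \<times> N2)). b \<le> fst x}) T G2"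
          unfolding subtopology_subtopology by (rule continuous_map_from_subtopology_mono[OF 2(4)])
        show "G1 x = G2 x" if "x \<in> topspace (subtopology E ({a..c} \<times> N2))" "fst x = b" for x
          using that 2(5) by (cases x) auto
      qed simp
      moreover have "G (a, y) = g y" if "y \<in> N2" for y
        using that le 1(5) 2(3) by (auto simp: G_def)
      moreover have "q (G (t, y)) = H (t, y)" if "t \<in> {a..c}" "y \<in> N2" for t y
        using that 1(6)[of t y] 2(3) 2(6)[of t y] unfolding G_def by (cases "t \<le> b") auto
      ultimately have "good a c M g N2 G"
        using 1(3) 2(1-3) unfolding good_def by blast
      thus "\<exists>N G. good a c M g N G" by blast
    qed
  next
    fix x :: real assume x: "0 \<le> x" "x \<le> 1"
    have "H (x, y0) \<in> topspace X"
      using H x y0 by (auto simp: continuous_map_def)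
    then obtain U V where U: "H (x, y0) \<in> U" and UV: "sheets T X q U V" by (rule covering_map_sheetsE[OF cov])
    define A where "A = {p \<in> topspace (prod_topology I01 Y). H p \<in> U}"
    have "openin (prod_topology I01 Y) A"
      unfolding A_def using H sheets_open_base[OF UV] by (rule openin_continuous_map_preimage)
    moreover have "(x, y0) \<in> A"
      unfolding A_def using U x y0 by simp
    ultimately have "\<exists>I N0. openin I01 I \<and> openin Y N0 \<and> x \<in> I \<and> y0 \<in> N0 \<and> I \<times> N0 \<subseteq> A"
      unfolding openin_prod_topology_alt by simp
    then obtain I N0 where I: "openin I01 I" "openin Y N0" "x \<in> I" "y0 \<in> N0" "I \<times> N0 \<subseteq> A" by (elim exE conjE)
    then obtain O' where O': "open O'" "I = {0..1} \<inter> O'" by (auto simp: openin_open)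
    hence "x \<in> O'" using I(3) by simp
    then obtain d where d: "d > 0" "ball x d \<subseteq> O'" by (rule openE[OF O'(1)])
    show "\<exists>d>0. \<forall>a b. a \<le> x \<and> x \<le> b \<and> b - a < d \<longrightarrow> P a b"
    proof (intro exI[of _ d] conjI allI impI d(1))
      fix a b assume ab: "a \<le> x \<and> x \<le> b \<and> b - a < d"
      show "P a b"
        unfolding P_def
      proof (intro impI allI)
        fix M g assume a: "0 \<le> a" "b \<le> 1" and M: "openin Y M" "y0 \<in> M"
          "continuous_map (subtopology Y M) T g" "\<forall>y\<in>M. q (g y) = H (a, y)"
        have I': "{a..b} \<subseteq> I"
        proof
          fix t assume "t \<in> {a..b}"
          hence "dist x t < d" "t \<in> {0..1}" using ab a by (auto simp: dist_real_def)
          thus "t \<in> I" using d(2) O'(2) by auto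
        qed
        have HU: "H (t, y) \<in> U" if "t \<in> {a..b}" "y \<in> N0" for t y
          using that I' I(5) unfolding A_def by blast
        have MY: "topspace (subtopology Y M) = M" using M(1) openin_subset by auto
        have gy: "g y0 \<in> topspace T" "q (g y0) \<in> U"
        proof -
          show "g y0 \<in> topspace T"
            using continuous_map_image_subset_topspace[OF M(3)] M(2) unfolding MY by blast
          show "q (g y0) \<in> U" using M(2,4) HU[of a y0] I(4) ab by simp
        qed
        obtain s where "continuous_map (subtopology X U) T s \<and> (\<forall>u\<in>U. s u \<in> V (g y0) \<and> q (s u) = u) \<and>
            (\<forall>z\<in>V (g y0). s (q z) = z) \<and> homeomorphic_maps (subtopology T (V (g y0))) (subtopology X U) q s"
          using sheets_section_ex[OF UV gy] by (elim exE)
        hence s: "continuous_map (subtopology X U) T s"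
          "\<And>u. u \<in> U \<Longrightarrow> s u \<in> V (g y0) \<and> q (s u) = u" "\<And>z. z \<in> V (g y0) \<Longrightarrow> s (q z) = z" by simp_all
        \<comment> \<open>Only where \<open>g\<close> lies in the sheet through \<open>g y0\<close>
          does the section onto this sheet return the initial values.\<close>
        define N where "N = N0 \<inter> {y \<in> topspace (subtopology Y M). g y \<in> V (g y0)}"
        have "openin Y {y \<in> topspace (subtopology Y M). g y \<in> V (g y0)}"
          using openin_continuous_map_preimage[OF M(3) sheets_open[OF UV gy]] M(1) by (rule openin_trans_full)
        hence N: "openin Y N" unfolding N_def using I(2) by blast
        have yN: "y0 \<in> N" unfolding N_def MY using I(4) M(2) sheets_self[OF UV gy] by simp
        have NM: "N \<subseteq> M" "N \<subseteq> N0" unfolding N_def MY by auto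
        have NY: "N \<subseteq> topspace Y" using N openin_subset by blast
        have "continuous_map (subtopology E ({a..b} \<times> N)) (subtopology X U) H"
        proof (rule continuous_map_into_subtopology)
          show "continuous_map (subtopology E ({a..b} \<times> N)) X H"
            by (rule continuous_map_from_subtopology_mono[OF H']) (use a NY in auto)
          show "H \<in> topspace (subtopology E ({a..b} \<times> N)) \<rightarrow> U"
            using HU NM by auto
        qed
        hence "continuous_map (subtopology E ({a..b} \<times> N)) T (s \<circ> H)"
          using s(1) by (rule continuous_map_compose)
        moreover have "(s \<circ> H) (a, y) = g y" if "y \<in> N" for y
        proof -
          have "g y \<in> V (g y0)" "y \<in> M" using that NM unfolding N_def MY by blast+
          thus ?thesis using s(3)[of "g y"] bspec[OF M(4), of y] by simp
        qed
        moreover have "q ((s \<circ> H) (t, y)) = H (t, y)" if "t \<in> {a..b}" "y \<in> N" for t y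
          using s(2)[OF HU[of t y]] that NM by auto
        ultimately have "good a b M g N (s \<circ> H)"
          unfolding good_def using N yN NM by blast
        thus "\<exists>N G. good a b M g N G" by blast
      qed
    qed
  qed simp
  moreover have "continuous_map (subtopology Y (topspace Y)) T f" using f by simp
  ultimately obtain N G where "good 0 1 (topspace Y) f N G"
    unfolding P_def using f0 y0 openin_topspace by (metis order_refl)
  thus thesis
    using that[of N G] unfolding good_def E by blast
qed

text \<open>The local lifts can be glued: for each \<open>y\<close> they restrict to lifts of one
  path with the same start, hence agree on overlaps.\<close>

lemma homotopy_lift:
  assumes cov: "covering_map T X q"
    and H: "continuous_map (prod_topology I01 Y) X H"
    and f: "continuous_map Y T f" and f0: "\<And>y. y \<in> topspace Y \<Longrightarrow> q (f y) = H (0, y)"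
  obtains G where "continuous_map (prod_topology I01 Y) T G"
    "\<And>y. y \<in> topspace Y \<Longrightarrow> G (0, y) = f y"
    "\<And>t y. t \<in> {0..1} \<Longrightarrow> y \<in> topspace Y \<Longrightarrow> q (G (t, y)) = H (t, y)"
proof -
  define ok where "ok y0 N G \<longleftrightarrow> openin Y N \<and> y0 \<in> N \<and>
    continuous_map (prod_topology I01 (subtopology Y N)) T G \<and>
    (\<forall>y\<in>N. G (0, y) = f y) \<and> (\<forall>t\<in>{0..1}. \<forall>y\<in>N. q (G (t, y)) = H (t, y))" for y0 N G
  have "\<exists>N G. ok y0 N G" if "y0 \<in> topspace Y" for y0
  proof (rule homotopy_lift_local[OF cov H f f0 that])
    fix N G assume "openin Y N" "y0 \<in> N"
      "continuous_map (prod_topology I01 (subtopology Y N)) T G"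
      "\<And>y. y \<in> N \<Longrightarrow> G (0, y) = f y"
      "\<And>t y. t \<in> {0..1} \<Longrightarrow> y \<in> N \<Longrightarrow> q (G (t, y)) = H (t, y)"
    hence "ok y0 N G" unfolding ok_def by blast
    thus "\<exists>N G. ok y0 N G" by blast
  qed simp
  then obtain N G where NG: "\<And>y. y \<in> topspace Y \<Longrightarrow> ok y (N y) (G y)" by metis
  define K where "K = (\<lambda>(t, y). G y (t :: real, y))"
  have agree: "G y' (t, y') = G y (t, y')" if y: "y \<in> topspace Y" and y': "y' \<in> N y" and t: "t \<in> {0..1}" for y y' t
  proof -
    have y'Y: "y' \<in> topspace Y" using NG[OF y] y' openin_subset unfolding ok_def by blast
    have c: "pathin T (\<lambda>t. G z (t, y'))" if "z \<in> topspace Y" "y' \<in> N z" for z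
    proof -
      have "continuous_map I01 (prod_topology I01 (subtopology Y (N z))) (\<lambda>t. (t, y'))"
        using that y'Y by (intro continuous_map_pairedI) (auto simp: continuous_map_in_subtopology)
      hence "continuous_map I01 T (G z \<circ> (\<lambda>t. (t, y')))"
        using NG[OF that(1)] unfolding ok_def by (elim conjE) (rule continuous_map_compose)
      thus ?thesis by (simp add: pathin_def comp_def)
    qed
    have y'N: "y' \<in> N y'" using NG[OF y'Y] by (simp add: ok_def)
    show ?thesis by (rule path_lift_unique[OF cov c[OF y'Y y'N] c[OF y y'], of 0])
         (use NG[OF y'Y, unfolded ok_def] NG[OF y, unfolded ok_def] y' y'N t in simp_all)
  qed
  show thesis
  proof (rule that[of K])
    show "continuous_map (prod_topology I01 Y) T K"
    proof (rule continuous_map_locally)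
      fix p assume "p \<in> topspace (prod_topology I01 Y)"
      then obtain t y where p: "p = (t, y)" "t \<in> {0..1}" "y \<in> topspace Y" by auto
      note ok = NG[OF p(3), unfolded ok_def]
      have N: "N y \<subseteq> topspace Y" using ok openin_subset by blast
      have "continuous_map (prod_topology I01 (subtopology Y (N y))) T K"
      proof (rule continuous_map_eq)
        show "continuous_map (prod_topology I01 (subtopology Y (N y))) T (G y)" using ok by blast
        show "G y x = K x" if "x \<in> topspace (prod_topology I01 (subtopology Y (N y)))" for x
          using that agree[OF p(3)] unfolding K_def by (cases x) auto
      qed
      hence "continuous_map (subtopology (prod_topology I01 Y) ({0..1} \<times> N y)) T K"
        by (simp add: subtopology_Times subtopology_subtopology)
      moreover have "openin (prod_topology I01 Y) ({0..1} \<times> N y)"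
        using ok by (simp add: openin_prod_Times_iff)
      ultimately show "\<exists>U. openin (prod_topology I01 Y) U \<and> p \<in> U \<and>
          continuous_map (subtopology (prod_topology I01 Y) U) T K"
        using p ok by (intro exI[of _ "{0..1} \<times> N y"]) simp
    qed
  qed (use NG in \<open>auto simp: K_def ok_def\<close>)
qed

text \<open>The case of a one-point parameter space.\<close>

lemma path_lift:
  assumes cov: "covering_map T X q" and g: "pathin X g" and y: "y \<in> topspace T" "q y = g 0"
  obtains w where "pathin T w" "w 0 = y" "\<And>t. t \<in> {0..1} \<Longrightarrow> q (w t) = g t"
proof -
  let ?Y = "discrete_topology {()}"
  have H: "continuous_map (prod_topology I01 ?Y) X (g \<circ> fst)"
    using continuous_map_fst g unfolding pathin_def by (rule continuous_map_compose)
  obtain G where G: "continuous_map (prod_topology I01 ?Y) T G"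
    "\<And>u. u \<in> topspace ?Y \<Longrightarrow> G (0, u) = y"
    "\<And>t u. t \<in> {0..1} \<Longrightarrow> u \<in> topspace ?Y \<Longrightarrow> q (G (t, u)) = (g \<circ> fst) (t, u)"
    by (rule homotopy_lift[OF cov H, of "\<lambda>_. y"]) (use y in auto)
  have "continuous_map I01 (prod_topology I01 ?Y) (\<lambda>t. (t, ()))"
    by (intro continuous_map_pairedI) (auto simp: continuous_map_in_subtopology)
  hence "continuous_map I01 T (G \<circ> (\<lambda>t. (t, ())))"
    using G(1) by (rule continuous_map_compose)
  thus thesis
    using G(2,3) by (intro that[of "\<lambda>t. G (t, ())"]) (auto simp: pathin_def comp_def)
qed

text \<open>Lift the square starting from \<open>w\<close>. Its two sides lie over constant paths
  and are constant, so its last row starts where \<open>w'\<close> does, equals \<open>w'\<close>,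
  and ends where \<open>w\<close> ends.\<close>

lemma homotopic_lift_end:
  assumes cov: "covering_map T X q"
    and K: "continuous_map (prod_topology I01 I01) X K"
    and ends: "\<And>t. t \<in> {0..1} \<Longrightarrow> K (t, 0) = a" "\<And>t. t \<in> {0..1} \<Longrightarrow> K (t, 1) = b"
    and w: "pathin T w" "\<And>s. s \<in> {0..1} \<Longrightarrow> q (w s) = K (0, s)"
    and w': "pathin T w'" "\<And>s. s \<in> {0..1} \<Longrightarrow> q (w' s) = K (1, s)"
    and eq: "w 0 = w' 0"
  shows "w 1 = w' 1"
proof -
  obtain G where G: "continuous_map (prod_topology I01 I01) T G"
    "\<And>s. s \<in> {0..1} \<Longrightarrow> G (0, s) = w s"
    "\<And>t s. t \<in> {0..1} \<Longrightarrow> s \<in> {0..1} \<Longrightarrow> q (G (t, s)) = K (t, s)"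
    by (rule homotopy_lift[OF cov K, of w]) (use w in \<open>auto simp: pathin_def\<close>)
  have p1: "pathin T (\<lambda>s. G (t, s))" if "t \<in> {0..1}" for t
  proof -
    have "continuous_map I01 (prod_topology I01 I01) (\<lambda>s. (t, s))"
      using that by (intro continuous_map_pairedI) (auto simp: continuous_map_in_subtopology)
    hence "continuous_map I01 T (G \<circ> (\<lambda>s. (t, s)))"
      using G(1) by (rule continuous_map_compose)
    thus ?thesis by (simp add: pathin_def comp_def)
  qed
  have p2: "pathin T (\<lambda>t. G (t, s))" if "s \<in> {0..1}" for s
  proof -
    have "continuous_map I01 (prod_topology I01 I01) (\<lambda>t. (t, s))"
      using that by (intro continuous_map_pairedI) (auto simp: continuous_map_in_subtopology)
    hence "continuous_map I01 T (G \<circ> (\<lambda>t. (t, s)))"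
      using G(1) by (rule continuous_map_compose)
    thus ?thesis by (simp add: pathin_def comp_def)
  qed
  have const: "G (1, s) = G (0, s)" if s: "s \<in> {0..1}" and c: "\<And>t. t \<in> {0..1} \<Longrightarrow> K (t, s) = c" for s c
  proof -
    have T: "G (0, s) \<in> topspace T" using pathin_subset[OF p2[OF s], of 0] by simp
    show ?thesis by (rule path_lift_unique[OF cov p2[OF s], of "\<lambda>_. G (0, s)" 0 1]) (use T s c G(3) in auto)
  qed
  have "G (1, 0) = w' 0" using const[of 0 a] ends(1) G(2)[of 0] eq by simp
  hence "G (1, 1) = w' 1" by (intro path_lift_unique[OF cov p1[of 1] w'(1), of 0 1]) (use G(3) w'(2) in auto)
  thus ?thesis using const[of 1 b] ends(2) G(2)[of 1] by simp
qed

section \<open>Lifting criteria and maps between coverings\<close>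

lemma lift_criterion_path_connected:
  assumes cov: "covering_map T X q" and N: "locally_path_connected_space N" "path_connected_space N"
    and p: "continuous_map N X p" and n0: "n0 \<in> topspace N" and y0: "y0 \<in> topspace T" "q y0 = p n0"
    and loops: "\<And>c w. \<lbrakk>pathin N c; c 0 = n0; c 1 = n0; pathin T w; w 0 = y0;
        \<And>t. t \<in> {0..1} \<Longrightarrow> q (w t) = p (c t)\<rbrakk> \<Longrightarrow> w 1 = y0"
  obtains f where "continuous_map N T f" "f n0 = y0" "\<And>n. n \<in> topspace N \<Longrightarrow> q (f n) = p n"
proof -
  \<comment> \<open>The lift of \<open>p\<close> will be the function with graph \<open>R\<close>:
    follow a path from \<open>n0\<close> to \<open>n\<close> downstairs and take the end of its lift
    from \<open>y0\<close>.\<close>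
  define R where "R n z \<longleftrightarrow> (\<exists>c w. pathin N c \<and> c 0 = n0 \<and> c 1 = n \<and> pathin T w \<and> w 0 = y0 \<and>
      (\<forall>t\<in>{0..1}. q (w t) = p (c t)) \<and> w 1 = z)" for n z
  have pc: "pathin X (\<lambda>t. p (c t))" if "pathin N c" for c
    using pathin_compose[OF that p] by (simp add: comp_def)
  have ex: "\<exists>z. R n z" if n: "n \<in> topspace N" for n
  proof -
    obtain c where c: "pathin N c" "c 0 = n0" "c 1 = n"
      using N(2) n0 n unfolding path_connected_space_def by blast
    obtain w where "pathin T w" "w 0 = y0" "\<And>t. t \<in> {0..1} \<Longrightarrow> q (w t) = p (c t)"
      by (rule path_lift[OF cov pc[OF c(1)], of y0]) (use y0 c in auto)
    thus ?thesis unfolding R_def using c by blast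
  qed
  have step: "R (b 1) (v 1)" if R: "R (b 0) (v 0)" and b: "pathin N b" and v: "pathin T v"
    and vb: "\<forall>t\<in>{0..1}. q (v t) = p (b t)" for b v
  proof -
    obtain c w where cw: "pathin N c" "c 0 = n0" "c 1 = b 0" "pathin T w" "w 0 = y0"
      "\<forall>t\<in>{0..1}. q (w t) = p (c t)" "w 1 = v 0"
      using R unfolding R_def by metis
    have "\<forall>t\<in>{0..1}. q (path_join w v t) = path_join (p \<circ> c) (p \<circ> b) t"
      using cw(6) vb by (intro path_join_lift) auto
    hence "\<forall>t\<in>{0..1}. q (path_join w v t) = p (path_join c b t)" by (simp flip: path_join_comp)
    thus ?thesis
      unfolding R_def using pathin_path_join[OF cw(1) b cw(3)] pathin_path_join[OF cw(4) v cw(7)] cw(2,5)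
      by (intro exI[of _ "path_join c b"] exI[of _ "path_join w v"]) simp
  qed
  \<comment> \<open>Continue the lift ending in \<open>z\<close> by the lift \<open>v\<close> of the
    reversed second path. By \<open>loops\<close> it returns to \<open>y0\<close>, so the reverse of
    \<open>v\<close> is the lift \<open>w'\<close> of the second path, and both ends are
    \<open>z\<close>.\<close>
  have uniq: "z = z'" if z: "R n z" "R n z'" for n z z'
  proof -
    obtain c w where cw: "pathin N c" "c 0 = n0" "c 1 = n" "pathin T w" "w 0 = y0"
      "\<forall>t\<in>{0..1}. q (w t) = p (c t)" "w 1 = z"
      using z unfolding R_def by blast
    obtain c' w' where cw': "pathin N c'" "c' 0 = n0" "c' 1 = n" "pathin T w'" "w' 0 = y0"
      "\<forall>t\<in>{0..1}. q (w' t) = p (c' t)" "w' 1 = z'"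
      using z unfolding R_def by blast
    have r: "pathin N (\<lambda>t. c' (1 - t))" using cw'(1) by (rule pathin_reverse)
    obtain v where v: "pathin T v" "v 0 = z" "\<And>t. t \<in> {0..1} \<Longrightarrow> q (v t) = p (c' (1 - t))"
    proof (rule path_lift[OF cov pc[OF r], of z])
      show "z \<in> topspace T" using path_finish_in_topspace[OF cw(4)] cw(7) by simp
      have "q (w 1) = p (c 1)" using cw(6) by simp
      thus "q z = p (c' (1 - 0))" using cw(3,7) cw'(3) by simp
    qed blast
    have "R (c' (1 - 0)) (v 0)" using z(1) cw'(3) v(2) by simp
    hence "R (c' (1 - 1)) (v 1)" by (rule step[OF _ r v(1)]) (use v(3) in blast)
    hence "R n0 (v 1)" using cw'(2) by simp
    then obtain c2 w2 where "pathin N c2" "c2 0 = n0" "c2 1 = n0" "pathin T w2" "w2 0 = y0"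
      "\<forall>t\<in>{0..1}. q (w2 t) = p (c2 t)" "w2 1 = v 1"
      unfolding R_def by blast
    hence v1: "v 1 = y0" using loops[of c2 w2] by simp
    have "v (1 - 1) = w' 1"
    proof (rule path_lift_unique[OF cov pathin_reverse[OF v(1)] cw'(4), of 0 1])
      show "q (v (1 - t)) = q (w' t)" if "t \<in> {0..1}" for t
        using v(3)[of "1 - t"] cw'(6) that by simp
    qed (use v1 cw'(5) in auto)
    thus ?thesis using v(2) cw'(7) by simp
  qed
  define f where "f n = (THE z. R n z)" for n
  have fI: "f n = z" if "R n z" for n z
    unfolding f_def using that uniq[OF _ that] by (rule the_equality)
  have fR: "R n (f n)" if n: "n \<in> topspace N" for n
  proof -
    obtain z where "R n z" using ex[OF n] by blast
    thus ?thesis using fI by simp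
  qed
  have fT: "f n \<in> topspace T \<and> q (f n) = p n" if n: "n \<in> topspace N" for n
  proof -
    obtain c w where "c 1 = n" "pathin T w" "\<forall>t\<in>{0..1}. q (w t) = p (c t)" "w 1 = f n"
      using fR[OF n] unfolding R_def by blast
    thus ?thesis using path_finish_in_topspace[of T w] by (metis atLeastAtMost_iff order_refl zero_le_one)
  qed
  show thesis
  proof (rule that[of f])
    have "R n0 y0"
      unfolding R_def using n0 y0 by (intro exI[of _ "\<lambda>_. n0"] exI[of _ "\<lambda>_. y0"]) simp
    thus "f n0 = y0" by (rule fI)
    show "continuous_map N T f"
    proof (rule continuous_map_locally)
      fix n assume n: "n \<in> topspace N"
      have fn: "f n \<in> topspace T" "q (f n) = p n" using fT[OF n] by auto
      have "p n \<in> topspace X" using p n by (auto simp: continuous_map_def)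
      then obtain U V where U: "p n \<in> U" and UV: "sheets T X q U V" by (rule covering_map_sheetsE[OF cov])
      have qU: "q (f n) \<in> U" using U fn by simp
      obtain s where "continuous_map (subtopology X U) T s \<and> (\<forall>u\<in>U. s u \<in> V (f n) \<and> q (s u) = u) \<and>
          (\<forall>z\<in>V (f n). s (q z) = z) \<and> homeomorphic_maps (subtopology T (V (f n))) (subtopology X U) q s"
        using sheets_section_ex[OF UV fn(1) qU] by (elim exE)
      hence s: "continuous_map (subtopology X U) T s"
        "\<And>u. u \<in> U \<Longrightarrow> s u \<in> V (f n) \<and> q (s u) = u" "\<And>z. z \<in> V (f n) \<Longrightarrow> s (q z) = z" by simp_all
      have "openin N {x \<in> topspace N. p x \<in> U}"
        using p sheets_open_base[OF UV] by (rule openin_continuous_map_preimage)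
      moreover have "n \<in> {x \<in> topspace N. p x \<in> U}" using n U by simp
      ultimately obtain W where W: "openin N W" "path_connectedin N W" "n \<in> W" "W \<subseteq> {x \<in> topspace N. p x \<in> U}"
        using N(1) unfolding locally_path_connected_space by meson
      have "continuous_map (subtopology N W) (subtopology X U) p"
        using W by (intro continuous_map_into_subtopology continuous_map_from_subtopology[OF p]) auto
      hence sp: "continuous_map (subtopology N W) T (s \<circ> p)"
        using s(1) by (rule continuous_map_compose)
      \<comment> \<open>Append a path inside \<open>W\<close> from \<open>n\<close> to
        \<open>m\<close>. Its lift is given by the section, so \<open>f\<close> coincides on
        \<open>W\<close> with the continuous map \<open>s \<circ> p\<close>.\<close>
      have "(s \<circ> p) m = f m" if m: "m \<in> W" for m
      proof -
        obtain b where b: "pathin N b" "b \<in> {0..1} \<rightarrow> W" "b 0 = n" "b 1 = m"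
          using W(2,3) m unfolding path_connectedin by blast
        have bW: "pathin (subtopology N W) b"
          using b unfolding pathin_subtopology by auto
        have "R (b 1) ((s \<circ> p \<circ> b) 1)"
        proof (rule step[OF _ b(1) pathin_compose[OF bW sp]])
          have "s (p n) = f n" using s(3)[OF sheets_self[OF UV fn(1) qU]] fn by simp
          thus "R (b 0) ((s \<circ> p \<circ> b) 0)" using fR[OF n] b by simp
          show "\<forall>t\<in>{0..1}. q ((s \<circ> p \<circ> b) t) = p (b t)"
          proof
            fix t :: real assume "t \<in> {0..1}"
            hence "b t \<in> W" using b(2) by blast
            hence "p (b t) \<in> U" using W(4) by blast
            thus "q ((s \<circ> p \<circ> b) t) = p (b t)" using s(2) by simp
          qed
        qed
        thus ?thesis using fI b by simp
      qed
      hence "continuous_map (subtopology N W) T f"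
        using continuous_map_eq[OF sp] by simp
      thus "\<exists>U. openin N U \<and> n \<in> U \<and> continuous_map (subtopology N U) T f"
        using W by blast
    qed
  qed (use fT in blast)
qed

lemma covering_map_path_connected_sheets:
  assumes "covering_map T X q" "locally_path_connected_space X" "x \<in> topspace X" "openin X O'" "x \<in> O'"
  obtains U V where "x \<in> U" "U \<subseteq> O'" "path_connectedin X U" "sheets T X q U V"
proof -
  obtain U V where U: "x \<in> U" "sheets T X q U V" by (rule covering_map_sheetsE[OF assms(1,3)])
  have "openin X (U \<inter> O')" using sheets_open_base[OF U(2)] assms(4) by blast
  hence "\<exists>U'. openin X U' \<and> path_connectedin X U' \<and> x \<in> U' \<and> U' \<subseteq> U \<inter> O'"
    using assms(2,5) U(1) unfolding locally_path_connected_space by blast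
  then obtain U' where U': "openin X U'" "path_connectedin X U'" "x \<in> U'" "U' \<subseteq> U \<inter> O'" by (elim exE conjE)
  have "sheets T X q U' (\<lambda>y. {z \<in> V y. q z \<in> U'})"
    by (rule sheets_subset[OF U(2) U'(1) _ covering_map_continuous[OF assms(1)]]) (use U'(4) in blast)
  thus thesis using that[OF U'(3) _ U'(2)] U'(4) by blast
qed

lemma sheets_path_connectedin:
  assumes "sheets T X q U V" "path_connectedin X U" "y \<in> topspace T" "q y \<in> U"
  shows "path_connectedin T (V y)"
proof -
  obtain s where s: "continuous_map (subtopology X U) T s" "\<forall>u\<in>U. s u \<in> V y \<and> q (s u) = u"
        "\<forall>z\<in>V y. s (q z) = z"
    using sheets_section_ex[OF assms(1,3,4)] by (elim exE conjE)
  have "V y \<subseteq> s ` U"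
  proof
    fix z assume z: "z \<in> V y"
    hence "q z \<in> U" using sheets_image[OF assms(1,3,4)] by blast
    thus "z \<in> s ` U" using s(3) z by (intro image_eqI[of _ _ "q z"]) simp_all
  qed
  hence "s ` U = V y" using s(2) by blast
  moreover have "path_connectedin T (s ` U)"
    by (rule path_connectedin_continuous_map_image[OF s(1)]) (simp add: assms(2))
  ultimately show ?thesis by simp
qed

lemma covering_map_locally_path_connected_space:
  assumes "covering_map T X q" "locally_path_connected_space X"
  shows "locally_path_connected_space T"
  unfolding locally_path_connected_space
proof (intro allI impI, elim conjE)
  fix W y assume W: "openin T W" "y \<in> W"
  hence y: "y \<in> topspace T" using openin_subset by blast
  obtain U0 V0 where U0: "q y \<in> U0" "sheets T X q U0 V0"
    by (rule covering_map_sheetsE[OF assms(1) covering_map_in[OF assms(1) y]])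
  have oW: "openin T (W \<inter> V0 y)" using W sheets_open[OF U0(2) y U0(1)] by blast
  have "openin X (q ` (W \<inter> V0 y))" by (rule sheets_open_image[OF U0(2) y U0(1) oW]) blast
  moreover have "q y \<in> q ` (W \<inter> V0 y)" using W sheets_self[OF U0(2) y U0(1)] by blast
  ultimately have "\<exists>U. openin X U \<and> path_connectedin X U \<and> q y \<in> U \<and> U \<subseteq> q ` (W \<inter> V0 y)"
    using assms(2) unfolding locally_path_connected_space by blast
  then obtain U where U: "openin X U" "path_connectedin X U" "q y \<in> U" "U \<subseteq> q ` (W \<inter> V0 y)" by (elim exE conjE)
  have sub: "U \<subseteq> U0"
    using U(4) sheets_image[OF U0(2) y U0(1)] by blast
  define V where "V z = {w \<in> V0 z. q w \<in> U}" for z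
  have V: "sheets T X q U V"
    unfolding V_def by (rule sheets_subset[OF U0(2) U(1) sub covering_map_continuous[OF assms(1)]])
  have "V y \<subseteq> W"
  proof
    fix z assume z: "z \<in> V y"
    then obtain w where w: "w \<in> W \<inter> V0 y" "q w = q z" using U(4) unfolding V_def by force
    hence "w = z" using sheets_inj[OF U0(2) y U0(1)] z unfolding V_def by blast
    thus "z \<in> W" using w by blast
  qed
  thus "\<exists>U. openin T U \<and> path_connectedin T U \<and> y \<in> U \<and> U \<subseteq> W"
    using sheets_open[OF V y U(3)] sheets_path_connectedin[OF V U(2) y U(3)] sheets_self[OF V y U(3)]
    by (intro exI[of _ "V y"] conjI)
qed

text \<open>\<open>S\<close> and \<open>b\<close> prescribe values, but these are attained only at
  one point of \<open>S\<close> in each path component, which is all the freedom that unique lifting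
  leaves. Path components are open here, so the lifts over them combine to a continuous map.\<close>

lemma lift_criterion:
  assumes cov: "covering_map T X q" and N: "locally_path_connected_space N"
    and p: "continuous_map N X p"
    and S: "\<And>s. s \<in> S \<Longrightarrow> b s \<in> topspace T \<and> q (b s) = p s"
    and loops: "\<And>c w. \<lbrakk>pathin N c; c 0 = c 1; pathin T w;
        \<forall>t\<in>{0..1}. q (w t) = p (c t)\<rbrakk> \<Longrightarrow> w 0 = w 1"
  shows "\<exists>f. continuous_map N T f \<and> (\<forall>n\<in>topspace N. q (f n) = p n) \<and>
    (\<forall>n. (\<exists>s\<in>S. path_component_of N n s) \<longrightarrow> (\<exists>s\<in>S. path_component_of N n s \<and> f s = b s))"
proof -
  \<comment> \<open>Taking the base point from \<open>S\<close> when possible makes the prescribed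
    value the starting value of the lift.\<close>
  define base where "base K = (if S \<inter> K = {} then SOME s. s \<in> K else SOME s. s \<in> S \<inter> K)" for K
  have base: "base K \<in> K" "S \<inter> K \<noteq> {} \<Longrightarrow> base K \<in> S" if "K \<noteq> {}" for K
    unfolding base_def using that some_in_eq[of K] some_in_eq[of "S \<inter> K"] by (auto split: if_splits)
  define K where "K n = path_component_of_set N n" for n
  have Ksub: "K n \<subseteq> topspace N" for n
    unfolding K_def by (rule path_component_of_subset_topspace)
  have KI: "n \<in> K n" if "n \<in> topspace N" for n
    unfolding K_def using that by (simp add: path_component_of_refl)
  have Ko: "openin N (K n)" for n
    unfolding K_def by (rule openin_path_component_of_locally_path_connected_space[OF N])
  have Keq: "K m = K n" if "m \<in> K n" for m n
    using that path_component_of_equiv[of N n m] unfolding K_def by auto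
  have "\<exists>f. continuous_map (subtopology N (K n)) T f \<and> (\<forall>m\<in>K n. q (f m) = p m) \<and>
      (S \<inter> K n \<noteq> {} \<longrightarrow> f (base (K n)) = b (base (K n)))" if n: "n \<in> topspace N" for n
  proof -
    have ne: "K n \<noteq> {}" using KI[OF n] by blast
    have bK: "base (K n) \<in> K n" by (rule base(1)[OF ne])
    hence bN: "base (K n) \<in> topspace N" using Ksub by blast
    have "p (base (K n)) \<in> topspace X" using p bN by (auto simp: continuous_map_def)
    then obtain z where z: "z \<in> topspace T" "q z = p (base (K n))"
      using covering_map_surj[OF cov] by (metis imageE)
    define y0 where "y0 = (if S \<inter> K n = {} then z else b (base (K n)))"
    have y0: "y0 \<in> topspace T" "q y0 = p (base (K n))"
      unfolding y0_def using z S[OF base(2)[OF ne]] by auto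
    have top: "topspace (subtopology N (K n)) = K n" using Ksub by auto
    obtain f where f: "continuous_map (subtopology N (K n)) T f" "f (base (K n)) = y0"
      "\<And>m. m \<in> topspace (subtopology N (K n)) \<Longrightarrow> q (f m) = p m"
    proof (rule lift_criterion_path_connected[OF cov, of "subtopology N (K n)" p "base (K n)" y0])
      show "locally_path_connected_space (subtopology N (K n))"
        by (rule locally_path_connected_space_open_subset[OF N Ko])
      show "path_connected_space (subtopology N (K n))"
        using path_connectedin_path_component_of[of N n] unfolding K_def path_connectedin_def by blast
      show "continuous_map (subtopology N (K n)) X p" using p by (rule continuous_map_from_subtopology)
      show "base (K n) \<in> topspace (subtopology N (K n))" unfolding top by (rule bK)
      fix c w assume cw: "pathin (subtopology N (K n)) c" "c 0 = base (K n)" "c 1 = base (K n)" "pathin T w" "w 0 = y0"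
        "\<And>t. t \<in> {0..1} \<Longrightarrow> q (w t) = p (c t)"
      have "pathin N c" using cw(1) by (simp add: pathin_subtopology)
      hence "w 0 = w 1" using cw by (intro loops[of c w]) simp_all
      thus "w 1 = y0" using cw(5) by simp
    qed (use y0 in blast)+
    thus ?thesis unfolding top y0_def by (intro exI[of _ f]) simp
  qed
  hence "\<forall>k\<in>K ` topspace N. \<exists>f. continuous_map (subtopology N k) T f \<and> (\<forall>m\<in>k. q (f m) = p m) \<and>
      (S \<inter> k \<noteq> {} \<longrightarrow> f (base k) = b (base k))" by (simp only: ball_simps(9)) (rule ballI)
  from bchoice[OF this] obtain F where F: "\<forall>k\<in>K ` topspace N. continuous_map (subtopology N k) T (F k) \<and>
      (\<forall>m\<in>k. q (F k m) = p m) \<and> (S \<inter> k \<noteq> {} \<longrightarrow> F k (base k) = b (base k))" by (elim exE)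
  note F = bspec[OF F imageI]
  define f where "f n = F (K n) n" for n
  show ?thesis
  proof (intro exI[of _ f] conjI ballI allI impI)
    show "continuous_map N T f"
    proof (rule continuous_map_locally)
      fix n assume n: "n \<in> topspace N"
      have "continuous_map (subtopology N (K n)) T f"
      proof (rule continuous_map_eq)
        show "continuous_map (subtopology N (K n)) T (F (K n))" using F[OF n] by (rule conjunct1)
        show "F (K n) m = f m" if "m \<in> topspace (subtopology N (K n))" for m
          using that Keq[of m n] unfolding f_def by simp
      qed
      thus "\<exists>U. openin N U \<and> n \<in> U \<and> continuous_map (subtopology N U) T f"
        using Ko[of n] KI[OF n] by (intro exI[of _ "K n"] conjI)
    qed
    show "q (f n) = p n" if "n \<in> topspace N" for n
      using F[OF that] KI[OF that] unfolding f_def by simp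
    fix n assume "\<exists>s\<in>S. path_component_of N n s"
    hence ne: "S \<inter> K n \<noteq> {}" unfolding K_def by blast
    then obtain s where "path_component_of N n s" unfolding K_def by blast
    hence n: "n \<in> topspace N" unfolding path_component_of_equiv[of N n s] by (elim conjE)
    have "K n \<noteq> {}" using ne by blast
    note b = base[OF this]
    have "f (base (K n)) = b (base (K n))"
      unfolding f_def using Keq[OF b(1)] F[OF n] ne by simp
    thus "\<exists>s\<in>S. path_component_of N n s \<and> f s = b s"
      using b(1) b(2)[OF ne] unfolding K_def by (intro bexI[of _ "base (path_component_of_set N n)"]) simp_all
  qed
qed

text \<open>Components and path components of the covering coincide, so the connected part over a
  component of the base supplies a path.\<close>

lemma covering_map_path_component:
  assumes "covering_map X B r" "locally_path_connected_space B"
    and "\<And>C. C \<in> connected_components_of B \<Longrightarrow> connectedin X {y \<in> topspace X. r y \<in> C}"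
    and "x \<in> topspace X" "x' \<in> topspace X" "connected_component_of B (r x) (r x')"
  shows "path_component_of X x x'"
proof -
  let ?C = "connected_component_of_set B (r x)"
  have "?C \<in> connected_components_of B"
    by (rule iffD2[OF connected_component_in_connected_components_of]) (rule covering_map_in[OF assms(1,4)])
  hence "connectedin X {y \<in> topspace X. r y \<in> ?C}" by (rule assms(3))
  moreover have "x \<in> {y \<in> topspace X. r y \<in> ?C}" "x' \<in> {y \<in> topspace X. r y \<in> ?C}"
    using assms(4-6) covering_map_in[OF assms(1,4)] by (auto simp: connected_component_of_refl)
  ultimately have "\<exists>P. connectedin X P \<and> x \<in> P \<and> x' \<in> P" by (intro exI[of _ "{y \<in> topspace X. r y \<in> ?C}"] conjI)
  hence "connected_component_of X x x'" by (simp only: connected_component_of_def)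
  hence "x' \<in> connected_component_of_set X x" by simp
  hence "x' \<in> path_component_of_set X x"
    unfolding path_component_eq_connected_component_of[OF covering_map_locally_path_connected_space[OF assms(1,2)]] .
  thus ?thesis by simp
qed

text \<open>Near a point \<open>f\<close> is \<open>r\<close> followed by the inverse of
  \<open>r'\<close> on a sheet, and both are open.\<close>

lemma lift_open_map:
  assumes "covering_map X B r" "covering_map X' B r'" "continuous_map X X' f"
    and rf: "\<And>x. x \<in> topspace X \<Longrightarrow> r' (f x) = r x"
  shows "open_map X X' f"
  unfolding open_map_def
proof (intro allI impI)
  fix W assume W: "openin X W"
  show "openin X' (f ` W)"
  proof (subst openin_subopen, safe)
    fix x assume x: "x \<in> W"
    hence xX: "x \<in> topspace X" using W openin_subset by blast
    have fx: "f x \<in> topspace X'" using assms(3) xX by (auto simp: continuous_map_def)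
    obtain U V where U: "r' (f x) \<in> U" and UV: "sheets X' B r' U V"
      by (rule covering_map_sheetsE[OF assms(2) covering_map_in[OF assms(2) fx]])
    define W' where "W' = W \<inter> {z \<in> topspace X. f z \<in> V (f x)}"
    have oV: "openin X' (V (f x))" using UV fx U by (rule sheets_open)
    have "openin X W'"
      unfolding W'_def using W openin_continuous_map_preimage[OF assms(3) oV] by (rule openin_Int)
    hence "openin B (r ` W')" using covering_map_open_map[OF assms(1)] unfolding open_map_def by blast
    hence o: "openin X' (V (f x) \<inter> {z \<in> topspace X'. r' z \<in> r ` W'})"
      using oV covering_map_continuous[OF assms(2)] openin_continuous_map_preimage by blast
    have "V (f x) \<inter> {z \<in> topspace X'. r' z \<in> r ` W'} \<subseteq> f ` W"
    proof
      fix z assume "z \<in> V (f x) \<inter> {z \<in> topspace X'. r' z \<in> r ` W'}"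
      then obtain w where w: "w \<in> W'" "r' z = r w" "z \<in> V (f x)" by blast
      have "f w \<in> V (f x)" "r' (f w) = r' z" "w \<in> W" using w rf[of w] unfolding W'_def by auto
      hence "f w = z" using sheets_inj[OF UV fx U] w(3) by blast
      thus "z \<in> f ` W" using \<open>w \<in> W\<close> by blast
    qed
    moreover have "x \<in> W'" unfolding W'_def using x xX sheets_self[OF UV fx U] by simp
    hence "f x \<in> V (f x) \<inter> {z \<in> topspace X'. r' z \<in> r ` W'}"
      using sheets_self[OF UV fx U] fx rf[OF xX] by auto
    ultimately show "\<exists>T. openin X' T \<and> f x \<in> T \<and> T \<subseteq> f ` W" using o by blast
  qed
qed

text \<open>The two halves of \<open>loops\<close> have different roles: closedness passing from
  \<open>X\<close> to \<open>X'\<close> gives the lift \<open>f\<close>, the converse makes it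
  injective. Surjectivity comes from lifting paths, since the part of \<open>X'\<close> over each
  component of the base is connected.\<close>

lemma covering_iso:
  assumes r: "covering_map X B r" and r': "covering_map X' B r'" and B: "locally_path_connected_space B"
    and conn: "\<And>C. C \<in> connected_components_of B \<Longrightarrow> connectedin X {y \<in> topspace X. r y \<in> C}"
      "\<And>C. C \<in> connected_components_of B \<Longrightarrow> connectedin X' {y \<in> topspace X'. r' y \<in> C}"
    and S: "\<And>s. s \<in> S \<Longrightarrow> b s \<in> topspace X' \<and> r' (b s) = r s"
    and loops: "\<And>w w'. \<lbrakk>pathin X w; pathin X' w'; \<forall>t\<in>{0..1}. r (w t) = r' (w' t)\<rbrakk>
        \<Longrightarrow> w 0 = w 1 \<longleftrightarrow> w' 0 = w' 1"
  shows "\<exists>f. homeomorphic_map X X' f \<and> (\<forall>x\<in>topspace X. r' (f x) = r x) \<and>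
    (\<forall>x. (\<exists>s\<in>S. path_component_of X x s) \<longrightarrow> (\<exists>s\<in>S. path_component_of X x s \<and> f s = b s))"
proof -
  have lX: "locally_path_connected_space X" by (rule covering_map_locally_path_connected_space[OF r B])
  have "\<exists>f. continuous_map X X' f \<and> (\<forall>x\<in>topspace X. r' (f x) = r x) \<and>
    (\<forall>x. (\<exists>s\<in>S. path_component_of X x s) \<longrightarrow> (\<exists>s\<in>S. path_component_of X x s \<and> f s = b s))"
  proof (rule lift_criterion[OF r' lX covering_map_continuous[OF r] S])
    fix c w assume "pathin X c" "c 0 = c 1" "pathin X' w" "\<forall>t\<in>{0..1}. r' (w t) = r (c t)"
    thus "w 0 = w 1" using loops[of c w] by simp
  qed
  then obtain f where f: "continuous_map X X' f" "\<forall>x\<in>topspace X. r' (f x) = r x"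
    "\<forall>x. (\<exists>s\<in>S. path_component_of X x s) \<longrightarrow> (\<exists>s\<in>S. path_component_of X x s \<and> f s = b s)" by (elim exE conjE)
  have fX: "f x \<in> topspace X'" if "x \<in> topspace X" for x
    using f(1) that by (auto simp: continuous_map_def)
  have "open_map X X' f" using lift_open_map[OF r r' f(1)] f(2) by blast
  moreover have "inj_on f (topspace X)"
  proof (rule inj_onI)
    fix x y assume xy: "x \<in> topspace X" "y \<in> topspace X" "f x = f y"
    hence "r x = r y" using f(2) by metis
    hence "path_component_of X x y"
      using covering_map_path_component[OF r B conn(1) xy(1,2)] covering_map_in[OF r xy(1)]
      by (simp add: connected_component_of_refl)
    then obtain w where w: "pathin X w" "w 0 = x" "w 1 = y" unfolding path_component_of_def by blast
    have "w 0 = w 1 \<longleftrightarrow> (f \<circ> w) 0 = (f \<circ> w) 1"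
      by (rule loops[OF w(1) pathin_compose[OF w(1) f(1)]]) (use f(2) pathin_subset[OF w(1)] in simp)
    thus "x = y" using w xy(3) by simp
  qed
  moreover have "f ` topspace X = topspace X'"
  proof (intro equalityI subsetI)
    fix x' assume x': "x' \<in> topspace X'"
    hence "r' x' \<in> r ` topspace X" using covering_map_in[OF r' x'] covering_map_surj[OF r] by simp
    then obtain p where p: "p \<in> topspace X" "r p = r' x'" by (metis imageE)
    hence "r' (f p) = r' x'" using f(2) by simp
    hence "path_component_of X' (f p) x'"
      using covering_map_path_component[OF r' B conn(2) fX[OF p(1)] x'] covering_map_in[OF r' x']
      by (simp add: connected_component_of_refl)
    then obtain w' where w': "pathin X' w'" "w' 0 = f p" "w' 1 = x'" unfolding path_component_of_def by blast
    have rw: "pathin B (r' \<circ> w')" using w'(1) covering_map_continuous[OF r'] by (rule pathin_compose)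
    obtain w where w: "pathin X w" "w 0 = p" "\<And>t. t \<in> {0..1} \<Longrightarrow> r (w t) = (r' \<circ> w') t"
      by (rule path_lift[OF r rw p(1)]) (use w'(2) f(2) p in auto)
    have "(f \<circ> w) 1 = w' 1" by (rule path_lift_unique[OF r' pathin_compose[OF w(1) f(1)] w'(1), of 0])
         (use w w' f(2) pathin_subset[OF w(1)] in simp_all)
    thus "x' \<in> f ` topspace X" using w'(3) path_finish_in_topspace[OF w(1)] by force
  qed (use fX in blast)
  ultimately have "homeomorphic_map X X' f"
    using f(1) by (intro bijective_open_imp_homeomorphic_map)
  thus ?thesis using f(2,3) by (intro exI[of _ f] conjI)
qed

text \<open>Over a path connected set that is evenly covered by both \<open>p\<close> and
  \<open>r\<close>, the sheets of \<open>p\<close> are also sheets of \<open>f\<close>: on such a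
  sheet unique lifting identifies \<open>f\<close> with \<open>p\<close> followed by a section of
  \<open>r\<close>.\<close>

lemma covering_factor:
  assumes p: "covering_map N B p" and r: "covering_map X B r" and B: "locally_path_connected_space B"
    and f: "continuous_map N X f" and rf: "\<And>n. n \<in> topspace N \<Longrightarrow> r (f n) = p n"
    and X: "path_connected_space X" and ne: "topspace N \<noteq> {}"
  shows "covering_map N X f"
  unfolding covering_map_sheets
proof (intro conjI ballI f)
  have fX: "f n \<in> topspace X" if "n \<in> topspace N" for n
    using f that by (auto simp: continuous_map_def)
  show "f ` topspace N = topspace X"
  proof (intro equalityI subsetI)
    fix x assume x: "x \<in> topspace X"
    obtain n where n: "n \<in> topspace N" using ne by blast
    obtain w' where w': "pathin X w'" "w' 0 = f n" "w' 1 = x"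
      using X fX[OF n] x unfolding path_connected_space_def by blast
    have rw: "pathin B (r \<circ> w')" using w'(1) covering_map_continuous[OF r] by (rule pathin_compose)
    obtain w where w: "pathin N w" "w 0 = n" "\<And>t. t \<in> {0..1} \<Longrightarrow> p (w t) = (r \<circ> w') t"
      by (rule path_lift[OF p rw n]) (use w'(2) rf n in auto)
    have "(f \<circ> w) 1 = w' 1" by (rule path_lift_unique[OF r pathin_compose[OF w(1) f] w'(1), of 0])
         (use w w' rf pathin_subset[OF w(1)] in simp_all)
    thus "x \<in> f ` topspace N" using w'(3) path_finish_in_topspace[OF w(1)] by force
  qed (use fX in blast)
  fix x assume x: "x \<in> topspace X"
  obtain U0 V0 where U0: "r x \<in> U0" and V0: "sheets X B r U0 V0"
    by (rule covering_map_sheetsE[OF r covering_map_in[OF r x]])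
  obtain U W where U: "r x \<in> U" "U \<subseteq> U0" "path_connectedin B U" and W: "sheets N B p U W"
    by (rule covering_map_path_connected_sheets[OF p B covering_map_in[OF r x] sheets_open_base[OF V0] U0])
  define V where "V y = {z \<in> V0 y. r z \<in> U}" for y
  have V: "sheets X B r U V"
    unfolding V_def by (rule sheets_subset[OF V0 sheets_open_base[OF W] U(2) covering_map_continuous[OF r]])
  obtain s where s: "continuous_map (subtopology B U) X s" "\<forall>u\<in>U. s u \<in> V x \<and> r (s u) = u"
        "\<forall>z\<in>V x. s (r z) = z" "homeomorphic_maps (subtopology X (V x)) (subtopology B U) r s"
    using sheets_section_ex[OF V x U(1)] by (elim exE conjE)
  have hs: "homeomorphic_map (subtopology B U) (subtopology X (V x)) s"
    using s(4) homeomorphic_maps_sym homeomorphic_maps_imp_map by blast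
  have "sheets N X f (V x) W"
    unfolding sheets_def
  proof (intro conjI ballI impI)
    show "openin X (V x)" by (rule sheets_open[OF V x U(1)])
    fix n assume n: "n \<in> topspace N" "f n \<in> V x"
    have pn: "p n \<in> U" using rf[OF n(1)] n(2) unfolding V_def by simp
    show "n \<in> W n" "openin N (W n)" using sheets_self[OF W n(1) pn] sheets_open[OF W n(1) pn] by blast+
    show "W z = W n" if "z \<in> W n" for z using sheets_eq[OF W n(1) pn that] .
    have Wt: "topspace (subtopology N (W n)) = W n"
      using sheets_open[OF W n(1) pn] openin_subset by auto
    have pW: "path_connectedin N (W n)" using sheets_path_connectedin[OF W U(3) n(1) pn] .
    have hp: "homeomorphic_map (subtopology N (W n)) (subtopology B U) p" by (rule sheets_homeo[OF W n(1) pn])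
    hence sp: "homeomorphic_map (subtopology N (W n)) (subtopology X (V x)) (s \<circ> p)"
      using hs by (rule homeomorphic_map_compose)
    moreover have "(s \<circ> p) z = f z" if z: "z \<in> W n" for z
    proof -
      obtain c where c: "pathin N c" "c \<in> {0..1} \<rightarrow> W n" "c 0 = n" "c 1 = z"
        using pW z sheets_self[OF W n(1) pn] unfolding path_connectedin by blast
      have cW: "pathin (subtopology N (W n)) c"
        using c unfolding pathin_subtopology by auto
      have spc: "continuous_map (subtopology N (W n)) X (s \<circ> p)"
        using homeomorphic_imp_continuous_map[OF sp] by (simp add: continuous_map_in_subtopology)
      have "(f \<circ> c) 1 = (s \<circ> p \<circ> c) 1"
      proof (rule path_lift_unique[OF r pathin_compose[OF c(1) f] pathin_compose[OF cW spc], of 0])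
        fix t :: real assume t: "t \<in> {0..1}"
        hence "c t \<in> W n" using c(2) by blast
        hence "p (c t) \<in> U" using sheets_image[OF W n(1) pn] by blast
        thus "r ((f \<circ> c) t) = r ((s \<circ> p \<circ> c) t)"
          using s(2) rf pathin_subset[OF c(1) t] by simp
      next
        show "(f \<circ> c) 0 = (s \<circ> p \<circ> c) 0" using s(3) n rf[OF n(1)] c(3) by force
      qed simp_all
      thus ?thesis using c(4) by simp
    qed
    ultimately show "homeomorphic_map (subtopology N (W n)) (subtopology X (V x)) f"
      using homeomorphic_map_eq[OF sp] Wt by blast
  qed
  thus "\<exists>U V. x \<in> U \<and> sheets N X f U V"
    using sheets_self[OF V x U(1)] by blast
qed

section \<open>Restrictions and products of coverings; separation and countability\<close>

lemma covering_map_restrict: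
  assumes "covering_map T X q"
  shows "covering_map (subtopology T {y \<in> topspace T. q y \<in> A}) (subtopology X A) q"
  unfolding covering_map_sheets
proof (intro conjI ballI)
  let ?P = "{y \<in> topspace T. q y \<in> A}"
  show "continuous_map (subtopology T ?P) (subtopology X A) q"
    by (rule continuous_map_into_subtopology[OF continuous_map_from_subtopology[OF covering_map_continuous[OF assms]]]) auto
  have "q ` topspace T = topspace X" by (rule covering_map_surj[OF assms])
  thus "q ` topspace (subtopology T ?P) = topspace (subtopology X A)" by auto
  fix x assume "x \<in> topspace (subtopology X A)"
  hence x: "x \<in> topspace X" "x \<in> A" by auto
  obtain U V where U: "x \<in> U" and UV: "sheets T X q U V" by (rule covering_map_sheetsE[OF assms x(1)])
  have "sheets (subtopology T ?P) (subtopology X A) q (U \<inter> A) (\<lambda>y. V y \<inter> ?P)"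
    unfolding sheets_def
  proof (intro conjI ballI impI)
    show "openin (subtopology X A) (U \<inter> A)"
      using sheets_open_base[OF UV] openin_subtopology by blast
    fix y assume "y \<in> topspace (subtopology T ?P)" "q y \<in> U \<inter> A"
    hence y: "y \<in> topspace T" "q y \<in> A" "q y \<in> U" by auto
    show "y \<in> V y \<inter> ?P" using y sheets_self[OF UV y(1,3)] by simp
    show "openin (subtopology T ?P) (V y \<inter> ?P)"
      using sheets_open[OF UV y(1,3)] openin_subtopology by blast
    show "V z \<inter> ?P = V y \<inter> ?P" if "z \<in> V y \<inter> ?P" for z
      using sheets_eq[OF UV y(1,3), of z] that by simp
    have "homeomorphic_map (subtopology (subtopology T (V y)) ?P) (subtopology (subtopology X U) A) q"
      by (rule homeomorphic_map_subtopologies_alt[OF sheets_homeo[OF UV y(1,3)]]) auto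
    thus "homeomorphic_map (subtopology (subtopology T ?P) (V y \<inter> ?P)) (subtopology (subtopology X A) (U \<inter> A)) q"
      by (simp add: subtopology_subtopology Int_commute Int_left_commute Int_absorb)
  qed
  thus "\<exists>U V. x \<in> U \<and> sheets (subtopology T ?P) (subtopology X A) q U V"
    using U x(2) by blast
qed

lemma covering_map_prod:
  assumes "covering_map T X q" "covering_map T' X' q'"
  shows "covering_map (prod_topology T T') (prod_topology X X') (map_prod q q')"
  unfolding covering_map_sheets
proof (intro conjI ballI)
  show "continuous_map (prod_topology T T') (prod_topology X X') (map_prod q q')"
    unfolding map_prod_def case_prod_unfold
    using covering_map_continuous[OF assms(1)] covering_map_continuous[OF assms(2)]
    by (intro continuous_map_pairedI continuous_map_compose[OF continuous_map_fst, unfolded comp_def]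
        continuous_map_compose[OF continuous_map_snd, unfolded comp_def])
  show "map_prod q q' ` topspace (prod_topology T T') = topspace (prod_topology X X')"
    using covering_map_surj[OF assms(1)] covering_map_surj[OF assms(2)] by (simp add: map_prod_surj_on)
  fix p assume "p \<in> topspace (prod_topology X X')"
  then obtain x x' where p: "p = (x, x')" "x \<in> topspace X" "x' \<in> topspace X'" by auto
  obtain U V where U: "x \<in> U" and V: "sheets T X q U V" by (rule covering_map_sheetsE[OF assms(1) p(2)])
  obtain U' V' where U': "x' \<in> U'" and V': "sheets T' X' q' U' V'" by (rule covering_map_sheetsE[OF assms(2) p(3)])
  have "sheets (prod_topology T T') (prod_topology X X') (map_prod q q') (U \<times> U') (\<lambda>(y, y'). V y \<times> V' y')"
    unfolding sheets_def
  proof (intro conjI ballI impI)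
    show "openin (prod_topology X X') (U \<times> U')"
      using sheets_open_base[OF V] sheets_open_base[OF V'] by (simp add: openin_prod_Times_iff)
    fix z assume "z \<in> topspace (prod_topology T T')" "map_prod q q' z \<in> U \<times> U'"
    then obtain y y' where z: "z = (y, y')" "y \<in> topspace T" "y' \<in> topspace T'" "q y \<in> U" "q' y' \<in> U'" by auto
    note y = z(2,4) and y' = z(3,5)
    show "z \<in> (case z of (y, y') \<Rightarrow> V y \<times> V' y')"
      using sheets_self[OF V y] sheets_self[OF V' y'] z(1) by simp
    show "openin (prod_topology T T') (case z of (y, y') \<Rightarrow> V y \<times> V' y')"
      using sheets_open[OF V y] sheets_open[OF V' y'] z(1) by (simp add: openin_prod_Times_iff)
    show "(case w of (y, y') \<Rightarrow> V y \<times> V' y') = (case z of (y, y') \<Rightarrow> V y \<times> V' y')"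
      if "w \<in> (case z of (y, y') \<Rightarrow> V y \<times> V' y')" for w
      using that z(1) sheets_eq[OF V y, of "fst w"] sheets_eq[OF V' y', of "snd w"] by (cases w) simp
    obtain s where s: "homeomorphic_maps (subtopology T (V y)) (subtopology X U) q s"
      using sheets_homeo[OF V y] unfolding homeomorphic_map_maps by (elim exE)
    obtain s' where s': "homeomorphic_maps (subtopology T' (V' y')) (subtopology X' U') q' s'"
      using sheets_homeo[OF V' y'] unfolding homeomorphic_map_maps by (elim exE)
    have "homeomorphic_maps (prod_topology (subtopology T (V y)) (subtopology T' (V' y')))
        (prod_topology (subtopology X U) (subtopology X' U')) (\<lambda>(x, y). (q x, q' y)) (\<lambda>(x, y). (s x, s' y))"
      unfolding homeomorphic_maps_prod by (intro disjI2 conjI s s')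
    hence "homeomorphic_map (prod_topology (subtopology T (V y)) (subtopology T' (V' y')))
        (prod_topology (subtopology X U) (subtopology X' U')) (map_prod q q')"
      unfolding map_prod_def by (rule homeomorphic_maps_imp_map)
    thus "homeomorphic_map (subtopology (prod_topology T T') (case z of (y, y') \<Rightarrow> V y \<times> V' y'))
      (subtopology (prod_topology X X') (U \<times> U')) (map_prod q q')" by (simp add: z(1) subtopology_Times)
  qed
  moreover have "p \<in> U \<times> U'" using U U' p(1) by simp
  ultimately show "\<exists>U V. p \<in> U \<and> sheets (prod_topology T T') (prod_topology X X') (map_prod q q') U V"
    by (intro exI conjI)
qed

text \<open>Points of one fibre are separated by their sheets, other points by preimages of sets in
  the base.\<close>

lemma covering_map_Hausdorff_space:
  assumes "covering_map T X q" "Hausdorff_space X"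
  shows "Hausdorff_space T"
  unfolding Hausdorff_space_def
proof (intro allI impI, elim conjE)
  fix x y assume x: "x \<in> topspace T" and y: "y \<in> topspace T" and ne: "x \<noteq> y"
  note qx = covering_map_in[OF assms(1) x] and qy = covering_map_in[OF assms(1) y]
  note cq = covering_map_continuous[OF assms(1)]
  show "\<exists>U V. openin T U \<and> openin T V \<and> x \<in> U \<and> y \<in> V \<and> disjnt U V"
  proof (cases "q x = q y")
    case True
    obtain U V where U: "q x \<in> U" and V: "sheets T X q U V" by (rule covering_map_sheetsE[OF assms(1) qx])
    have U': "q y \<in> U" using U True by simp
    have "disjnt (V x) (V y)"
      unfolding disjnt_iff
    proof (intro allI notI, elim conjE)
      fix z assume z: "z \<in> V x" "z \<in> V y"
      have "V x = V y" using sheets_eq[OF V x U z(1)] sheets_eq[OF V y U' z(2)] by simp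
      hence "x \<in> V y" using sheets_self[OF V x U] by simp
      hence "x = y" by (rule sheets_inj[OF V y U' _ sheets_self[OF V y U'] True])
      thus False using ne by blast
    qed
    thus ?thesis
      using sheets_open[OF V x U] sheets_open[OF V y U'] sheets_self[OF V x U] sheets_self[OF V y U']
      by (intro exI[of _ "V x"] exI[of _ "V y"] conjI)
  next
    case False
    hence "\<exists>U V. openin X U \<and> openin X V \<and> q x \<in> U \<and> q y \<in> V \<and> disjnt U V"
      using assms(2) qx qy unfolding Hausdorff_space_def by simp
    then obtain U V where "openin X U" "openin X V" "q x \<in> U" "q y \<in> V" "disjnt U V" by (elim exE conjE)
    thus ?thesis
      using x y openin_continuous_map_preimage[OF cq, of U] openin_continuous_map_preimage[OF cq, of V]
      by (intro exI[of _ "{z \<in> topspace T. q z \<in> U}"] exI[of _ "{z \<in> topspace T. q z \<in> V}"])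
         (simp add: disjnt_iff)
  qed
qed

lemma second_countable_countable_open_cover:
  assumes "countable I" "\<And>i. i \<in> I \<Longrightarrow> openin T (W i)"
    "\<And>i. i \<in> I \<Longrightarrow> second_countable (subtopology T (W i))" "topspace T \<subseteq> (\<Union>i\<in>I. W i)"
  shows "second_countable T"
proof -
  have "\<forall>i\<in>I. \<exists>\<B>. countable \<B> \<and> (\<forall>V\<in>\<B>. openin (subtopology T (W i)) V) \<and>
     (\<forall>U x. openin (subtopology T (W i)) U \<and> x \<in> U \<longrightarrow> (\<exists>V\<in>\<B>. x \<in> V \<and> V \<subseteq> U))"
    using assms(3) unfolding second_countable_def by simp
  from bchoice[OF this] obtain \<B> where "\<forall>i\<in>I. countable (\<B> i) \<and> (\<forall>V\<in>\<B> i. openin (subtopology T (W i)) V) \<and>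
     (\<forall>U x. openin (subtopology T (W i)) U \<and> x \<in> U \<longrightarrow> (\<exists>V\<in>\<B> i. x \<in> V \<and> V \<subseteq> U))" by (elim exE)
  hence \<B>: "\<And>i. i \<in> I \<Longrightarrow> countable (\<B> i)" "\<And>i V. i \<in> I \<Longrightarrow> V \<in> \<B> i \<Longrightarrow> openin (subtopology T (W i)) V"
    "\<And>i U x. i \<in> I \<Longrightarrow> openin (subtopology T (W i)) U \<Longrightarrow> x \<in> U \<Longrightarrow> \<exists>V\<in>\<B> i. x \<in> V \<and> V \<subseteq> U" by simp_all
  show ?thesis
    unfolding second_countable_def
  proof (intro exI[of _ "\<Union>i\<in>I. \<B> i"] conjI ballI allI impI)
    show "countable (\<Union>i\<in>I. \<B> i)" using assms(1) \<B>(1) by (rule countable_UN)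
    show "openin T V" if V: "V \<in> (\<Union>i\<in>I. \<B> i)" for V
    proof -
      obtain i where i: "i \<in> I" "V \<in> \<B> i" using V by (elim UN_E)
      show ?thesis by (rule openin_trans_full[OF \<B>(2)[OF i] assms(2)[OF i(1)]])
    qed
    fix U x assume U: "openin T U \<and> x \<in> U"
    hence "x \<in> topspace T" using openin_subset by blast
    then obtain i where i: "i \<in> I" "x \<in> W i" using assms(4) by blast
    have "openin (subtopology T (W i)) (W i \<inter> U)" using U openin_subtopology_Int2 by blast
    then obtain V where "V \<in> \<B> i" "x \<in> V" "V \<subseteq> W i \<inter> U" using \<B>(3)[OF i(1)] i(2) U by blast
    thus "\<exists>V\<in>\<Union>i\<in>I. \<B> i. x \<in> V \<and> V \<subseteq> U" using i(1) by blast
  qed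
qed

text \<open>Poincare-Volterra: every sheet of a countable cover by evenly covered sets meets only countably
  many others, since each intersection contains a point over a fixed countable dense set; hence the
  sheets that can be reached by chains from countably many starting points are clopen and countable
  in number.\<close>

lemma covering_map_second_countable:
  assumes q: "covering_map T X q" and X: "second_countable X" "locally_path_connected_space X"
    and conn: "\<And>C. C \<in> connected_components_of X \<Longrightarrow> connectedin T {y \<in> topspace T. q y \<in> C}"
  shows "second_countable T"
proof -
  define \<U> where "\<U> = {U. \<exists>V. sheets T X q U V}"
  have "\<forall>U\<in>\<U>. openin X U" unfolding \<U>_def using sheets_open_base by blast
  moreover have "\<Union>\<U> = topspace X"
  proof (intro equalityI subsetI)
    fix x assume x: "x \<in> topspace X"
    obtain U V where "x \<in> U" "sheets T X q U V" by (rule covering_map_sheetsE[OF q x])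
    thus "x \<in> \<Union>\<U>" unfolding \<U>_def by blast
  next
    fix x assume "x \<in> \<Union>\<U>"
    thus "x \<in> topspace X" using \<open>\<forall>U\<in>\<U>. openin X U\<close> openin_subset by blast
  qed
  ultimately have "\<exists>\<V>. countable \<V> \<and> \<V> \<subseteq> \<U> \<and> \<Union>\<V> = topspace X"
    using second_countable_imp_Lindelof_space[OF X(1), unfolded Lindelof_space_def, rule_format, of \<U>] by simp
  then obtain \<V> where \<V>: "countable \<V>" "\<V> \<subseteq> \<U>" "\<Union>\<V> = topspace X" by (elim exE conjE)
  have "\<forall>U\<in>\<V>. \<exists>V. sheets T X q U V" using \<V>(2) unfolding \<U>_def by blast
  from bchoice[OF this] obtain V where "\<forall>U\<in>\<V>. sheets T X q U (V U)" by (elim exE)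
  note V = bspec[OF this]
  obtain D where D: "countable D" "D \<subseteq> topspace X" "X closure_of D = topspace X"
    using second_countable_imp_separable_space[OF X(1)] unfolding separable_space_def by (elim exE conjE)
  have dense: "D \<inter> W \<noteq> {}" if "openin X W" "W \<noteq> {}" for W
    using D(3) that unfolding dense_intersects_open by simp
  \<comment> \<open>The points over \<open>D\<close> in the chosen sheets through \<open>y\<close>.
    There are countably many sheets, and on each of them \<open>q\<close> is injective with values
    in the countable set \<open>D\<close>.\<close>
  define N where "N y = (\<Union>U\<in>{U \<in> \<V>. q y \<in> U}. {z \<in> V U y. q z \<in> D})" for y
  have N: "countable (N y)" if y: "y \<in> topspace T" for y
    unfolding N_def
  proof (intro countable_UN)
    show "countable {U \<in> \<V>. q y \<in> U}" using \<V>(1) by (rule countable_subset[rotated]) blast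
    fix U assume U: "U \<in> {U \<in> \<V>. q y \<in> U}"
    show "countable {z \<in> V U y. q z \<in> D}"
    proof (rule countable_image_inj_on)
      show "countable (q ` {z \<in> V U y. q z \<in> D})" using D(1) by (rule countable_subset[rotated]) blast
      show "inj_on q {z \<in> V U y. q z \<in> D}"
      proof (rule inj_onI)
        have U': "U \<in> \<V>" "q y \<in> U" using U by simp_all
        fix z z' assume "z \<in> {z \<in> V U y. q z \<in> D}" "z' \<in> {z \<in> V U y. q z \<in> D}" "q z = q z'"
        thus "z = z'" using sheets_inj[OF V[OF U'(1)] y U'(2), of z z'] by simp
      qed
    qed
  qed
  have NT: "N y \<subseteq> topspace T" if "y \<in> topspace T" for y
  proof
    fix z assume "z \<in> N y"
    then obtain U where U: "U \<in> \<V>" "q y \<in> U" "z \<in> V U y" unfolding N_def by blast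
    thus "z \<in> topspace T" using sheets_in[OF V[OF U(1)] that U(2,3)] by simp
  qed
  define g where "g = inv_into (topspace T) q"
  have g: "g x \<in> topspace T \<and> q (g x) = x" if "x \<in> topspace X" for x
    unfolding g_def using that covering_map_surj[OF q] inv_into_into[of x q "topspace T"] f_inv_into_f[of x q "topspace T"]
    by simp
  \<comment> \<open>Points that chains of \<open>n\<close> sheets reach from one chosen point over
    each point of \<open>D\<close>. Their union \<open>PP\<close> is countable and closed under
    passing to \<open>N\<close>.\<close>
  define P where "P n = ((\<lambda>S. \<Union>y\<in>S. N y) ^^ n) (g ` D)" for n :: nat
  have P0: "P 0 = g ` D" and PS: "P (Suc n) = (\<Union>y\<in>P n. N y)" for n by (simp_all add: P_def)
  have P: "countable (P n) \<and> P n \<subseteq> topspace T" for n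
  proof (induction n)
    case 0
    thus ?case unfolding P0 using D(1,2) g by (auto intro!: countable_image)
  next
    case (Suc n)
    hence "countable (\<Union>y\<in>P n. N y)" using N by (intro countable_UN) auto
    thus ?case unfolding PS using Suc NT by blast
  qed
  define PP where "PP = (\<Union>n. P n)"
  have PP: "countable PP" "PP \<subseteq> topspace T" unfolding PP_def using P by auto
  have step: "z \<in> PP" if yz: "y \<in> PP" "z \<in> N y" for y z
  proof -
    obtain n where "y \<in> P n" using yz(1) unfolding PP_def by blast
    hence "z \<in> P (Suc n)" unfolding PS using yz(2) by blast
    thus ?thesis unfolding PP_def by blast
  qed
  define I where "I = {(y, U). y \<in> PP \<and> U \<in> \<V> \<and> q y \<in> U}"
  define W where "W = (\<lambda>(y, U). V U y)"
  have I: "countable I" by (rule countable_subset[of _ "PP \<times> \<V>"]) (use PP(1) \<V>(1) in \<open>auto simp: I_def\<close>)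
  have WI: "openin T (W i) \<and> second_countable (subtopology T (W i))" if i: "i \<in> I" for i
  proof -
    obtain y U where yi: "i = (y, U)" by (cases i)
    hence yU: "i = (y, U)" "y \<in> PP" "U \<in> \<V>" "q y \<in> U" using i unfolding I_def by simp_all
    have y: "y \<in> topspace T" using yU(2) PP(2) by blast
    have "subtopology T (V U y) homeomorphic_space subtopology X U"
      using sheets_homeo[OF V[OF yU(3)] y yU(4)] by (rule homeomorphic_map_imp_homeomorphic_space)
    hence "second_countable (subtopology T (V U y))"
      by (rule iffD2[OF homeomorphic_space_second_countability second_countable_subtopology[OF X(1)]])
    thus ?thesis
      unfolding yU(1) W_def using sheets_open[OF V[OF yU(3)] y yU(4)] by simp
  qed
  define O' where "O' = (\<Union>i\<in>I. W i)"
  have oO: "openin T O'" unfolding O'_def using WI by (intro openin_Union) auto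
  have "openin T (topspace T - O')"
  proof (subst openin_subopen, intro ballI)
    fix z assume z: "z \<in> topspace T - O'"
    hence zT: "z \<in> topspace T" by blast
    have "q z \<in> \<Union>\<V>" using \<V>(3) covering_map_in[OF q zT] by simp
    then obtain U where U: "U \<in> \<V>" "q z \<in> U" by (elim UnionE)
    have oV: "openin T (V U z)" by (rule sheets_open[OF V[OF U(1)] zT U(2)])
    \<comment> \<open>If the sheet met \<open>O'\<close>, the open intersection would contain a
      point over \<open>D\<close>. This point is reached in one more step, and the sheet over
      \<open>U\<close> through it is the sheet through \<open>z\<close>.\<close>
    have "V U z \<inter> O' = {}"
    proof (rule ccontr)
      assume "V U z \<inter> O' \<noteq> {}"
      then obtain v where v: "v \<in> V U z" "v \<in> O'" by blast
      then obtain i where i: "i \<in> I" "v \<in> W i" unfolding O'_def by (elim UN_E)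
      obtain y U' where "i = (y, U')" by (cases i)
      hence y: "y \<in> PP" "U' \<in> \<V>" "q y \<in> U'" "v \<in> V U z" "v \<in> V U' y"
        using i v(1) unfolding I_def W_def by simp_all
      have yT: "y \<in> topspace T" using y(1) PP(2) by blast
      have o: "openin T (V U z \<inter> V U' y)"
        using oV sheets_open[OF V[OF y(2)] yT y(3)] by (rule openin_Int)
      have "openin X (q ` (V U z \<inter> V U' y))"
        using covering_map_open_map[OF q] o unfolding open_map_def by blast
      hence "D \<inter> q ` (V U z \<inter> V U' y) \<noteq> {}"
      proof (rule dense)
        show "q ` (V U z \<inter> V U' y) \<noteq> {}" using y(4,5) by auto
      qed
      then obtain w where w: "w \<in> V U z" "w \<in> V U' y" "q w \<in> D" by blast
      have "w \<in> N y" unfolding N_def using y(2,3) w by blast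
      hence "w \<in> PP" by (rule step[OF y(1)])
      moreover have "q w \<in> U" using imageI[OF w(1), of q] by (simp only: sheets_image[OF V[OF U(1)] zT U(2)])
      ultimately have "(w, U) \<in> I" unfolding I_def using U(1) by simp
      moreover have "V U w = V U z" by (rule sheets_eq[OF V[OF U(1)] zT U(2) w(1)])
      hence "z \<in> W (w, U)" unfolding W_def using sheets_self[OF V[OF U(1)] zT U(2)] by simp
      ultimately have "z \<in> O'" unfolding O'_def by (rule UN_I)
      thus False using z by blast
    qed
    moreover have "V U z \<subseteq> topspace T" using oV openin_subset by blast
    ultimately show "\<exists>S. openin T S \<and> z \<in> S \<and> S \<subseteq> topspace T - O'"
      using oV sheets_self[OF V[OF U(1)] zT U(2)] by (intro exI[of _ "V U z"]) blast
  qed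
  hence cO: "closedin T O'" unfolding closedin_def using openin_subset[OF oO] by blast
  \<comment> \<open>Each component of the base is open and so meets \<open>D\<close>. The part of
    \<open>T\<close> over it is connected and meets the clopen set \<open>O'\<close>, hence is
    contained in it.\<close>
  have "topspace T \<subseteq> O'"
  proof
    fix z assume z: "z \<in> topspace T"
    define C where "C = connected_component_of_set X (q z)"
    have C: "C \<in> connected_components_of X"
      unfolding C_def by (rule iffD2[OF connected_component_in_connected_components_of]) (rule covering_map_in[OF q z])
    have "openin X C"
      unfolding C_def using X(2)
      by (intro openin_connected_component_of_locally_connected_space locally_path_connected_imp_locally_connected_space)
    moreover have zC: "q z \<in> C"
      unfolding C_def using covering_map_in[OF q z] by (simp add: connected_component_of_refl)
    ultimately have "D \<inter> C \<noteq> {}" using dense by blast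
    then obtain d where d: "d \<in> D" "d \<in> C" by blast
    have dX: "d \<in> topspace X" using d D(2) by blast
    hence "d \<in> \<Union>\<V>" using \<V>(3) by simp
    then obtain U where U: "U \<in> \<V>" "d \<in> U" by (elim UnionE)
    have "g d \<in> P 0" unfolding P0 using d(1) by blast
    hence "g d \<in> PP" unfolding PP_def by blast
    hence "(g d, U) \<in> I" unfolding I_def using U g[OF dX] by simp
    moreover have "g d \<in> W (g d, U)" unfolding W_def using sheets_self[OF V[OF U(1)], of "g d"] g[OF dX] U(2) by simp
    ultimately have "g d \<in> O'" unfolding O'_def by (rule UN_I)
    moreover have "g d \<in> {y \<in> topspace T. q y \<in> C}" using g[OF dX] d(2) by simp
    ultimately have "{y \<in> topspace T. q y \<in> C} \<subseteq> O'"
      using connectedin_clopen_cases[OF conn[OF C] cO oO] by (auto simp: disjnt_iff)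
    thus "z \<in> O'" using z zC by blast
  qed
  thus ?thesis
    unfolding O'_def by (rule second_countable_countable_open_cover[OF I, rotated 2]) (use WI in simp_all)
qed

section \<open>Cocycles and paths\<close>

text \<open>Parametrized by coordinate 1 as in \<open>H1_eval\<close>, so that vertex 0 is the start
  of the path.\<close>

definition path_simplex :: "(real \<Rightarrow> 'a) \<Rightarrow> (nat \<Rightarrow> real) \<Rightarrow> 'a" where
  "path_simplex g = restrict (\<lambda>u. g (u 1)) (standard_simplex 1)"

definition cocycle :: "'a topology \<Rightarrow> 'a cochain \<Rightarrow> bool" where
  "cocycle X z \<longleftrightarrow> cochain 1 X z \<and> coboundary 1 X z = (\<lambda>_. 0)"

text \<open>Meant for all paths: on a path that is not closed the value depends on the chosen
  cocycle, but it is still additive under joining.\<close>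

definition path_value :: "'a cochain \<Rightarrow> (real \<Rightarrow> 'a) \<Rightarrow> real" where
  "path_value z g = z (path_simplex g)"

text \<open>The standard 2-simplex in its coordinates 1 and 2.\<close>

definition triangle :: "(real \<times> real) set" where
  "triangle = {(a, b). 0 \<le> a \<and> 0 \<le> b \<and> a + b \<le> 1}"

definition point_simplex :: "'a \<Rightarrow> (nat \<Rightarrow> real) \<Rightarrow> 'a" where
  "point_simplex x = restrict (\<lambda>_. x) (standard_simplex 0)"

section \<open>Simplices of dimension at most two in terms of paths and triangles\<close>

lemma cochain_eval_superset:
  assumes "finite S" "Poly_Mapping.keys c \<subseteq> S"
  shows "cochain_eval z c = (\<Sum>s\<in>S. of_int (Poly_Mapping.lookup c s) * z s)"
  unfolding cochain_eval_def using assms by (intro sum.mono_neutral_left) (auto simp: in_keys_iff)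

lemma cochain_eval_add: "cochain_eval z (c + d) = cochain_eval z c + cochain_eval z d"
proof -
  let ?S = "Poly_Mapping.keys c \<union> Poly_Mapping.keys d"
  have "Poly_Mapping.keys (c + d) \<subseteq> ?S" by (rule Poly_Mapping.keys_add)
  thus ?thesis by (simp add: cochain_eval_superset[of ?S] lookup_add algebra_simps sum.distrib)
qed

lemma cochain_eval_frag_of [simp]: "cochain_eval z (frag_of s) = z s"
  by (simp add: cochain_eval_superset[of "{s}"])

lemma cochain_eval_diff: "cochain_eval z (c - d) = cochain_eval z c - cochain_eval z d"
  using cochain_eval_add[of z "c - d" d] by simp

lemma coboundary_0: "singular_simplex 1 X s \<Longrightarrow> coboundary 0 X b s = b (singular_face 1 0 s) - b (singular_face 1 1 s)"
  unfolding coboundary_def chain_boundary_of by (simp add: cochain_eval_add cochain_eval_diff)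

lemma coboundary_1:
  "singular_simplex 2 X s \<Longrightarrow>
    coboundary 1 X z s = z (singular_face 2 0 s) - z (singular_face 2 1 s) + z (singular_face 2 2 s)"
  unfolding coboundary_def chain_boundary_of by (simp add: cochain_eval_add cochain_eval_diff numeral_2_eq_2)

lemma singular_simplex_path_simplex:
  assumes "pathin X g"
  shows "singular_simplex 1 X (path_simplex g)"
proof -
  have "continuous_map (subtopology (powertop_real UNIV) (standard_simplex 1)) I01 (\<lambda>u. u 1)"
    by (intro continuous_map_into_subtopology continuous_map_from_subtopology continuous_map_product_projection)
       (auto simp: standard_simplex_def)
  hence "continuous_map (subtopology (powertop_real UNIV) (standard_simplex 1)) X (g \<circ> (\<lambda>u. u 1))"
    using assms unfolding pathin_def by (rule continuous_map_compose)
  thus ?thesis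
    unfolding singular_simplex_def path_simplex_def comp_def
    by (intro conjI restrict_extensional, elim continuous_map_eq) simp
qed

lemma path_simplex_cong: "(\<And>t. t \<in> {0..1} \<Longrightarrow> f t = g t) \<Longrightarrow> path_simplex f = path_simplex g"
  unfolding path_simplex_def by (rule restrict_ext) (simp add: standard_simplex_def)

lemma path_value_cong: "(\<And>t. t \<in> {0..1} \<Longrightarrow> f t = g t) \<Longrightarrow> path_value z f = path_value z g"
  unfolding path_value_def using path_simplex_cong[of f g] by simp

lemma singular_1_simplex_path:
  assumes "singular_simplex 1 X s"
  obtains g where "pathin X g" "s = path_simplex g"
proof -
  \<comment> \<open>The inverse of reading off coordinate 1.\<close>
  define e where "e t = (\<lambda>i::nat. if i = 0 then 1 - t else if i = 1 then t else 0)" for t :: real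
  have "continuous_map I01 (subtopology (powertop_real UNIV) (standard_simplex 1)) e"
  proof (intro continuous_map_into_subtopology)
    show "continuous_map I01 (powertop_real UNIV) e"
      unfolding continuous_map_componentwise_UNIV
    proof
      fix k show "continuous_map I01 euclideanreal (\<lambda>x. e x k)"
        by (cases "k = 0"; cases "k = 1"; simp add: e_def continuous_on_diff)
    qed
  qed (auto simp: e_def standard_simplex_def)
  hence "pathin X (s \<circ> e)"
    using continuous_map_compose[of _ _ e X s] assms unfolding pathin_def singular_simplex_def by simp
  moreover have "s = path_simplex (s \<circ> e)"
  proof
    fix u show "s u = path_simplex (s \<circ> e) u"
    proof (cases "u \<in> standard_simplex 1")
      case True
      hence "u = e (u 1)" unfolding e_def standard_simplex_def by (auto simp: fun_eq_iff)
      thus ?thesis using True by (simp add: path_simplex_def)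
    next
      case False
      thus ?thesis using assms by (simp add: path_simplex_def singular_simplex_def extensional_def)
    qed
  qed
  ultimately show thesis by (rule that)
qed

text \<open>Face \<open>k\<close> omits vertex \<open>k\<close>, so face 0 is the end of the path
  and face 1 its start.\<close>

lemma singular_face_path_simplex:
  "singular_face 1 0 (path_simplex g) = point_simplex (g 1)"
  "singular_face 1 1 (path_simplex g) = point_simplex (g 0)"
proof -
  have "simplical_face 0 u \<in> standard_simplex 1" "simplical_face 1 u \<in> standard_simplex 1"
    if "u \<in> standard_simplex 0" for u :: "nat \<Rightarrow> real"
    using that simplical_face_in_standard_simplex[of 1] by simp_all
  thus "singular_face 1 0 (path_simplex g) = point_simplex (g 1)"
    "singular_face 1 1 (path_simplex g) = point_simplex (g 0)"
    unfolding singular_face_def path_simplex_def point_simplex_def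
    by (auto intro!: restrict_ext simp: simplical_face_def standard_simplex_0)
qed

definition triangle_simplex :: "(real \<times> real \<Rightarrow> 'a) \<Rightarrow> (nat \<Rightarrow> real) \<Rightarrow> 'a" where
  "triangle_simplex g = restrict (\<lambda>u. g (u 1, u 2)) (standard_simplex 2)"

lemma standard_simplex_2: "u \<in> standard_simplex 2 \<Longrightarrow> (u 1, u 2) \<in> triangle \<and> u 0 = 1 - u 1 - u 2"
proof -
  assume u: "u \<in> standard_simplex 2"
  have "0 \<le> u i" for i using u unfolding standard_simplex_def by simp
  from this[of 0] this[of 1] this[of 2] have "0 \<le> u 0" "0 \<le> u 1" "0 \<le> u 2" .
  moreover have "u 0 + u 1 + u 2 = 1" using u unfolding standard_simplex_def by (simp add: numeral_2_eq_2)
  ultimately show ?thesis unfolding triangle_def by simp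
qed

lemma singular_simplex_triangle_simplex:
  assumes "continuous_map (top_of_set triangle) X g"
  shows "singular_simplex 2 X (triangle_simplex g)"
proof -
  have "continuous_map (subtopology (powertop_real UNIV) (standard_simplex 2)) (prod_topology euclideanreal euclideanreal) (\<lambda>u. (u 1, u 2))"
    by (intro continuous_map_pairedI continuous_map_from_subtopology continuous_map_product_projection) auto
  hence "continuous_map (subtopology (powertop_real UNIV) (standard_simplex 2)) (top_of_set triangle) (\<lambda>u. (u 1, u 2))"
    using standard_simplex_2 by (intro continuous_map_into_subtopology) (auto simp: prod_topology_subtopology_eu[of UNIV UNIV, simplified])
  hence "continuous_map (subtopology (powertop_real UNIV) (standard_simplex 2)) X (g \<circ> (\<lambda>u. (u 1, u 2)))"
    using assms by (rule continuous_map_compose)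
  thus ?thesis
    unfolding singular_simplex_def triangle_simplex_def comp_def
    by (intro conjI restrict_extensional, elim continuous_map_eq) simp
qed

text \<open>The vertices 0, 1, 2 sit at \<open>(0, 0)\<close>, \<open>(1, 0)\<close>,
  \<open>(0, 1)\<close>; face \<open>k\<close> is the edge opposite to vertex \<open>k\<close>,
  traversed in the order of the vertices.\<close>

lemma singular_face_triangle_simplex:
  "singular_face 2 0 (triangle_simplex g) = path_simplex (\<lambda>t. g (1 - t, t))"
  "singular_face 2 1 (triangle_simplex g) = path_simplex (\<lambda>t. g (0, t))"
  "singular_face 2 2 (triangle_simplex g) = path_simplex (\<lambda>t. g (t, 0))"
proof -
  have *: "simplical_face k u \<in> standard_simplex 2"
    if "u \<in> standard_simplex 1" "k \<le> 2" for u :: "nat \<Rightarrow> real" and k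
    using that simplical_face_in_standard_simplex[of 2 k u] by simp
  have **: "u 0 = 1 - u 1" if "u \<in> standard_simplex 1" for u :: "nat \<Rightarrow> real"
    using that by (auto simp: standard_simplex_def)
  have face: "singular_face 2 k (triangle_simplex g) = path_simplex h"
    if k: "k \<le> 2" and h: "\<And>u. u \<in> standard_simplex 1 \<Longrightarrow> g (simplical_face k u 1, simplical_face k u 2) = h (u 1)" for k h
  proof -
    have "singular_face 2 k (triangle_simplex g) = restrict (triangle_simplex g \<circ> simplical_face k) (standard_simplex 1)"
      by (simp add: singular_face_def)
    also have "\<dots> = path_simplex h"
      unfolding path_simplex_def
    proof (rule restrict_ext)
      fix u :: "nat \<Rightarrow> real" assume u: "u \<in> standard_simplex 1"
      show "(triangle_simplex g \<circ> simplical_face k) u = h (u 1)"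
        using *[OF u k] h[OF u] by (simp add: triangle_simplex_def)
    qed
    finally show ?thesis .
  qed
  show "singular_face 2 0 (triangle_simplex g) = path_simplex (\<lambda>t. g (1 - t, t))"
    by (rule face) (simp_all add: simplical_face_def **[unfolded One_nat_def])
  show "singular_face 2 1 (triangle_simplex g) = path_simplex (\<lambda>t. g (0, t))"
    by (rule face) (simp_all add: simplical_face_def)
  show "singular_face 2 2 (triangle_simplex g) = path_simplex (\<lambda>t. g (t, 0))"
    by (rule face) (simp_all add: simplical_face_def)
qed

lemma singular_2_simplex_triangle:
  assumes "singular_simplex 2 X s"
  obtains g where "continuous_map (top_of_set triangle) X g" "s = triangle_simplex g"
proof -
  define e where "e = (\<lambda>(a, b). \<lambda>i::nat. if i = 0 then 1 - a - b else if i = 1 then a else if i = 2 then b else (0::real))"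
  have "continuous_map (top_of_set triangle) (powertop_real UNIV) e"
    unfolding continuous_map_componentwise_UNIV
  proof
    fix k :: nat
    consider "k = 0" | "k = 1" | "k = 2" | "k \<noteq> 0" "k \<noteq> 1" "k \<noteq> 2" by blast
    thus "continuous_map (top_of_set triangle) euclideanreal (\<lambda>x. e x k)"
      by cases (simp_all add: e_def case_prod_unfold continuous_on_diff continuous_on_fst continuous_on_snd)
  qed
  moreover have "e p \<in> standard_simplex 2" if "p \<in> triangle" for p
    using that unfolding e_def standard_simplex_def triangle_def by (auto simp: numeral_2_eq_2)
  ultimately have "continuous_map (top_of_set triangle) (subtopology (powertop_real UNIV) (standard_simplex 2)) e"
    by (intro continuous_map_into_subtopology) auto
  hence "continuous_map (top_of_set triangle) X (s \<circ> e)"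
    using continuous_map_compose[of _ _ e X s] assms unfolding singular_simplex_def by simp
  moreover have "s = triangle_simplex (s \<circ> e)"
  proof
    fix u show "s u = triangle_simplex (s \<circ> e) u"
    proof (cases "u \<in> standard_simplex 2")
      case True
      have "u = e (u 1, u 2)"
      proof
        fix i show "u i = e (u 1, u 2) i"
          using True standard_simplex_2[OF True] unfolding e_def standard_simplex_def
          by (cases "i > 2") (auto simp: less_Suc_eq numeral_2_eq_2 not_less le_Suc_eq)
      qed
      thus ?thesis using True by (simp add: triangle_simplex_def)
    next
      case False
      thus ?thesis using assms by (simp add: triangle_simplex_def singular_simplex_def extensional_def)
    qed
  qed
  ultimately show thesis by (rule that)
qed

text \<open>The cocycle condition in a form free of singular simplices: along two consecutive edges
  of a triangle the values add up to the value on the third. The path identities below arise by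
  choosing a suitable map on the triangle.\<close>

lemma cocycle_iff:
  "cocycle X z \<longleftrightarrow> cochain 1 X z \<and> (\<forall>g. continuous_map (top_of_set triangle) X g \<longrightarrow>
     path_value z (\<lambda>t. g (t, 0)) + path_value z (\<lambda>t. g (1 - t, t)) = path_value z (\<lambda>t. g (0, t)))"
proof -
  have "coboundary 1 X z = (\<lambda>_. 0) \<longleftrightarrow> (\<forall>s. singular_simplex 2 X s \<longrightarrow> coboundary 1 X z s = 0)"
    by (auto simp: fun_eq_iff coboundary_def numeral_2_eq_2)
  also have "\<dots> \<longleftrightarrow> (\<forall>g. continuous_map (top_of_set triangle) X g \<longrightarrow> coboundary 1 X z (triangle_simplex g) = 0)"
  proof (intro iffI allI impI)
    fix g assume "\<forall>s. singular_simplex 2 X s \<longrightarrow> coboundary 1 X z s = 0" "continuous_map (top_of_set triangle) X g"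
    thus "coboundary 1 X z (triangle_simplex g) = 0" using singular_simplex_triangle_simplex by blast
  next
    fix s assume *: "\<forall>g. continuous_map (top_of_set triangle) X g \<longrightarrow> coboundary 1 X z (triangle_simplex g) = 0"
      "singular_simplex 2 X s"
    obtain g where g: "continuous_map (top_of_set triangle) X g" "s = triangle_simplex g"
      using *(2) by (rule singular_2_simplex_triangle)
    thus "coboundary 1 X z s = 0" using *(1) by simp
  qed
  also have "\<dots> \<longleftrightarrow> (\<forall>g. continuous_map (top_of_set triangle) X g \<longrightarrow>
     path_value z (\<lambda>t. g (t, 0)) + path_value z (\<lambda>t. g (1 - t, t)) = path_value z (\<lambda>t. g (0, t)))"
    by (intro all_cong1 imp_cong refl)
       (simp only: coboundary_1 singular_simplex_triangle_simplex singular_face_triangle_simplex path_value_def, argo)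
  finally show ?thesis unfolding cocycle_def by simp
qed

lemma continuous_map_euclidean_compose:
  assumes "continuous_map (top_of_set S) X f" "continuous_on A h" "\<And>a. a \<in> A \<Longrightarrow> h a \<in> S"
  shows "continuous_map (top_of_set A) X (\<lambda>p. f (h p))"
proof -
  have "continuous_map (top_of_set A) (top_of_set S) h"
    using assms(2,3) by (simp add: continuous_map_in_subtopology Pi_iff)
  from continuous_map_compose[OF this assms(1)] show ?thesis by (simp add: comp_def)
qed

lemma cocycle_cochain: "cocycle X z \<Longrightarrow> cochain 1 X z" by (simp add: cocycle_def)

lemma path_value_triangle:
  assumes "cocycle X z" "continuous_map (top_of_set triangle) X g"
  shows "path_value z (\<lambda>t. g (t, 0)) + path_value z (\<lambda>t. g (1 - t, t)) = path_value z (\<lambda>t. g (0, t))"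
  using assms unfolding cocycle_iff by (elim conjE allE impE)

text \<open>The triangle is collapsed onto the joined path in such a way that its two consecutive
  edges run through the halves and its third edge through the whole.\<close>

lemma path_value_join:
  assumes z: "cocycle X z" and f: "pathin X f" and g: "pathin X g" and fg: "f 1 = g 0"
  shows "path_value z (path_join f g) = path_value z f + path_value z g"
proof -
  have c: "continuous_map (top_of_set triangle) X (\<lambda>p. path_join f g (fst p / 2 + snd p))"
    by (rule continuous_map_euclidean_compose[OF pathin_path_join[OF f g fg, unfolded pathin_def]])
       (auto simp: triangle_def intro!: continuous_intros)
  have "path_value z f = path_value z (\<lambda>t. path_join f g (t / 2))"
    by (rule path_value_cong) (simp add: path_join_def)
  moreover have "path_value z g = path_value z (\<lambda>t. path_join f g ((1 - t) / 2 + t))"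
  proof (rule path_value_cong)
    fix t :: real assume t: "t \<in> {0..1}"
    have e: "(1 - t) / 2 + t = (1 + t) / 2" by (simp add: field_simps)
    show "g t = path_join f g ((1 - t) / 2 + t)"
      unfolding e using t fg by (cases "t = 0") (simp_all add: path_join_def add_divide_distrib)
  qed
  ultimately show ?thesis using path_value_triangle[OF z c] by simp
qed

lemma path_value_const:
  assumes "cocycle X z" "x \<in> topspace X"
  shows "path_value z (\<lambda>_. x) = 0"
  using path_value_triangle[OF assms(1), of "\<lambda>_. x"] assms(2) by simp

text \<open>Collapsing the triangle to its first coordinate turns the third edge into a constant
  path.\<close>

lemma path_value_reverse:
  assumes z: "cocycle X z" and f: "pathin X f"
  shows "path_value z (\<lambda>t. f (1 - t)) = - path_value z f"
proof -
  have c: "continuous_map (top_of_set triangle) X (\<lambda>p. f (fst p))"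
    by (rule continuous_map_euclidean_compose[OF f[unfolded pathin_def]])
       (auto simp: triangle_def intro!: continuous_intros)
  show ?thesis
    using path_value_triangle[OF z c] path_value_const[OF z path_start_in_topspace[OF f]] by simp
qed

text \<open>The diagonal cuts the square into two triangles, and either way round the square gives
  the value of the diagonal.\<close>

lemma path_value_square:
  assumes z: "cocycle X z" and K: "continuous_map (top_of_set ({0..1} \<times> {0..1})) X K"
  shows "path_value z (\<lambda>t. K (0, t)) + path_value z (\<lambda>t. K (t, 1)) =
    path_value z (\<lambda>t. K (t, 0)) + path_value z (\<lambda>t. K (1, t))"
proof -
  have c1: "continuous_map (top_of_set triangle) X (\<lambda>p. K (snd p, fst p + snd p))"
    by (rule continuous_map_euclidean_compose[OF K])
       (auto simp: triangle_def intro!: continuous_intros)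
  have c2: "continuous_map (top_of_set triangle) X (\<lambda>p. K (fst p + snd p, snd p))"
    by (rule continuous_map_euclidean_compose[OF K])
       (auto simp: triangle_def intro!: continuous_intros)
  show ?thesis using path_value_triangle[OF z c1] path_value_triangle[OF z c2] by simp
qed

abbreviation rel_ends :: "'a \<Rightarrow> 'a \<Rightarrow> 'a topology \<Rightarrow> (real \<Rightarrow> 'a) \<Rightarrow> (real \<Rightarrow> 'a) \<Rightarrow> bool" where
  "rel_ends a b X \<equiv> homotopic_with (\<lambda>h. h 0 = a \<and> h 1 = b) I01 X"

lemma rel_endsE:
  assumes "rel_ends a b X f g"
  obtains K where "continuous_map (top_of_set ({0..1::real} \<times> {0..1::real})) X K"
    "\<And>s. K (0, s) = f s" "\<And>s. K (1, s) = g s" "\<And>t. t \<in> {0..1} \<Longrightarrow> K (t, 0) = a" "\<And>t. t \<in> {0..1} \<Longrightarrow> K (t, 1) = b"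
proof -
  obtain K where K: "continuous_map (top_of_set ({0..1::real} \<times> {0..1::real})) X K"
    "\<forall>s. K (0, s) = f s" "\<forall>s. K (1, s) = g s" "\<forall>t\<in>{0..1}. K (t, 0) = a \<and> K (t, 1) = b"
    using assms unfolding homotopic_with_def prod_topology_subtopology_eu by (elim exE conjE)
  show thesis by (rule that[of K]) (use K in simp_all)
qed

text \<open>A homotopy relative to the ends is a square with two constant sides.\<close>

lemma rel_ends_path_value:
  assumes z: "cocycle X z" and h: "rel_ends a b X f g"
  shows "path_value z f = path_value z g"
proof (rule rel_endsE[OF h])
  fix K assume K: "continuous_map (top_of_set ({0..1::real} \<times> {0..1::real})) X K"
    "\<And>s. K (0, s) = f s" "\<And>s. K (1, s) = g s" "\<And>t. t \<in> {0..1} \<Longrightarrow> K (t, 0) = a" "\<And>t. t \<in> {0..1} \<Longrightarrow> K (t, 1) = b"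
  have "K (0, 0) \<in> topspace X" "K (0, 1) \<in> topspace X"
    using continuous_map_image_subset_topspace[OF K(1)] by (auto simp: image_subset_iff)
  hence ab: "a \<in> topspace X" "b \<in> topspace X" using K(4)[of 0] K(5)[of 0] by simp_all
  have "path_value z (\<lambda>t. K (t, 1)) = path_value z (\<lambda>_. b)" "path_value z (\<lambda>t. K (t, 0)) = path_value z (\<lambda>_. a)"
    using K(4,5) by (auto intro!: path_value_cong)
  thus ?thesis
    using path_value_square[OF z K(1)] path_value_const[OF z] ab by (simp add: K(2,3))
qed

section \<open>First cohomology\<close>

lemma path_value_coboundary:
  assumes "pathin X g"
  shows "path_value (coboundary 0 X b) g = b (point_simplex (g 1)) - b (point_simplex (g 0))"
  unfolding path_value_def coboundary_0[OF singular_simplex_path_simplex[OF assms]] singular_face_path_simplex ..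

lemma pathin_triangle_edges:
  assumes "continuous_map (top_of_set triangle) X g"
  shows "pathin X (\<lambda>t. g (t, 0))" "pathin X (\<lambda>t. g (1 - t, t))" "pathin X (\<lambda>t. g (0, t))"
  unfolding pathin_def
  by (rule continuous_map_euclidean_compose[OF assms]; auto simp: triangle_def intro!: continuous_intros)+

lemma path_value_add: "path_value (\<lambda>s. z s + y s) g = path_value z g + path_value y g"
  by (simp add: path_value_def)

lemma cocycle_add_coboundary:
  assumes "cocycle X z"
  shows "cocycle X (\<lambda>s. z s + coboundary 0 X b s)"
  unfolding cocycle_iff
proof (intro conjI allI impI)
  show "cochain 1 X (\<lambda>s. z s + coboundary 0 X b s)"
    using cocycle_cochain[OF assms] unfolding cochain_def coboundary_def by simp
  fix g assume g: "continuous_map (top_of_set triangle) X g"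
  show "path_value (\<lambda>s. z s + coboundary 0 X b s) (\<lambda>t. g (t, 0)) + path_value (\<lambda>s. z s + coboundary 0 X b s) (\<lambda>t. g (1 - t, t)) =
     path_value (\<lambda>s. z s + coboundary 0 X b s) (\<lambda>t. g (0, t))"
    unfolding path_value_add
    using path_value_triangle[OF assms g] path_value_coboundary[OF pathin_triangle_edges(1)[OF g], of b]
      path_value_coboundary[OF pathin_triangle_edges(2)[OF g], of b] path_value_coboundary[OF pathin_triangle_edges(3)[OF g], of b]
    by simp
qed

lemma H1_class_memD:
  assumes "cocycle X z" "z' \<in> H1_class X z"
  shows "cocycle X z'" "pathin X g \<Longrightarrow> g 0 = g 1 \<Longrightarrow> path_value z' g = path_value z g"
proof -
  obtain b where z': "z' = (\<lambda>s. z s + coboundary 0 X b s)"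
    using assms(2) unfolding H1_class_def by (elim CollectE exE conjE)
  show "cocycle X z'" unfolding z' by (rule cocycle_add_coboundary[OF assms(1)])
  show "path_value z' g = path_value z g" if "pathin X g" "g 0 = g 1"
    unfolding z' path_value_add path_value_coboundary[OF that(1)] that(2) by simp
qed

lemma cochain_eval_add_left: "cochain_eval (\<lambda>s. b s + c s) x = cochain_eval b x + cochain_eval c x"
  by (simp add: cochain_eval_def algebra_simps sum.distrib)

lemma coboundary_add: "coboundary p X (\<lambda>s. b s + c s) = (\<lambda>s. coboundary p X b s + coboundary p X c s)"
  by (auto simp: coboundary_def cochain_eval_add_left fun_eq_iff)

lemma coboundary_zero: "coboundary p X (\<lambda>_. 0) = (\<lambda>_. 0)"
  by (auto simp: coboundary_def cochain_eval_def fun_eq_iff)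

lemma H1_class_self: "z \<in> H1_class X z"
  unfolding H1_class_def by (rule CollectI, rule exI[of _ "\<lambda>_. 0"]) (simp add: coboundary_zero cochain_def)

lemma H1_class_mono:
  assumes "z \<in> H1_class X z'"
  shows "H1_class X z \<subseteq> H1_class X z'"
proof
  fix y assume "y \<in> H1_class X z"
  then obtain b where b: "y = (\<lambda>s. z s + coboundary 0 X b s)" "cochain 0 X b"
    unfolding H1_class_def by (elim CollectE exE conjE)
  obtain c where c: "z = (\<lambda>s. z' s + coboundary 0 X c s)" "cochain 0 X c"
    using assms unfolding H1_class_def by (elim CollectE exE conjE)
  show "y \<in> H1_class X z'"
    unfolding H1_class_def
  proof (rule CollectI, rule exI[of _ "\<lambda>s. c s + b s"], intro conjI)
    show "y = (\<lambda>s. z' s + coboundary 0 X (\<lambda>s. c s + b s) s)"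
      unfolding coboundary_add b(1) c(1) by (simp add: add.assoc)
  qed (use b(2) c(2) in \<open>simp add: cochain_def\<close>)
qed

text \<open>A primitive \<open>b\<close> of the difference is found by integrating along a chosen
  path from the base point of the path component. The loop that leads from the base point to the
  start of \<open>g\<close>, along \<open>g\<close> and back from its end yields the coboundary
  equation.\<close>

lemma H1_class_memI:
  assumes z: "cocycle X z" and z': "cocycle X z'"
    and eq: "\<And>g. pathin X g \<Longrightarrow> g 0 = g 1 \<Longrightarrow> path_value z' g = path_value z g"
  shows "z' \<in> H1_class X z"
proof -
  \<comment> \<open>\<open>path_component_of X x\<close> is the same predicate for all
    \<open>x\<close> in one path component, so the choice is constant there.\<close>
  define base where "base x = (SOME y. path_component_of X x y)" for x
  have base: "path_component_of X x (base x)" if "x \<in> topspace X" for x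
    unfolding base_def by (rule someI[of "path_component_of X x" x]) (simp add: path_component_of_refl that)
  have base_eq: "base x = base y" if "path_component_of X x y" for x y
    using that unfolding path_component_of_equiv[of X x y] base_def by simp
  define c where "c x = (SOME g. pathin X g \<and> g 0 = base x \<and> g 1 = x)" for x
  have c: "pathin X (c x) \<and> c x 0 = base x \<and> c x 1 = x" if x: "x \<in> topspace X" for x
  proof -
    have "path_component_of X (base x) x" using base[OF x] by (rule path_component_of_sym)
    hence "\<exists>g. pathin X g \<and> g 0 = base x \<and> g 1 = x" unfolding path_component_of_def .
    thus ?thesis unfolding c_def by (rule someI_ex)
  qed
  \<comment> \<open>The only point of the standard 0-simplex; it recovers a point of
    \<open>X\<close> from a singular 0-simplex.\<close>
  define e where "e = (\<lambda>j::nat. if j = 0 then 1 else (0::real))"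
  define b where "b s = (if singular_simplex 0 X s then path_value z' (c (s e)) - path_value z (c (s e)) else 0)" for s
  have b: "b (point_simplex x) = path_value z' (c x) - path_value z (c x)" if x: "x \<in> topspace X" for x
  proof -
    have "singular_simplex 0 X (point_simplex x)"
      using singular_simplex_singular_face[OF singular_simplex_path_simplex[of X "\<lambda>_. x"], of 0]
        singular_face_path_simplex(1)[of "\<lambda>_. x"] x by simp
    moreover have "point_simplex x e = x"
      unfolding point_simplex_def e_def by (simp add: standard_simplex_0)
    ultimately show ?thesis by (simp add: b_def)
  qed
  have "z' = (\<lambda>s. z s + coboundary 0 X b s)"
  proof
    fix s show "z' s = z s + coboundary 0 X b s"
    proof (cases "singular_simplex 1 X s")
      case False
      thus ?thesis
        using cocycle_cochain[OF z] cocycle_cochain[OF z'] by (simp add: cochain_def coboundary_def)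
    next
      case True
      show ?thesis
      proof (rule singular_1_simplex_path[OF True])
        fix g assume g: "pathin X g" "s = path_simplex g"
        define x y where "x = g 0" and "y = g 1"
        have xy: "x \<in> topspace X" "y \<in> topspace X"
          unfolding x_def y_def using path_start_in_topspace[OF g(1)] path_finish_in_topspace[OF g(1)] by simp_all
        have "path_component_of X x y" unfolding path_component_of_def x_def y_def using g(1) by blast
        hence beq: "base x = base y" by (rule base_eq)
        have cx: "pathin X (c x)" "c x 0 = base x" "c x 1 = x" and cy: "pathin X (c y)" "c y 0 = base y" "c y 1 = y"
          using c xy by simp_all
        define p where "p = path_join (path_join (c x) g) (\<lambda>t. c y (1 - t))"
        have p1: "pathin X (path_join (c x) g)"
          by (rule pathin_path_join[OF cx(1) g(1)]) (simp only: cx(3), simp only: x_def)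
        have p: "pathin X p"
          unfolding p_def by (rule pathin_path_join[OF p1 pathin_reverse[OF cy(1)]]) (simp add: cy(3), simp add: y_def)
        have pv: "path_value w p = path_value w (c x) + path_value w g - path_value w (c y)" if w: "cocycle X w" for w
        proof -
          have "path_value w p = path_value w (path_join (c x) g) + path_value w (\<lambda>t. c y (1 - t))"
            unfolding p_def by (rule path_value_join[OF w p1 pathin_reverse[OF cy(1)]]) (simp add: cy(3), simp add: y_def)
          also have "path_value w (path_join (c x) g) = path_value w (c x) + path_value w g"
            by (rule path_value_join[OF w cx(1) g(1)]) (simp only: cx(3), simp only: x_def)
          finally show ?thesis using path_value_reverse[OF w cy(1)] by simp
        qed
        have "p 0 = p 1" unfolding p_def using cx(2) cy(2) beq by simp
        hence "path_value z' p = path_value z p" by (rule eq[OF p])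
        hence "path_value z' g = path_value z g + path_value (coboundary 0 X b) g"
          unfolding pv[OF z] pv[OF z'] path_value_coboundary[OF g(1)] x_def[symmetric] y_def[symmetric] b[OF xy(1)] b[OF xy(2)]
          by simp
        thus ?thesis unfolding path_value_def g(2) .
      qed
    qed
  qed
  moreover have "cochain 0 X b" unfolding cochain_def b_def by simp
  ultimately show ?thesis unfolding H1_class_def by (intro CollectI exI[of _ b] conjI)
qed

text \<open>Real classes of degree one are determined by their periods. This turns statements about
  cosets of cochains into statements about closed paths.\<close>

lemma H1_class_eq_iff:
  assumes "cocycle X z" "cocycle X z'"
  shows "H1_class X z = H1_class X z' \<longleftrightarrow> (\<forall>g. pathin X g \<and> g 0 = g 1 \<longrightarrow> path_value z g = path_value z' g)"
proof
  assume "H1_class X z = H1_class X z'"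
  hence "z \<in> H1_class X z'" using H1_class_self[of z X] by simp
  thus "\<forall>g. pathin X g \<and> g 0 = g 1 \<longrightarrow> path_value z g = path_value z' g"
    using H1_class_memD(2)[OF assms(2)] by simp
next
  assume r: "\<forall>g. pathin X g \<and> g 0 = g 1 \<longrightarrow> path_value z g = path_value z' g"
  have "z \<in> H1_class X z'" by (rule H1_class_memI[OF assms(2,1)]) (use r in simp)
  moreover have "z' \<in> H1_class X z" by (rule H1_class_memI[OF assms]) (use r in simp)
  ultimately show "H1_class X z = H1_class X z'" by (intro equalityI H1_class_mono)
qed

lemma H1_rep:
  assumes "l \<in> H1 X"
  obtains z where "cocycle X z" "l = H1_class X z" "z \<in> l"
proof -
  obtain z where "z \<in> {z. cochain 1 X z \<and> coboundary 1 X z = (\<lambda>_. 0)}" "l = H1_class X z"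
    using assms unfolding H1_def by (elim imageE)
  thus thesis using that[of z] H1_class_self[of z X] by (simp add: cocycle_def)
qed

lemma H1_memD:
  assumes "l \<in> H1 X" "z \<in> l"
  shows "cocycle X z" "z' \<in> l \<Longrightarrow> pathin X g \<Longrightarrow> g 0 = g 1 \<Longrightarrow> path_value z' g = path_value z g" "l = H1_class X z"
proof -
  obtain y where y: "cocycle X y" "l = H1_class X y" "y \<in> l" using assms(1) by (rule H1_rep)
  show c: "cocycle X z" using H1_class_memD(1)[OF y(1)] assms(2) y(2) by simp
  show "z' \<in> l \<Longrightarrow> pathin X g \<Longrightarrow> g 0 = g 1 \<Longrightarrow> path_value z' g = path_value z g"
    using H1_class_memD(2)[OF y(1), of z' g] H1_class_memD(2)[OF y(1), of z g] assms(2) y(2) by simp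
  show "l = H1_class X z"
    unfolding y(2) H1_class_eq_iff[OF y(1) c] using H1_class_memD(2)[OF y(1)] assms(2) y(2) by simp
qed

text \<open>The description in \<open>H1_eval\<close> denotes because all cocycles of the class
  agree on a loop.\<close>

lemma H1_eval_eq:
  assumes "l \<in> H1 X" "z \<in> l" "pathin X g" "g 0 = g 1"
  shows "H1_eval l g = path_value z g"
  unfolding H1_eval_def path_simplex_def[symmetric] path_value_def[symmetric]
proof (rule the_equality)
  show "\<exists>y\<in>l. path_value z g = path_value y g" using assms(2) by blast
  show "v = path_value z g" if v: "\<exists>y\<in>l. v = path_value y g" for v
  proof -
    obtain y where "y \<in> l" "v = path_value y g" using v by (elim bexE)
    thus ?thesis using H1_memD(2)[OF assms(1,2) _ assms(3,4)] by simp
  qed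
qed

section \<open>Pullback of classes\<close>

definition cochain_pullback :: "'b topology \<Rightarrow> ('b \<Rightarrow> 'a) \<Rightarrow> 'a cochain \<Rightarrow> 'b cochain" where
  "cochain_pullback Y f z = (\<lambda>s. if singular_simplex 1 Y s then z (simplex_map 1 f s) else 0)"

lemma path_value_pullback:
  assumes "pathin Y g"
  shows "path_value (cochain_pullback Y f z) g = path_value z (\<lambda>t. f (g t))"
proof -
  have "simplex_map 1 f (path_simplex g) = path_simplex (\<lambda>t. f (g t))"
    unfolding simplex_map_def path_simplex_def by (rule restrict_ext) simp
  thus ?thesis
    unfolding path_value_def cochain_pullback_def using singular_simplex_path_simplex[OF assms] by simp
qed

lemma cocycle_pullback:
  assumes "cocycle X z" "continuous_map Y X f"
  shows "cocycle Y (cochain_pullback Y f z)"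
  unfolding cocycle_iff
proof (intro conjI allI impI)
  show "cochain 1 Y (cochain_pullback Y f z)" by (simp add: cochain_def cochain_pullback_def)
  fix g assume g: "continuous_map (top_of_set triangle) Y g"
  have "continuous_map (top_of_set triangle) X (f \<circ> g)" by (rule continuous_map_compose[OF g assms(2)])
  from path_value_triangle[OF assms(1) this]
  show "path_value (cochain_pullback Y f z) (\<lambda>t. g (t, 0)) + path_value (cochain_pullback Y f z) (\<lambda>t. g (1 - t, t)) =
    path_value (cochain_pullback Y f z) (\<lambda>t. g (0, t))"
    unfolding path_value_pullback[OF pathin_triangle_edges(1)[OF g]] path_value_pullback[OF pathin_triangle_edges(2)[OF g]]
      path_value_pullback[OF pathin_triangle_edges(3)[OF g]] by simp
qed

text \<open>The union in the definition runs over equal cosets, because pullbacks of cohomologous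
  cocycles agree on loops.\<close>

lemma H1_pullback_eq:
  assumes l: "l \<in> H1 X" "z \<in> l" and f: "continuous_map Y X f"
  shows "H1_pullback Y f l = H1_class Y (cochain_pullback Y f z)"
proof -
  have "H1_class Y (cochain_pullback Y f y) = H1_class Y (cochain_pullback Y f z)" if y: "y \<in> l" for y
  proof (subst H1_class_eq_iff)
    show "cocycle Y (cochain_pullback Y f y)" "cocycle Y (cochain_pullback Y f z)"
      using cocycle_pullback[OF H1_memD(1)[OF l(1)] f] y l(2) by simp_all
    show "\<forall>g. pathin Y g \<and> g 0 = g 1 \<longrightarrow> path_value (cochain_pullback Y f y) g = path_value (cochain_pullback Y f z) g"
    proof (intro allI impI, elim conjE)
      fix g assume g: "pathin Y g" "g 0 = g 1"
      have "pathin X (\<lambda>t. f (g t))" using pathin_compose[OF g(1) f] by (simp add: comp_def)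
      thus "path_value (cochain_pullback Y f y) g = path_value (cochain_pullback Y f z) g"
        unfolding path_value_pullback[OF g(1)] using H1_memD(2)[OF l y] g(2) by simp
    qed
  qed
  hence "(\<Union>y\<in>l. H1_class Y (cochain_pullback Y f y)) = (\<Union>y\<in>l. H1_class Y (cochain_pullback Y f z))"
    by (intro SUP_cong refl)
  also have "\<dots> = H1_class Y (cochain_pullback Y f z)" using l(2) by (intro UN_constant[THEN trans]) auto
  finally show ?thesis unfolding H1_pullback_def cochain_pullback_def[symmetric] .
qed

lemma H1_pullback_eq_iff:
  assumes "l \<in> H1 X" "z \<in> l" "continuous_map Y X f" "l' \<in> H1 X'" "z' \<in> l'" "continuous_map Y X' f'"
  shows "H1_pullback Y f l = H1_pullback Y f' l' \<longleftrightarrow>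
    (\<forall>g. pathin Y g \<and> g 0 = g 1 \<longrightarrow> path_value z (\<lambda>t. f (g t)) = path_value z' (\<lambda>t. f' (g t)))"
  unfolding H1_pullback_eq[OF assms(1-3)] H1_pullback_eq[OF assms(4-6)]
    H1_class_eq_iff[OF cocycle_pullback[OF H1_memD(1)[OF assms(1,2)] assms(3)] cocycle_pullback[OF H1_memD(1)[OF assms(4,5)] assms(6)]]
  by (intro all_cong1 imp_cong refl) (simp add: path_value_pullback)

section \<open>The fundamental group\<close>

lemma path_class_mem: "g' \<in> path_class X g \<longleftrightarrow> rel_ends (g 0) (g 1) X g g'" by (simp add: path_class_def)

lemma path_class_memD:
  assumes "g' \<in> path_class X g"
  shows "g' 0 = g 0" "g' 1 = g 1" "pathin X g" "pathin X g'"
  using homotopic_with_imp_property[OF assms[unfolded path_class_mem]]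
    homotopic_with_imp_continuous_maps[OF assms[unfolded path_class_mem]] by (simp_all add: pathin_def)

lemma path_class_self: "pathin X g \<Longrightarrow> g \<in> path_class X g" by (simp add: path_class_mem pathin_def)

lemma path_class_eqI:
  assumes "g' \<in> path_class X g"
  shows "path_class X g' = path_class X g"
proof -
  have e: "g' 0 = g 0" "g' 1 = g 1" using path_class_memD[OF assms] by simp_all
  have 1: "rel_ends (g 0) (g 1) X g g'" using assms by (simp add: path_class_mem)
  show ?thesis
  proof (intro equalityI subsetI)
    fix h assume "h \<in> path_class X g'"
    hence "rel_ends (g 0) (g 1) X g' h" by (simp add: path_class_mem e)
    thus "h \<in> path_class X g" unfolding path_class_mem by (rule homotopic_with_trans[OF 1])
  next
    fix h assume "h \<in> path_class X g"
    hence "rel_ends (g 0) (g 1) X g h" by (simp add: path_class_mem)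
    thus "h \<in> path_class X g'" unfolding path_class_mem e by (rule homotopic_with_trans[OF homotopic_with_symD[OF 1]])
  qed
qed

lemma path_class_cong:
  assumes "pathin X f" "\<And>t. t \<in> {0..1} \<Longrightarrow> f t = g t"
  shows "path_class X f = path_class X g"
proof -
  have "g \<in> path_class X f"
    unfolding path_class_mem by (rule homotopic_with_equal) (use assms in \<open>auto simp: pathin_def\<close>)
  thus ?thesis by (rule path_class_eqI[symmetric])
qed

text \<open>The straight-line homotopy between the two parametrizations stays in the convex set
  \<open>S\<close>.\<close>

lemma path_class_reparam:
  assumes f: "continuous_map (top_of_set S) X f" and S: "convex S"
    and a: "continuous_on {0..1} a" "\<And>t. t \<in> {0..1} \<Longrightarrow> a t \<in> S"
    and b: "continuous_on {0..1} b" "\<And>t. t \<in> {0..1} \<Longrightarrow> b t \<in> S"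
    and ends: "a 0 = b 0" "a 1 = (b 1 :: real)"
  shows "path_class X (\<lambda>t. f (a t)) = path_class X (\<lambda>t. f (b t))"
proof -
  let ?K = "\<lambda>p. f ((1 - fst p) * a (snd p) + fst p * b (snd p))"
  have ca: "continuous_on ({0..1} \<times> {0..1}) (\<lambda>p. a (snd p))"
    by (rule continuous_on_compose2[OF a(1)]) (auto intro!: continuous_intros)
  have cb: "continuous_on ({0..1} \<times> {0..1}) (\<lambda>p. b (snd p))"
    by (rule continuous_on_compose2[OF b(1)]) (auto intro!: continuous_intros)
  have "continuous_map (top_of_set ({0..1::real} \<times> {0..1})) X ?K"
  proof (rule continuous_map_euclidean_compose[OF f])
    show "continuous_on ({0..1} \<times> {0..1}) (\<lambda>p. (1 - fst p) * a (snd p) + fst p * b (snd p))"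
      by (intro continuous_intros ca cb)
    fix p :: "real \<times> real" assume "p \<in> {0..1} \<times> {0..1}"
    thus "(1 - fst p) * a (snd p) + fst p * b (snd p) \<in> S"
      using convexD[OF S a(2)[of "snd p"] b(2)[of "snd p"], of "1 - fst p" "fst p"] by auto
  qed
  hence "(\<lambda>t. f (b t)) \<in> path_class X (\<lambda>t. f (a t))"
    unfolding path_class_mem homotopic_with_def prod_topology_subtopology_eu
    by (intro exI[of _ ?K] conjI) (auto simp: ends algebra_simps)
  thus ?thesis by (rule path_class_eqI[symmetric])
qed

lemma path_class_reparam_path:
  assumes f: "pathin X f" and b: "continuous_on {0..1} b" "\<And>t. t \<in> {0..1} \<Longrightarrow> b t \<in> {0..1}" "b 0 = 0" "b 1 = (1 :: real)"
    and g: "\<And>t. t \<in> {0..1} \<Longrightarrow> g t = f (b t)"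
  shows "path_class X g = path_class X f"
proof -
  have "pathin X g"
  proof (rule iffD2[OF pathin_cong[OF g]])
    show "pathin X (\<lambda>t. f (b t))" by (rule pathin_reparam[OF f b(1)]) (use b(2) in \<open>rule image_subsetI\<close>)
  qed
  hence "path_class X g = path_class X (\<lambda>t. f (b t))" using g by (rule path_class_cong)
  also have "\<dots> = path_class X (\<lambda>t. f t)" by (rule path_class_reparam[OF f[unfolded pathin_def]]) (use b in auto)
  finally show ?thesis by simp
qed

lemma path_class_join:
  assumes f: "f' \<in> path_class X f" and g: "g' \<in> path_class X g" and fg: "f 1 = g 0"
  shows "path_class X (path_join f' g') = path_class X (path_join f g)"
proof (rule rel_endsE[OF f[unfolded path_class_mem]], rule rel_endsE[OF g[unfolded path_class_mem]])
  fix K L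
  assume K: "continuous_map (top_of_set ({0..1::real} \<times> {0..1::real})) X K" "\<And>s. K (0, s) = f s" "\<And>s. K (1, s) = f' s"
    "\<And>t. t \<in> {0..1} \<Longrightarrow> K (t, 0) = f 0" "\<And>t. t \<in> {0..1} \<Longrightarrow> K (t, 1) = f 1"
  assume L: "continuous_map (top_of_set ({0..1::real} \<times> {0..1::real})) X L" "\<And>s. L (0, s) = g s" "\<And>s. L (1, s) = g' s"
    "\<And>t. t \<in> {0..1} \<Longrightarrow> L (t, 0) = g 0" "\<And>t. t \<in> {0..1} \<Longrightarrow> L (t, 1) = g 1"
  let ?Q = "{0..1::real} \<times> {0..1::real}"
  let ?J = "\<lambda>p. if snd p \<le> 1/2 then K (fst p, 2 * snd p) else L (fst p, 2 * snd p - 1)"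
  have "continuous_map (top_of_set ?Q) X ?J"
  proof (rule continuous_map_cases_le)
    show "continuous_map (subtopology (top_of_set ?Q) {x \<in> topspace (top_of_set ?Q). snd x \<le> 1/2}) X (\<lambda>p. K (fst p, 2 * snd p))"
      unfolding subtopology_subtopology
      by (rule continuous_map_euclidean_compose[OF K(1)]) (auto intro!: continuous_intros)
    show "continuous_map (subtopology (top_of_set ?Q) {x \<in> topspace (top_of_set ?Q). 1/2 \<le> snd x}) X (\<lambda>p. L (fst p, 2 * snd p - 1))"
      unfolding subtopology_subtopology
      by (rule continuous_map_euclidean_compose[OF L(1)]) (auto intro!: continuous_intros)
    fix x assume "x \<in> topspace (top_of_set ?Q)" "snd x = 1/2"
    hence "fst x \<in> {0..1}" "2 * snd x = 1" "2 * snd x - 1 = 0" by auto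
    thus "K (fst x, 2 * snd x) = L (fst x, 2 * snd x - 1)"
      using K(5) L(4) fg by simp
  qed (simp_all add: continuous_on_snd)
  hence "path_join f' g' \<in> path_class X (path_join f g)"
    unfolding path_class_mem homotopic_with_def prod_topology_subtopology_eu
    by (intro exI[of _ ?J] conjI) (auto simp: path_join_def K(2-5) L(2-5))
  thus ?thesis by (rule path_class_eqI)
qed

lemma fundamental_group_carrier:
  "a \<in> carrier (fundamental_group X x) \<longleftrightarrow> (\<exists>g. pathin X g \<and> g 0 = x \<and> g 1 = x \<and> a = path_class X g)"
  unfolding fundamental_group_def by auto

lemma fundamental_group_mult:
  assumes "pathin X f" "pathin X g" "f 1 = g 0"
  shows "path_class X f \<otimes>\<^bsub>fundamental_group X x\<^esub> path_class X g = path_class X (path_join f g)"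
proof -
  have "(\<Union>f'\<in>path_class X f. \<Union>g'\<in>path_class X g. path_class X (path_join f' g')) =
      (\<Union>f'\<in>path_class X f. \<Union>g'\<in>path_class X g. path_class X (path_join f g))"
    by (intro SUP_cong refl path_class_join assms(3))
  also have "\<dots> = path_class X (path_join f g)"
    using path_class_self[OF assms(1)] path_class_self[OF assms(2)] by auto
  finally show ?thesis by (simp add: fundamental_group_def)
qed

lemma fundamental_group_one: "\<one>\<^bsub>fundamental_group X x\<^esub> = path_class X (\<lambda>_. x)" by (simp add: fundamental_group_def)

lemma path_class_assoc:
  assumes "pathin X a" "pathin X b" "pathin X c" "a 1 = b 0" "b 1 = c 0"
  shows "path_class X (path_join (path_join a b) c) = path_class X (path_join a (path_join b c))"
proof -
  let ?\<sigma> = "\<lambda>s::real. if s \<le> 1/2 then s / 2 else if s \<le> 3/4 then s - 1/4 else 2 * s - 1"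
  \<comment> \<open>The reparametrization has the slopes 1/2, 1 and 2, so it is convex and equals
    the maximum of its linear pieces; in this form its continuity is immediate.\<close>
  let ?\<rho> = "\<lambda>s::real. max (s / 2) (max (s - 1/4) (2 * s - 1))"
  have eq: "?\<sigma> s = ?\<rho> s" for s by (auto simp: max_def)
  have p: "pathin X (path_join (path_join a b) c)" by (intro pathin_path_join assms) (simp_all add: assms)
  have "path_class X (path_join a (path_join b c)) = path_class X (path_join (path_join a b) c)"
  proof (rule path_class_reparam_path[OF p, of ?\<rho>])
    show "continuous_on {0..1} ?\<rho>" by (intro continuous_intros) auto
    fix t :: real assume t: "t \<in> {0..1}"
    show "?\<rho> t \<in> {0..1}" using t by (auto simp: max_def)
    consider "t \<le> 1/2" | "1/2 < t" "t \<le> 3/4" | "3/4 < t" by linarith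
    hence "path_join a (path_join b c) t = path_join (path_join a b) c (?\<sigma> t)"
    proof cases
      case 1
      thus ?thesis by (simp add: path_join_def)
    next
      case 2
      have "path_join a (path_join b c) t = b (2 * (2 * t - 1))" using 2 by (simp add: path_join_def)
      moreover have "path_join (path_join a b) c (t - 1/4) = b (2 * (2 * (t - 1/4)) - 1)"
        using 2 by (simp add: path_join_def)
      moreover have "2 * (2 * t - 1) = 2 * (2 * (t - 1/4)) - 1" by (simp add: algebra_simps)
      ultimately show ?thesis using 2 by simp
    next
      case 3
      thus ?thesis by (simp add: path_join_def)
    qed
    thus "path_join a (path_join b c) t = path_join (path_join a b) c (?\<rho> t)" unfolding eq .
  qed (auto simp: max_def)
  thus ?thesis by simp
qed

lemma path_class_left_one:
  assumes "pathin X a"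
  shows "path_class X (path_join (\<lambda>_. a 0) a) = path_class X a"
proof (rule path_class_reparam_path[OF assms, of "\<lambda>s. max 0 (2 * s - 1)"])
  show "continuous_on {0..1} (\<lambda>s::real. max 0 (2 * s - 1))" by (intro continuous_intros)
  show "path_join (\<lambda>_. a 0) a t = a (max 0 (2 * t - 1))" for t by (cases "t \<le> 1/2") (simp_all add: path_join_def)
qed auto

text \<open>Back and forth is \<open>a\<close> along \<open>\<bar>2 * t - 1\<bar>\<close>, a path of
  parameters from 1 to 1, which contracts to the constant 1.\<close>

lemma path_class_left_inverse:
  assumes a: "pathin X a"
  shows "path_class X (path_join (\<lambda>t. a (1 - t)) a) = path_class X (\<lambda>_. a 1)"
proof -
  have p: "pathin X (path_join (\<lambda>t. a (1 - t)) a)" by (intro pathin_path_join pathin_reverse a) simp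
  have "path_class X (path_join (\<lambda>t. a (1 - t)) a) = path_class X (\<lambda>t. a \<bar>2 * t - 1\<bar>)"
  proof (rule path_class_cong[OF p])
    show "path_join (\<lambda>t. a (1 - t)) a t = a \<bar>2 * t - 1\<bar>" for t by (cases "t \<le> 1/2") (simp_all add: path_join_def)
  qed
  also have "\<dots> = path_class X (\<lambda>t. a ((\<lambda>_. 1) t))"
    by (rule path_class_reparam[OF a[unfolded pathin_def]]) (auto intro!: continuous_intros)
  finally show ?thesis by simp
qed

lemma group_fundamental_group:
  assumes x: "x \<in> topspace X"
  shows "group (fundamental_group X x)"
proof (rule groupI)
  let ?G = "fundamental_group X x"
  show "\<one>\<^bsub>?G\<^esub> \<in> carrier ?G"
    unfolding fundamental_group_one fundamental_group_carrier using x by (intro exI[of _ "\<lambda>_. x"]) simp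
  fix A assume "A \<in> carrier ?G"
  then obtain a where a: "pathin X a" "a 0 = x" "a 1 = x" "A = path_class X a"
    unfolding fundamental_group_carrier by (elim exE conjE)
  show "\<one>\<^bsub>?G\<^esub> \<otimes>\<^bsub>?G\<^esub> A = A"
  proof -
    have "path_class X (\<lambda>_. x) \<otimes>\<^bsub>?G\<^esub> path_class X a = path_class X (path_join (\<lambda>_. x) a)"
      by (rule fundamental_group_mult) (simp_all add: x a(1,2))
    thus ?thesis
      unfolding fundamental_group_one a(4) using path_class_left_one[OF a(1)] a(2) by simp
  qed
  show "\<exists>B\<in>carrier ?G. B \<otimes>\<^bsub>?G\<^esub> A = \<one>\<^bsub>?G\<^esub>"
  proof (rule bexI[of _ "path_class X (\<lambda>t. a (1 - t))"])
    show "path_class X (\<lambda>t. a (1 - t)) \<otimes>\<^bsub>?G\<^esub> A = \<one>\<^bsub>?G\<^esub>"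
    proof -
      have "path_class X (\<lambda>t. a (1 - t)) \<otimes>\<^bsub>?G\<^esub> path_class X a = path_class X (path_join (\<lambda>t. a (1 - t)) a)"
        by (rule fundamental_group_mult[OF pathin_reverse[OF a(1)] a(1)]) simp
      thus ?thesis
        unfolding fundamental_group_one a(4) using path_class_left_inverse[OF a(1)] a(3) by simp
    qed
    show "path_class X (\<lambda>t. a (1 - t)) \<in> carrier ?G"
      unfolding fundamental_group_carrier using pathin_reverse[OF a(1)] a(2,3)
      by (intro exI[of _ "\<lambda>t. a (1 - t)"]) simp
  qed
  fix B assume "B \<in> carrier ?G"
  then obtain b where b: "pathin X b" "b 0 = x" "b 1 = x" "B = path_class X b"
    unfolding fundamental_group_carrier by (elim exE conjE)
  have AB: "A \<otimes>\<^bsub>?G\<^esub> B = path_class X (path_join a b)"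
    unfolding a(4) b(4) by (rule fundamental_group_mult[OF a(1) b(1)]) (simp add: a b)
  have pab: "pathin X (path_join a b)" by (rule pathin_path_join[OF a(1) b(1)]) (simp add: a b)
  show "A \<otimes>\<^bsub>?G\<^esub> B \<in> carrier ?G"
    unfolding AB fundamental_group_carrier using pab a b by (intro exI[of _ "path_join a b"]) simp
  fix C assume "C \<in> carrier ?G"
  then obtain c where c: "pathin X c" "c 0 = x" "c 1 = x" "C = path_class X c"
    unfolding fundamental_group_carrier by (elim exE conjE)
  have BC: "B \<otimes>\<^bsub>?G\<^esub> C = path_class X (path_join b c)"
    unfolding b(4) c(4) by (rule fundamental_group_mult[OF b(1) c(1)]) (simp add: b c)
  have pbc: "pathin X (path_join b c)" by (rule pathin_path_join[OF b(1) c(1)]) (simp add: b c)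
  show "A \<otimes>\<^bsub>?G\<^esub> B \<otimes>\<^bsub>?G\<^esub> C = A \<otimes>\<^bsub>?G\<^esub> (B \<otimes>\<^bsub>?G\<^esub> C)"
  proof -
    have "A \<otimes>\<^bsub>?G\<^esub> B \<otimes>\<^bsub>?G\<^esub> C = path_class X (path_join (path_join a b) c)"
      unfolding AB c(4) by (rule fundamental_group_mult[OF pab c(1)]) (simp add: b c)
    moreover have "A \<otimes>\<^bsub>?G\<^esub> (B \<otimes>\<^bsub>?G\<^esub> C) = path_class X (path_join a (path_join b c))"
      unfolding BC a(4) by (rule fundamental_group_mult[OF a(1) pbc]) (simp add: a b)
    ultimately show ?thesis
      using path_class_assoc[OF a(1) b(1) c(1)] by (simp add: a b c)
  qed
qed

text \<open>The description in \<open>pi1_hom\<close> denotes because the value is invariant under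
  homotopies that fix the ends.\<close>

lemma pi1_hom_path_class:
  assumes "l \<in> H1 X" "z \<in> l" "pathin X g" "g 0 = g 1"
  shows "pi1_hom l (path_class X g) = path_value z g"
  unfolding pi1_hom_def
proof (rule the_equality)
  show "\<exists>g'\<in>path_class X g. path_value z g = H1_eval l g'"
    using H1_eval_eq[OF assms] path_class_self[OF assms(3)] by (intro bexI[of _ g]) simp_all
  fix v assume "\<exists>g'\<in>path_class X g. v = H1_eval l g'"
  then obtain g' where g': "g' \<in> path_class X g" "v = H1_eval l g'" by (elim bexE)
  have "g' 0 = g' 1" using path_class_memD[OF g'(1)] assms(4) by simp
  hence "v = path_value z g'" using H1_eval_eq[OF assms(1,2) path_class_memD(4)[OF g'(1)]] g'(2) by simp
  also have "\<dots> = path_value z g"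
    using rel_ends_path_value[OF H1_memD(1)[OF assms(1,2)] g'(1)[unfolded path_class_mem]] by simp
  finally show "v = path_value z g" .
qed

lemma pi1_map_path_class:
  assumes q: "continuous_map T X q" and g: "pathin T g"
  shows "pi1_map q X (path_class T g) = path_class X (q \<circ> g)"
proof -
  have "path_class X (q \<circ> g') = path_class X (q \<circ> g)" if "g' \<in> path_class T g" for g'
  proof (rule path_class_eqI)
    have "homotopic_with (\<lambda>h. h 0 = q (g 0) \<and> h 1 = q (g 1)) I01 X (q \<circ> g) (q \<circ> g')"
      by (rule homotopic_with_compose_continuous_map_left[OF that[unfolded path_class_mem] q]) simp
    thus "q \<circ> g' \<in> path_class X (q \<circ> g)" unfolding path_class_mem by simp
  qed
  hence "pi1_map q X (path_class T g) = (\<Union>g'\<in>path_class T g. path_class X (q \<circ> g))"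
    unfolding pi1_map_def by (intro SUP_cong refl) simp
  thus ?thesis using path_class_self[OF g] by auto
qed

section \<open>Trivializing covers\<close>

lemma pathin_in_component:
  assumes "A \<in> connected_components_of X" "pathin X g" "g s \<in> A" "s \<in> {0..1}" "t \<in> {0..1}"
  shows "g t \<in> A"
proof -
  have "g ` {0..1} \<subseteq> A" by (rule connected_components_of_maximal[OF assms(1) connectedin_path_image[OF assms(2)]])
       (use assms(3,4) in \<open>auto simp: disjnt_iff\<close>)
  thus ?thesis using assms(5) by blast
qed

lemma deck_group_in:
  assumes "g \<in> deck_group T q A" "y \<in> topspace T" "q y \<in> A"
  shows "g y \<in> topspace T \<and> q (g y) = q y"
proof -
  have g: "homeomorphic_map (cover_over T q A) (cover_over T q A) g" "\<forall>y\<in>topspace (cover_over T q A). q (g y) = q y"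
    using assms(1) unfolding deck_group_def by simp_all
  have y: "y \<in> topspace (cover_over T q A)" unfolding cover_over_def using assms(2,3) by simp
  hence "g y \<in> topspace (cover_over T q A)"
    using homeomorphic_imp_surjective_map[OF g(1)] by blast
  thus ?thesis using g(2) y unfolding cover_over_def by simp
qed

locale triv =
  fixes X :: "'a topology" and l :: "'a cochain set" and T :: "'t topology" and q :: "'t \<Rightarrow> 'a" and z :: "'a cochain"
  assumes triv: "trivializing_cover X l T q" and l: "l \<in> H1 X" and zl: "z \<in> l"
    and lpc: "locally_path_connected_space X"
begin

lemma cocycle_z: "cocycle X z" by (rule H1_memD(1)[OF l zl])

lemma cov: "covering_map T X q"
  using triv unfolding trivializing_cover_def by (elim conjE)

lemma conn: "A \<in> connected_components_of X \<Longrightarrow> connectedin T {y \<in> topspace T. q y \<in> A}"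
  using triv unfolding trivializing_cover_def by (elim conjE) (erule (1) bspec)

lemma cont: "continuous_map T X q" by (rule covering_map_continuous[OF cov])

lemma normal_pi1:
  assumes "y \<in> topspace T"
  shows "pi1_map q X ` carrier (fundamental_group T y) \<lhd> fundamental_group X (q y)"
    and "a \<in> pi1_map q X ` carrier (fundamental_group T y) \<Longrightarrow> pi1_hom l a = 0"
proof -
  have *: "pi1_map q X ` carrier (fundamental_group T y) \<lhd> fundamental_group X (q y) \<and>
      (\<forall>a\<in>pi1_map q X ` carrier (fundamental_group T y). pi1_hom l a = 0)"
    using triv assms unfolding trivializing_cover_def Let_def by (elim conjE) (erule (1) bspec)
  thus "pi1_map q X ` carrier (fundamental_group T y) \<lhd> fundamental_group X (q y)" by (rule conjunct1)
  show "a \<in> pi1_map q X ` carrier (fundamental_group T y) \<Longrightarrow> pi1_hom l a = 0"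
    using * by (elim conjE) (erule (1) bspec)
qed

lemma pathin_proj: "pathin T c \<Longrightarrow> pathin X (\<lambda>t. q (c t))"
  using pathin_compose[OF _ cont] by (simp add: comp_def)

text \<open>This is what containment of the subgroup in the kernel of the class means for paths
  upstairs.\<close>

lemma path_value_loop:
  assumes c: "pathin T c" "c 0 = c 1"
  shows "path_value z (\<lambda>t. q (c t)) = 0"
proof -
  have "path_class T c \<in> carrier (fundamental_group T (c 0))"
    unfolding fundamental_group_carrier using c by (intro exI[of _ c]) simp
  hence "pi1_hom l (pi1_map q X (path_class T c)) = 0"
    by (intro normal_pi1(2)[OF path_start_in_topspace[OF c(1)]] imageI)
  thus ?thesis
    unfolding pi1_map_path_class[OF cont c(1)] comp_def
    using pi1_hom_path_class[OF l zl pathin_proj[OF c(1)]] c(2) by simp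
qed

lemma path_component_fibre:
  assumes "y \<in> topspace T" "y' \<in> topspace T" "q y = q y'"
  shows "path_component_of T y y'" by (rule covering_map_path_component[OF cov lpc conn assms(1,2)])
     (use assms(3) covering_map_in[OF cov assms(2)] in \<open>simp_all add: connected_component_of_refl\<close>)

text \<open>Normality in terms of paths. Conjugating with a path between the two starting points
  gives a loop in the subgroup at \<open>y'\<close>; by normality the original loop lies there too.
  It is then homotopic to the image of a closed path at \<open>y'\<close>, and lifting the homotopy
  shows that \<open>w'\<close> is closed.\<close>

lemma regular:
  assumes w: "pathin T w" and w': "pathin T w'" and eq: "\<forall>t\<in>{0..1}. q (w t) = q (w' t)" and "w 0 = w 1"
  shows "w' 0 = w' 1"
proof -
  define y y' where "y = w 0" and "y' = w' 0"
  have y: "y \<in> topspace T" "y' \<in> topspace T" and qy: "q y = q y'"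
    unfolding y_def y'_def using path_start_in_topspace w w' eq by auto
  obtain g where g: "pathin T g" "g 0 = y'" "g 1 = y"
    using path_component_fibre[OF y(2,1) qy[symmetric]] unfolding path_component_of_def by (elim exE conjE)
  define x where "x = q y'"
  define b a rb where "b = q \<circ> g" and "a = q \<circ> w" and "rb = q \<circ> (\<lambda>t. g (1 - t))"
  have b: "pathin X b" "b 0 = x" "b 1 = x" and a: "pathin X a" "a 0 = x" "a 1 = x" and rb: "pathin X rb" "rb 0 = x" "rb 1 = x"
    unfolding b_def a_def rb_def x_def
    using pathin_compose[OF g(1) cont] pathin_compose[OF w cont] pathin_compose[OF pathin_reverse[OF g(1)] cont]
      g(2,3) qy assms(4) by (simp_all add: y_def)
  have rb_def': "rb = (\<lambda>t. b (1 - t))" unfolding rb_def b_def by auto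
  define G where "G = fundamental_group X x"
  define N where "N = pi1_map q X ` carrier (fundamental_group T y')"
  have xX: "x \<in> topspace X" using b path_start_in_topspace by blast
  interpret group G unfolding G_def by (rule group_fundamental_group[OF xX])
  have N: "N \<lhd> G" unfolding N_def G_def x_def by (rule normal_pi1(1)[OF y(2)])
  have cb: "path_class X b \<in> carrier G" and ca: "path_class X a \<in> carrier G" and crb: "path_class X rb \<in> carrier G"
    unfolding G_def fundamental_group_carrier using b a rb by metis+
  have "path_class X rb \<otimes>\<^bsub>G\<^esub> path_class X b = path_class X (path_join rb b)"
    unfolding G_def by (rule fundamental_group_mult) (simp_all add: rb b)
  also have "\<dots> = \<one>\<^bsub>G\<^esub>"
    unfolding G_def fundamental_group_one rb_def' using path_class_left_inverse[OF b(1)] b(3) by simp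
  finally have inv: "inv\<^bsub>G\<^esub> path_class X b = path_class X rb" by (rule inv_equality[OF _ cb crb])
  have gw: "pathin T (path_join g w)" by (rule pathin_path_join[OF g(1) w]) (simp add: g y_def)
  \<comment> \<open>A closed path at \<open>y'\<close> whose image is the conjugate of
    \<open>a\<close> by \<open>b\<close>.\<close>
  define h where "h = path_join (path_join g w) (\<lambda>t. g (1 - t))"
  have h: "pathin T h" "h 0 = y'" "h 1 = y'"
    unfolding h_def using g(2,3) assms(4) by (auto intro!: pathin_path_join[OF gw pathin_reverse[OF g(1)]] simp: y_def)
  have "path_class T h \<in> carrier (fundamental_group T y')"
    unfolding fundamental_group_carrier using h by (intro exI[of _ h]) simp
  hence "pi1_map q X (path_class T h) \<in> N" unfolding N_def by (rule imageI)
  moreover have "pi1_map q X (path_class T h) = path_class X (path_join (path_join b a) rb)"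
  proof -
    have "q \<circ> h = path_join (path_join b a) rb"
      unfolding h_def path_join_comp b_def a_def rb_def ..
    thus ?thesis using pi1_map_path_class[OF cont h(1)] by simp
  qed
  moreover have "path_class X (path_join (path_join b a) rb) = path_class X b \<otimes>\<^bsub>G\<^esub> path_class X a \<otimes>\<^bsub>G\<^esub> path_class X rb"
  proof -
    have "path_class X b \<otimes>\<^bsub>G\<^esub> path_class X a = path_class X (path_join b a)"
      unfolding G_def by (rule fundamental_group_mult) (simp_all add: a b)
    moreover have "path_class X (path_join b a) \<otimes>\<^bsub>G\<^esub> path_class X rb = path_class X (path_join (path_join b a) rb)"
      unfolding G_def by (rule fundamental_group_mult) (simp_all add: a b rb pathin_path_join)
    ultimately show ?thesis by simp
  qed
  ultimately have "path_class X b \<otimes>\<^bsub>G\<^esub> path_class X a \<otimes>\<^bsub>G\<^esub> path_class X rb \<in> N" by simp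
  \<comment> \<open>Conjugating back with \<open>b\<close> stays in \<open>N\<close> by normality
    and leaves \<open>a\<close>.\<close>
  hence "inv\<^bsub>G\<^esub> path_class X b \<otimes>\<^bsub>G\<^esub> (path_class X b \<otimes>\<^bsub>G\<^esub> path_class X a \<otimes>\<^bsub>G\<^esub> inv\<^bsub>G\<^esub> path_class X b) \<otimes>\<^bsub>G\<^esub> path_class X b \<in> N"
    unfolding inv using normal.inv_op_closed1[OF N cb] inv by simp
  also have "inv\<^bsub>G\<^esub> path_class X b \<otimes>\<^bsub>G\<^esub> (path_class X b \<otimes>\<^bsub>G\<^esub> path_class X a \<otimes>\<^bsub>G\<^esub> inv\<^bsub>G\<^esub> path_class X b) \<otimes>\<^bsub>G\<^esub> path_class X b =
      (inv\<^bsub>G\<^esub> path_class X b \<otimes>\<^bsub>G\<^esub> path_class X b) \<otimes>\<^bsub>G\<^esub> path_class X a \<otimes>\<^bsub>G\<^esub> (inv\<^bsub>G\<^esub> path_class X b \<otimes>\<^bsub>G\<^esub> path_class X b)"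
    using cb ca by (simp only: m_assoc m_closed inv_closed)
  also have "\<dots> = path_class X a" using cb ca by simp
  finally have "path_class X a \<in> N" .
  then obtain A where A: "A \<in> carrier (fundamental_group T y')" "path_class X a = pi1_map q X A"
    unfolding N_def by (elim imageE)
  then obtain v where v: "pathin T v" "v 0 = y'" "v 1 = y'" "A = path_class T v"
    unfolding fundamental_group_carrier by (elim exE conjE)
  have "path_class X a = path_class X (q \<circ> v)"
    using A(2) unfolding v(4) pi1_map_path_class[OF cont v(1)] .
  hence "a \<in> path_class X (q \<circ> v)" using path_class_self[OF a(1)] by simp
  hence h: "rel_ends ((q \<circ> v) 0) ((q \<circ> v) 1) X (q \<circ> v) a" unfolding path_class_mem .
  have "v 1 = w' 1"
  proof (rule rel_endsE[OF h])
    fix K assume K: "continuous_map (top_of_set ({0..1::real} \<times> {0..1::real})) X K"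
      "\<And>s. K (0, s) = (q \<circ> v) s" "\<And>s. K (1, s) = a s" "\<And>t. t \<in> {0..1} \<Longrightarrow> K (t, 0) = (q \<circ> v) 0"
      "\<And>t. t \<in> {0..1} \<Longrightarrow> K (t, 1) = (q \<circ> v) 1"
    show ?thesis
    proof (rule homotopic_lift_end[OF cov _ K(4,5) v(1) _ w'])
      show "continuous_map (prod_topology I01 I01) X K" using K(1) by simp
      show "q (v s) = K (0, s)" for s using K(2) by simp
      show "q (w' s) = K (1, s)" if "s \<in> {0..1}" for s using K(3) eq that by (simp add: a_def)
      show "v 0 = w' 0" using v(2) by (simp add: y'_def)
    qed
  qed
  thus ?thesis using v(2,3) by (simp add: y'_def)
qed

text \<open>\<open>covering_iso\<close> compares \<open>T\<close> with itself; by
  \<open>regular\<close> the same paths are closed in both copies. The result is an automorphism of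
  all of \<open>T\<close>, which preserves the part over every component.\<close>

lemma deck_exists:
  assumes y: "y \<in> topspace T" "y' \<in> topspace T" "q y = q y'" and A: "A \<in> connected_components_of X"
  shows "\<exists>g. g \<in> deck_group T q A \<and> g y = y'"
proof -
  have "\<exists>f. homeomorphic_map T T f \<and> (\<forall>x\<in>topspace T. q (f x) = q x) \<and>
      (\<forall>x. (\<exists>s\<in>{y}. path_component_of T x s) \<longrightarrow> (\<exists>s\<in>{y}. path_component_of T x s \<and> f s = y'))"
  proof (rule covering_iso[OF cov cov lpc conn conn])
    fix w w' assume "pathin T w" "pathin T w'" "\<forall>t\<in>{0..1}. q (w t) = q (w' t)"
    thus "w 0 = w 1 \<longleftrightarrow> w' 0 = w' 1" using regular[of w w'] regular[of w' w] by auto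
  qed (use y in auto)
  then obtain f where f: "homeomorphic_map T T f" "\<forall>x\<in>topspace T. q (f x) = q x"
    "\<forall>x. (\<exists>s\<in>{y}. path_component_of T x s) \<longrightarrow> (\<exists>s\<in>{y}. path_component_of T x s \<and> f s = y')" by (elim exE conjE)
  have "f y = y'" using f(3) y(1) path_component_of_refl[of T y] by auto
  moreover have "homeomorphic_map (cover_over T q A) (cover_over T q A) f"
    unfolding cover_over_def
  proof (rule homeomorphic_map_subtopologies_alt[OF f(1)])
    fix x assume x: "x \<in> topspace T"
    have "f x \<in> topspace T" using homeomorphic_imp_surjective_map[OF f(1)] x by blast
    thus "(f x \<in> {y \<in> topspace T. q y \<in> A}) = (x \<in> {y \<in> topspace T. q y \<in> A})"
      using x f(2) by simp
  qed
  ultimately show ?thesis unfolding deck_group_def cover_over_def using f(2) by (intro exI[of _ f]) simp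
qed

text \<open>Independence of the path: if \<open>a\<close> joins \<open>c 0\<close> to
  \<open>d 0\<close>, then \<open>c\<close> followed by \<open>g \<circ> a\<close> and
  \<open>a\<close> followed by \<open>d\<close> have the same ends upstairs, hence the same value,
  and \<open>g \<circ> a\<close> lies over the same path as \<open>a\<close>.\<close>

lemma deck_hom_eq:
  assumes A: "A \<in> connected_components_of X" and g: "g \<in> deck_group T q A"
    and c: "pathin T c" "q (c 0) \<in> A" "c 1 = g (c 0)"
  shows "deck_hom l T q A g = path_value z (\<lambda>t. q (c t))"
proof -
  define P where "P = {y \<in> topspace T. q y \<in> A}"
  have top: "topspace (cover_over T q A) = P" unfolding cover_over_def P_def by auto
  have gc: "continuous_map (subtopology T P) (subtopology T P) g" and gq: "\<And>y. y \<in> P \<Longrightarrow> q (g y) = q y"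
    using g homeomorphic_imp_continuous_map unfolding deck_group_def top by (auto simp: cover_over_def P_def)
  have pin: "pathin (subtopology T P) d" if d: "pathin T d" "q (d 0) \<in> A" for d
    unfolding pathin_subtopology
  proof (intro conjI ballI d(1))
    fix t :: real assume t: "t \<in> {0..1}"
    show "d t \<in> P"
      unfolding P_def using pathin_subset[OF d(1) t] pathin_in_component[OF A pathin_proj[OF d(1)] d(2) _ t] by simp
  qed
  have *: "path_value z (\<lambda>t. q (d t)) = path_value z (\<lambda>t. q (c t))"
    if d: "pathin T d" "q (d 0) \<in> A" "d 1 = g (d 0)" for d
  proof -
    have cd: "c 0 \<in> P" "d 0 \<in> P"
      unfolding P_def using c d path_start_in_topspace by auto
    have "connected_component_of X (q (c 0)) (q (d 0))"
      unfolding connected_component_of_def using connectedin_connected_components_of[OF A] c(2) d(2) by blast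
    hence "path_component_of T (c 0) (d 0)"
      using cd by (intro covering_map_path_component[OF cov lpc conn]) (auto simp: P_def)
    then obtain a where a: "pathin T a" "a 0 = c 0" "a 1 = d 0"
      unfolding path_component_of_def by (elim exE conjE)
    have aP: "pathin (subtopology T P) a" using a(1) c(2) a(2) by (intro pin) simp_all
    have ga: "pathin T (g \<circ> a)"
      using pathin_compose[OF aP gc] by (simp add: pathin_subtopology)
    have qga: "q ((g \<circ> a) t) = q (a t)" if "t \<in> {0..1}" for t
      using aP gq that by (simp add: pathin_subtopology)
    define L R where "L = path_join c (g \<circ> a)" and "R = path_join a d"
    have L: "pathin T L" unfolding L_def by (rule pathin_path_join[OF c(1) ga]) (simp add: a c)
    have R: "pathin T R" unfolding R_def by (rule pathin_path_join[OF a(1) d(1)]) (simp add: a)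
    have v: "path_value z (\<lambda>t. q (path_join f h t)) = path_value z (\<lambda>t. q (f t)) + path_value z (\<lambda>t. q (h t))"
      if "pathin T f" "pathin T h" "f 1 = h 0" for f h
      using path_value_join[OF cocycle_z pathin_proj[OF that(1)] pathin_proj[OF that(2)]] that(3)
        path_join_comp[of q f h] by (simp add: comp_def)
    have LR: "L 1 = R 1" "L 0 = R 0" unfolding L_def R_def by (simp_all add: a c d)
    define S where "S = path_join L (\<lambda>t. R (1 - t))"
    have S: "pathin T S" "S 0 = S 1"
      unfolding S_def using LR by (auto intro!: pathin_path_join[OF L pathin_reverse[OF R]])
    have "0 = path_value z (\<lambda>t. q (S t))" using path_value_loop[OF S] by simp
    also have "\<dots> = path_value z (\<lambda>t. q (L t)) + path_value z (\<lambda>t. q (R (1 - t)))"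
      unfolding S_def by (rule v[OF L pathin_reverse[OF R]]) (simp add: LR)
    also have "path_value z (\<lambda>t. q (R (1 - t))) = - path_value z (\<lambda>t. q (R t))"
      by (rule path_value_reverse[OF cocycle_z pathin_proj[OF R]])
    also have "path_value z (\<lambda>t. q (L t)) = path_value z (\<lambda>t. q (c t)) + path_value z (\<lambda>t. q ((g \<circ> a) t))"
      unfolding L_def by (rule v[OF c(1) ga]) (simp add: a c)
    also have "path_value z (\<lambda>t. q ((g \<circ> a) t)) = path_value z (\<lambda>t. q (a t))" by (rule path_value_cong) (rule qga)
    also have "path_value z (\<lambda>t. q (R t)) = path_value z (\<lambda>t. q (a t)) + path_value z (\<lambda>t. q (d t))"
      unfolding R_def by (rule v[OF a(1) d(1)]) (simp add: a)
    finally show ?thesis by simp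
  qed
  have ev: "H1_eval l (q \<circ> d) = path_value z (\<lambda>t. q (c t))"
    if d: "pathin (cover_over T q A) d" "d 1 = g (d 0)" for d
  proof -
    have dT: "pathin T d" "\<forall>t\<in>{0..1}. d t \<in> P"
      using d(1) unfolding cover_over_def pathin_subtopology P_def by blast+
    hence d0: "d 0 \<in> P" by simp
    have "H1_eval l (q \<circ> d) = path_value z (q \<circ> d)"
      by (rule H1_eval_eq[OF l zl pathin_compose[OF dT(1) cont]]) (simp add: d(2) gq[OF d0])
    also have "\<dots> = path_value z (\<lambda>t. q (c t))"
      using *[OF dT(1) _ d(2)] d0 by (simp add: P_def comp_def)
    finally show ?thesis .
  qed
  have cP: "pathin (cover_over T q A) c" using pin[OF c(1,2)] unfolding cover_over_def P_def .
  show ?thesis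
    unfolding deck_hom_def
  proof (rule the_equality)
    show "\<exists>d. pathin (cover_over T q A) d \<and> d 1 = g (d 0) \<and> path_value z (\<lambda>t. q (c t)) = H1_eval l (q \<circ> d)"
      using cP c(3) ev[OF cP c(3)] by (intro exI[of _ c]) simp
    fix v assume "\<exists>d. pathin (cover_over T q A) d \<and> d 1 = g (d 0) \<and> v = H1_eval l (q \<circ> d)"
    then obtain d where "pathin (cover_over T q A) d" "d 1 = g (d 0)" "v = H1_eval l (q \<circ> d)" by (elim exE conjE)
    thus "v = path_value z (\<lambda>t. q (c t))" using ev by simp
  qed
qed

end

text \<open>Serves for the cover constructed below. If a lift of a loop is closed exactly when its
  value vanishes, the subgroup is the kernel of a homomorphism to the reals, and therefore
  normal.\<close>

lemma trivializing_coverI: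
  assumes l: "l \<in> H1 X" "z \<in> l" and q: "covering_map T X q"
    and conn: "\<And>A. A \<in> connected_components_of X \<Longrightarrow> connectedin T {y \<in> topspace T. q y \<in> A}"
    and char: "\<And>w. pathin T w \<Longrightarrow> w 0 = w 1 \<longleftrightarrow> q (w 0) = q (w 1) \<and> path_value z (\<lambda>t. q (w t)) = 0"
  shows "trivializing_cover X l T q"
  unfolding trivializing_cover_def Let_def
proof (intro conjI ballI q conn)
  note cont = covering_map_continuous[OF q]
  fix y assume y: "y \<in> topspace T"
  define G where "G = fundamental_group X (q y)"
  define N where "N = pi1_map q X ` carrier (fundamental_group T y)"
  \<comment> \<open>The additive group of the reals as a target of group homomorphisms, so that the
    normality of kernels applies.\<close>
  define R where "R = \<lparr>carrier = UNIV :: real set, monoid.mult = ((+) :: real \<Rightarrow> real \<Rightarrow> real), one = 0 :: real\<rparr>"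
  have gG: "group G" unfolding G_def by (rule group_fundamental_group[OF covering_map_in[OF q y]])
  have gR: "group R" by (rule groupI) (auto simp: R_def intro!: exI[of _ "- _"])
  have rep: "\<exists>g. pathin X g \<and> g 0 = q y \<and> g 1 = q y \<and> a = path_class X g \<and> pi1_hom l a = path_value z g"
    if a: "a \<in> carrier G" for a
  proof -
    obtain g where g: "pathin X g" "g 0 = q y" "g 1 = q y" "a = path_class X g"
      using a unfolding G_def fundamental_group_carrier by (elim exE conjE)
    have "pi1_hom l a = path_value z g" unfolding g(4) by (rule pi1_hom_path_class[OF l g(1)]) (simp add: g)
    thus ?thesis using g by (intro exI[of _ g]) simp
  qed
  have "pi1_hom l \<in> hom G R"
  proof (rule homI)
    fix a b assume ab: "a \<in> carrier G" "b \<in> carrier G"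
    obtain g where g: "pathin X g" "g 0 = q y" "g 1 = q y" "a = path_class X g" "pi1_hom l a = path_value z g"
      using rep[OF ab(1)] by (elim exE conjE)
    obtain h where h: "pathin X h" "h 0 = q y" "h 1 = q y" "b = path_class X h" "pi1_hom l b = path_value z h"
      using rep[OF ab(2)] by (elim exE conjE)
    have e: "g 1 = h 0" by (simp add: g h)
    have "a \<otimes>\<^bsub>G\<^esub> b = path_class X (path_join g h)"
      unfolding G_def g(4) h(4) by (rule fundamental_group_mult[OF g(1) h(1) e])
    hence "pi1_hom l (a \<otimes>\<^bsub>G\<^esub> b) = path_value z (path_join g h)"
      using pi1_hom_path_class[OF l pathin_path_join[OF g(1) h(1) e]] g(2) h(3) by simp
    thus "pi1_hom l (a \<otimes>\<^bsub>G\<^esub> b) = pi1_hom l a \<otimes>\<^bsub>R\<^esub> pi1_hom l b"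
      using path_value_join[OF H1_memD(1)[OF l] g(1) h(1) e] g(5) h(5) by (simp add: R_def)
  qed (simp add: R_def)
  hence gh: "group_hom G R (pi1_hom l)"
    using gG gR by (simp add: group_hom_def group_hom_axioms_def)
  have "N = kernel G R (pi1_hom l)"
  proof (intro equalityI subsetI)
    fix a assume "a \<in> N"
    then obtain A where A: "A \<in> carrier (fundamental_group T y)" "a = pi1_map q X A" unfolding N_def by (elim imageE)
    obtain v where v: "pathin T v" "v 0 = y" "v 1 = y" "A = path_class T v"
      using A(1) unfolding fundamental_group_carrier by (elim exE conjE)
    have a: "a = path_class X (q \<circ> v)" unfolding A(2) v(4) by (rule pi1_map_path_class[OF cont v(1)])
    have p: "pathin X (q \<circ> v)" by (rule pathin_compose[OF v(1) cont])
    have "a \<in> carrier G"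
      unfolding G_def fundamental_group_carrier using p v(2,3) a by (intro exI[of _ "q \<circ> v"]) simp
    moreover have "pi1_hom l a = path_value z (q \<circ> v)"
      unfolding a by (rule pi1_hom_path_class[OF l p]) (simp add: v)
    moreover have "path_value z (q \<circ> v) = 0" using char[OF v(1)] v(2,3) by (simp add: comp_def)
    ultimately show "a \<in> kernel G R (pi1_hom l)" by (simp add: kernel_def R_def)
  next
    fix a assume "a \<in> kernel G R (pi1_hom l)"
    hence a: "a \<in> carrier G" "pi1_hom l a = 0" by (simp_all add: kernel_def R_def)
    obtain g where g: "pathin X g" "g 0 = q y" "g 1 = q y" "a = path_class X g" "pi1_hom l a = path_value z g"
      using rep[OF a(1)] by (elim exE conjE)
    obtain v where v: "pathin T v" "v 0 = y" "\<And>t. t \<in> {0..1} \<Longrightarrow> q (v t) = g t"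
      by (rule path_lift[OF q g(1) y]) (use g(2) in auto)
    have "path_value z (\<lambda>t. q (v t)) = path_value z g" by (rule path_value_cong) (rule v(3))
    hence "v 0 = v 1" using char[OF v(1)] v(3)[of 0] v(3)[of 1] g a(2) by simp
    hence A: "path_class T v \<in> carrier (fundamental_group T y)"
      unfolding fundamental_group_carrier using v(1,2) by (intro exI[of _ v]) simp
    have "pi1_map q X (path_class T v) = path_class X (q \<circ> v)" by (rule pi1_map_path_class[OF cont v(1)])
    also have "\<dots> = a" unfolding g(4) by (rule path_class_cong[OF pathin_compose[OF v(1) cont]]) (simp add: v(3))
    finally show "a \<in> N" unfolding N_def using A by (intro image_eqI[of _ _ "path_class T v"]) simp_all
  qed
  thus "N \<lhd> fundamental_group X (q y)"
    using group_hom.normal_kernel[OF gh] unfolding G_def by simp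
  show "pi1_hom l a = 0" if "a \<in> N" for a
    using that \<open>N = kernel G R (pi1_hom l)\<close> by (simp add: kernel_def R_def)
qed

section \<open>The box sum as a covering space\<close>

lemma openin_quotient_topology:
  "openin (quotient_topology X h) U \<longleftrightarrow> U \<subseteq> h ` topspace X \<and> openin X {x \<in> topspace X. h x \<in> U}"
proof -
  have "istopology (\<lambda>U. U \<subseteq> h ` topspace X \<and> openin X {x \<in> topspace X. h x \<in> U})"
    unfolding istopology_def
  proof (intro conjI allI impI)
    fix S T assume S: "S \<subseteq> h ` topspace X \<and> openin X {x \<in> topspace X. h x \<in> S}"
      and T: "T \<subseteq> h ` topspace X \<and> openin X {x \<in> topspace X. h x \<in> T}"
    show "S \<inter> T \<subseteq> h ` topspace X" using S by blast
    have "{x \<in> topspace X. h x \<in> S \<inter> T} = {x \<in> topspace X. h x \<in> S} \<inter> {x \<in> topspace X. h x \<in> T}" by blast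
    thus "openin X {x \<in> topspace X. h x \<in> S \<inter> T}" using openin_Int[OF conjunct2[OF S] conjunct2[OF T]] by simp
  next
    fix K assume K: "\<forall>S\<in>K. S \<subseteq> h ` topspace X \<and> openin X {x \<in> topspace X. h x \<in> S}"
    thus "\<Union>K \<subseteq> h ` topspace X" by blast
    have "{x \<in> topspace X. h x \<in> \<Union>K} = (\<Union>S\<in>K. {x \<in> topspace X. h x \<in> S})" by blast
    thus "openin X {x \<in> topspace X. h x \<in> \<Union>K}" using K by (auto intro!: openin_Union)
  qed
  thus ?thesis unfolding quotient_topology_def by (simp add: topology_inverse')
qed

lemma topspace_quotient_topology: "topspace (quotient_topology X h) = h ` topspace X"
proof (rule equalityI)
  show "topspace (quotient_topology X h) \<subseteq> h ` topspace X"
    using openin_topspace[of "quotient_topology X h"] unfolding openin_quotient_topology by blast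
  have "{x \<in> topspace X. h x \<in> h ` topspace X} = topspace X" by blast
  hence "openin (quotient_topology X h) (h ` topspace X)" unfolding openin_quotient_topology by simp
  thus "h ` topspace X \<subseteq> topspace (quotient_topology X h)" by (rule openin_subset)
qed

lemma continuous_map_quotient_topology: "continuous_map X (quotient_topology X h) h"
  unfolding continuous_map_def topspace_quotient_topology openin_quotient_topology by auto

text \<open>These properties characterize the box sum among coverings of the product. The later
  comparison results start from them alone, so that they also reach minimal coverings given
  abstractly.\<close>

definition box_covering ::
  "'a topology \<Rightarrow> 'a cochain \<Rightarrow> 'b topology \<Rightarrow> 'b cochain \<Rightarrow> 'x topology \<Rightarrow> ('x \<Rightarrow> 'a \<times> 'b) \<Rightarrow> bool" where
  "box_covering X1 z1 X2 z2 X r \<longleftrightarrow> covering_map X (prod_topology X1 X2) r \<and>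
     (\<forall>C\<in>connected_components_of (prod_topology X1 X2). connectedin X {y \<in> topspace X. r y \<in> C}) \<and>
     (\<forall>w. pathin X w \<longrightarrow> (w 0 = w 1 \<longleftrightarrow> r (w 0) = r (w 1) \<and>
        path_value z1 (\<lambda>t. fst (r (w t))) = path_value z2 (\<lambda>t. snd (r (w t)))))"

section \<open>Orbits in the product of two trivializing covers\<close>

locale box = t1: triv X1 l1 T1 q1 z1 + t2: triv X2 l2 T2 q2 z2
  for X1 :: "'a topology" and l1 and T1 :: "'t topology" and q1 and z1
    and X2 :: "'b topology" and l2 and T2 :: "'s topology" and q2 and z2
begin

abbreviation P where "P \<equiv> prod_topology T1 T2"
abbreviation B where "B \<equiv> prod_topology X1 X2"
abbreviation c where "c \<equiv> map_prod q1 q2"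
abbreviation orb where "orb \<equiv> box_orbit X1 l1 T1 q1 X2 l2 T2 q2"
abbreviation X where "X \<equiv> quotient_topology P orb"
abbreviation r where "r \<equiv> box_proj q1 q2"

text \<open>For a path between two points of a fibre this is the difference of the two deck group
  homomorphisms, so its vanishing is the condition in \<open>deck12\<close>.\<close>

definition dv :: "(real \<Rightarrow> 't \<times> 's) \<Rightarrow> real" where
  "dv w = path_value z1 (\<lambda>t. q1 (fst (w t))) - path_value z2 (\<lambda>t. q2 (snd (w t)))"

lemma cov_c: "covering_map P B c" by (rule covering_map_prod[OF t1.cov t2.cov])

lemma lpc_B: "locally_path_connected_space B"
  using t1.lpc t2.lpc by (simp add: locally_path_connected_space_prod_topology)

lemma pathin_fst: "pathin P w \<Longrightarrow> pathin T1 (\<lambda>t. fst (w t))"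
  using pathin_compose[OF _ continuous_map_fst] by (simp add: comp_def)

lemma pathin_snd: "pathin P w \<Longrightarrow> pathin T2 (\<lambda>t. snd (w t))"
  using pathin_compose[OF _ continuous_map_snd] by (simp add: comp_def)

lemma pathin_pair: "pathin T1 f \<Longrightarrow> pathin T2 g \<Longrightarrow> pathin P (\<lambda>t. (f t, g t))"
  unfolding pathin_def by (rule continuous_map_pairedI)

lemma dv_join:
  assumes "pathin P v" "pathin P w" "v 1 = w 0"
  shows "dv (path_join v w) = dv v + dv w"
proof -
  have 1: "(\<lambda>t. q1 (fst (path_join v w t))) = path_join (\<lambda>t. q1 (fst (v t))) (\<lambda>t. q1 (fst (w t)))"
    and 2: "(\<lambda>t. q2 (snd (path_join v w t))) = path_join (\<lambda>t. q2 (snd (v t))) (\<lambda>t. q2 (snd (w t)))"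
    by (auto simp: path_join_def)
  show ?thesis
    unfolding dv_def 1 2
    using path_value_join[OF t1.cocycle_z t1.pathin_proj[OF pathin_fst[OF assms(1)]] t1.pathin_proj[OF pathin_fst[OF assms(2)]]]
      path_value_join[OF t2.cocycle_z t2.pathin_proj[OF pathin_snd[OF assms(1)]] t2.pathin_proj[OF pathin_snd[OF assms(2)]]]
      assms(3) by simp
qed

lemma dv_reverse:
  assumes "pathin P w"
  shows "dv (\<lambda>t. w (1 - t)) = - dv w"
  unfolding dv_def
  using path_value_reverse[OF t1.cocycle_z t1.pathin_proj[OF pathin_fst[OF assms]]]
    path_value_reverse[OF t2.cocycle_z t2.pathin_proj[OF pathin_snd[OF assms]]] by simp

lemma dv_loop:
  assumes "pathin P w" "w 0 = w 1"
  shows "dv w = 0"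
  unfolding dv_def
  using t1.path_value_loop[OF pathin_fst[OF assms(1)]] t2.path_value_loop[OF pathin_snd[OF assms(1)]] assms(2) by simp

lemma dv_cong: "(\<And>t. t \<in> {0..1} \<Longrightarrow> c (v t) = c (w t)) \<Longrightarrow> dv v = dv w"
proof -
  assume *: "\<And>t. t \<in> {0..1} \<Longrightarrow> c (v t) = c (w t)"
  have "q1 (fst (v t)) = q1 (fst (w t)) \<and> q2 (snd (v t)) = q2 (snd (w t))" if "t \<in> {0..1}" for t
    using *[OF that] by (cases "v t"; cases "w t") simp
  hence "path_value z1 (\<lambda>t. q1 (fst (v t))) = path_value z1 (\<lambda>t. q1 (fst (w t)))"
    "path_value z2 (\<lambda>t. q2 (snd (v t))) = path_value z2 (\<lambda>t. q2 (snd (w t)))" by (auto intro!: path_value_cong)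
  thus ?thesis unfolding dv_def by simp
qed

lemma dv_ends:
  assumes "pathin P v" "pathin P w" "v 0 = w 0" "v 1 = w 1"
  shows "dv v = dv w"
proof -
  have w': "pathin P (\<lambda>t. w (1 - t))" by (rule pathin_reverse[OF assms(2)])
  have "dv (path_join v (\<lambda>t. w (1 - t))) = 0"
    by (rule dv_loop[OF pathin_path_join[OF assms(1) w']]) (use assms(3,4) in simp_all)
  thus ?thesis using dv_join[OF assms(1) w'] dv_reverse[OF assms(2)] assms(4) by simp
qed

text \<open>Replaces deck transformations by paths: a path from \<open>p\<close> to its image
  computes both homomorphisms. In the converse \<open>orb_memI\<close> the transformations come from
  \<open>deck_exists\<close>. Symmetry and transitivity of orbits then follow by reversing and
  joining paths.\<close>

lemma orb_memD:
  assumes p: "p \<in> topspace P" and p': "p' \<in> orb p"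
  shows "p' \<in> topspace P" "c p' = c p" "\<exists>w. pathin P w \<and> w 0 = p \<and> w 1 = p' \<and> dv w = 0"
proof -
  obtain x y where xy: "p = (x, y)" "x \<in> topspace T1" "y \<in> topspace T2" using p by auto
  define A where "A = connected_component_of_set X1 (q1 x)"
  define A' where "A' = connected_component_of_set X2 (q2 y)"
  have xA: "q1 x \<in> A" "q2 y \<in> A'"
    unfolding A_def A'_def using covering_map_in[OF t1.cov xy(2)] covering_map_in[OF t2.cov xy(3)]
    by (simp_all add: connected_component_of_refl)
  have A: "A \<in> connected_components_of X1" "A' \<in> connected_components_of X2"
    unfolding A_def A'_def connected_component_in_connected_components_of
    using covering_map_in[OF t1.cov xy(2)] covering_map_in[OF t2.cov xy(3)] by simp_all
  obtain g1 g2 where g: "p' = (g1 x, g2 y)" "(g1, g2) \<in> deck12 l1 T1 q1 A l2 T2 q2 A'"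
    using p' unfolding box_orbit_def xy(1) A_def A'_def by auto
  hence g12: "g1 \<in> deck_group T1 q1 A" "g2 \<in> deck_group T2 q2 A'"
    and h: "deck_hom l1 T1 q1 A g1 = deck_hom l2 T2 q2 A' g2"
    unfolding deck12_def by simp_all
  have 1: "g1 x \<in> topspace T1" "q1 (g1 x) = q1 x"
    using deck_group_in[OF g12(1) xy(2) xA(1)] by simp_all
  have 2: "g2 y \<in> topspace T2" "q2 (g2 y) = q2 y"
    using deck_group_in[OF g12(2) xy(3) xA(2)] by simp_all
  show "p' \<in> topspace P" "c p' = c p" using 1 2 by (simp_all add: g(1) xy(1))
  obtain u where u: "pathin T1 u" "u 0 = x" "u 1 = g1 x"
    using t1.path_component_fibre[OF xy(2) 1(1)] 1(2) unfolding path_component_of_def by auto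
  obtain v where v: "pathin T2 v" "v 0 = y" "v 1 = g2 y"
    using t2.path_component_fibre[OF xy(3) 2(1)] 2(2) unfolding path_component_of_def by auto
  have "deck_hom l1 T1 q1 A g1 = path_value z1 (\<lambda>t. q1 (u t))"
    by (rule t1.deck_hom_eq[OF A(1) g12(1) u(1)]) (simp_all add: u xA)
  moreover have "deck_hom l2 T2 q2 A' g2 = path_value z2 (\<lambda>t. q2 (v t))"
    by (rule t2.deck_hom_eq[OF A(2) g12(2) v(1)]) (simp_all add: v xA)
  ultimately show "\<exists>w. pathin P w \<and> w 0 = p \<and> w 1 = p' \<and> dv w = 0"
    using pathin_pair[OF u(1) v(1)] u v h by (intro exI[of _ "\<lambda>t. (u t, v t)"]) (simp add: dv_def g(1) xy(1))
qed

lemma orb_memI: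
  assumes w: "pathin P w" "c (w 0) = c (w 1)" "dv w = 0"
  shows "w 1 \<in> orb (w 0)"
proof -
  obtain x y where xy: "w 0 = (x, y)" by (cases "w 0")
  obtain x' y' where xy': "w 1 = (x', y')" by (cases "w 1")
  have t: "x \<in> topspace T1" "y \<in> topspace T2" "x' \<in> topspace T1" "y' \<in> topspace T2"
    using path_start_in_topspace[OF w(1)] path_finish_in_topspace[OF w(1)] by (simp_all add: xy xy')
  have q: "q1 x = q1 x'" "q2 y = q2 y'" using w(2) by (simp_all add: xy xy')
  define A where "A = connected_component_of_set X1 (q1 x)"
  define A' where "A' = connected_component_of_set X2 (q2 y)"
  have xA: "q1 x \<in> A" "q2 y \<in> A'"
    unfolding A_def A'_def using covering_map_in[OF t1.cov t(1)] covering_map_in[OF t2.cov t(2)]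
    by (simp_all add: connected_component_of_refl)
  have A: "A \<in> connected_components_of X1" "A' \<in> connected_components_of X2"
    unfolding A_def A'_def connected_component_in_connected_components_of
    using covering_map_in[OF t1.cov t(1)] covering_map_in[OF t2.cov t(2)] by simp_all
  obtain g1 where g1: "g1 \<in> deck_group T1 q1 A" "g1 x = x'"
    using t1.deck_exists[OF t(1,3) q(1) A(1)] by (elim exE conjE)
  obtain g2 where g2: "g2 \<in> deck_group T2 q2 A'" "g2 y = y'"
    using t2.deck_exists[OF t(2,4) q(2) A(2)] by (elim exE conjE)
  have "deck_hom l1 T1 q1 A g1 = path_value z1 (\<lambda>t. q1 (fst (w t)))"
    by (rule t1.deck_hom_eq[OF A(1) g1(1) pathin_fst[OF w(1)]]) (simp_all add: xy xy' xA g1)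
  moreover have "deck_hom l2 T2 q2 A' g2 = path_value z2 (\<lambda>t. q2 (snd (w t)))"
    by (rule t2.deck_hom_eq[OF A(2) g2(1) pathin_snd[OF w(1)]]) (simp_all add: xy xy' xA g2)
  ultimately have "(g1, g2) \<in> deck12 l1 T1 q1 A l2 T2 q2 A'"
    using g1(1) g2(1) w(3) by (simp add: deck12_def dv_def)
  thus ?thesis
    unfolding box_orbit_def xy xy' A_def A'_def using g1(2) g2(2) by auto
qed

lemma orb_self:
  assumes "p \<in> topspace P"
  shows "p \<in> orb p"
proof -
  have w: "pathin P (\<lambda>_. p)" using assms by simp
  show ?thesis using orb_memI[OF w] dv_loop[OF w] by simp
qed

lemma orb_sym:
  assumes "p \<in> topspace P" "p' \<in> orb p"
  shows "p \<in> orb p'"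
proof -
  obtain w where w: "pathin P w" "w 0 = p" "w 1 = p'" "dv w = 0"
    using orb_memD(3)[OF assms] by (elim exE conjE)
  have "(\<lambda>t. w (1 - t)) 1 \<in> orb ((\<lambda>t. w (1 - t)) 0)" by (rule orb_memI[OF pathin_reverse[OF w(1)]])
       (use w orb_memD(2)[OF assms] dv_reverse[OF w(1)] in simp_all)
  thus ?thesis using w by simp
qed

lemma orb_trans:
  assumes "p \<in> topspace P" "p' \<in> orb p" "p'' \<in> orb p'"
  shows "p'' \<in> orb p"
proof -
  note p' = orb_memD(1)[OF assms(1,2)]
  obtain w where w: "pathin P w" "w 0 = p" "w 1 = p'" "dv w = 0"
    using orb_memD(3)[OF assms(1,2)] by (elim exE conjE)
  obtain v where v: "pathin P v" "v 0 = p'" "v 1 = p''" "dv v = 0"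
    using orb_memD(3)[OF p' assms(3)] by (elim exE conjE)
  have e: "w 1 = v 0" by (simp add: w v)
  have "path_join w v 1 \<in> orb (path_join w v 0)" by (rule orb_memI[OF pathin_path_join[OF w(1) v(1) e]])
       (use w v orb_memD(2)[OF assms(1,2)] orb_memD(2)[OF p' assms(3)] dv_join[OF w(1) v(1) e] in simp_all)
  thus ?thesis using w v by simp
qed

lemma orb_eq_iff:
  assumes "p \<in> topspace P" "p' \<in> topspace P"
  shows "orb p = orb p' \<longleftrightarrow> p' \<in> orb p"
proof
  assume "orb p = orb p'"
  thus "p' \<in> orb p" using orb_self[OF assms(2)] by simp
next
  assume p': "p' \<in> orb p"
  show "orb p = orb p'"
  proof (intro equalityI subsetI)
    show "x \<in> orb p" if "x \<in> orb p'" for x by (rule orb_trans[OF assms(1) p' that])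
    show "x \<in> orb p'" if "x \<in> orb p" for x by (rule orb_trans[OF assms(2) orb_sym[OF assms(1) p'] that])
  qed
qed

text \<open>\<open>dv\<close> depends only on the ends of a path upstairs, so any single path
  between two points decides whether they are equivalent.\<close>

lemma orb_path_iff:
  assumes w: "pathin P w"
  shows "orb (w 0) = orb (w 1) \<longleftrightarrow> c (w 0) = c (w 1) \<and> dv w = 0"
proof
  note 0 = path_start_in_topspace[OF w] and 1 = path_finish_in_topspace[OF w]
  show "orb (w 0) = orb (w 1)" if "c (w 0) = c (w 1) \<and> dv w = 0"
    unfolding orb_eq_iff[OF 0 1] by (rule orb_memI[OF w conjunct1[OF that] conjunct2[OF that]])
  assume "orb (w 0) = orb (w 1)"
  hence m: "w 1 \<in> orb (w 0)" unfolding orb_eq_iff[OF 0 1] .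
  obtain v where v: "pathin P v" "v 0 = w 0" "v 1 = w 1" "dv v = 0"
    using orb_memD(3)[OF 0 m] by (elim exE conjE)
  thus "c (w 0) = c (w 1) \<and> dv w = 0"
    using orb_memD(2)[OF 0 m] dv_ends[OF w v(1)] by simp
qed

text \<open>Makes the choice of a representative in \<open>box_proj\<close> harmless.\<close>

lemma proj_orb:
  assumes "p \<in> topspace P"
  shows "r (orb p) = c p"
proof -
  have "(SOME y. y \<in> orb p) \<in> orb p" by (rule someI[of "\<lambda>y. y \<in> orb p"], rule orb_self[OF assms])
  thus ?thesis unfolding box_proj_def by (rule orb_memD(2)[OF assms])
qed

text \<open>Go back along \<open>v\<close>, across by a path with \<open>dv\<close> zero and forth
  along \<open>w\<close>: the contributions of \<open>v\<close> and \<open>w\<close> cancel because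
  they lie over the same path. This does the work of the action of \<open>deck12\<close> on lifted
  paths.\<close>

lemma orb_transport:
  assumes v: "pathin P v" and w: "pathin P w" and eq: "\<And>t. t \<in> {0..1} \<Longrightarrow> c (v t) = c (w t)"
    and o: "orb (v 0) = orb (w 0)"
  shows "orb (v 1) = orb (w 1)"
proof -
  note v0 = path_start_in_topspace[OF v] and w0 = path_start_in_topspace[OF w]
  have m: "w 0 \<in> orb (v 0)" using o unfolding orb_eq_iff[OF v0 w0] .
  obtain u where u: "pathin P u" "u 0 = v 0" "u 1 = w 0" "dv u = 0"
    using orb_memD(3)[OF v0 m] by (elim exE conjE)
  have e1: "v (1 - 1) = u 0" and e2: "path_join (\<lambda>t. v (1 - t)) u 1 = w 0" by (simp_all add: u)
  note p1 = pathin_path_join[OF pathin_reverse[OF v] u(1) e1]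
  note p2 = pathin_path_join[OF p1 w e2]
  have "dv (path_join (path_join (\<lambda>t. v (1 - t)) u) w) = 0"
    using dv_join[OF p1 w e2] dv_join[OF pathin_reverse[OF v] u(1) e1] dv_reverse[OF v] u(4) dv_cong[of v w, OF eq] by simp
  hence "orb (path_join (path_join (\<lambda>t. v (1 - t)) u) w 0) = orb (path_join (path_join (\<lambda>t. v (1 - t)) u) w 1)"
    unfolding orb_path_iff[OF p2] using eq[of 1] by simp
  thus ?thesis by simp
qed

text \<open>Sheets over a path connected set through equivalent points correspond: join
  \<open>p\<close> to \<open>u\<close> within its sheet and compare with the path over the same
  points in the sheet of \<open>v\<close>.\<close>

lemma sheet_transport:
  assumes V: "sheets P B c U V" and U: "path_connectedin B U"
    and p: "p \<in> topspace P" "c p \<in> U" and v: "v \<in> topspace P" "c v = c p" "orb p = orb v"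
    and u: "u \<in> V p" "u' \<in> V v" "c u = c u'"
  shows "orb u = orb u'"
proof -
  have vU: "c v \<in> U" using v(2) p(2) by simp
  obtain w where w: "pathin P w" "w \<in> {0..1} \<rightarrow> V p" "w 0 = p" "w 1 = u"
    using sheets_path_connectedin[OF V U p] sheets_self[OF V p] u(1) unfolding path_connectedin by blast
  have wU: "c (w t) \<in> U" if "t \<in> {0..1}" for t
    using w(2) that sheets_image[OF V p] by blast
  obtain s where s: "continuous_map (subtopology B U) P s" "\<forall>b\<in>U. s b \<in> V v \<and> c (s b) = b" "\<forall>y\<in>V v. s (c y) = y"
    using sheets_section_ex[OF V v(1) vU] by (elim exE conjE)
  have cw: "pathin (subtopology B U) (c \<circ> w)"
    unfolding pathin_subtopology using pathin_compose[OF w(1) covering_map_continuous[OF cov_c]] wU by simp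
  have sw: "pathin P (s \<circ> (c \<circ> w))" by (rule pathin_compose[OF cw s(1)])
  have "orb (w 1) = orb ((s \<circ> (c \<circ> w)) 1)"
  proof (rule orb_transport[OF w(1) sw])
    show "c (w t) = c ((s \<circ> (c \<circ> w)) t)" if "t \<in> {0..1}" for t using s(2) wU[OF that] by simp
    have "s (c v) = v" using s(3) sheets_self[OF V v(1) vU] by simp
    thus "orb (w 0) = orb ((s \<circ> (c \<circ> w)) 0)" using w(3) v(2,3) by simp
  qed
  moreover have "s (c u') = u'" using s(3) u(2) by simp
  ultimately show ?thesis using w(4) u(3) by simp
qed

section \<open>The orbit space as a covering of the product\<close>

lemma topspace_X: "topspace X = orb ` topspace P" by (rule topspace_quotient_topology)

lemma continuous_orb: "continuous_map P X orb" by (rule continuous_map_quotient_topology)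

lemma open_map_orb: "open_map P X orb"
  unfolding open_map_def
proof (intro allI impI)
  fix O' assume O': "openin P O'"
  hence OP: "O' \<subseteq> topspace P" by (rule openin_subset)
  show "openin X (orb ` O')"
    unfolding openin_quotient_topology
  proof (intro conjI)
    show "orb ` O' \<subseteq> orb ` topspace P" using OP by blast
    show "openin P {y \<in> topspace P. orb y \<in> orb ` O'}"
    proof (subst openin_subopen, rule ballI)
      fix p assume "p \<in> {y \<in> topspace P. orb y \<in> orb ` O'}"
      then obtain p' where p': "p \<in> topspace P" "p' \<in> O'" "orb p = orb p'" by (elim CollectE conjE imageE)
      note p = p'(1) subsetD[OF OP p'(2)] p'(2,3)
      have "p' \<in> orb p" using p(4) unfolding orb_eq_iff[OF p(1,2)] .
      hence cp: "c p' = c p" by (rule orb_memD(2)[OF p(1)])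
      have cB: "c p \<in> topspace B" by (rule covering_map_in[OF cov_c p(1)])
      obtain U V where U: "c p \<in> U" "path_connectedin B U" and V: "sheets P B c U V"
        by (rule covering_map_path_connected_sheets[OF cov_c lpc_B cB openin_topspace cB])
      have U': "c p' \<in> U" using U(1) cp by simp
      \<comment> \<open>\<open>W\<close> consists of the points in the sheet through
        \<open>p\<close> that lie over points of \<open>O'\<close> in the sheet through the
        equivalent point \<open>p'\<close>; by \<open>sheet_transport\<close> corresponding points
        are equivalent.\<close>
      define W where "W = V p \<inter> {v \<in> topspace P. c v \<in> c ` (O' \<inter> V p')}"
      have "openin B (c ` (O' \<inter> V p'))"
        using covering_map_open_map[OF cov_c] openin_Int[OF O' sheets_open[OF V p(2) U']] unfolding open_map_def by blast
      hence "openin P W"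
        unfolding W_def by (intro openin_Int sheets_open[OF V p(1) U(1)] openin_continuous_map_preimage[OF covering_map_continuous[OF cov_c]])
      moreover have "p \<in> W"
        unfolding W_def using sheets_self[OF V p(1) U(1)] sheets_self[OF V p(2) U'] p(1,3) cp
        by (intro IntI CollectI conjI image_eqI[of _ _ p']) simp_all
      moreover have "W \<subseteq> {y \<in> topspace P. orb y \<in> orb ` O'}"
      proof
        fix v assume v: "v \<in> W"
        hence "c v \<in> c ` (O' \<inter> V p')" unfolding W_def by simp
        then obtain v' where v': "v' \<in> O'" "v' \<in> V p'" "c v = c v'" by (elim imageE IntE)
        have "v \<in> V p" "v \<in> topspace P" using v unfolding W_def by blast+
        hence "orb v = orb v'" by (intro sheet_transport[OF V U(2) p(1) U(1) p(2) cp p(4) _ v'(2,3)])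
        thus "v \<in> {y \<in> topspace P. orb y \<in> orb ` O'}" using v'(1) \<open>v \<in> topspace P\<close> by blast
      qed
      ultimately show "\<exists>W. openin P W \<and> p \<in> W \<and> W \<subseteq> {y \<in> topspace P. orb y \<in> orb ` O'}"
        by (intro exI[of _ W] conjI)
    qed
  qed
qed

lemma continuous_r: "continuous_map X B r"
  unfolding continuous_map_def
proof (intro conjI allI impI)
  show "r \<in> topspace X \<rightarrow> topspace B"
    unfolding topspace_X using proj_orb covering_map_in[OF cov_c] by auto
  fix U assume U: "openin B U"
  show "openin X {x \<in> topspace X. r x \<in> U}"
    unfolding openin_quotient_topology topspace_X
  proof (intro conjI)
    have "{y \<in> topspace P. orb y \<in> {x \<in> orb ` topspace P. r x \<in> U}} = {y \<in> topspace P. c y \<in> U}"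
      by (rule Collect_cong, rule conj_cong[OF refl]) (simp only: mem_Collect_eq proj_orb imageI simp_thms)
    thus "openin P {y \<in> topspace P. orb y \<in> {x \<in> orb ` topspace P. r x \<in> U}}"
      using openin_continuous_map_preimage[OF covering_map_continuous[OF cov_c] U] by simp
  qed blast
qed

lemma open_map_r:
  assumes W: "openin X W"
  shows "openin B (r ` W)"
proof -
  have o: "openin P {y \<in> topspace P. orb y \<in> W}" and s: "W \<subseteq> orb ` topspace P"
    using W unfolding openin_quotient_topology by simp_all
  have "r ` W = c ` {y \<in> topspace P. orb y \<in> W}"
  proof (intro equalityI subsetI)
    fix b assume "b \<in> r ` W"
    then obtain x where x: "x \<in> W" "b = r x" by (elim imageE)
    then obtain y where y: "y \<in> topspace P" "x = orb y" using s by blast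
    have "b = c y" using x(2) y proj_orb[OF y(1)] by simp
    thus "b \<in> c ` {y \<in> topspace P. orb y \<in> W}" using x(1) y by simp
  next
    fix b assume "b \<in> c ` {y \<in> topspace P. orb y \<in> W}"
    then obtain y where y: "y \<in> topspace P" "orb y \<in> W" "b = c y" by (elim imageE CollectE conjE)
    hence "b = r (orb y)" using proj_orb[of y] by simp
    thus "b \<in> r ` W" using y(2) by (rule image_eqI)
  qed
  thus ?thesis using covering_map_open_map[OF cov_c] o unfolding open_map_def by simp
qed

text \<open>The sheets of \<open>X\<close> are the images of sheets of \<open>P\<close>. On such an
  image \<open>r\<close> is injective because \<open>c\<close> is injective on the sheet, and
  equivalent representatives give the same image by \<open>sheet_transport\<close>.\<close>

lemma cov_r: "covering_map X B r"
  unfolding covering_map_sheets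
proof (intro conjI ballI continuous_r)
  have "r ` orb ` topspace P = c ` topspace P"
    unfolding image_image using proj_orb by (intro image_cong refl) simp
  thus "r ` topspace X = topspace B"
    unfolding topspace_X using covering_map_surj[OF cov_c] by simp
  fix b assume b: "b \<in> topspace B"
  obtain U V where U: "b \<in> U" "path_connectedin B U" and V: "sheets P B c U V"
    by (rule covering_map_path_connected_sheets[OF cov_c lpc_B b openin_topspace b])
  define rep where "rep x = (SOME p. p \<in> topspace P \<and> orb p = x)" for x
  have rep: "rep x \<in> topspace P \<and> orb (rep x) = x" if x: "x \<in> topspace X" for x
  proof -
    have "\<exists>p. p \<in> topspace P \<and> orb p = x" using x unfolding topspace_X by blast
    thus ?thesis unfolding rep_def by (rule someI_ex)
  qed
  have "sheets X B r U (\<lambda>x. orb ` V (rep x))"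
    unfolding sheets_def
  proof (intro conjI ballI impI sheets_open_base[OF V])
    fix x assume x: "x \<in> topspace X" "r x \<in> U"
    define p where "p = rep x"
    have p: "p \<in> topspace P" "orb p = x" unfolding p_def using rep[OF x(1)] by simp_all
    have cp: "c p \<in> U" using proj_orb[OF p(1)] p(2) x(2) by simp
    have Vsub: "V p \<subseteq> topspace P" using sheets_open[OF V p(1) cp] by (rule openin_subset)
    show "x \<in> orb ` V (rep x)"
      using sheets_self[OF V p(1) cp] p(2) unfolding p_def by (intro image_eqI) simp_all
    have oV: "openin X (orb ` V p)"
      using open_map_orb sheets_open[OF V p(1) cp] unfolding open_map_def by blast
    thus "openin X (orb ` V (rep x))" unfolding p_def .
    have rorb: "r (orb v) = c v" if "v \<in> V p" for v using proj_orb that Vsub by blast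
    have oVX: "topspace (subtopology X (orb ` V p)) = orb ` V p"
      using openin_subset[OF oV] by (simp add: Int_absorb1)
    have UB: "topspace (subtopology B U) = U"
      using openin_subset[OF sheets_open_base[OF V]] by (simp only: topspace_subtopology_subset)
    have rV: "r ` orb ` V p = U"
    proof -
      have "r ` orb ` V p = c ` V p" unfolding image_image by (rule image_cong[OF refl rorb])
      thus ?thesis using sheets_image[OF V p(1) cp] by simp
    qed
    show "homeomorphic_map (subtopology X (orb ` V (rep x))) (subtopology B U) r"
      unfolding p_def[symmetric]
    proof (rule bijective_open_imp_homeomorphic_map)
      show "continuous_map (subtopology X (orb ` V p)) (subtopology B U) r"
        using rV by (intro continuous_map_into_subtopology continuous_map_from_subtopology continuous_r) (auto simp: oVX)
      show "open_map (subtopology X (orb ` V p)) (subtopology B U) r"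
        unfolding open_map_def
      proof (intro allI impI)
        fix W assume W: "openin (subtopology X (orb ` V p)) W"
        have "openin B (r ` W)" by (rule open_map_r[OF openin_trans_full[OF W oV]])
        moreover have "r ` W \<subseteq> U" using openin_subset[OF W] rV unfolding oVX by blast
        ultimately show "openin (subtopology B U) (r ` W)"
          using sheets_open_base[OF V] by (simp add: openin_open_subtopology)
      qed
      show "r ` topspace (subtopology X (orb ` V p)) = topspace (subtopology B U)"
        unfolding oVX UB by (rule rV)
      show "inj_on r (topspace (subtopology X (orb ` V p)))"
        unfolding oVX
      proof (rule inj_onI)
        fix a a' assume "a \<in> orb ` V p" "a' \<in> orb ` V p" and e: "r a = r a'"
        then obtain v v' where v: "v \<in> V p" "a = orb v" "v' \<in> V p" "a' = orb v'" by blast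
        have "c v = c v'" using e rorb[OF v(1)] rorb[OF v(3)] v(2,4) by simp
        hence "v = v'" by (rule sheets_inj[OF V p(1) cp v(1,3)])
        thus "a = a'" using v(2,4) by simp
      qed
    qed
    fix x' assume "x' \<in> orb ` V (rep x)"
    then obtain v where v: "v \<in> V p" "x' = orb v" unfolding p_def by blast
    have vP: "v \<in> topspace P" using v(1) Vsub by blast
    have x'X: "x' \<in> topspace X" unfolding topspace_X v(2) using vP by (rule imageI)
    define p' where "p' = rep x'"
    have p': "p' \<in> topspace P" "orb p' = orb v" unfolding p'_def using rep[OF x'X] v(2) by simp_all
    have cv: "c v \<in> U" using imageI[OF v(1), of c] sheets_image[OF V p(1) cp] by simp
    have "v \<in> orb p'" using p'(2) orb_eq_iff[OF p'(1) vP] by simp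
    hence cp': "c v = c p'" by (rule orb_memD(2)[OF p'(1)])
    have cp'U: "c p' \<in> U" using cv cp' by simp
    have Vv: "V v = V p" by (rule sheets_eq[OF V p(1) cp v(1)])
    have ex: "\<exists>u'\<in>V y. c u' = c u" if "y \<in> topspace P" "c y \<in> U" "y' \<in> topspace P" "c y' \<in> U" "u \<in> V y'" for y y' u
    proof -
      have "c u \<in> U" using imageI[OF that(5), of c] sheets_image[OF V that(3,4)] by simp
      hence "c u \<in> c ` V y" using sheets_image[OF V that(1,2)] by simp
      thus ?thesis by (metis imageE)
    qed
    have "orb ` V p' = orb ` V v"
    proof (intro equalityI subsetI)
      fix a assume "a \<in> orb ` V p'"
      then obtain u where u: "u \<in> V p'" "a = orb u" by blast
      obtain u' where u': "u' \<in> V v" "c u' = c u" using ex[OF vP cv p'(1) cp'U u(1)] by (elim bexE)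
      have "orb u = orb u'" by (rule sheet_transport[OF V U(2) p'(1) cp'U vP cp' p'(2) u(1) u'(1) u'(2)[symmetric]])
      thus "a \<in> orb ` V v" using u(2) u'(1) by blast
    next
      fix a assume "a \<in> orb ` V v"
      then obtain u where u: "u \<in> V v" "a = orb u" by blast
      obtain u' where u': "u' \<in> V p'" "c u' = c u" using ex[OF p'(1) cp'U vP cv u(1)] by (elim bexE)
      have "orb u = orb u'" by (rule sheet_transport[OF V U(2) vP cv p'(1) cp'[symmetric] p'(2)[symmetric] u(1) u'(1) u'(2)[symmetric]])
      thus "a \<in> orb ` V p'" using u(2) u'(1) by blast
    qed
    thus "orb ` V (rep x') = orb ` V (rep x)" unfolding p_def[symmetric] p'_def[symmetric] Vv .
  qed
  thus "\<exists>U V. b \<in> U \<and> sheets X B r U V"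
    using U(1) by (intro exI conjI)
qed

lemma conn_r:
  assumes "C \<in> connected_components_of B"
  shows "connectedin X {x \<in> topspace X. r x \<in> C}"
proof -
  obtain A A' where A: "A \<in> connected_components_of X1" "A' \<in> connected_components_of X2" "C = A \<times> A'"
    using assms unfolding connected_components_of_prod_topology by blast
  let ?Q = "{y \<in> topspace T1. q1 y \<in> A} \<times> {y \<in> topspace T2. q2 y \<in> A'}"
  have "connectedin P ?Q"
    unfolding connectedin_Times using t1.conn[OF A(1)] t2.conn[OF A(2)] by simp
  hence "connectedin X (orb ` ?Q)" by (rule connectedin_continuous_map_image[OF continuous_orb])
  moreover have "orb ` ?Q = {x \<in> topspace X. r x \<in> C}"
  proof (intro equalityI subsetI)
    fix x assume "x \<in> orb ` ?Q"
    then obtain p where p: "p \<in> ?Q" "x = orb p" by blast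
    hence "p \<in> topspace P" "c p \<in> C" unfolding A(3) by auto
    thus "x \<in> {x \<in> topspace X. r x \<in> C}" unfolding topspace_X p(2) using proj_orb[of p] by simp
  next
    fix x assume "x \<in> {x \<in> topspace X. r x \<in> C}"
    then obtain p where p: "p \<in> topspace P" "x = orb p" "r x \<in> C" unfolding topspace_X by blast
    hence "c p \<in> C" using proj_orb[OF p(1)] by simp
    hence "p \<in> ?Q" using p(1) unfolding A(3) by (cases p) simp
    thus "x \<in> orb ` ?Q" unfolding p(2) by (rule imageI)
  qed
  ultimately show ?thesis by simp
qed

text \<open>A path in \<open>X\<close> is the image of a path in \<open>P\<close>, found by lifting
  its projection. Closedness in \<open>X\<close> is then equality of two orbits, which
  \<open>orb_path_iff\<close> decides.\<close>

lemma box_covering: "box_covering X1 z1 X2 z2 X r"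
  unfolding box_covering_def
proof (intro conjI ballI allI impI cov_r conn_r)
  fix v assume v: "pathin X v"
  have "v 0 \<in> orb ` topspace P" using path_start_in_topspace[OF v] unfolding topspace_X .
  then obtain p where p: "p \<in> topspace P" "v 0 = orb p" by blast
  obtain w where w: "pathin P w" "w 0 = p" "\<And>t. t \<in> {0..1} \<Longrightarrow> c (w t) = (r \<circ> v) t"
    by (rule path_lift[OF cov_c pathin_compose[OF v continuous_r] p(1)]) (use p proj_orb in auto)
  have ov: "(orb \<circ> w) t = v t" if t: "t \<in> {0..1}" for t
  proof (rule path_lift_unique[OF cov_r pathin_compose[OF w(1) continuous_orb] v, of 0 t])
    show "r ((orb \<circ> w) t) = r (v t)" if "t \<in> {0..1}" for t
      using proj_orb[OF pathin_subset[OF w(1) that]] w(3)[OF that] by simp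
  qed (use t w(2) p(2) in simp_all)
  have f: "fst (r (v t)) = q1 (fst (w t)) \<and> snd (r (v t)) = q2 (snd (w t))" if "t \<in> {0..1}" for t
    using w(3)[OF that] by (metis comp_apply fst_map_prod snd_map_prod)
  have d: "dv w = path_value z1 (\<lambda>t. fst (r (v t))) - path_value z2 (\<lambda>t. snd (r (v t)))"
  proof -
    have "path_value z1 (\<lambda>t. fst (r (v t))) = path_value z1 (\<lambda>t. q1 (fst (w t)))"
      "path_value z2 (\<lambda>t. snd (r (v t))) = path_value z2 (\<lambda>t. q2 (snd (w t)))"
      by (auto intro!: path_value_cong simp: f)
    thus ?thesis unfolding dv_def by simp
  qed
  have "v 0 = v 1 \<longleftrightarrow> orb (w 0) = orb (w 1)" using ov[of 0] ov[of 1] by simp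
  also have "\<dots> \<longleftrightarrow> c (w 0) = c (w 1) \<and> dv w = 0" by (rule orb_path_iff[OF w(1)])
  also have "c (w 0) = c (w 1) \<longleftrightarrow> r (v 0) = r (v 1)" using w(3)[of 0] w(3)[of 1] by simp
  finally show "v 0 = v 1 \<longleftrightarrow> r (v 0) = r (v 1) \<and>
      path_value z1 (\<lambda>t. fst (r (v t))) = path_value z2 (\<lambda>t. snd (r (v t)))"
    unfolding d by simp
qed

end

section \<open>Smooth functions\<close>

lemma Ck_on_subset: "Ck_on k V U f \<Longrightarrow> U' \<subseteq> U \<Longrightarrow> Ck_on k V U' f"
proof (induction k arbitrary: f)
  case 0
  thus ?case unfolding Ck_on.simps by (rule continuous_on_subset)
next
  case (Suc k)
  show ?case
    unfolding Ck_on.simps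
  proof (intro conjI ballI)
    have "continuous_on U f" using Suc.prems(1) by simp
    thus "continuous_on U' f" using Suc.prems(2) by (rule continuous_on_subset)
    fix v assume "v \<in> V"
    then obtain g where g: "\<forall>x\<in>U. ((\<lambda>s. f (x + s *\<^sub>R v)) has_vector_derivative g x) (at 0 within {s. x + s *\<^sub>R v \<in> U})" "Ck_on k V U g"
      using Suc.prems(1) unfolding Ck_on.simps by (elim conjE) (drule (1) bspec, elim exE conjE)
    show "\<exists>g. (\<forall>x\<in>U'. ((\<lambda>s. f (x + s *\<^sub>R v)) has_vector_derivative g x) (at 0 within {s. x + s *\<^sub>R v \<in> U'})) \<and> Ck_on k V U' g"
    proof (intro exI[of _ g] conjI ballI)
      fix x assume "x \<in> U'"
      thus "((\<lambda>s. f (x + s *\<^sub>R v)) has_vector_derivative g x) (at 0 within {s. x + s *\<^sub>R v \<in> U'})"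
        using g(1) Suc.prems(2) by (rule_tac has_vector_derivative_within_subset[where S = "{s. x + s *\<^sub>R v \<in> U}"]) blast+
    qed (rule Suc.IH[OF g(2) Suc.prems(2)])
  qed
qed

text \<open>No induction on \<open>k\<close>: the derivatives of \<open>f\<close> serve for
  \<open>g\<close> as well.\<close>

lemma Ck_on_cong: "Ck_on k V U f \<Longrightarrow> (\<And>x. x \<in> U \<Longrightarrow> f x = g x) \<Longrightarrow> Ck_on k V U g"
proof (cases k)
  case 0
  assume "Ck_on k V U f" "\<And>x. x \<in> U \<Longrightarrow> f x = g x"
  thus ?thesis using 0 by (simp cong: continuous_on_cong)
next
  case (Suc n)
  assume f: "Ck_on k V U f" and eq: "\<And>x. x \<in> U \<Longrightarrow> f x = g x"
  show ?thesis
    unfolding Suc Ck_on.simps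
  proof (intro conjI ballI)
    have "continuous_on U f" using f unfolding Suc by simp
    thus "continuous_on U g" using eq by (simp cong: continuous_on_cong)
    fix v assume "v \<in> V"
    then obtain h where h: "\<forall>x\<in>U. ((\<lambda>s. f (x + s *\<^sub>R v)) has_vector_derivative h x) (at 0 within {s. x + s *\<^sub>R v \<in> U})" "Ck_on n V U h"
      using f unfolding Suc Ck_on.simps by (elim conjE) (drule (1) bspec, elim exE conjE)
    show "\<exists>h. (\<forall>x\<in>U. ((\<lambda>s. g (x + s *\<^sub>R v)) has_vector_derivative h x) (at 0 within {s. x + s *\<^sub>R v \<in> U})) \<and> Ck_on n V U h"
    proof (intro exI[of _ h] conjI ballI h(2))
      fix x assume x: "x \<in> U"
      show "((\<lambda>s. g (x + s *\<^sub>R v)) has_vector_derivative h x) (at 0 within {s. x + s *\<^sub>R v \<in> U})"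
        by (rule has_vector_derivative_transform[OF _ _ bspec[OF h(1) x]]) (use x eq in auto)
    qed
  qed
qed

text \<open>Linear substitutions are what products and families call for, since their coordinate
  expressions are composed with projections.\<close>

lemma Ck_on_linear:
  assumes L: "bounded_linear L" and V: "L ` V' \<subseteq> V"
  shows "Ck_on k V U f \<Longrightarrow> L ` U' \<subseteq> U \<Longrightarrow> Ck_on k V' U' (\<lambda>x. f (L x))"
proof (induction k arbitrary: f)
  case 0
  have "continuous_on U f" using 0(1) by simp
  thus ?case
    unfolding Ck_on.simps by (rule continuous_on_compose2[OF _ linear_continuous_on[OF L] 0(2)])
next
  case (Suc k)
  show ?case
    unfolding Ck_on.simps
  proof (intro conjI ballI)
    have "continuous_on U f" using Suc.prems by simp
    thus "continuous_on U' (\<lambda>x. f (L x))"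
      by (rule continuous_on_compose2[OF _ linear_continuous_on[OF L] Suc.prems(2)])
    fix v assume "v \<in> V'"
    hence "L v \<in> V" using V by blast
    then obtain g where g: "\<forall>x\<in>U. ((\<lambda>s. f (x + s *\<^sub>R L v)) has_vector_derivative g x) (at 0 within {s. x + s *\<^sub>R L v \<in> U})" "Ck_on k V U g"
      using Suc.prems(1) unfolding Ck_on.simps by (elim conjE) (drule (1) bspec, elim exE conjE)
    have Lx: "L (x + s *\<^sub>R v) = L x + s *\<^sub>R L v" for x s
      using bounded_linear.linear[OF L] by (simp add: linear_add linear_scale)
    show "\<exists>g. (\<forall>x\<in>U'. ((\<lambda>s. f (L (x + s *\<^sub>R v))) has_vector_derivative g x) (at 0 within {s. x + s *\<^sub>R v \<in> U'})) \<and> Ck_on k V' U' g"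
    proof (intro exI[of _ "\<lambda>x. g (L x)"] conjI ballI)
      fix x assume x: "x \<in> U'"
      have "{s. x + s *\<^sub>R v \<in> U'} \<subseteq> {s. L x + s *\<^sub>R L v \<in> U}"
      proof
        fix s assume "s \<in> {s. x + s *\<^sub>R v \<in> U'}"
        hence "L (x + s *\<^sub>R v) \<in> U" using Suc.prems(2) by blast
        thus "s \<in> {s. L x + s *\<^sub>R L v \<in> U}" unfolding Lx by simp
      qed
      moreover have "L x \<in> U" using x Suc.prems(2) by blast
      ultimately show "((\<lambda>s. f (L (x + s *\<^sub>R v))) has_vector_derivative g (L x)) (at 0 within {s. x + s *\<^sub>R v \<in> U'})"
        unfolding Lx using g(1) by (rule_tac has_vector_derivative_within_subset[where S = "{s. L x + s *\<^sub>R L v \<in> U}"]) blast+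
    qed (rule Suc.IH[OF g(2) Suc.prems(2)])
  qed
qed

lemma Ck_on_Pair: "Ck_on k V U f \<Longrightarrow> Ck_on k V U g \<Longrightarrow> Ck_on k V U (\<lambda>x. (f x, g x))"
proof (induction k arbitrary: f g)
  case 0
  thus ?case by (simp add: continuous_on_Pair)
next
  case (Suc k)
  show ?case
    unfolding Ck_on.simps
  proof (intro conjI ballI)
    show "continuous_on U (\<lambda>x. (f x, g x))" using Suc.prems by (simp add: continuous_on_Pair)
    fix v assume v: "v \<in> V"
    obtain f' where f': "\<forall>x\<in>U. ((\<lambda>s. f (x + s *\<^sub>R v)) has_vector_derivative f' x) (at 0 within {s. x + s *\<^sub>R v \<in> U})" "Ck_on k V U f'"
      using Suc.prems(1) v unfolding Ck_on.simps by (elim conjE) (drule (1) bspec, elim exE conjE)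
    obtain g' where g': "\<forall>x\<in>U. ((\<lambda>s. g (x + s *\<^sub>R v)) has_vector_derivative g' x) (at 0 within {s. x + s *\<^sub>R v \<in> U})" "Ck_on k V U g'"
      using Suc.prems(2) v unfolding Ck_on.simps by (elim conjE) (drule (1) bspec, elim exE conjE)
    show "\<exists>h. (\<forall>x\<in>U. ((\<lambda>s. (f (x + s *\<^sub>R v), g (x + s *\<^sub>R v))) has_vector_derivative h x) (at 0 within {s. x + s *\<^sub>R v \<in> U})) \<and> Ck_on k V U h"
      using f'(1) g'(1) by (intro exI[of _ "\<lambda>x. (f' x, g' x)"] conjI ballI has_vector_derivative_Pair Suc.IH[OF f'(2) g'(2)]) simp_all
  qed
qed

text \<open>In an open subset of the subspace \<open>V\<close> the one-sided derivatives are ordinary ones.\<close>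

lemma open_direction:
  fixes V :: "'e::real_normed_vector set"
  assumes V: "subspace V" and U: "openin (top_of_set V) U" and x: "x \<in> U" and v: "v \<in> V"
  shows "open {s. x + s *\<^sub>R v \<in> U}" "0 \<in> {s. x + s *\<^sub>R v \<in> U}"
proof -
  obtain S where S: "open S" "U = V \<inter> S" using U by (auto simp: openin_open)
  have "x + s *\<^sub>R v \<in> V" for s
    using x S(2) v V by (simp add: subspace_add subspace_scale)
  hence "{s. x + s *\<^sub>R v \<in> U} = (\<lambda>s. x + s *\<^sub>R v) -` S" using S(2) by auto
  moreover have "open ((\<lambda>s. x + s *\<^sub>R v) -` S)" by (rule open_vimage[OF S(1)]) (intro continuous_intros)
  ultimately show "open {s. x + s *\<^sub>R v \<in> U}" by simp
qed (use x in simp)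

lemma Ck_on_direction:
  fixes V :: "'e::real_normed_vector set"
  assumes V: "subspace V" and U: "openin (top_of_set V) U" and f: "Ck_on (Suc k) V U f" and v: "v \<in> V"
  shows "\<exists>g. (\<forall>x\<in>U. ((\<lambda>s. f (x + s *\<^sub>R v)) has_vector_derivative g x) (at 0)) \<and> Ck_on k V U g"
proof -
  obtain g where g: "\<forall>x\<in>U. ((\<lambda>s. f (x + s *\<^sub>R v)) has_vector_derivative g x) (at 0 within {s. x + s *\<^sub>R v \<in> U})" "Ck_on k V U g"
    using f v unfolding Ck_on.simps by (elim conjE) (drule (1) bspec, elim exE conjE)
  have "((\<lambda>s. f (x + s *\<^sub>R v)) has_vector_derivative g x) (at 0)" if x: "x \<in> U" for x
    using bspec[OF g(1) x] at_within_open[OF open_direction(2,1)[OF V U x v]] by simp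
  thus ?thesis using g(2) by (intro exI[of _ g]) simp
qed

lemma continuous_on_openin_local:
  fixes f :: "'e::real_normed_vector \<Rightarrow> 'f::real_normed_vector"
  assumes U: "openin (top_of_set V) U"
    and loc: "\<And>x. x \<in> U \<Longrightarrow> \<exists>W. openin (top_of_set V) W \<and> x \<in> W \<and> W \<subseteq> U \<and> continuous_on W f"
  shows "continuous_on U f"
  unfolding continuous_on_eq_continuous_within
proof (rule ballI)
  fix x assume x: "x \<in> U"
  obtain W where W: "openin (top_of_set V) W" "x \<in> W" "W \<subseteq> U" "continuous_on W f" using loc[OF x] by (elim exE conjE)
  obtain S where S: "open S" "W = V \<inter> S" using W(1) by (auto simp: openin_open)
  have UV: "U \<subseteq> V" using openin_imp_subset[OF U] .
  have "continuous (at x within W) f" using W(2,4) by (simp add: continuous_on_eq_continuous_within)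
  moreover have "at x within W = at x within U" by (rule at_within_nhd[of x S]) (use S W(2,3) UV in auto)
  ultimately show "continuous (at x within U) f" by simp
qed

lemma Ck_on_local:
  fixes V :: "'e::real_normed_vector set"
  assumes V: "subspace V" and U: "openin (top_of_set V) U"
  shows "(\<And>x. x \<in> U \<Longrightarrow> \<exists>W. openin (top_of_set V) W \<and> x \<in> W \<and> W \<subseteq> U \<and> Ck_on k V W f) \<Longrightarrow> Ck_on k V U f"
proof (induction k arbitrary: f)
  case 0
  show ?case
    unfolding Ck_on.simps by (rule continuous_on_openin_local[OF U]) (use 0 in simp)
next
    case (Suc k)
    show ?case
      unfolding Ck_on.simps
    proof (intro conjI ballI)
      show "continuous_on U f"
      proof (rule continuous_on_openin_local[OF U])
        fix x assume "x \<in> U"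
        from Suc.prems[OF this] show "\<exists>W. openin (top_of_set V) W \<and> x \<in> W \<and> W \<subseteq> U \<and> continuous_on W f"
          unfolding Ck_on.simps by (elim exE conjE) (intro exI conjI)
      qed
      fix v assume v: "v \<in> V"
      \<comment> \<open>Derivatives at points of a relatively open set are unique, so the local
        derivatives are restrictions of this one function.\<close>
      define g where "g x = vector_derivative (\<lambda>s. f (x + s *\<^sub>R v)) (at 0)" for x
      have W: "\<exists>W. openin (top_of_set V) W \<and> x \<in> W \<and> W \<subseteq> U \<and> Ck_on k V W g \<and>
          ((\<lambda>s. f (x + s *\<^sub>R v)) has_vector_derivative g x) (at 0)" if x: "x \<in> U" for x
      proof -
        obtain W where W: "openin (top_of_set V) W" "x \<in> W" "W \<subseteq> U" "Ck_on (Suc k) V W f"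
          using Suc.prems[OF x] by (elim exE conjE)
        obtain h where h: "\<forall>x\<in>W. ((\<lambda>s. f (x + s *\<^sub>R v)) has_vector_derivative h x) (at 0)" "Ck_on k V W h"
          using Ck_on_direction[OF V W(1,4) v] by (elim exE conjE)
        have hg: "h y = g y" if "y \<in> W" for y
          unfolding g_def using vector_derivative_at[OF bspec[OF h(1) that]] by simp
        have "Ck_on k V W g" by (rule Ck_on_cong[OF h(2) hg])
        thus ?thesis using W(1-3) bspec[OF h(1) W(2)] hg[OF W(2)] by (intro exI[of _ W]) simp
      qed
      show "\<exists>g. (\<forall>x\<in>U. ((\<lambda>s. f (x + s *\<^sub>R v)) has_vector_derivative g x) (at 0 within {s. x + s *\<^sub>R v \<in> U})) \<and> Ck_on k V U g"
      proof (intro exI[of _ g] conjI ballI)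
        show "Ck_on k V U g"
        proof (rule Suc.IH)
          fix x assume x: "x \<in> U"
          show "\<exists>W. openin (top_of_set V) W \<and> x \<in> W \<and> W \<subseteq> U \<and> Ck_on k V W g"
            using W[OF x] by (elim exE conjE) (intro exI conjI)
        qed
        fix x assume x: "x \<in> U"
        have "((\<lambda>s. f (x + s *\<^sub>R v)) has_vector_derivative g x) (at 0)"
          using W[OF x] by (elim exE conjE)
        thus "((\<lambda>s. f (x + s *\<^sub>R v)) has_vector_derivative g x) (at 0 within {s. x + s *\<^sub>R v \<in> U})"
          by (rule has_vector_derivative_at_within)
      qed
    qed
qed

lemma smooth_on_subset: "smooth_on V U f \<Longrightarrow> U' \<subseteq> U \<Longrightarrow> smooth_on V U' f"
  unfolding smooth_on_def using Ck_on_subset[of _ V U f U'] by simp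

lemma smooth_on_cong: "smooth_on V U f \<Longrightarrow> (\<And>x. x \<in> U \<Longrightarrow> f x = g x) \<Longrightarrow> smooth_on V U g"
  unfolding smooth_on_def using Ck_on_cong[of _ V U f g] by simp

lemma smooth_on_linear:
  "bounded_linear L \<Longrightarrow> L ` V' \<subseteq> V \<Longrightarrow> smooth_on V U f \<Longrightarrow> L ` U' \<subseteq> U \<Longrightarrow> smooth_on V' U' (\<lambda>x. f (L x))"
  unfolding smooth_on_def using Ck_on_linear[of L V' V _ U f U'] by simp

lemma smooth_on_Pair: "smooth_on V U f \<Longrightarrow> smooth_on V U g \<Longrightarrow> smooth_on V U (\<lambda>x. (f x, g x))"
  unfolding smooth_on_def using Ck_on_Pair[of _ V U f g] by simp

lemma smooth_on_local:
  fixes V :: "'e::real_normed_vector set"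
  assumes V: "subspace V" and U: "openin (top_of_set V) U"
    and W: "\<And>x. x \<in> U \<Longrightarrow> \<exists>W. openin (top_of_set V) W \<and> x \<in> W \<and> W \<subseteq> U \<and> smooth_on V W f"
  shows "smooth_on V U f"
  unfolding smooth_on_def
proof
  fix k show "Ck_on k V U f"
  proof (rule Ck_on_local[OF V U])
    fix x assume "x \<in> U"
    from W[OF this] show "\<exists>W. openin (top_of_set V) W \<and> x \<in> W \<and> W \<subseteq> U \<and> Ck_on k V W f"
      unfolding smooth_on_def by (elim exE conjE) (intro exI conjI, assumption+, erule spec)
  qed
qed

lemma smooth_on_fst: "smooth_on V U f \<Longrightarrow> smooth_on (V \<times> V') (U \<times> U') (\<lambda>x. f (fst x))"
  by (rule smooth_on_linear[OF bounded_linear_fst]) auto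

lemma smooth_on_snd: "smooth_on V' U' f \<Longrightarrow> smooth_on (V \<times> V') (U \<times> U') (\<lambda>x. f (snd x))"
  by (rule smooth_on_linear[OF bounded_linear_snd]) auto

lemma smooth_on_map_prod:
  assumes "smooth_on V U f" "smooth_on V' U' g"
  shows "smooth_on (V \<times> V') (U \<times> U') (map_prod f g)"
  using smooth_on_Pair[OF smooth_on_fst[OF assms(1)] smooth_on_snd[OF assms(2)]]
  by (simp add: map_prod_def case_prod_unfold)

text \<open>Continuous directional derivatives give a Frechet derivative: telescope the increment over an
  orthonormal basis of \<open>V\<close>.\<close>

lemma Ck_on_has_derivative:
  fixes f :: "'e::euclidean_space \<Rightarrow> 'f::real_normed_vector"
  assumes V: "subspace V" and U: "openin (top_of_set V) U" and f: "Ck_on 1 V U f" and x: "x \<in> U"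
  shows "\<exists>D. linear D \<and> (f has_derivative D) (at x within U)"
proof -
  obtain B where B: "B \<subseteq> V" "pairwise orthogonal B" "\<And>b. b \<in> B \<Longrightarrow> norm b = 1" "independent B" "card B = dim V" "span B = V"
    by (rule orthonormal_basis_subspace[OF V]) blast
  have fB: "finite B" using B(4) by (rule independent_imp_finite)
  have "\<forall>b\<in>B. \<exists>g. (\<forall>x\<in>U. ((\<lambda>s. f (x + s *\<^sub>R b)) has_vector_derivative g x) (at 0)) \<and> Ck_on 0 V U g"
    by (intro ballI Ck_on_direction[OF V U f[unfolded One_nat_def]]) (use B(1) in blast)
  from bchoice[OF this] obtain g where
    "\<forall>b\<in>B. (\<forall>x\<in>U. ((\<lambda>s. f (x + s *\<^sub>R b)) has_vector_derivative g b x) (at 0)) \<and> Ck_on 0 V U (g b)" by (elim exE)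
  hence g: "\<And>b x. b \<in> B \<Longrightarrow> x \<in> U \<Longrightarrow> ((\<lambda>s. f (x + s *\<^sub>R b)) has_vector_derivative g b x) (at 0)"
    "\<And>b. b \<in> B \<Longrightarrow> continuous_on U (g b)" unfolding Ck_on.simps by blast+
  define D where "D h = (\<Sum>b\<in>B. (h \<bullet> b) *\<^sub>R g b x)" for h
  have lD: "linear D"
    by (rule linearI) (simp_all add: D_def inner_add_left scaleR_add_left sum.distrib scaleR_sum_right)
  obtain S where S: "open S" "U = V \<inter> S" using U by (auto simp: openin_open)
  define n where "n = real (card B)"
  have n0: "0 \<le> n" by (simp add: n_def)
  have est: "\<exists>d>0. \<forall>h. h \<in> V \<and> norm h < d \<longrightarrow> norm (f (x + h) - f x - D h) \<le> e * norm h" if e: "e > 0" for e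
  proof -
    \<comment> \<open>Each of the \<open>n\<close> coordinate steps contributes an error of at most
      \<open>e' * norm h\<close>; adding 1 avoids division by zero when \<open>V\<close> is
      trivial.\<close>
    define e' where "e' = e / (n + 1)"
    have e': "e' > 0" "n * e' \<le> e" using e n0 by (simp_all add: e'_def field_simps)
    have "\<forall>b\<in>B. \<exists>r>0. \<forall>y\<in>U. dist y x < r \<longrightarrow> dist (g b y) (g b x) < e'"
    proof (rule ballI)
      fix b assume b: "b \<in> B"
      have "\<forall>e>0. \<exists>r>0. \<forall>y\<in>U. dist y x < r \<longrightarrow> dist (g b y) (g b x) < e"
        using bspec[OF g(2)[OF b, unfolded continuous_on_iff] x] .
      thus "\<exists>r>0. \<forall>y\<in>U. dist y x < r \<longrightarrow> dist (g b y) (g b x) < e'" using e'(1) by (elim allE impE)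
    qed
    from bchoice[OF this] obtain r where
      "\<forall>b\<in>B. r b > 0 \<and> (\<forall>y\<in>U. dist y x < r b \<longrightarrow> dist (g b y) (g b x) < e')" by (elim exE)
    hence r: "\<And>b. b \<in> B \<Longrightarrow> r b > 0" "\<And>b y. b \<in> B \<Longrightarrow> y \<in> U \<Longrightarrow> dist y x < r b \<Longrightarrow> dist (g b y) (g b x) < e'" by simp_all
    have xS: "x \<in> S" using x S(2) by simp
    obtain r0 where r0: "r0 > 0" "ball x r0 \<subseteq> S" by (rule openE[OF S(1) xS])
    \<comment> \<open>A common radius around \<open>x\<close>, within which points of
      \<open>V\<close> stay in \<open>S\<close> and each \<open>g b\<close> varies by less than
      \<open>e'\<close>.\<close>
    define \<rho> where "\<rho> = Min (insert r0 (r ` B))"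
    have \<rho>: "\<rho> > 0" "\<rho> \<le> r0" "\<And>b. b \<in> B \<Longrightarrow> \<rho> \<le> r b"
      unfolding \<rho>_def using fB r0(1) r(1) by (auto simp: Min_gr_iff)
    \<comment> \<open>A partial sum has length at most \<open>n * norm h\<close> and the next step
      at most \<open>norm h\<close>, so dividing by \<open>n + 1\<close> keeps all intermediate
      points within \<open>\<rho>\<close>.\<close>
    define d where "d = \<rho> / (n + 1)"
    have d: "d > 0" "(n + 1) * d \<le> \<rho>" using \<rho>(1) n0 by (simp_all add: d_def)
    have "norm (f (x + h) - f x - D h) \<le> e * norm h" if h: "h \<in> V" "norm h < d" for h
    proof -
      have hb: "\<bar>h \<bullet> b\<bar> \<le> norm h" if "b \<in> B" for b
        using Cauchy_Schwarz_ineq2[of h b] B(3)[OF that] by simp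
      have partial: "norm (f (x + (\<Sum>b\<in>A. (h \<bullet> b) *\<^sub>R b)) - f x - (\<Sum>b\<in>A. (h \<bullet> b) *\<^sub>R g b x)) \<le> real (card A) * (e' * norm h)"
        if "A \<subseteq> B" for A
        using finite_subset[OF that fB] that
      proof (induction A rule: finite_induct)
        case empty
        thus ?case by simp
      next
        case (insert b A)
        have b: "b \<in> B" and A: "A \<subseteq> B" using insert.prems by auto
        define y where "y = x + (\<Sum>b\<in>A. (h \<bullet> b) *\<^sub>R b)"
        have yU: "y + s *\<^sub>R b \<in> U \<and> dist (y + s *\<^sub>R b) x < \<rho>" if s: "\<bar>s\<bar> \<le> norm h" for s
        proof -
          have "norm (\<Sum>b\<in>A. (h \<bullet> b) *\<^sub>R b) \<le> (\<Sum>b\<in>A. norm h)"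
            using hb A B(3) by (intro sum_norm_le) auto
          also have "\<dots> = real (card A) * norm h" by simp
          also have "\<dots> \<le> n * norm h"
            unfolding n_def using card_mono[OF fB A] by (intro mult_right_mono) simp_all
          finally have "norm ((\<Sum>b\<in>A. (h \<bullet> b) *\<^sub>R b) + s *\<^sub>R b) \<le> n * norm h + norm h"
            using s B(3)[OF b] by (intro norm_triangle_le add_mono) simp_all
          also have "\<dots> = (n + 1) * norm h" by (simp add: algebra_simps)
          also have "\<dots> < (n + 1) * d" using h(2) n0 by simp
          also have "\<dots> \<le> \<rho>" by (rule d(2))
          finally have dx: "dist (y + s *\<^sub>R b) x < \<rho>" unfolding y_def dist_norm by (simp add: algebra_simps)
          hence "y + s *\<^sub>R b \<in> ball x r0" using \<rho>(2) by (simp add: dist_commute)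
          moreover have "y + s *\<^sub>R b \<in> V"
            unfolding y_def using x S(2) A B(1) b V by (intro subspace_add subspace_sum subspace_scale) auto
          ultimately show ?thesis using r0(2) S(2) dx by blast
        qed
        have fin: "norm (f (y + (h \<bullet> b) *\<^sub>R b) - f y - (h \<bullet> b) *\<^sub>R g b x) \<le> e' * norm h"
        proof -
          define J where "J = closed_segment 0 (h \<bullet> b)"
          have J: "\<bar>s\<bar> \<le> norm h" if "s \<in> J" for s
            using that hb[OF b] unfolding J_def by (auto simp: closed_segment_eq_real_ivl split: if_splits)
          \<comment> \<open>Subtracting the expected linear increment leaves a function with
            derivative at most \<open>e'\<close>, to which the mean value inequality
            applies.\<close>
          let ?\<phi> = "\<lambda>s. f (y + s *\<^sub>R b) - s *\<^sub>R g b x"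
          have "norm (?\<phi> (h \<bullet> b) - ?\<phi> 0) \<le> e' * norm ((h \<bullet> b) - 0)"
          proof (rule differentiable_bound[of J ?\<phi> "\<lambda>s t. t *\<^sub>R (g b (y + s *\<^sub>R b) - g b x)"])
            show "convex J" unfolding J_def by simp
            show "h \<bullet> b \<in> J" "0 \<in> J" unfolding J_def by simp_all
            fix s assume s: "s \<in> J"
            have sU: "y + s *\<^sub>R b \<in> U" "dist (y + s *\<^sub>R b) x < \<rho>" using yU[OF J[OF s]] by simp_all
            have "((\<lambda>u. f ((y + s *\<^sub>R b) + u *\<^sub>R b)) has_vector_derivative g b (y + s *\<^sub>R b)) (at (s - s))"
              using g(1)[OF b sU(1)] by simp
            hence "((\<lambda>u. f ((y + s *\<^sub>R b) + u *\<^sub>R b)) \<circ> (\<lambda>u. u - s) has_vector_derivative (1 *\<^sub>R g b (y + s *\<^sub>R b))) (at s)"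
              by (intro vector_diff_chain_at) (auto intro!: derivative_eq_intros)
            hence "((\<lambda>u. f (y + u *\<^sub>R b)) has_vector_derivative g b (y + s *\<^sub>R b)) (at s)"
              by (simp add: comp_def algebra_simps)
            hence "(?\<phi> has_vector_derivative g b (y + s *\<^sub>R b) - g b x) (at s)"
              by (auto intro!: derivative_eq_intros)
            thus "(?\<phi> has_derivative (\<lambda>t. t *\<^sub>R (g b (y + s *\<^sub>R b) - g b x))) (at s within J)"
              unfolding has_vector_derivative_def by (rule has_derivative_at_withinI)
            have "norm (g b (y + s *\<^sub>R b) - g b x) < e'"
              using r(2)[OF b sU(1)] sU(2) \<rho>(3)[OF b] by (simp add: dist_norm)
            thus "onorm (\<lambda>t. t *\<^sub>R (g b (y + s *\<^sub>R b) - g b x)) \<le> e'"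
              by (intro onorm_le) (simp add: mult.commute[of e'] mult_left_mono)
          qed
          also have "\<dots> \<le> e' * norm h" using hb[OF b] e'(1) by (simp add: mult_left_mono)
          finally show ?thesis by (simp add: algebra_simps)
        qed
        have ih: "norm (f y - f x - (\<Sum>b\<in>A. (h \<bullet> b) *\<^sub>R g b x)) \<le> real (card A) * (e' * norm h)"
          using insert.IH[OF A] unfolding y_def .
        have eq: "f (x + (\<Sum>b\<in>insert b A. (h \<bullet> b) *\<^sub>R b)) - f x - (\<Sum>b\<in>insert b A. (h \<bullet> b) *\<^sub>R g b x) =
            (f (y + (h \<bullet> b) *\<^sub>R b) - f y - (h \<bullet> b) *\<^sub>R g b x) + (f y - f x - (\<Sum>b\<in>A. (h \<bullet> b) *\<^sub>R g b x))"
          unfolding y_def using insert.hyps by (simp add: algebra_simps)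
        have "norm (f (x + (\<Sum>b\<in>insert b A. (h \<bullet> b) *\<^sub>R b)) - f x - (\<Sum>b\<in>insert b A. (h \<bullet> b) *\<^sub>R g b x)) \<le>
            e' * norm h + real (card A) * (e' * norm h)"
          unfolding eq by (rule norm_triangle_mono[OF fin ih])
        thus ?case using insert.hyps by (simp add: algebra_simps)
      qed
      have "(\<Sum>b\<in>B. (h \<bullet> b) *\<^sub>R b) = h"
        using orthonormal_basis_expand[OF B(2,3) _ fB, of h] h(1) B(6) by simp
      hence "norm (f (x + h) - f x - D h) \<le> n * (e' * norm h)"
        using partial[OF order_refl] unfolding D_def n_def by simp
      also have "\<dots> \<le> e * norm h" using e'(2) by (simp add: mult_right_mono flip: mult.assoc)
      finally show ?thesis .
    qed
    thus ?thesis using d(1) by blast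
  qed
  have "(f has_derivative D) (at x within U)"
    unfolding has_derivative_within_alt
  proof (intro conjI allI impI)
    show "bounded_linear D" using lD by (simp add: linear_conv_bounded_linear)
    fix e :: real assume "e > 0"
    from est[OF this] obtain d where d: "d > 0" "\<forall>h. h \<in> V \<and> norm h < d \<longrightarrow> norm (f (x + h) - f x - D h) \<le> e * norm h"
      by (elim exE conjE)
    show "\<exists>d>0. \<forall>y\<in>U. norm (y - x) < d \<longrightarrow> norm (f y - f x - D (y - x)) \<le> e * norm (y - x)"
    proof (intro exI[of _ d] conjI d(1) ballI impI)
      fix y assume y: "y \<in> U" "norm (y - x) < d"
      hence "y - x \<in> V" using x S(2) V by (simp add: subspace_diff)
      with d(2) y(2) have "norm (f (x + (y - x)) - f x - D (y - x)) \<le> e * norm (y - x)" by blast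
      thus "norm (f y - f x - D (y - x)) \<le> e * norm (y - x)" by simp
    qed
  qed
  thus ?thesis using lD by blast
qed

section \<open>Derivatives along curves\<close>

definition dir_deriv :: "('e::real_normed_vector \<Rightarrow> 'f::real_normed_vector) \<Rightarrow> 'e \<Rightarrow> 'e \<Rightarrow> 'f" where
  "dir_deriv f x v = vector_derivative (\<lambda>s. f (x + s *\<^sub>R v)) (at 0)"

text \<open>The velocity lies in \<open>V\<close> since the difference quotients do and
  \<open>V\<close> is closed. The Frechet derivative is identified with \<open>dir_deriv\<close> by
  applying the chain rule to the straight line in direction \<open>w\<close>, as well as to
  \<open>g\<close> itself.\<close>

lemma dir_deriv_chain:
  fixes g :: "real \<Rightarrow> 'e::euclidean_space"
  assumes V: "subspace V" and U: "openin (top_of_set V) U" and f: "smooth_on V U f"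
    and g: "(g has_vector_derivative w) (at 0)" and gU: "\<forall>\<^sub>F s in at 0. g s \<in> U" and g0: "g 0 \<in> U"
  shows "w \<in> V" "((\<lambda>s. f (g s)) has_vector_derivative dir_deriv f (g 0) w) (at 0)"
proof -
  have UV: "U \<subseteq> V" using openin_imp_subset[OF U] .
  have f1: "Ck_on 1 V U f" using f unfolding smooth_on_def by blast
  obtain D where D: "linear D" "(f has_derivative D) (at (g 0) within U)"
    using Ck_on_has_derivative[OF V U f1 g0] by (elim exE conjE)
  have chain: "((\<lambda>s. f (h s)) has_vector_derivative D v) (at 0)"
    if h: "(h has_vector_derivative v) (at 0)" "\<forall>\<^sub>F s in at 0. h s \<in> U" "h 0 = g 0" for h :: "real \<Rightarrow> 'e" and v
  proof -
    obtain d where d: "d > 0" "\<And>s. s \<noteq> 0 \<Longrightarrow> dist s 0 < d \<Longrightarrow> h s \<in> U"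
      using h(2) unfolding eventually_at by (elim exE conjE) simp
    have hU: "h ` ball 0 d \<subseteq> U"
    proof (rule image_subsetI)
      fix s :: real assume "s \<in> ball 0 d"
      thus "h s \<in> U" using d(2)[of s] h(3) g0 by (cases "s = 0") (simp_all add: dist_commute)
    qed
    have "((f \<circ> h) has_vector_derivative D v) (at 0 within ball 0 d)"
    proof (rule vector_derivative_diff_chain_within)
      show "(h has_vector_derivative v) (at 0 within ball 0 d)" by (rule has_vector_derivative_at_within[OF h(1)])
      show "(f has_derivative D) (at (h 0) within h ` ball 0 d)"
        unfolding h(3) by (rule has_derivative_subset[OF D(2) hU])
    qed
    thus ?thesis using d(1) by (simp add: at_within_ball comp_def)
  qed
  show w: "w \<in> V"
  proof -
    have "closed V" by (rule closed_subspace[OF V])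
    have "((\<lambda>s. (g s - g 0) /\<^sub>R s) \<longlongrightarrow> w) (at 0)"
      using g unfolding has_vector_derivative_def has_derivative_at2
    proof (elim conjE)
      assume "((\<lambda>y. (1 / norm (y - 0)) *\<^sub>R (g y - (g 0 + (y - 0) *\<^sub>R w))) \<longlongrightarrow> 0) (at 0)"
      hence *: "((\<lambda>y. norm ((1 / norm (y - 0)) *\<^sub>R (g y - (g 0 + (y - 0) *\<^sub>R w)))) \<longlongrightarrow> 0) (at 0)"
        by (rule tendsto_norm_zero)
      have "((\<lambda>s. norm ((g s - g 0) /\<^sub>R s - w)) \<longlongrightarrow> 0) (at 0)"
      proof (rule Lim_transform_eventually[OF *])
        show "\<forall>\<^sub>F y in at 0. norm ((1 / norm (y - 0)) *\<^sub>R (g y - (g 0 + (y - 0) *\<^sub>R w))) = norm ((g y - g 0) /\<^sub>R y - w)"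
          unfolding eventually_at
        proof (intro exI[of _ 1] conjI ballI impI)
          fix y :: real assume "y \<noteq> 0 \<and> dist y 0 < 1"
          hence y: "y \<noteq> 0" by simp
          have "(g y - g 0) /\<^sub>R y - w = (1 / y) *\<^sub>R (g y - (g 0 + y *\<^sub>R w))"
            using y by (simp add: algebra_simps divide_inverse)
          thus "norm ((1 / norm (y - 0)) *\<^sub>R (g y - (g 0 + (y - 0) *\<^sub>R w))) = norm ((g y - g 0) /\<^sub>R y - w)" by simp
        qed simp
      qed
      thus ?thesis by (simp add: tendsto_norm_zero_iff LIM_zero_iff)
    qed
    moreover have "\<forall>\<^sub>F s in at 0. (g s - g 0) /\<^sub>R s \<in> V"
      using gU by eventually_elim (use UV g0 V in \<open>auto intro!: subspace_scale subspace_diff\<close>)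
    ultimately show ?thesis by (intro Lim_in_closed_set[OF \<open>closed V\<close>, of _ "at (0::real)"]) auto
  qed
  have "((\<lambda>s. g 0 + s *\<^sub>R w) has_vector_derivative w) (at 0)" by (auto intro!: derivative_eq_intros)
  moreover have "\<forall>\<^sub>F s in at 0. g 0 + s *\<^sub>R w \<in> U"
    unfolding eventually_at_topological
    by (intro exI[of _ "{s. g 0 + s *\<^sub>R w \<in> U}"] conjI open_direction[OF V U g0 w]) simp
  ultimately have "((\<lambda>s. f (g 0 + s *\<^sub>R w)) has_vector_derivative D w) (at 0)" by (rule chain) simp
  hence "dir_deriv f (g 0) w = D w" unfolding dir_deriv_def by (rule vector_derivative_at)
  thus "((\<lambda>s. f (g s)) has_vector_derivative dir_deriv f (g 0) w) (at 0)"
    using chain[OF g gU refl] by simp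
qed

lemma dir_deriv_linear:
  fixes f :: "'e::euclidean_space \<Rightarrow> 'f::real_normed_vector"
  assumes V: "subspace V" and U: "openin (top_of_set V) U" and f: "smooth_on V U f" and x: "x \<in> U"
  shows "\<exists>D. linear D \<and> (\<forall>v\<in>V. dir_deriv f x v = D v \<and> ((\<lambda>s. f (x + s *\<^sub>R v)) has_vector_derivative D v) (at 0))"
proof -
  have f1: "Ck_on 1 V U f" using f unfolding smooth_on_def by blast
  obtain D where D: "linear D" "(f has_derivative D) (at x within U)"
    using Ck_on_has_derivative[OF V U f1 x] by (elim exE conjE)
  have "((\<lambda>s. f (x + s *\<^sub>R v)) has_vector_derivative D v) (at 0)" if v: "v \<in> V" for v
  proof -
    let ?S = "{s. x + s *\<^sub>R v \<in> U}"
    have "(f \<circ> (\<lambda>s. x + s *\<^sub>R v) has_vector_derivative D v) (at 0 within ?S)"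
    proof (rule vector_derivative_diff_chain_within)
      show "((\<lambda>s. x + s *\<^sub>R v) has_vector_derivative v) (at 0 within ?S)" by (auto intro!: derivative_eq_intros)
      show "(f has_derivative D) (at (x + 0 *\<^sub>R v) within (\<lambda>s. x + s *\<^sub>R v) ` ?S)"
        using has_derivative_subset[OF D(2), of "(\<lambda>s. x + s *\<^sub>R v) ` ?S"] by auto
    qed
    thus ?thesis using at_within_open[OF open_direction(2,1)[OF V U x v]] by (simp add: comp_def)
  qed
  thus ?thesis using D(1) unfolding dir_deriv_def by (intro exI[of _ D]) (simp add: vector_derivative_at)
qed

section \<open>Charts\<close>

lemma smooth_manifoldD:
  assumes "smooth_manifold M"
  shows "Hausdorff_space (mtop M)" "second_countable (mtop M)" "subspace (model M)"
    "\<Union>(fst ` atlas M) = mspc M"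
  using assms unfolding smooth_manifold_def by blast+

context
  fixes M :: "('a, 'e::euclidean_space) mfd" and U \<xi>
  assumes M: "smooth_manifold M" and U: "(U, \<xi>) \<in> atlas M"
begin

lemma chart_open: "openin (mtop M) U"
  and chart_image_open: "openin (top_of_set (model M)) (\<xi> ` U)"
  and chart_homeo: "homeomorphic_map (subtopology (mtop M) U) (top_of_set (\<xi> ` U)) \<xi>"
proof -
  have "\<forall>(U, \<xi>)\<in>atlas M. openin (mtop M) U \<and> openin (top_of_set (model M)) (\<xi> ` U) \<and>
        homeomorphic_map (subtopology (mtop M) U) (top_of_set (\<xi> ` U)) \<xi>"
    using M unfolding smooth_manifold_def by (elim conjE)
  from bspec[OF this U] show "openin (mtop M) U" "openin (top_of_set (model M)) (\<xi> ` U)"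
    "homeomorphic_map (subtopology (mtop M) U) (top_of_set (\<xi> ` U)) \<xi>" by simp_all
qed

lemma chart_subset: "U \<subseteq> mspc M"
  using chart_open by (rule openin_subset)

lemma chart_inj: "inj_on \<xi> U"
  using homeomorphic_imp_injective_map[OF chart_homeo] chart_subset by (simp add: Int_absorb1)

lemma chart_inv: "x \<in> U \<Longrightarrow> inv_into U \<xi> (\<xi> x) = x"
  using chart_inj by (rule inv_into_f_f)

lemma chart_open_image:
  assumes "openin (mtop M) W" "W \<subseteq> U"
  shows "openin (top_of_set (model M)) (\<xi> ` W)"
proof -
  have "openin (subtopology (mtop M) U) W" using assms chart_open by (simp add: openin_open_subtopology)
  hence "openin (top_of_set (\<xi> ` U)) (\<xi> ` W)"
    using homeomorphic_imp_open_map[OF chart_homeo] unfolding open_map_def by blast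
  thus ?thesis using chart_image_open by (rule openin_trans)
qed

lemma chart_inv_continuous: "continuous_map (top_of_set (\<xi> ` U)) (mtop M) (inv_into U \<xi>)"
proof -
  obtain g where g: "homeomorphic_maps (subtopology (mtop M) U) (top_of_set (\<xi> ` U)) \<xi> g"
    using chart_homeo unfolding homeomorphic_map_maps by (elim exE)
  have "continuous_map (top_of_set (\<xi> ` U)) (mtop M) g"
    using g unfolding homeomorphic_maps_def continuous_map_in_subtopology by (elim conjE)
  moreover have "g y = inv_into U \<xi> y" if "y \<in> topspace (top_of_set (\<xi> ` U))" for y
  proof -
    have "y \<in> \<xi> ` U" using that by simp
    then obtain x where x: "x \<in> U" "y = \<xi> x" by (elim imageE)
    have "g (\<xi> x) = x" using g x(1) chart_subset unfolding homeomorphic_maps_def by auto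
    thus ?thesis using chart_inv[OF x(1)] x(2) by simp
  qed
  ultimately show ?thesis by (rule continuous_map_eq)
qed

end

lemma chart_exists:
  assumes "smooth_manifold M" "x \<in> mspc M"
  obtains U \<xi> where "(U, \<xi>) \<in> atlas M" "x \<in> U"
proof -
  have "x \<in> \<Union>(fst ` atlas M)" using smooth_manifoldD(4)[OF assms(1)] assms(2) by simp
  thus thesis using that by auto
qed

lemma chart_transition:
  assumes "smooth_manifold M" "(U, \<xi>) \<in> atlas M" "(W, \<psi>) \<in> atlas M"
  shows "smooth_on (model M) (\<xi> ` (U \<inter> W)) (\<psi> \<circ> inv_into U \<xi>)"
proof -
  have "\<forall>(U, \<xi>)\<in>atlas M. \<forall>(W, \<psi>)\<in>atlas M.
        smooth_on (model M) (\<xi> ` (U \<inter> W)) (\<psi> \<circ> inv_into U \<xi>)"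
    using assms(1) unfolding smooth_manifold_def by (elim conjE)
  from bspec[OF this assms(2)] show ?thesis using assms(3) by auto
qed

lemma smooth_mapD:
  assumes "smooth_map M N f"
  shows "continuous_map (mtop M) (mtop N) f"
    "(U, \<xi>) \<in> atlas M \<Longrightarrow> (W, \<psi>) \<in> atlas N \<Longrightarrow> smooth_on (model M) (\<xi> ` {x\<in>U. f x \<in> W}) (\<psi> \<circ> f \<circ> inv_into U \<xi>)"
proof -
  have *: "\<forall>(U, \<xi>)\<in>atlas M. \<forall>(W, \<psi>)\<in>atlas N. smooth_on (model M) (\<xi> ` {x\<in>U. f x \<in> W}) (\<psi> \<circ> f \<circ> inv_into U \<xi>)"
    using assms unfolding smooth_map_def by (elim conjE)
  show "continuous_map (mtop M) (mtop N) f" using assms unfolding smooth_map_def by (elim conjE)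
  assume U: "(U, \<xi>) \<in> atlas M" and W: "(W, \<psi>) \<in> atlas N"
  from bspec[OF * U] show "smooth_on (model M) (\<xi> ` {x\<in>U. f x \<in> W}) (\<psi> \<circ> f \<circ> inv_into U \<xi>)"
    using W by auto
qed

lemma smooth_mapI:
  assumes "continuous_map (mtop M) (mtop N) f"
    and "\<And>U \<xi> W \<psi>. (U, \<xi>) \<in> atlas M \<Longrightarrow> (W, \<psi>) \<in> atlas N \<Longrightarrow>
      smooth_on (model M) (\<xi> ` {x\<in>U. f x \<in> W}) (\<psi> \<circ> f \<circ> inv_into U \<xi>)"
  shows "smooth_map M N f"
  unfolding smooth_map_def using assms by auto

text \<open>The condition on \<open>M\<close> is coverage by its charts, so that the lemma also
  applies to open submanifolds.\<close>

lemma smooth_map_cong: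
  assumes M: "\<Union>(fst ` atlas M) = mspc M" and f: "smooth_map M N f" and eq: "\<And>x. x \<in> mspc M \<Longrightarrow> f x = g x"
  shows "smooth_map M N g"
proof (rule smooth_mapI)
  show "continuous_map (mtop M) (mtop N) g" by (rule continuous_map_eq[OF smooth_mapD(1)[OF f] eq])
  fix U \<xi> W \<psi> assume U: "(U, \<xi>) \<in> atlas M" and W: "(W, \<psi>) \<in> atlas N"
  have UM: "U \<subseteq> mspc M" using U unfolding M[symmetric] by force
  have "{x\<in>U. g x \<in> W} = {x\<in>U. f x \<in> W}" using UM eq by auto
  moreover have "smooth_on (model M) (\<xi> ` {x\<in>U. f x \<in> W}) (\<psi> \<circ> g \<circ> inv_into U \<xi>)"
  proof (rule smooth_on_cong[OF smooth_mapD(2)[OF f U W]])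
    fix u assume "u \<in> \<xi> ` {x\<in>U. f x \<in> W}"
    hence "inv_into U \<xi> u \<in> U" by (auto intro: inv_into_into)
    thus "(\<psi> \<circ> f \<circ> inv_into U \<xi>) u = (\<psi> \<circ> g \<circ> inv_into U \<xi>) u" using UM eq by auto
  qed
  ultimately show "smooth_on (model M) (\<xi> ` {x\<in>U. g x \<in> W}) (\<psi> \<circ> g \<circ> inv_into U \<xi>)" by simp
qed

lemma smooth_map_id:
  assumes "smooth_manifold M"
  shows "smooth_map M M (\<lambda>x. x)"
proof (rule smooth_mapI)
  fix U \<xi> W \<psi> assume "(U, \<xi>) \<in> atlas M" "(W, \<psi>) \<in> atlas M"
  from chart_transition[OF assms this]
  show "smooth_on (model M) (\<xi> ` {x\<in>U. x \<in> W}) (\<psi> \<circ> (\<lambda>x. x) \<circ> inv_into U \<xi>)" by (simp add: comp_def Int_def)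
qed simp

text \<open>Take the preimage of a small convex set in a chart.\<close>

lemma chart_ball:
  assumes M: "smooth_manifold M" and N: "openin (mtop M) N" "x \<in> N"
  obtains W where "openin (mtop M) W" "x \<in> W" "W \<subseteq> N" "path_connectedin (mtop M) W"
    "\<And>z c. cocycle (mtop M) z \<Longrightarrow> pathin (mtop M) c \<Longrightarrow> c ` {0..1} \<subseteq> W \<Longrightarrow> c 0 = c 1 \<Longrightarrow> path_value z c = 0"
proof -
  have xM: "x \<in> mspc M" using openin_subset[OF N(1)] N(2) by blast
  obtain U \<xi> where U: "(U, \<xi>) \<in> atlas M" "x \<in> U" by (rule chart_exists[OF M xM])
  define V where "V = model M"
  have V: "subspace V" unfolding V_def by (rule smooth_manifoldD(3)[OF M])
  define A where "A = \<xi> ` (N \<inter> U)"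
  have oA: "openin (top_of_set V) A"
    unfolding A_def V_def by (rule chart_open_image[OF M U(1) openin_Int[OF N(1) chart_open[OF M U(1)]]]) blast
  obtain S where S: "open S" "A = V \<inter> S" using oA unfolding openin_open by (elim exE conjE)
  have "\<xi> x \<in> A" unfolding A_def using N(2) U(2) by blast
  hence "\<xi> x \<in> S" using S(2) by simp
  then obtain e where e: "e > 0" "ball (\<xi> x) e \<subseteq> S" by (rule openE[OF S(1)])
  define C where "C = ball (\<xi> x) e \<inter> V"
  have C: "convex C" unfolding C_def by (intro convex_Int convex_ball subspace_imp_convex[OF V])
  have CA: "C \<subseteq> A" unfolding C_def S(2) using e(2) by blast
  have CU: "C \<subseteq> \<xi> ` U" using CA unfolding A_def by blast
  have xC: "\<xi> x \<in> C" unfolding C_def using e(1) \<open>\<xi> x \<in> A\<close> S(2) by simp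
  define W where "W = {y \<in> topspace (subtopology (mtop M) U). \<xi> y \<in> C}"
  have tU: "topspace (subtopology (mtop M) U) = U" using chart_subset[OF M U(1)] by (simp add: Int_absorb1)
  have WI: "inv_into U \<xi> u \<in> W" "\<xi> (inv_into U \<xi> u) = u" if "u \<in> C" for u
  proof -
    have u: "u \<in> \<xi> ` U" using that CU by blast
    show "\<xi> (inv_into U \<xi> u) = u" using u by (rule f_inv_into_f)
    thus "inv_into U \<xi> u \<in> W" unfolding W_def tU using inv_into_into[OF u] that by simp
  qed
  have oC: "openin (top_of_set (\<xi> ` U)) C"
  proof -
    have "C = ball (\<xi> x) e \<inter> \<xi> ` U"
      using CU openin_imp_subset[OF chart_image_open[OF M U(1)]] unfolding C_def V_def by blast
    thus ?thesis unfolding openin_open by (intro exI[of _ "ball (\<xi> x) e"]) auto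
  qed
  have "openin (subtopology (mtop M) U) W"
    unfolding W_def by (rule openin_continuous_map_preimage[OF homeomorphic_imp_continuous_map[OF chart_homeo[OF M U(1)]] oC])
  hence oW: "openin (mtop M) W" using chart_open[OF M U(1)] by (rule openin_trans_full)
  have ic: "continuous_map (top_of_set (\<xi> ` U)) (mtop M) (inv_into U \<xi>)" by (rule chart_inv_continuous[OF M U(1)])
  have seg: "(1 - t) *\<^sub>R a + t *\<^sub>R b \<in> C" if "a \<in> C" "b \<in> C" "t \<in> {0..1}" for a b and t :: real
    using convexD[OF C that(1,2), of "1 - t" t] that(3) by simp
  have WU: "y \<in> U \<and> \<xi> y \<in> C" if "y \<in> W" for y using that unfolding W_def tU by simp
  show thesis
  proof (rule that[OF oW])
    show "x \<in> W" unfolding W_def tU using U(2) xC by simp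
    show "W \<subseteq> N"
    proof
      fix y assume y: "y \<in> W"
      hence "\<xi> y \<in> \<xi> ` (N \<inter> U)" using WU CA unfolding A_def by blast
      then obtain y' where "y' \<in> N \<inter> U" "\<xi> y = \<xi> y'" by (elim imageE)
      hence "y = y'" using inj_onD[OF chart_inj[OF M U(1)]] WU[OF y] by blast
      thus "y \<in> N" using \<open>y' \<in> N \<inter> U\<close> by simp
    qed
    show "path_connectedin (mtop M) W"
      unfolding path_connectedin
    proof (intro conjI ballI)
      show "W \<subseteq> mspc M" using oW by (rule openin_subset)
      fix a b assume a: "a \<in> W" and b: "b \<in> W"
      let ?g = "\<lambda>t. inv_into U \<xi> ((1 - t) *\<^sub>R \<xi> a + t *\<^sub>R \<xi> b)"
      have s: "(1 - t) *\<^sub>R \<xi> a + t *\<^sub>R \<xi> b \<in> C" if "t \<in> {0..1}" for t :: real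
        using seg[OF _ _ that] WU[OF a] WU[OF b] by simp
      have "pathin (mtop M) ?g"
        unfolding pathin_def
        by (rule continuous_map_euclidean_compose[OF ic]) (use s CU in \<open>auto intro!: continuous_intros\<close>)
      moreover have "?g \<in> {0..1} \<rightarrow> W" using WI(1)[OF s] by blast
      moreover have "?g 0 = a" "?g 1 = b" using chart_inv[OF M U(1)] WU[OF a] WU[OF b] by simp_all
      ultimately show "\<exists>g. pathin (mtop M) g \<and> g \<in> {0..1} \<rightarrow> W \<and> g 0 = a \<and> g 1 = b" by (intro exI[of _ ?g] conjI)
    qed
    fix z c assume z: "cocycle (mtop M) z" and c: "pathin (mtop M) c" "c ` {0..1} \<subseteq> W" "c 0 = c 1"
    have cW: "c t \<in> U \<and> \<xi> (c t) \<in> C" if "t \<in> {0..1}" for t using WU[of "c t"] c(2) that by blast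
    \<comment> \<open>Contraction to \<open>c 0\<close> along segments in the chart. As the loop is
      closed, the two sides over its ends are equal, and \<open>path_value_square\<close> leaves the
      value of \<open>c\<close> equal to that of a constant path.\<close>
    let ?K = "\<lambda>p. inv_into U \<xi> ((1 - fst p) *\<^sub>R \<xi> (c (snd p)) + fst p *\<^sub>R \<xi> (c 0))"
    have "pathin (subtopology (mtop M) U) c" unfolding pathin_subtopology using c(1) cW by simp
    hence "continuous_map I01 (top_of_set (\<xi> ` U)) (\<xi> \<circ> c)"
      unfolding pathin_def by (rule continuous_map_compose[OF _ homeomorphic_imp_continuous_map[OF chart_homeo[OF M U(1)]]])
    hence cc: "continuous_on {0..1} (\<lambda>s. \<xi> (c s))" by (simp add: comp_def)
    have "continuous_map (top_of_set ({0..1::real} \<times> {0..1::real})) (mtop M) ?K"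
    proof (rule continuous_map_euclidean_compose[OF ic])
      have "continuous_on ({0..1::real} \<times> {0..1::real}) (\<lambda>p. \<xi> (c (snd p)))"
        by (rule continuous_on_compose2[OF cc]) (auto intro!: continuous_intros)
      thus "continuous_on ({0..1::real} \<times> {0..1::real}) (\<lambda>p. (1 - fst p) *\<^sub>R \<xi> (c (snd p)) + fst p *\<^sub>R \<xi> (c 0))"
        by (intro continuous_intros)
      fix p assume "p \<in> {0..1::real} \<times> {0..1::real}"
      hence "(1 - fst p) *\<^sub>R \<xi> (c (snd p)) + fst p *\<^sub>R \<xi> (c 0) \<in> C"
        using seg[of "\<xi> (c (snd p))" "\<xi> (c 0)" "fst p"] cW[of "snd p"] cW[of 0] by auto
      thus "(1 - fst p) *\<^sub>R \<xi> (c (snd p)) + fst p *\<^sub>R \<xi> (c 0) \<in> \<xi> ` U" using CU by blast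
    qed
    note sq = path_value_square[OF z this]
    have "path_value z (\<lambda>t. ?K (0, t)) = path_value z c"
      by (rule path_value_cong) (use cW chart_inv[OF M U(1)] in simp)
    moreover have "path_value z (\<lambda>t. ?K (1, t)) = 0"
      using path_value_const[OF z, of "c 0"] path_start_in_topspace[OF c(1)] chart_inv[OF M U(1), of "c 0"] cW[of 0] by simp
    ultimately show "path_value z c = 0" using sq c(3) by simp
  qed
qed

lemma manifold_locally_path_connected:
  assumes "smooth_manifold M"
  shows "locally_path_connected_space (mtop M)"
  unfolding locally_path_connected_space
proof (intro allI impI, elim conjE)
  fix N x assume N: "openin (mtop M) N" "x \<in> N"
  show "\<exists>U. openin (mtop M) U \<and> path_connectedin (mtop M) U \<and> x \<in> U \<and> U \<subseteq> N" by (rule chart_ball[OF assms N]) blast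
qed

section \<open>Products and pullbacks of manifolds\<close>

lemma second_countable_prod_topology:
  assumes "second_countable X" "second_countable Y"
  shows "second_countable (prod_topology X Y)"
proof -
  obtain A where A: "countable A" "\<forall>V\<in>A. openin X V" "\<forall>U x. openin X U \<and> x \<in> U \<longrightarrow> (\<exists>V\<in>A. x \<in> V \<and> V \<subseteq> U)"
    using assms(1) unfolding second_countable_def by (elim exE conjE)
  obtain B where B: "countable B" "\<forall>V\<in>B. openin Y V" "\<forall>U x. openin Y U \<and> x \<in> U \<longrightarrow> (\<exists>V\<in>B. x \<in> V \<and> V \<subseteq> U)"
    using assms(2) unfolding second_countable_def by (elim exE conjE)
  show ?thesis
    unfolding second_countable_def
  proof (intro exI[of _ "(\<lambda>(V, W). V \<times> W) ` (A \<times> B)"] conjI allI impI)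
    show "countable ((\<lambda>(V, W). V \<times> W) ` (A \<times> B))" using A(1) B(1) by simp
    show "\<forall>V\<in>(\<lambda>(V, W). V \<times> W) ` (A \<times> B). openin (prod_topology X Y) V"
      using A(2) B(2) by (auto simp: openin_prod_Times_iff)
    fix U p assume U: "openin (prod_topology X Y) U \<and> p \<in> U"
    obtain x y where p: "p = (x, y)" by (cases p)
    have "(x, y) \<in> U" using U p by simp
    hence "\<exists>V W. openin X V \<and> openin Y W \<and> x \<in> V \<and> y \<in> W \<and> V \<times> W \<subseteq> U"
      using conjunct1[OF U] unfolding openin_prod_topology_alt by simp
    then obtain V W where VW: "openin X V" "openin Y W" "x \<in> V" "y \<in> W" "V \<times> W \<subseteq> U" by (elim exE conjE)
    obtain V' where V': "V' \<in> A" "x \<in> V'" "V' \<subseteq> V" using A(3) VW(1,3) by blast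
    obtain W' where W': "W' \<in> B" "y \<in> W'" "W' \<subseteq> W" using B(3) VW(2,4) by blast
    show "\<exists>V\<in>(\<lambda>(V, W). V \<times> W) ` (A \<times> B). p \<in> V \<and> V \<subseteq> U"
    proof (rule bexI[of _ "V' \<times> W'"])
      show "p \<in> V' \<times> W' \<and> V' \<times> W' \<subseteq> U" using V' W' VW(5) p by blast
      show "V' \<times> W' \<in> (\<lambda>(V, W). V \<times> W) ` (A \<times> B)" using V'(1) W'(1) by (intro image_eqI[of _ _ "(V', W')"]) simp_all
    qed
  qed
qed

lemma prod_mfd_simps [simp]:
  "mtop (prod_mfd M N) = prod_topology (mtop M) (mtop N)" "model (prod_mfd M N) = model M \<times> model N"
  by (simp_all add: prod_mfd_def)

lemma prod_mfd_atlas: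
  "(V, \<kappa>) \<in> atlas (prod_mfd M N) \<longleftrightarrow>
    (\<exists>U \<xi> W \<psi>. (U, \<xi>) \<in> atlas M \<and> (W, \<psi>) \<in> atlas N \<and> V = U \<times> W \<and> \<kappa> = map_prod \<xi> \<psi>)" by (auto simp: prod_mfd_def)

lemma inv_into_map_prod:
  assumes "inj_on \<xi> U" "inj_on \<psi> W" "a \<in> \<xi> ` U" "b \<in> \<psi> ` W"
  shows "inv_into (U \<times> W) (map_prod \<xi> \<psi>) (a, b) = (inv_into U \<xi> a, inv_into W \<psi> b)"
proof (rule inv_into_f_eq)
  show "inj_on (map_prod \<xi> \<psi>) (U \<times> W)" using assms(1,2) by (rule map_prod_inj_on)
qed (use assms(3,4) in \<open>simp_all add: inv_into_into f_inv_into_f\<close>)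

lemma smooth_map_prod_chart:
  assumes M: "smooth_manifold M" and N: "smooth_manifold N" and f: "smooth_map M M' f" and g: "smooth_map N N' g"
  shows "smooth_map (prod_mfd M N) (prod_mfd M' N') (map_prod f g)"
proof (rule smooth_mapI)
  show "continuous_map (mtop (prod_mfd M N)) (mtop (prod_mfd M' N')) (map_prod f g)"
    unfolding prod_mfd_simps map_prod_def case_prod_unfold
    using smooth_mapD(1)[OF f] smooth_mapD(1)[OF g]
    by (intro continuous_map_pairedI continuous_map_compose[OF continuous_map_fst, unfolded comp_def]
        continuous_map_compose[OF continuous_map_snd, unfolded comp_def])
  fix V \<kappa> V' \<kappa>' assume "(V, \<kappa>) \<in> atlas (prod_mfd M N)" "(V', \<kappa>') \<in> atlas (prod_mfd M' N')"
  then obtain U \<xi> W \<psi> U' \<xi>' W' \<psi>' where c: "(U, \<xi>) \<in> atlas M" "(W, \<psi>) \<in> atlas N" "(U', \<xi>') \<in> atlas M'" "(W', \<psi>') \<in> atlas N'"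
    and V: "V = U \<times> W" "\<kappa> = map_prod \<xi> \<psi>" "V' = U' \<times> W'" "\<kappa>' = map_prod \<xi>' \<psi>'"
    unfolding prod_mfd_atlas by (elim exE conjE)
  define A where "A = \<xi> ` {x\<in>U. f x \<in> U'}"
  define B where "B = \<psi> ` {x\<in>W. g x \<in> W'}"
  have s: "smooth_on (model M \<times> model N) (A \<times> B) (map_prod (\<xi>' \<circ> f \<circ> inv_into U \<xi>) (\<psi>' \<circ> g \<circ> inv_into W \<psi>))"
    unfolding A_def B_def by (rule smooth_on_map_prod[OF smooth_mapD(2)[OF f c(1,3)] smooth_mapD(2)[OF g c(2,4)]])
  have "\<kappa> ` {x\<in>V. map_prod f g x \<in> V'} = A \<times> B"
    unfolding V A_def B_def by force
  moreover have "smooth_on (model M \<times> model N) (A \<times> B) (\<kappa>' \<circ> map_prod f g \<circ> inv_into V \<kappa>)"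
  proof (rule smooth_on_cong[OF s])
    fix p assume "p \<in> A \<times> B"
    then obtain a b where p: "p = (a, b)" "a \<in> \<xi> ` U" "b \<in> \<psi> ` W" unfolding A_def B_def by blast
    show "map_prod (\<xi>' \<circ> f \<circ> inv_into U \<xi>) (\<psi>' \<circ> g \<circ> inv_into W \<psi>) p = (\<kappa>' \<circ> map_prod f g \<circ> inv_into V \<kappa>) p"
      unfolding p(1) V using inv_into_map_prod[OF chart_inj[OF M c(1)] chart_inj[OF N c(2)] p(2,3)] by simp
  qed
  ultimately show "smooth_on (model (prod_mfd M N)) (\<kappa> ` {x\<in>V. map_prod f g x \<in> V'}) (\<kappa>' \<circ> map_prod f g \<circ> inv_into V \<kappa>)"
    by simp
qed

lemma smooth_manifoldI:
  assumes "Hausdorff_space (mtop M)" "second_countable (mtop M)" "subspace (model M)"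
    and "\<And>U \<xi>. (U, \<xi>) \<in> atlas M \<Longrightarrow> openin (mtop M) U \<and> openin (top_of_set (model M)) (\<xi> ` U) \<and>
        homeomorphic_map (subtopology (mtop M) U) (top_of_set (\<xi> ` U)) \<xi>"
    and "\<And>x. x \<in> mspc M \<Longrightarrow> \<exists>U \<xi>. (U, \<xi>) \<in> atlas M \<and> x \<in> U"
    and "\<And>U \<xi> W \<psi>. (U, \<xi>) \<in> atlas M \<Longrightarrow> (W, \<psi>) \<in> atlas M \<Longrightarrow>
        smooth_on (model M) (\<xi> ` (U \<inter> W)) (\<psi> \<circ> inv_into U \<xi>)"
  shows "smooth_manifold M"
proof -
  have "\<Union>(fst ` atlas M) \<subseteq> mspc M"
  proof
    fix x assume "x \<in> \<Union>(fst ` atlas M)"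
    then obtain U \<xi> where "(U, \<xi>) \<in> atlas M" "x \<in> U" by auto
    thus "x \<in> mspc M" using assms(4) openin_subset by blast
  qed
  moreover have "mspc M \<subseteq> \<Union>(fst ` atlas M)"
  proof
    fix x assume "x \<in> mspc M"
    then obtain U \<xi> where "(U, \<xi>) \<in> atlas M" "x \<in> U" using assms(5) by (metis)
    thus "x \<in> \<Union>(fst ` atlas M)" by (intro UnionI[of U] image_eqI[of _ _ "(U, \<xi>)"]) simp_all
  qed
  ultimately show ?thesis
    unfolding smooth_manifold_def using assms(1-4,6) by auto
qed

lemma smooth_manifold_prod_mfd:
  assumes M: "smooth_manifold M" and N: "smooth_manifold N"
  shows "smooth_manifold (prod_mfd M N)"
proof (rule smooth_manifoldI)
  show "Hausdorff_space (mtop (prod_mfd M N))"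
    using smooth_manifoldD(1)[OF M] smooth_manifoldD(1)[OF N] by (simp add: Hausdorff_space_prod_topology)
  show "second_countable (mtop (prod_mfd M N))"
    using second_countable_prod_topology smooth_manifoldD(2)[OF M] smooth_manifoldD(2)[OF N] by simp
  show "subspace (model (prod_mfd M N))"
    using smooth_manifoldD(3)[OF M] smooth_manifoldD(3)[OF N] by (simp add: subspace_Times)
  show "\<exists>V \<kappa>. (V, \<kappa>) \<in> atlas (prod_mfd M N) \<and> p \<in> V" if p: "p \<in> mspc (prod_mfd M N)" for p
  proof -
    have p: "fst p \<in> mspc M" "snd p \<in> mspc N" using p by auto
    obtain U \<xi> where U: "(U, \<xi>) \<in> atlas M" "fst p \<in> U" by (rule chart_exists[OF M p(1)])
    obtain W \<psi> where W: "(W, \<psi>) \<in> atlas N" "snd p \<in> W" by (rule chart_exists[OF N p(2)])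
    have "(U \<times> W, map_prod \<xi> \<psi>) \<in> atlas (prod_mfd M N)" unfolding prod_mfd_atlas using U(1) W(1) by blast
    moreover have "p \<in> U \<times> W" using U(2) W(2) by (simp add: mem_Times_iff)
    ultimately show ?thesis by blast
  qed
  show "openin (mtop (prod_mfd M N)) V \<and> openin (top_of_set (model (prod_mfd M N))) (\<kappa> ` V) \<and>
      homeomorphic_map (subtopology (mtop (prod_mfd M N)) V) (top_of_set (\<kappa> ` V)) \<kappa>"
    if V: "(V, \<kappa>) \<in> atlas (prod_mfd M N)" for V \<kappa>
  proof -
    obtain U \<xi> W \<psi> where U: "(U, \<xi>) \<in> atlas M" and W: "(W, \<psi>) \<in> atlas N" and VV: "V = U \<times> W" "\<kappa> = map_prod \<xi> \<psi>"
      using V unfolding prod_mfd_atlas by (elim exE conjE)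
    have im: "\<kappa> ` V = \<xi> ` U \<times> \<psi> ` W" unfolding VV by force
    obtain s where s: "homeomorphic_maps (subtopology (mtop M) U) (top_of_set (\<xi> ` U)) \<xi> s"
      using chart_homeo[OF M U] unfolding homeomorphic_map_maps by (elim exE)
    obtain s' where s': "homeomorphic_maps (subtopology (mtop N) W) (top_of_set (\<psi> ` W)) \<psi> s'"
      using chart_homeo[OF N W] unfolding homeomorphic_map_maps by (elim exE)
    have "homeomorphic_maps (prod_topology (subtopology (mtop M) U) (subtopology (mtop N) W))
        (prod_topology (top_of_set (\<xi> ` U)) (top_of_set (\<psi> ` W))) (\<lambda>(x, y). (\<xi> x, \<psi> y)) (\<lambda>(x, y). (s x, s' y))"
      unfolding homeomorphic_maps_prod by (intro disjI2 conjI s s')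
    hence "homeomorphic_map (prod_topology (subtopology (mtop M) U) (subtopology (mtop N) W))
        (prod_topology (top_of_set (\<xi> ` U)) (top_of_set (\<psi> ` W))) (map_prod \<xi> \<psi>)"
      unfolding map_prod_def by (rule homeomorphic_maps_imp_map)
    hence "homeomorphic_map (subtopology (mtop (prod_mfd M N)) V) (top_of_set (\<kappa> ` V)) \<kappa>"
      unfolding im unfolding VV by (simp add: subtopology_Times)
    moreover have "openin (mtop (prod_mfd M N)) V"
      unfolding VV using chart_open[OF M U] chart_open[OF N W] by (simp add: openin_prod_Times_iff)
    moreover have "openin (top_of_set (model (prod_mfd M N))) (\<kappa> ` V)"
      unfolding im prod_mfd_simps using chart_image_open[OF M U] chart_image_open[OF N W] by (rule openin_Times)
    ultimately show ?thesis by blast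
  qed
  \<comment> \<open>A coordinate change of the product is the coordinate expression of the identity,
    viewed as the product of two identities.\<close>
  show "smooth_on (model (prod_mfd M N)) (\<kappa> ` (V \<inter> V')) (\<kappa>' \<circ> inv_into V \<kappa>)"
    if "(V, \<kappa>) \<in> atlas (prod_mfd M N)" "(V', \<kappa>') \<in> atlas (prod_mfd M N)" for V \<kappa> V' \<kappa>'
    using smooth_mapD(2)[OF smooth_map_prod_chart[OF M N smooth_map_id[OF M] smooth_map_id[OF N]] that]
    by (simp add: map_prod_def comp_def case_prod_unfold Int_def)
qed

section \<open>Pulling back the smooth structure along a covering\<close>

lemma pullback_mfd_simps [simp]:
  "mtop (pullback_mfd X r P) = X" "model (pullback_mfd X r P) = model P" by (simp_all add: pullback_mfd_def)

lemma pullback_mfd_atlas: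
  "(V, \<kappa>) \<in> atlas (pullback_mfd X r P) \<longleftrightarrow>
    (\<exists>U \<xi>. \<kappa> = \<xi> \<circ> r \<and> openin X V \<and> (U, \<xi>) \<in> atlas P \<and> r ` V \<subseteq> U \<and> openin (mtop P) (r ` V) \<and>
      homeomorphic_map (subtopology X V) (subtopology (mtop P) (r ` V)) r)" by (auto simp: pullback_mfd_def)

locale pullback =
  fixes P :: "('b, 'e::euclidean_space) mfd" and X :: "'x topology" and r :: "'x \<Rightarrow> 'b"
  assumes P: "smooth_manifold P" and cov: "covering_map X (mtop P) r"
    and X: "Hausdorff_space X" "second_countable X"
begin

abbreviation "Q \<equiv> pullback_mfd X r P"

lemma atlasE:
  assumes "(V, \<kappa>) \<in> atlas Q"
  obtains U \<xi> where "\<kappa> = \<xi> \<circ> r" "openin X V" "(U, \<xi>) \<in> atlas P" "r ` V \<subseteq> U" "openin (mtop P) (r ` V)"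
    "homeomorphic_map (subtopology X V) (subtopology (mtop P) (r ` V)) r" "inj_on r V"
    "\<And>x. x \<in> V \<Longrightarrow> inv_into V \<kappa> (\<kappa> x) = x" "\<And>x. x \<in> V \<Longrightarrow> inv_into U \<xi> (\<kappa> x) = r x"
proof -
  obtain U \<xi> where c: "\<kappa> = \<xi> \<circ> r" "openin X V" "(U, \<xi>) \<in> atlas P" "r ` V \<subseteq> U" "openin (mtop P) (r ` V)"
    "homeomorphic_map (subtopology X V) (subtopology (mtop P) (r ` V)) r"
    using assms unfolding pullback_mfd_atlas by (elim exE conjE)
  have ir: "inj_on r V"
    using homeomorphic_imp_injective_map[OF c(6)] openin_subset[OF c(2)] by (simp add: Int_absorb1)
  have i\<xi>: "inj_on \<xi> (r ` V)" using chart_inj[OF P c(3)] c(4) by (rule inj_on_subset)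
  have i: "inj_on \<kappa> V" unfolding c(1) using ir i\<xi> by (rule comp_inj_on)
  have 1: "inv_into V \<kappa> (\<kappa> x) = x" if "x \<in> V" for x using i that by (rule inv_into_f_f)
  have 2: "inv_into U \<xi> (\<kappa> x) = r x" if "x \<in> V" for x
    using chart_inv[OF P c(3), of "r x"] that c(1,4) by auto
  show thesis by (rule that[OF c ir 1 2])
qed

text \<open>Shrinking to the sheet through \<open>x\<close> makes \<open>r\<close> injective, so
  every chart around \<open>r x\<close> pulls back to a chart at \<open>x\<close>.\<close>

lemma chart_at:
  assumes "openin X N" "x \<in> N" "(U, \<xi>) \<in> atlas P" "r x \<in> U"
  shows "\<exists>V. (V, \<xi> \<circ> r) \<in> atlas Q \<and> x \<in> V \<and> V \<subseteq> N"
proof -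
  have x: "x \<in> topspace X" using assms openin_subset by blast
  obtain U0 V0 where U0: "r x \<in> U0" and V0: "sheets X (mtop P) r U0 V0"
    by (rule covering_map_sheetsE[OF cov covering_map_in[OF cov x]])
  define V where "V = V0 x \<inter> N \<inter> {y \<in> topspace X. r y \<in> U}"
  have oV: "openin X V"
    unfolding V_def by (intro openin_Int sheets_open[OF V0 x U0] assms(1)
        openin_continuous_map_preimage[OF covering_map_continuous[OF cov]] chart_open[OF P assms(3)])
  have "openin (mtop P) (r ` V)" using covering_map_open_map[OF cov] oV unfolding open_map_def by blast
  moreover have "homeomorphic_map (subtopology X V) (subtopology (mtop P) (r ` V)) r"
  proof -
    have "homeomorphic_map (subtopology (subtopology X (V0 x)) V) (subtopology (subtopology (mtop P) U0) (r ` V)) r"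
    proof (rule homeomorphic_map_subtopologies_alt[OF sheets_homeo[OF V0 x U0]])
      fix y assume "y \<in> topspace (subtopology X (V0 x))"
      hence y: "y \<in> V0 x" by simp
      show "(r y \<in> r ` V) = (y \<in> V)"
      proof
        assume "r y \<in> r ` V"
        then obtain y' where y': "y' \<in> V" "r y = r y'" by (elim imageE)
        have "y = y'" using sheets_inj[OF V0 x U0 y, of y'] y' unfolding V_def by simp
        thus "y \<in> V" using y'(1) by simp
      qed (rule imageI)
    qed
    moreover have "V0 x \<inter> V = V" unfolding V_def by blast
    moreover have "U0 \<inter> r ` V = r ` V" using sheets_image[OF V0 x U0] unfolding V_def by blast
    ultimately show ?thesis by (simp add: subtopology_subtopology)
  qed
  moreover have "r ` V \<subseteq> U" unfolding V_def by blast
  ultimately have "(V, \<xi> \<circ> r) \<in> atlas Q"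
    unfolding pullback_mfd_atlas using oV assms(3) by (intro exI[of _ U] exI[of _ \<xi>] conjI refl)
  moreover have "x \<in> V" unfolding V_def using sheets_self[OF V0 x U0] assms x by simp
  moreover have "V \<subseteq> N" unfolding V_def by blast
  ultimately show ?thesis by blast
qed

text \<open>In pulled back charts \<open>f\<close> and \<open>r \<circ> f\<close> have the same
  coordinate expression. Continuity is asked for separately because \<open>f\<close> might jump
  between sheets.\<close>

lemma smooth_map_into:
  assumes "continuous_map (mtop N) X f" "smooth_map N P (\<lambda>x. r (f x))"
  shows "smooth_map N Q f"
proof (rule smooth_mapI)
  show "continuous_map (mtop N) (mtop Q) f" using assms(1) by simp
  fix U' \<eta> V \<kappa> assume U': "(U', \<eta>) \<in> atlas N" and V: "(V, \<kappa>) \<in> atlas Q"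
  show "smooth_on (model N) (\<eta> ` {x\<in>U'. f x \<in> V}) (\<kappa> \<circ> f \<circ> inv_into U' \<eta>)"
  proof (rule atlasE[OF V])
    fix U \<xi> assume c: "\<kappa> = \<xi> \<circ> r" "(U, \<xi>) \<in> atlas P" "r ` V \<subseteq> U"
    have "smooth_on (model N) (\<eta> ` {x\<in>U'. f x \<in> V}) (\<xi> \<circ> (\<lambda>x. r (f x)) \<circ> inv_into U' \<eta>)"
      by (rule smooth_on_subset[OF smooth_mapD(2)[OF assms(2) U' c(2)]]) (use c(3) in blast)
    thus ?thesis unfolding c(1) by (simp add: comp_def)
  qed
qed

lemma smooth_map_from:
  assumes "smooth_map P N f"
  shows "smooth_map Q N (\<lambda>x. f (r x))"
proof (rule smooth_mapI)
  show "continuous_map (mtop Q) (mtop N) (\<lambda>x. f (r x))"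
    using continuous_map_compose[OF covering_map_continuous[OF cov] smooth_mapD(1)[OF assms]] by (simp add: comp_def)
  fix V \<kappa> W \<psi> assume V: "(V, \<kappa>) \<in> atlas Q" and W: "(W, \<psi>) \<in> atlas N"
  show "smooth_on (model Q) (\<kappa> ` {x\<in>V. f (r x) \<in> W}) (\<psi> \<circ> (\<lambda>x. f (r x)) \<circ> inv_into V \<kappa>)"
  proof (rule atlasE[OF V])
    fix U \<xi> assume c: "\<kappa> = \<xi> \<circ> r" "(U, \<xi>) \<in> atlas P" "r ` V \<subseteq> U"
      and i: "\<And>x. x \<in> V \<Longrightarrow> inv_into V \<kappa> (\<kappa> x) = x" "\<And>x. x \<in> V \<Longrightarrow> inv_into U \<xi> (\<kappa> x) = r x"
    have "smooth_on (model P) (\<kappa> ` {x\<in>V. f (r x) \<in> W}) (\<psi> \<circ> f \<circ> inv_into U \<xi>)"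
      by (rule smooth_on_subset[OF smooth_mapD(2)[OF assms c(2) W]]) (use c(1,3) in auto)
    hence "smooth_on (model P) (\<kappa> ` {x\<in>V. f (r x) \<in> W}) (\<psi> \<circ> (\<lambda>x. f (r x)) \<circ> inv_into V \<kappa>)"
    proof (rule smooth_on_cong)
      fix u assume "u \<in> \<kappa> ` {x\<in>V. f (r x) \<in> W}"
      then obtain x where x: "x \<in> V" "u = \<kappa> x" by blast
      show "(\<psi> \<circ> f \<circ> inv_into U \<xi>) u = (\<psi> \<circ> (\<lambda>x. f (r x)) \<circ> inv_into V \<kappa>) u"
        unfolding x(2) by (simp add: i[OF x(1)])
    qed
    thus ?thesis by simp
  qed
qed

lemma smooth_map_r: "smooth_map Q P r"
  using smooth_map_from[OF smooth_map_id[OF P]] .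

lemma smooth_manifold_Q: "smooth_manifold Q"
proof (rule smooth_manifoldI)
  show "Hausdorff_space (mtop Q)" "second_countable (mtop Q)" using X by simp_all
  show "subspace (model Q)" using smooth_manifoldD(3)[OF P] by simp
  show "\<exists>V \<kappa>. (V, \<kappa>) \<in> atlas Q \<and> x \<in> V" if "x \<in> mspc Q" for x
  proof -
    have x: "x \<in> topspace X" using that by simp
    obtain U \<xi> where U: "(U, \<xi>) \<in> atlas P" "r x \<in> U" by (rule chart_exists[OF P covering_map_in[OF cov x]])
    show ?thesis using chart_at[OF openin_topspace x U] by blast
  qed
  show "openin (mtop Q) V \<and> openin (top_of_set (model Q)) (\<kappa> ` V) \<and>
      homeomorphic_map (subtopology (mtop Q) V) (top_of_set (\<kappa> ` V)) \<kappa>" if V: "(V, \<kappa>) \<in> atlas Q" for V \<kappa>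
  proof (rule atlasE[OF V])
    fix U \<xi> assume c: "\<kappa> = \<xi> \<circ> r" "openin X V" "(U, \<xi>) \<in> atlas P" "r ` V \<subseteq> U" "openin (mtop P) (r ` V)"
      "homeomorphic_map (subtopology X V) (subtopology (mtop P) (r ` V)) r"
    have im: "\<kappa> ` V = \<xi> ` (r ` V)" unfolding c(1) by (simp add: image_comp)
    have o: "openin (top_of_set (model P)) (\<kappa> ` V)"
      unfolding im by (rule chart_open_image[OF P c(3,5,4)])
    have "homeomorphic_map (subtopology (subtopology (mtop P) U) (r ` V)) (subtopology (top_of_set (\<xi> ` U)) (\<kappa> ` V)) \<xi>"
    proof (rule homeomorphic_map_subtopologies_alt[OF chart_homeo[OF P c(3)]])
      fix y assume "y \<in> topspace (subtopology (mtop P) U)"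
      hence y: "y \<in> U" by simp
      show "(\<xi> y \<in> \<kappa> ` V) = (y \<in> r ` V)"
        unfolding im using inj_on_image_mem_iff[OF chart_inj[OF P c(3)] y c(4)] .
    qed
    moreover have "U \<inter> r ` V = r ` V" "\<xi> ` U \<inter> \<kappa> ` V = \<kappa> ` V" unfolding im using c(4) by blast+
    ultimately have "homeomorphic_map (subtopology (mtop P) (r ` V)) (top_of_set (\<kappa> ` V)) \<xi>"
      by (simp add: subtopology_subtopology)
    from homeomorphic_map_compose[OF c(6) this] have "homeomorphic_map (subtopology X V) (top_of_set (\<kappa> ` V)) \<kappa>"
      unfolding c(1) .
    thus ?thesis using c(2) o by simp
  qed
  show "smooth_on (model Q) (\<kappa> ` (V \<inter> V')) (\<kappa>' \<circ> inv_into V \<kappa>)"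
    if V: "(V, \<kappa>) \<in> atlas Q" and V': "(V', \<kappa>') \<in> atlas Q" for V \<kappa> V' \<kappa>'
  proof (rule atlasE[OF V'])
    fix U' \<xi>' assume c: "\<kappa>' = \<xi>' \<circ> r" "(U', \<xi>') \<in> atlas P" "r ` V' \<subseteq> U'"
    have "smooth_on (model Q) (\<kappa> ` (V \<inter> V')) (\<xi>' \<circ> r \<circ> inv_into V \<kappa>)"
      by (rule smooth_on_subset[OF smooth_mapD(2)[OF smooth_map_r V c(2)]]) (use c(3) in blast)
    thus ?thesis unfolding c(1) .
  qed
qed

end

section \<open>Differentials in charts\<close>

lemma chart_deriv_dir: "chart_deriv U \<xi> \<psi> f x v = dir_deriv (\<psi> \<circ> f \<circ> inv_into U \<xi>) (\<xi> x) v"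
  by (simp add: chart_deriv_def dir_deriv_def comp_def)

lemma chart_domain_open:
  assumes M: "smooth_manifold M" and U: "(U, \<xi>) \<in> atlas M" and f: "continuous_map (mtop M) Y f" and W: "openin Y W"
  shows "openin (top_of_set (model M)) (\<xi> ` {x\<in>U. f x \<in> W})"
proof -
  have "{x\<in>U. f x \<in> W} = U \<inter> {x \<in> mspc M. f x \<in> W}" using chart_subset[OF M U] by blast
  moreover have "openin (mtop M) (U \<inter> {x \<in> mspc M. f x \<in> W})"
    by (intro openin_Int chart_open[OF M U] openin_continuous_map_preimage[OF f W])
  ultimately show ?thesis by (intro chart_open_image[OF M U]) auto
qed

lemma has_vector_derivative_eventually:
  assumes f: "(f has_vector_derivative w) (at (0::real))" and ev: "\<forall>\<^sub>F s in at 0. f s = g s" and "f 0 = g 0"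
  shows "(g has_vector_derivative w) (at 0)"
proof -
  have "\<forall>\<^sub>F s in nhds 0. f s = g s" using ev assms(3) by (simp add: eventually_nhds_conv_at)
  hence "(f has_vector_derivative w) (at 0) = (g has_vector_derivative w) (at 0)"
    using assms(3) by (intro has_vector_derivative_cong_ev) (auto elim: eventually_mono)
  thus ?thesis using f by simp
qed

text \<open>Stated for arbitrary curves with a velocity, because the image of a coordinate line
  under a map is no longer a line.\<close>

lemma chart_deriv_curve:
  assumes M: "smooth_manifold M" and N: "smooth_manifold N" and f: "smooth_map M N f"
    and U: "(U, \<xi>) \<in> atlas M" and W: "(W, \<psi>) \<in> atlas N"
    and c0: "c 0 \<in> U" "f (c 0) \<in> W" and c: "\<forall>\<^sub>F s in at 0. c s \<in> U \<and> f (c s) \<in> W"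
    and d: "((\<lambda>s. \<xi> (c s)) has_vector_derivative w) (at 0)"
  shows "w \<in> model M" "((\<lambda>s. \<psi> (f (c s))) has_vector_derivative chart_deriv U \<xi> \<psi> f (c 0) w) (at 0)"
proof -
  let ?A = "\<xi> ` {x\<in>U. f x \<in> W}"
  have V: "subspace (model M)" by (rule smooth_manifoldD(3)[OF M])
  have A: "openin (top_of_set (model M)) ?A"
    by (rule chart_domain_open[OF M U smooth_mapD(1)[OF f] chart_open[OF N W]])
  have ev: "\<forall>\<^sub>F s in at 0. \<xi> (c s) \<in> ?A" using c by eventually_elim blast
  have 0: "\<xi> (c 0) \<in> ?A" using c0 by blast
  note ch = dir_deriv_chain[OF V A smooth_mapD(2)[OF f U W] d ev 0]
  show "w \<in> model M" by (rule ch(1))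
  show "((\<lambda>s. \<psi> (f (c s))) has_vector_derivative chart_deriv U \<xi> \<psi> f (c 0) w) (at 0)"
    unfolding chart_deriv_dir
  proof (rule has_vector_derivative_eventually[OF ch(2)])
    show "\<forall>\<^sub>F s in at 0. (\<psi> \<circ> f \<circ> inv_into U \<xi>) (\<xi> (c s)) = \<psi> (f (c s))"
      using c by eventually_elim (simp add: chart_inv[OF M U])
  qed (simp add: chart_inv[OF M U] c0)
qed

text \<open>The coordinate line through \<open>x\<close> is the curve that computes
  \<open>chart_deriv\<close>. It runs inside the chart and the preimage of \<open>W\<close> for
  small parameters, hence the eventual statement.\<close>

lemma chart_line:
  assumes M: "smooth_manifold M" and U: "(U, \<xi>) \<in> atlas M" and x: "x \<in> U" and v: "v \<in> model M"
    and f: "continuous_map (mtop M) Y f" and W: "openin Y W" "f x \<in> W"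
    and c_def: "\<And>s. c s = inv_into U \<xi> (\<xi> x + s *\<^sub>R v)"
  shows "c 0 = x" "\<forall>\<^sub>F s in at 0. c s \<in> U \<and> f (c s) \<in> W" "((\<lambda>s. \<xi> (c s)) has_vector_derivative v) (at 0)"
proof -
  let ?A = "\<xi> ` {x\<in>U. f x \<in> W}"
  have A: "openin (top_of_set (model M)) ?A" by (rule chart_domain_open[OF M U f W(1)])
  have xA: "\<xi> x \<in> ?A" using x W(2) by blast
  note o = open_direction[OF smooth_manifoldD(3)[OF M] A xA v]
  have ev: "\<forall>\<^sub>F s in at 0. \<xi> x + s *\<^sub>R v \<in> ?A"
    using topological_tendstoD[OF tendsto_ident_at o] by simp
  show c0: "c 0 = x" unfolding c_def by (simp add: chart_inv[OF M U x])
  have cs: "c s \<in> U \<and> f (c s) \<in> W \<and> \<xi> (c s) = \<xi> x + s *\<^sub>R v" if s: "\<xi> x + s *\<^sub>R v \<in> ?A" for s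
  proof -
    obtain y where y: "y \<in> U" "f y \<in> W" "\<xi> x + s *\<^sub>R v = \<xi> y" using s by (elim imageE) blast
    have "c s = y" unfolding c_def y(3) by (rule chart_inv[OF M U y(1)])
    thus ?thesis using y by simp
  qed
  show "\<forall>\<^sub>F s in at 0. c s \<in> U \<and> f (c s) \<in> W" using ev by eventually_elim (use cs in blast)
  have "((\<lambda>s. \<xi> x + s *\<^sub>R v) has_vector_derivative v) (at 0)" by (auto intro!: derivative_eq_intros)
  thus "((\<lambda>s. \<xi> (c s)) has_vector_derivative v) (at 0)"
  proof (rule has_vector_derivative_eventually)
    show "\<forall>\<^sub>F s in at 0. \<xi> x + s *\<^sub>R v = \<xi> (c s)" using ev by eventually_elim (use cs in simp)
  qed (simp add: c0)
qed

text \<open>\<open>f\<close> takes the coordinate line to a curve whose velocity is the derivative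
  of \<open>f\<close>; the rule for curves then applies to \<open>g\<close>.\<close>

lemma chart_deriv_chain:
  assumes M: "smooth_manifold M" and N: "smooth_manifold N" and L: "smooth_manifold L"
    and f: "smooth_map M N f" and g: "smooth_map N L g"
    and U: "(U, \<xi>) \<in> atlas M" and W: "(W, \<psi>) \<in> atlas N" and Y: "(Y, \<kappa>) \<in> atlas L"
    and x: "x \<in> U" "f x \<in> W" "g (f x) \<in> Y" and v: "v \<in> model M"
  shows "chart_deriv U \<xi> \<psi> f x v \<in> model N"
    "chart_deriv U \<xi> \<kappa> (\<lambda>x. g (f x)) x v = chart_deriv W \<psi> \<kappa> g (f x) (chart_deriv U \<xi> \<psi> f x v)"
proof -
  define c where "c = (\<lambda>s. inv_into U \<xi> (\<xi> x + s *\<^sub>R v))"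
  have fc: "continuous_map (mtop M) (mtop N) f" by (rule smooth_mapD(1)[OF f])
  have gf: "continuous_map (mtop M) (mtop L) (\<lambda>x. g (f x))"
    using continuous_map_compose[OF fc smooth_mapD(1)[OF g]] by (simp add: comp_def)
  have cs: "c s = inv_into U \<xi> (\<xi> x + s *\<^sub>R v)" for s unfolding c_def ..
  note l1 = chart_line[OF M U x(1) v fc chart_open[OF N W] x(2) cs]
  note l2 = chart_line[OF M U x(1) v gf chart_open[OF L Y] x(3) cs]
  have d1: "((\<lambda>s. \<psi> (f (c s))) has_vector_derivative chart_deriv U \<xi> \<psi> f x v) (at 0)"
    using chart_deriv_curve(2)[OF M N f U W _ _ l1(2,3)] x l1(1) by simp
  have ev: "\<forall>\<^sub>F s in at 0. f (c s) \<in> W \<and> g (f (c s)) \<in> Y" using l1(2) l2(2) by eventually_elim blast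
  note d2 = chart_deriv_curve[OF N L g W Y _ _ ev d1, unfolded l1(1), OF x(2,3)]
  show "chart_deriv U \<xi> \<psi> f x v \<in> model N" by (rule d2(1))
  show "chart_deriv U \<xi> \<kappa> (\<lambda>x. g (f x)) x v = chart_deriv W \<psi> \<kappa> g (f x) (chart_deriv U \<xi> \<psi> f x v)"
    using vector_derivative_at[OF d2(2)] unfolding chart_deriv_def[of U] c_def .
qed

lemma chart_deriv_linear:
  assumes M: "smooth_manifold M" and N: "smooth_manifold N" and f: "smooth_map M N f"
    and U: "(U, \<xi>) \<in> atlas M" and W: "(W, \<psi>) \<in> atlas N" and x: "x \<in> U" "f x \<in> W"
  shows "\<exists>D. linear D \<and> (\<forall>v\<in>model M. chart_deriv U \<xi> \<psi> f x v = D v \<and>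
    ((\<lambda>s. \<psi> (f (inv_into U \<xi> (\<xi> x + s *\<^sub>R v)))) has_vector_derivative D v) (at 0))"
proof -
  have "\<xi> x \<in> \<xi> ` {x\<in>U. f x \<in> W}" using x by blast
  from dir_deriv_linear[OF smooth_manifoldD(3)[OF M]
      chart_domain_open[OF M U smooth_mapD(1)[OF f] chart_open[OF N W]] smooth_mapD(2)[OF f U W] this]
  show ?thesis unfolding chart_deriv_dir comp_def .
qed

lemma chart_deriv_ident:
  assumes M: "smooth_manifold M" and U: "(U, \<xi>) \<in> atlas M" and x: "x \<in> U" and v: "v \<in> model M"
  shows "chart_deriv U \<xi> \<xi> (\<lambda>x. x) x v = v"
  using vector_derivative_at[OF chart_line(3)[OF M U x v smooth_mapD(1)[OF smooth_map_id[OF M]] chart_open[OF M U] x refl]]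
  unfolding chart_deriv_def .

text \<open>An injective endomorphism of \<open>V\<close> is onto for reasons of dimension. For the
  converse this is applied to a right inverse of \<open>L\<close>.\<close>

lemma inj_iff_surj_on_subspace:
  fixes L :: "'e::euclidean_space \<Rightarrow> 'e"
  assumes L: "linear L" and V: "subspace V" and LV: "L ` V \<subseteq> V"
  shows "L ` V = V \<longleftrightarrow> (\<forall>v\<in>V. L v = 0 \<longrightarrow> v = 0)"
proof
  have *: "K ` V = V" if K: "linear K" "inj_on K V" "K ` V \<subseteq> V" for K :: "'e \<Rightarrow> 'e"
  proof (rule subspace_dim_equal)
    have sp: "span V = V" using V by (simp add: span_eq_iff)
    have "inj_on K (span V)" unfolding sp by (rule K(2))
    thus "dim V \<le> dim (K ` V)" using dim_image_eq[OF K(1), of V] by simp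
  qed (use K V linear_subspace_image in auto)
  {
    assume "\<forall>v\<in>V. L v = 0 \<longrightarrow> v = 0"
    hence "inj_on L V" using linear_injective_on_subspace_0[OF L V] by simp
    thus "L ` V = V" using *[OF L _ LV] by simp
  }
  assume s: "L ` V = V"
  obtain g where g: "g ` UNIV \<subseteq> V" "linear g" "\<forall>v\<in>L ` V. L (g v) = v"
    using linear_exists_right_inverse_on[OF L V] by (elim exE conjE)
  have "inj_on g V" by (rule inj_on_inverseI[of _ L]) (use g(3) s in simp)
  hence gV: "g ` V = V" using *[OF g(2)] g(1) by blast
  show "\<forall>v\<in>V. L v = 0 \<longrightarrow> v = 0"
  proof (intro ballI impI)
    fix v assume "v \<in> V" and 0: "L v = 0"
    hence "v \<in> g ` V" using gV by simp
    then obtain w where w: "w \<in> V" "v = g w" by (elim imageE)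
    hence "w = 0" using g(3) s 0 by simp
    thus "v = 0" unfolding w(2) using linear_0[OF g(2)] by simp
  qed
qed

section \<open>Transversality of two graphs at a fixed point\<close>

context
  fixes M :: "('a, 'e::euclidean_space) mfd" and \<phi> x
  assumes M: "smooth_manifold M" and \<phi>: "smooth_map M M \<phi>" and x: "x \<in> mspc M" "\<phi> x = x"
begin

text \<open>In the charts \<open>\<alpha>\<close> and \<open>\<beta>\<close> of the factors the two tangent spaces are the graphs of \<open>d(Id)\<close> and \<open>d\<phi>\<close>.\<close>

lemma graphs_span_iff:
  assumes U: "(U, \<xi>) \<in> atlas M" "x \<in> U" and U': "(U', \<xi>') \<in> atlas M" "x \<in> U'"
    and A: "(A, \<alpha>) \<in> atlas M" "x \<in> A" and B: "(B, \<beta>) \<in> atlas M" "x \<in> B"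
  shows "{(chart_deriv U \<xi> \<alpha> (\<lambda>x. x) x u, chart_deriv U \<xi> \<beta> (\<lambda>x. x) x u) +
      (chart_deriv U' \<xi>' \<alpha> (\<lambda>x. x) x v, chart_deriv U' \<xi>' \<beta> \<phi> x v) | u v. u \<in> model M \<and> v \<in> model M}
      = model M \<times> model M \<longleftrightarrow> \<not> (\<exists>v\<in>model M. v \<noteq> 0 \<and> chart_deriv A \<alpha> \<alpha> \<phi> x v = v)"
    (is "?S = _ \<longleftrightarrow> _")
proof -
  note id = smooth_map_id[OF M]
  define V where "V = model M"
  have V: "subspace V" unfolding V_def by (rule smooth_manifoldD(3)[OF M])
  have fx: "\<phi> x \<in> Y" if "x \<in> Y" for Y using that x(2) by simp
  \<comment> \<open>The chart \<open>\<psi>\<close> of the source is arbitrary. Every vector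
    \<open>w\<close> in the chart \<open>\<alpha>\<close> comes from a vector in
    \<open>\<psi>\<close> by the coordinate change, and derivatives along the two agree.\<close>
  have onto: "\<exists>u\<in>V. chart_deriv W \<psi> \<alpha> (\<lambda>x. x) x u = w \<and> (\<forall>f Y \<kappa>. (Y, \<kappa>) \<in> atlas M \<longrightarrow> x \<in> Y \<longrightarrow>
      smooth_map M M f \<longrightarrow> f x = x \<longrightarrow> chart_deriv W \<psi> \<kappa> f x u = chart_deriv A \<alpha> \<kappa> f x w)"
    if W: "(W, \<psi>) \<in> atlas M" "x \<in> W" and w: "w \<in> V" for W \<psi> w
  proof (intro bexI[of _ "chart_deriv A \<alpha> \<psi> (\<lambda>x. x) x w"] conjI allI impI)
    have wM: "w \<in> model M" using w unfolding V_def .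
    show "chart_deriv A \<alpha> \<psi> (\<lambda>x. x) x w \<in> V"
      unfolding V_def by (rule chart_deriv_chain(1)[OF M M M id id A(1) W(1) W(1) A(2) W(2) W(2) wM])
    show "chart_deriv W \<psi> \<alpha> (\<lambda>x. x) x (chart_deriv A \<alpha> \<psi> (\<lambda>x. x) x w) = w"
      using chart_deriv_chain(2)[OF M M M id id A(1) W(1) A(1) A(2) W(2) A(2) wM]
        chart_deriv_ident[OF M A wM] by simp
    fix f Y \<kappa> assume Y: "(Y, \<kappa>) \<in> atlas M" "x \<in> Y" and f: "smooth_map M M f" "f x = x"
    show "chart_deriv W \<psi> \<kappa> f x (chart_deriv A \<alpha> \<psi> (\<lambda>x. x) x w) = chart_deriv A \<alpha> \<kappa> f x w"
      using chart_deriv_chain(2)[OF M M M id f(1) A(1) W(1) Y(1) A(2) W(2) _ wM] f(2) Y(2) by simp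
  qed
  \<comment> \<open>\<open>E\<close> and \<open>E'\<close> are the coordinate changes between
    \<open>\<alpha>\<close> and \<open>\<beta>\<close>, and \<open>D\<close> is the differential of
    \<open>\<phi>\<close> in the chart \<open>\<alpha>\<close> on both sides.\<close>
  obtain E where E: "linear E" "\<forall>v\<in>V. chart_deriv A \<alpha> \<beta> (\<lambda>x. x) x v = E v"
    using chart_deriv_linear[OF M M id A(1) B(1) A(2) B(2)] unfolding V_def by blast
  obtain E' where E': "linear E'" "\<forall>v\<in>V. chart_deriv B \<beta> \<alpha> (\<lambda>x. x) x v = E' v"
    using chart_deriv_linear[OF M M id B(1) A(1) B(2) A(2)] unfolding V_def by blast
  obtain D where D: "linear D" "\<forall>v\<in>V. chart_deriv A \<alpha> \<alpha> \<phi> x v = D v"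
    using chart_deriv_linear[OF M M \<phi> A(1) A(1) A(2) fx[OF A(2)]] unfolding V_def by blast
  have EV: "E v \<in> V" "E' (E v) = v" if v: "v \<in> V" for v
  proof -
    have vM: "v \<in> model M" using v unfolding V_def .
    show *: "E v \<in> V"
      using chart_deriv_chain(1)[OF M M M id id A(1) B(1) B(1) A(2) B(2) B(2) vM] E(2) v unfolding V_def by simp
    show "E' (E v) = v"
      using chart_deriv_chain(2)[OF M M M id id A(1) B(1) A(1) A(2) B(2) A(2) vM]
        chart_deriv_ident[OF M A vM] E(2) E'(2) v * by simp
  qed
  have E'V: "E' v \<in> V" "E (E' v) = v" if v: "v \<in> V" for v
  proof -
    have vM: "v \<in> model M" using v unfolding V_def .
    show *: "E' v \<in> V"
      using chart_deriv_chain(1)[OF M M M id id B(1) A(1) A(1) B(2) A(2) A(2) vM] E'(2) v unfolding V_def by simp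
    show "E (E' v) = v"
      using chart_deriv_chain(2)[OF M M M id id B(1) A(1) B(1) B(2) A(2) B(2) vM]
        chart_deriv_ident[OF M B vM] E(2) E'(2) v * by simp
  qed
  have DV: "D v \<in> V" "chart_deriv A \<alpha> \<beta> \<phi> x v = E (D v)" if v: "v \<in> V" for v
  proof -
    have vM: "v \<in> model M" using v unfolding V_def .
    show *: "D v \<in> V"
      using chart_deriv_chain(1)[OF M M M \<phi> id A(1) A(1) A(1) A(2) fx[OF A(2)] fx[OF A(2)] vM] D(2) v unfolding V_def by simp
    show "chart_deriv A \<alpha> \<beta> \<phi> x v = E (D v)"
      using chart_deriv_chain(2)[OF M M M \<phi> id A(1) A(1) B(1) A(2) fx[OF A(2)] fx[OF B(2)] vM] D(2) E(2) v * x(2) by simp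
  qed
  have U2: "chart_deriv W \<psi> \<alpha> (\<lambda>x. x) x u \<in> V \<and> chart_deriv W \<psi> \<kappa> f x u = chart_deriv A \<alpha> \<kappa> f x (chart_deriv W \<psi> \<alpha> (\<lambda>x. x) x u)"
    if W: "(W, \<psi>) \<in> atlas M" "x \<in> W" and u: "u \<in> V" and f: "smooth_map M M f" "f x = x" and Y: "(Y, \<kappa>) \<in> atlas M" "x \<in> Y"
    for W \<psi> u f Y \<kappa>
  proof -
    have uM: "u \<in> model M" using u unfolding V_def .
    have fY: "f x \<in> Y" using f(2) Y(2) by simp
    show ?thesis using chart_deriv_chain[OF M M M id f(1) W(1) A(1) Y(1) W(2) A(2) fY uM] unfolding V_def by simp
  qed
  \<comment> \<open>Both tangent spaces are now parametrized by vectors in the chart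
    \<open>\<alpha>\<close>; \<open>E\<close> merely rewrites second components in the chart
    \<open>\<beta>\<close>.\<close>
  have S: "?S = {(a + b, E a + E (D b)) | a b. a \<in> V \<and> b \<in> V}"
  proof (rule subset_antisym; rule subsetI)
    fix p assume "p \<in> ?S"
    then obtain u v where uv: "u \<in> V" "v \<in> V" and p: "p = (chart_deriv U \<xi> \<alpha> (\<lambda>x. x) x u, chart_deriv U \<xi> \<beta> (\<lambda>x. x) x u) +
      (chart_deriv U' \<xi>' \<alpha> (\<lambda>x. x) x v, chart_deriv U' \<xi>' \<beta> \<phi> x v)" unfolding V_def mem_Collect_eq by (elim exE conjE)
    note a = U2[OF U uv(1) id refl B] and b = U2[OF U' uv(2) \<phi> x(2) B]
    show "p \<in> {(a + b, E a + E (D b)) | a b. a \<in> V \<and> b \<in> V}"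
      unfolding p mem_Collect_eq
      by (rule exI[of _ "chart_deriv U \<xi> \<alpha> (\<lambda>x. x) x u"], rule exI[of _ "chart_deriv U' \<xi>' \<alpha> (\<lambda>x. x) x v"])
        (use a b E(2) DV(2) in simp)
  next
    fix p assume "p \<in> {(a + b, E a + E (D b)) | a b. a \<in> V \<and> b \<in> V}"
    then obtain a b where ab: "a \<in> V" "b \<in> V" and p: "p = (a + b, E a + E (D b))" unfolding mem_Collect_eq by (elim exE conjE)
    obtain u where u: "u \<in> V" "chart_deriv U \<xi> \<alpha> (\<lambda>x. x) x u = a" "chart_deriv U \<xi> \<beta> (\<lambda>x. x) x u = chart_deriv A \<alpha> \<beta> (\<lambda>x. x) x a"
      using onto[OF U ab(1)] B id by blast
    obtain v where v: "v \<in> V" "chart_deriv U' \<xi>' \<alpha> (\<lambda>x. x) x v = b" "chart_deriv U' \<xi>' \<beta> \<phi> x v = chart_deriv A \<alpha> \<beta> \<phi> x b"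
      using onto[OF U' ab(2)] B \<phi> x(2) by blast
    show "p \<in> ?S"
      unfolding p mem_Collect_eq V_def[symmetric]
      by (rule exI[of _ u], rule exI[of _ v]) (use u v ab E(2) DV(2) in simp)
  qed
  define L where "L = (\<lambda>v. D v - v)"
  have L: "linear L" unfolding L_def by (rule linear_compose_sub[OF D(1) linear_ident])
  have LV: "L ` V \<subseteq> V" unfolding L_def using DV(1) subspace_diff[OF V] by blast
  have "?S = V \<times> V \<longleftrightarrow> L ` V = V"
  proof
    assume *: "?S = V \<times> V"
    have "V \<subseteq> L ` V"
    proof
      fix w assume w: "w \<in> V"
      \<comment> \<open>Test vector: a vanishing first component forces \<open>a = - b\<close>, and
        the second component then exhibits \<open>w\<close> as \<open>D b - b\<close>.\<close>
      hence "(0, E w) \<in> V \<times> V" using subspace_0[OF V] EV(1) by simp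
      hence "(0, E w) \<in> {(a + b, E a + E (D b)) | a b. a \<in> V \<and> b \<in> V}"
        using trans[OF *[symmetric] S] by (rule rev_subsetD[OF _ equalityD1])
      then obtain a b where ab: "a \<in> V" "b \<in> V" "0 = a + b" "E w = E a + E (D b)"
        unfolding mem_Collect_eq prod.inject by (elim exE conjE)
      have a: "a = - b" using ab(3) by (simp add: eq_neg_iff_add_eq_0)
      have "E (D b - b) = E w" unfolding ab(4) a linear_diff[OF E(1)] linear_neg[OF E(1)] by (rule diff_conv_add_uminus[THEN trans, OF add.commute])
      hence "E' (E (D b - b)) = E' (E w)" by (rule arg_cong)
      hence "w = D b - b" unfolding EV(2)[OF w] EV(2)[OF subspace_diff[OF V DV(1)[OF ab(2)] ab(2)]] by (rule sym)
      thus "w \<in> L ` V" using ab(2) unfolding L_def by blast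
    qed
    thus "L ` V = V" using LV by (rule subset_antisym[rotated])
  next
    assume *: "L ` V = V"
    show "?S = V \<times> V"
      unfolding S
    proof (rule subset_antisym; rule subsetI)
      fix p assume "p \<in> {(a + b, E a + E (D b)) | a b. a \<in> V \<and> b \<in> V}"
      thus "p \<in> V \<times> V" using subspace_add[OF V] EV(1) DV(1) by auto
    next
      fix p assume "p \<in> V \<times> V"
      then obtain s t where st: "p = (s, t)" "s \<in> V" "t \<in> V" by (elim SigmaE)
      \<comment> \<open>The system \<open>a + b = s\<close>, \<open>a + D b = E' t\<close> reduces
        to \<open>D b - b = E' t - s\<close>, with \<open>a = s - b\<close>.\<close>
      have "E' t - s \<in> L ` V" unfolding * by (rule subspace_diff[OF V E'V(1)[OF st(3)] st(2)])
      then obtain b where b: "b \<in> V" "E' t - s = D b - b" unfolding L_def by (elim imageE)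
      have t: "E' t = (s - b) + D b" using b(2) by (simp add: algebra_simps)
      have "t = E ((s - b) + D b)" unfolding t[symmetric] by (rule E'V(2)[OF st(3), symmetric])
      hence "t = E (s - b) + E (D b)" using linear_add[OF E(1)] by simp
      thus "p \<in> {(a + b, E a + E (D b)) | a b. a \<in> V \<and> b \<in> V}"
        unfolding st(1) mem_Collect_eq
        by (intro exI[of _ "s - b"] exI[of _ b]) (use b(1) st(2) subspace_diff[OF V] in simp)
    qed
  qed
  also have "\<dots> \<longleftrightarrow> (\<forall>v\<in>V. L v = 0 \<longrightarrow> v = 0)" by (rule inj_iff_surj_on_subspace[OF L V LV])
  also have "\<dots> \<longleftrightarrow> \<not> (\<exists>v\<in>V. v \<noteq> 0 \<and> chart_deriv A \<alpha> \<alpha> \<phi> x v = v)" unfolding L_def using D(2) by auto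
  finally show ?thesis unfolding V_def .
qed

end

section \<open>Smooth coverings\<close>

lemma open_submfd_simps [simp]:
  "mtop (open_submfd M S) = subtopology (mtop M) S" "model (open_submfd M S) = model M"
  by (simp_all add: open_submfd_def)

lemma open_submfd_atlas:
  "(V, \<kappa>) \<in> atlas (open_submfd M S) \<longleftrightarrow> (\<exists>U. (U, \<kappa>) \<in> atlas M \<and> V = U \<inter> S)" by (auto simp: open_submfd_def)

lemma smooth_map_restrict:
  assumes M: "smooth_manifold M" and f: "smooth_map M N f"
  shows "smooth_map (open_submfd M S) N f"
proof (rule smooth_mapI)
  show "continuous_map (mtop (open_submfd M S)) (mtop N) f"
    using continuous_map_from_subtopology[OF smooth_mapD(1)[OF f]] by simp
  fix V \<xi> W \<psi> assume "(V, \<xi>) \<in> atlas (open_submfd M S)" and W: "(W, \<psi>) \<in> atlas N"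
  then obtain U where U: "(U, \<xi>) \<in> atlas M" and V: "V = U \<inter> S" unfolding open_submfd_atlas by (elim exE conjE)
  have "smooth_on (model M) (\<xi> ` {x\<in>U \<inter> S. f x \<in> W}) (\<psi> \<circ> f \<circ> inv_into U \<xi>)"
    by (rule smooth_on_subset[OF smooth_mapD(2)[OF f U W]]) blast
  hence "smooth_on (model M) (\<xi> ` {x\<in>U \<inter> S. f x \<in> W}) (\<psi> \<circ> f \<circ> inv_into (U \<inter> S) \<xi>)"
  proof (rule smooth_on_cong)
    fix u assume "u \<in> \<xi> ` {x\<in>U \<inter> S. f x \<in> W}"
    then obtain x where x: "x \<in> U \<inter> S" "u = \<xi> x" by blast
    have "inv_into (U \<inter> S) \<xi> (\<xi> x) = x" by (rule inv_into_f_f[OF inj_on_subset[OF chart_inj[OF M U]] x(1)]) blast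
    thus "(\<psi> \<circ> f \<circ> inv_into U \<xi>) u = (\<psi> \<circ> f \<circ> inv_into (U \<inter> S) \<xi>) u"
      using chart_inv[OF M U] x by simp
  qed
  thus "smooth_on (model (open_submfd M S)) (\<xi> ` {x\<in>V. f x \<in> W}) (\<psi> \<circ> f \<circ> inv_into V \<xi>)"
    unfolding V by simp
qed

lemma smooth_map_into_open_submfd:
  assumes f: "smooth_map M N f" and S: "f \<in> mspc M \<rightarrow> S"
  shows "smooth_map M (open_submfd N S) f"
proof (rule smooth_mapI)
  show "continuous_map (mtop M) (mtop (open_submfd N S)) f"
    using smooth_mapD(1)[OF f] S by (simp add: continuous_map_in_subtopology image_subset_iff_funcset)
  fix U \<xi> V \<psi> assume U: "(U, \<xi>) \<in> atlas M" and "(V, \<psi>) \<in> atlas (open_submfd N S)"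
  then obtain W where W: "(W, \<psi>) \<in> atlas N" and V: "V = W \<inter> S" unfolding open_submfd_atlas by (elim exE conjE)
  show "smooth_on (model M) (\<xi> ` {x\<in>U. f x \<in> V}) (\<psi> \<circ> f \<circ> inv_into U \<xi>)"
    unfolding V by (rule smooth_on_subset[OF smooth_mapD(2)[OF f U W]]) blast
qed

lemma diffeo_homeomorphic_map:
  assumes "diffeo M N f"
  shows "homeomorphic_map (mtop M) (mtop N) f"
proof -
  obtain g where "smooth_map M N f" "smooth_map N M g" "\<forall>x\<in>mspc M. g (f x) = x" "\<forall>y\<in>mspc N. f (g y) = y"
    using assms unfolding diffeo_def by (elim exE conjE)
  hence "homeomorphic_maps (mtop M) (mtop N) f g"
    unfolding homeomorphic_maps_def by (intro conjI smooth_mapD(1))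
  thus ?thesis by (rule homeomorphic_maps_imp_map)
qed

lemma smooth_covering_covering_map:
  assumes "smooth_covering X P r"
  shows "covering_map (mtop X) (mtop P) r"
  unfolding covering_map_def
proof (intro conjI ballI)
  have s: "smooth_map X P r" "r ` mspc X = mspc P" and
    *: "\<forall>x\<in>mspc P. \<exists>U \<V>. openin (mtop P) U \<and> x \<in> U \<and> \<Union>\<V> = {y\<in>mspc X. r y \<in> U} \<and> pairwise disjnt \<V> \<and>
        (\<forall>V\<in>\<V>. openin (mtop X) V \<and> diffeo (open_submfd X V) (open_submfd P U) r)"
    using assms unfolding smooth_covering_def by blast+
  show "continuous_map (mtop X) (mtop P) r" by (rule smooth_mapD(1)[OF s(1)])
  show "r ` mspc X = mspc P" by (rule s(2))
  fix x assume "x \<in> mspc P"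
  from bspec[OF * this] obtain U \<V> where c: "openin (mtop P) U" "x \<in> U" "\<Union>\<V> = {y\<in>mspc X. r y \<in> U}" "pairwise disjnt \<V>"
    "\<forall>V\<in>\<V>. openin (mtop X) V \<and> diffeo (open_submfd X V) (open_submfd P U) r" by (elim exE conjE)
  have "\<forall>V\<in>\<V>. openin (mtop X) V \<and> homeomorphic_map (subtopology (mtop X) V) (subtopology (mtop P) U) r"
    using c(5) diffeo_homeomorphic_map[of "open_submfd X _" "open_submfd P U" r] by (simp only: open_submfd_simps) blast
  thus "\<exists>U \<V>. openin (mtop P) U \<and> x \<in> U \<and> \<Union>\<V> = {y\<in>mspc X. r y \<in> U} \<and> pairwise disjnt \<V> \<and>
      (\<forall>V\<in>\<V>. openin (mtop X) V \<and> homeomorphic_map (subtopology (mtop X) V) (subtopology (mtop P) U) r)"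
    using c(1-4) by (intro exI[of _ U] exI[of _ \<V>] conjI)
qed

context pullback
begin

text \<open>The inverse of \<open>r\<close> on a sheet is smooth by \<open>smooth_map_into\<close>,
  as it becomes the identity after composition with \<open>r\<close>.\<close>

lemma smooth_covering_Q: "smooth_covering Q P r"
  unfolding smooth_covering_def
proof (intro conjI ballI)
  show "smooth_map Q P r" by (rule smooth_map_r)
  show "r ` mspc Q = mspc P" using covering_map_surj[OF cov] by simp
  fix x assume x: "x \<in> mspc P"
  have "\<forall>x\<in>mspc P. \<exists>U \<V>. openin (mtop P) U \<and> x \<in> U \<and> \<Union>\<V> = {y\<in>topspace X. r y \<in> U} \<and> pairwise disjnt \<V> \<and>
      (\<forall>V\<in>\<V>. openin X V \<and> homeomorphic_map (subtopology X V) (subtopology (mtop P) U) r)"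
    using cov unfolding covering_map_def by (elim conjE)
  from bspec[OF this x] obtain U \<V> where c: "openin (mtop P) U" "x \<in> U" "\<Union>\<V> = {y\<in>topspace X. r y \<in> U}" "pairwise disjnt \<V>"
      "\<forall>V\<in>\<V>. openin X V \<and> homeomorphic_map (subtopology X V) (subtopology (mtop P) U) r" by (elim exE conjE)
  have UP: "U \<subseteq> mspc P" using c(1) by (rule openin_subset)
  have "diffeo (open_submfd Q V) (open_submfd P U) r" if V: "V \<in> \<V>" for V
  proof -
    have oV: "openin X V" and hV: "homeomorphic_map (subtopology X V) (subtopology (mtop P) U) r"
      using bspec[OF c(5) V] by simp_all
    have VX: "V \<subseteq> topspace X" using oV by (rule openin_subset)
    obtain s where s: "homeomorphic_maps (subtopology X V) (subtopology (mtop P) U) r s"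
      using hV unfolding homeomorphic_map_maps by (elim exE)
    have tV: "topspace (subtopology X V) = V" "topspace (subtopology (mtop P) U) = U"
      using VX UP by (simp_all add: Int_absorb1)
    have sr: "\<And>y. y \<in> V \<Longrightarrow> s (r y) = y" "\<And>z. z \<in> U \<Longrightarrow> r (s z) = z"
      and sc: "continuous_map (subtopology (mtop P) U) X s" and sV: "s \<in> U \<rightarrow> V"
      using s unfolding homeomorphic_maps_def continuous_map_in_subtopology tV by blast+
    have "smooth_map (open_submfd P U) P (\<lambda>z. r (s z))"
    proof (rule smooth_map_cong[OF _ smooth_map_restrict[OF P smooth_map_id[OF P]]])
      show "\<Union>(fst ` atlas (open_submfd P U)) = mspc (open_submfd P U)"
        using smooth_manifoldD(4)[OF P] unfolding open_submfd_def by force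
      show "z = r (s z)" if "z \<in> mspc (open_submfd P U)" for z using sr(2)[of z] that by simp
    qed
    hence "smooth_map (open_submfd P U) Q s" using sc by (intro smooth_map_into) simp_all
    hence "smooth_map (open_submfd P U) (open_submfd Q V) s" by (rule smooth_map_into_open_submfd) (use sV in auto)
    moreover have "smooth_map (open_submfd Q V) (open_submfd P U) r"
      by (rule smooth_map_into_open_submfd[OF smooth_map_restrict[OF smooth_manifold_Q smooth_map_r]])
        (use c(3) V in auto)
    ultimately show ?thesis unfolding diffeo_def using sr by auto
  qed
  thus "\<exists>U \<V>. openin (mtop P) U \<and> x \<in> U \<and> \<Union>\<V> = {y\<in>mspc Q. r y \<in> U} \<and> pairwise disjnt \<V> \<and>
      (\<forall>V\<in>\<V>. openin (mtop Q) V \<and> diffeo (open_submfd Q V) (open_submfd P U) r)"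
    using c by (intro exI[of _ U] exI[of _ \<V>]) simp
qed

text \<open>The two directions differ since \<open>Q\<close> has pulled back charts and
  \<open>X'\<close> an arbitrary atlas. The inverse of \<open>f\<close> is smooth because
  \<open>r\<close> after it is \<open>r'\<close>; \<open>f\<close> itself is locally
  \<open>r\<close> followed by the smooth inverse of \<open>r'\<close> on a sheet.\<close>

lemma cover_iso_smooth_covering:
  assumes X': "smooth_manifold X'" and r': "smooth_covering X' P r'" and f: "homeomorphic_map X (mtop X') f"
    and rf: "\<And>x. x \<in> topspace X \<Longrightarrow> r' (f x) = r x"
  shows "cover_iso Q r X' r' f"
proof -
  obtain g where "homeomorphic_maps X (mtop X') f g" using f unfolding homeomorphic_map_maps by (elim exE)
  hence fc: "continuous_map X (mtop X') f" and gc: "continuous_map (mtop X') X g"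
    and gf: "\<And>x. x \<in> topspace X \<Longrightarrow> g (f x) = x" and fg: "\<And>y. y \<in> mspc X' \<Longrightarrow> f (g y) = y"
    unfolding homeomorphic_maps_def by blast+
  have sr': "smooth_map X' P r'"
    and loc: "\<forall>x\<in>mspc P. \<exists>U \<V>. openin (mtop P) U \<and> x \<in> U \<and> \<Union>\<V> = {y\<in>mspc X'. r' y \<in> U} \<and> pairwise disjnt \<V> \<and>
        (\<forall>V\<in>\<V>. openin (mtop X') V \<and> diffeo (open_submfd X' V) (open_submfd P U) r')"
    using r' unfolding smooth_covering_def by blast+
  have "smooth_map X' P (\<lambda>y. r (g y))"
  proof (rule smooth_map_cong[OF smooth_manifoldD(4)[OF X'] sr'])
    fix y assume y: "y \<in> mspc X'"
    have "g y \<in> topspace X" using gc y by (simp add: continuous_map_def Pi_iff)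
    from rf[OF this] show "r' y = r (g y)" using fg[OF y] by simp
  qed
  hence g: "smooth_map X' Q g" by (rule smooth_map_into[OF gc])
  have fc': "continuous_map (mtop Q) (mtop X') f" using fc by simp
  have "smooth_map Q X' f"
  proof (rule smooth_mapI[OF fc'])
    fix V \<kappa> W \<psi> assume V: "(V, \<kappa>) \<in> atlas Q" and W: "(W, \<psi>) \<in> atlas X'"
    show "smooth_on (model Q) (\<kappa> ` {x\<in>V. f x \<in> W}) (\<psi> \<circ> f \<circ> inv_into V \<kappa>)"
    proof (rule smooth_on_local[OF smooth_manifoldD(3)[OF smooth_manifold_Q]
          chart_domain_open[OF smooth_manifold_Q V fc' chart_open[OF X' W]]])
      fix u assume "u \<in> \<kappa> ` {x\<in>V. f x \<in> W}"
      then obtain x where x: "x \<in> V" "f x \<in> W" "u = \<kappa> x" by blast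
      show "\<exists>A. openin (top_of_set (model Q)) A \<and> u \<in> A \<and> A \<subseteq> \<kappa> ` {x\<in>V. f x \<in> W} \<and>
          smooth_on (model Q) A (\<psi> \<circ> f \<circ> inv_into V \<kappa>)"
      proof (rule atlasE[OF V])
        fix U \<xi> assume c: "\<kappa> = \<xi> \<circ> r" "openin X V" "(U, \<xi>) \<in> atlas P" "r ` V \<subseteq> U"
          and iV: "\<And>x. x \<in> V \<Longrightarrow> inv_into V \<kappa> (\<kappa> x) = x"
        have VX: "V \<subseteq> topspace X" using c(2) by (rule openin_subset)
        have xX: "x \<in> topspace X" using VX x(1) by blast
        obtain U0 \<V> where U0: "openin (mtop P) U0" "r x \<in> U0" "\<Union>\<V> = {y\<in>mspc X'. r' y \<in> U0}"
          "\<forall>V\<in>\<V>. openin (mtop X') V \<and> diffeo (open_submfd X' V) (open_submfd P U0) r'"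
          using bspec[OF loc covering_map_in[OF cov xX]] by (elim exE conjE)
        have "f x \<in> mspc X'" using fc xX by (simp add: continuous_map_def Pi_iff)
        hence "f x \<in> \<Union>\<V>" unfolding U0(3) using rf[OF xX] U0(2) by simp
        then obtain V' where V': "V' \<in> \<V>" "f x \<in> V'" by (elim UnionE)
        have oV': "openin (mtop X') V'" and d: "diffeo (open_submfd X' V') (open_submfd P U0) r'"
          using bspec[OF U0(4) V'(1)] by simp_all
        obtain h where h: "smooth_map (open_submfd P U0) (open_submfd X' V') h"
          "\<forall>y\<in>mspc (open_submfd X' V'). h (r' y) = y" using d unfolding diffeo_def by (elim exE conjE)
        have hV: "r y \<in> U \<inter> U0 \<and> h (r y) = f y" if y: "y \<in> V" "f y \<in> V'" for y
        proof -
          have fy: "f y \<in> mspc (open_submfd X' V')" using y(2) openin_subset[OF oV'] by auto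
          moreover have "r' (f y) = r y" by (rule rf) (use VX y(1) in blast)
          moreover have "r' (f y) \<in> U0" using V'(1) U0(3) y(2) by blast
          ultimately show ?thesis using bspec[OF h(2) fy] c(4) y(1) by (auto simp: image_subset_iff)
        qed
        let ?A = "\<kappa> ` {y\<in>V. f y \<in> W \<inter> V'}"
        have hs: "smooth_on (model P) (\<xi> ` {z\<in>U \<inter> U0. h z \<in> W \<inter> V'}) (\<psi> \<circ> h \<circ> inv_into (U \<inter> U0) \<xi>)"
        proof -
          have "(U \<inter> U0, \<xi>) \<in> atlas (open_submfd P U0)" "(W \<inter> V', \<psi>) \<in> atlas (open_submfd X' V')"
            unfolding open_submfd_atlas using c(3) W by blast+
          from smooth_mapD(2)[OF h(1) this] show ?thesis by simp
        qed
        have "smooth_on (model P) ?A (\<psi> \<circ> h \<circ> inv_into (U \<inter> U0) \<xi>)"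
        proof (rule smooth_on_subset[OF hs], rule subsetI)
          fix w assume "w \<in> ?A"
          then obtain y where y: "y \<in> V" "f y \<in> W" "f y \<in> V'" "w = \<xi> (r y)" unfolding c(1) by auto
          show "w \<in> \<xi> ` {z\<in>U \<inter> U0. h z \<in> W \<inter> V'}" unfolding y(4) by (rule imageI) (use hV[OF y(1,3)] y in simp)
        qed
        hence "smooth_on (model P) ?A (\<psi> \<circ> f \<circ> inv_into V \<kappa>)"
        proof (rule smooth_on_cong)
          fix w assume "w \<in> ?A"
          then obtain y where y: "y \<in> V" "f y \<in> W" "f y \<in> V'" "w = \<kappa> y" by auto
          note hy = hV[OF y(1,3)]
          have "inv_into (U \<inter> U0) \<xi> (\<xi> (r y)) = r y"
            by (rule inv_into_f_f[OF inj_on_subset[OF chart_inj[OF P c(3)]]]) (use hy in auto)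
          hence "inv_into (U \<inter> U0) \<xi> w = r y" unfolding y(4) c(1) by simp
          thus "(\<psi> \<circ> h \<circ> inv_into (U \<inter> U0) \<xi>) w = (\<psi> \<circ> f \<circ> inv_into V \<kappa>) w"
            using hy iV[OF y(1)] unfolding y(4) by simp
        qed
        moreover have "openin (top_of_set (model Q)) ?A"
          by (rule chart_domain_open[OF smooth_manifold_Q V fc' openin_Int[OF chart_open[OF X' W] oV']])
        moreover have "u \<in> ?A" unfolding x(3) using x(1,2) V'(2) by blast
        moreover have "?A \<subseteq> \<kappa> ` {x\<in>V. f x \<in> W}" by blast
        ultimately show ?thesis by (intro exI[of _ ?A]) simp
      qed
    qed
  qed
  thus ?thesis unfolding cover_iso_def diffeo_def using g gf fg rf by auto
qed

end

section \<open>Lifts to coverings of a product\<close>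

lemma smooth_map_Pair:
  assumes f: "smooth_map M N f" and g: "smooth_map M N' g"
  shows "smooth_map M (prod_mfd N N') (\<lambda>x. (f x, g x))"
proof (rule smooth_mapI)
  show "continuous_map (mtop M) (mtop (prod_mfd N N')) (\<lambda>x. (f x, g x))"
    using continuous_map_pairedI[OF smooth_mapD(1)[OF f] smooth_mapD(1)[OF g]] by simp
  fix U \<xi> V \<kappa> assume U: "(U, \<xi>) \<in> atlas M" and "(V, \<kappa>) \<in> atlas (prod_mfd N N')"
  then obtain A \<alpha> B \<beta> where c: "(A, \<alpha>) \<in> atlas N" "(B, \<beta>) \<in> atlas N'" "V = A \<times> B" "\<kappa> = map_prod \<alpha> \<beta>"
    unfolding prod_mfd_atlas by (elim exE conjE)
  have "smooth_on (model M) (\<xi> ` {x\<in>U. (f x, g x) \<in> V}) (\<lambda>u. ((\<alpha> \<circ> f \<circ> inv_into U \<xi>) u, (\<beta> \<circ> g \<circ> inv_into U \<xi>) u))"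
    unfolding c(3) by (intro smooth_on_Pair smooth_on_subset[OF smooth_mapD(2)[OF f U c(1)]]
        smooth_on_subset[OF smooth_mapD(2)[OF g U c(2)]]) auto
  thus "smooth_on (model M) (\<xi> ` {x\<in>U. (f x, g x) \<in> V}) (\<kappa> \<circ> (\<lambda>x. (f x, g x)) \<circ> inv_into U \<xi>)"
    unfolding c(4) by (simp add: comp_def)
qed

locale pullback_prod = pullback "prod_mfd M1 M2" X r
  for M1 :: "('a, 'e::euclidean_space) mfd" and M2 :: "('b, 'f::euclidean_space) mfd"
    and X :: "'x topology" and r +
  assumes M1: "smooth_manifold M1" and M2: "smooth_manifold M2"
begin

lemma prod_atlasE:
  assumes "(W, \<psi>) \<in> atlas Q"
  obtains A \<alpha> B \<beta> where "(A, \<alpha>) \<in> atlas M1" "(B, \<beta>) \<in> atlas M2" "\<psi> = map_prod \<alpha> \<beta> \<circ> r"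
    "\<And>p. p \<in> W \<Longrightarrow> p \<in> topspace X \<and> fst (r p) \<in> A \<and> snd (r p) \<in> B"
proof (rule atlasE[OF assms])
  fix U \<xi> assume c: "\<psi> = \<xi> \<circ> r" "openin X W" "(U, \<xi>) \<in> atlas (prod_mfd M1 M2)" "r ` W \<subseteq> U"
  obtain A \<alpha> B \<beta> where d: "(A, \<alpha>) \<in> atlas M1" "(B, \<beta>) \<in> atlas M2" "U = A \<times> B" "\<xi> = map_prod \<alpha> \<beta>"
    using c(3) unfolding prod_mfd_atlas by (elim exE conjE)
  show thesis
  proof (rule that[OF d(1,2)])
    show "\<psi> = map_prod \<alpha> \<beta> \<circ> r" using c(1) d(4) by simp
    fix p assume p: "p \<in> W"
    hence "r p \<in> A \<times> B" using c(4) d(3) by blast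
    thus "p \<in> topspace X \<and> fst (r p) \<in> A \<and> snd (r p) \<in> B"
      using openin_subset[OF c(2)] p by (auto simp: mem_Times_iff)
  qed
qed

lemma r_in: "p \<in> topspace X \<Longrightarrow> fst (r p) \<in> mspc M1 \<and> snd (r p) \<in> mspc M2"
  using covering_map_in[OF cov] by (auto simp: mem_Times_iff)

context
  fixes \<phi> G
  assumes \<phi>: "smooth_map M1 M2 \<phi>" and G: "continuous_map (mtop M1) X G"
    and rG: "\<And>x. x \<in> mspc M1 \<Longrightarrow> r (G x) = (x, \<phi> x)"
begin

text \<open>Computed along the coordinate line through \<open>x\<close>: there
  \<open>r \<circ> G\<close> is the graph map, which is differentiated componentwise.\<close>

lemma graph_deriv:
  assumes U: "(U, \<xi>) \<in> atlas M1" "x \<in> U" and A: "(A, \<alpha>) \<in> atlas M1" "x \<in> A"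
    and B: "(B, \<beta>) \<in> atlas M2" "\<phi> x \<in> B" and v: "v \<in> model M1"
  shows "chart_deriv U \<xi> (map_prod \<alpha> \<beta> \<circ> r) G x v = (chart_deriv U \<xi> \<alpha> (\<lambda>x. x) x v, chart_deriv U \<xi> \<beta> \<phi> x v)"
proof -
  define c where "c = (\<lambda>s. inv_into U \<xi> (\<xi> x + s *\<^sub>R v))"
  have cs: "c s = inv_into U \<xi> (\<xi> x + s *\<^sub>R v)" for s unfolding c_def ..
  note l = chart_line[OF M1 U v smooth_mapD(1)[OF smooth_map_id[OF M1]] chart_open[OF M1 U(1)] U(2) cs]
  have d1: "((\<lambda>s. \<alpha> (c s)) has_vector_derivative chart_deriv U \<xi> \<alpha> (\<lambda>x. x) x v) (at 0)"
    using chart_deriv_linear[OF M1 M1 smooth_map_id[OF M1] U(1) A(1) U(2) A(2)] v unfolding c_def by auto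
  have d2: "((\<lambda>s. \<beta> (\<phi> (c s))) has_vector_derivative chart_deriv U \<xi> \<beta> \<phi> x v) (at 0)"
    using chart_deriv_linear[OF M1 M2 \<phi> U(1) B(1) U(2) B(2)] v unfolding c_def by auto
  have e: "(\<alpha> y, \<beta> (\<phi> y)) = (map_prod \<alpha> \<beta> \<circ> r) (G y)" if "y \<in> U" for y
    using rG[of y] chart_subset[OF M1 U(1)] that by auto
  have "((\<lambda>s. (map_prod \<alpha> \<beta> \<circ> r) (G (c s))) has_vector_derivative
      (chart_deriv U \<xi> \<alpha> (\<lambda>x. x) x v, chart_deriv U \<xi> \<beta> \<phi> x v)) (at 0)"
  proof (rule has_vector_derivative_eventually[OF has_vector_derivative_Pair[OF d1 d2]])
    show "\<forall>\<^sub>F s in at 0. (\<alpha> (c s), \<beta> (\<phi> (c s))) = (map_prod \<alpha> \<beta> \<circ> r) (G (c s))"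
      using l(2) by eventually_elim (use e in blast)
    show "(\<alpha> (c 0), \<beta> (\<phi> (c 0))) = (map_prod \<alpha> \<beta> \<circ> r) (G (c 0))" unfolding l(1) by (rule e[OF U(2)])
  qed
  from vector_derivative_at[OF this] show ?thesis unfolding chart_deriv_def[of U \<xi> "map_prod \<alpha> \<beta> \<circ> r"] c_def .
qed

text \<open>An embedding because \<open>fst \<circ> r\<close> is a left inverse; an immersion
  because the first component of the derivative is a coordinate change of \<open>M1\<close>, which
  has an inverse.\<close>

lemma graph_lift: "graph_lift M1 Q r \<phi> G"
  unfolding graph_lift_def smooth_embedding_def immersion_def
proof (intro conjI ballI)
  have "smooth_map M1 (prod_mfd M1 M2) (\<lambda>x. r (G x))"
    by (rule smooth_map_cong[OF smooth_manifoldD(4)[OF M1] smooth_map_Pair[OF smooth_map_id[OF M1] \<phi>]])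
      (simp add: rG)
  thus "smooth_map M1 Q G" by (rule smooth_map_into[OF G])
  show "r (G x) = (x, \<phi> x)" if "x \<in> mspc M1" for x using that by (rule rG)
  have "continuous_map X (mtop M1) (\<lambda>p. fst (r p))"
    using continuous_map_compose[OF covering_map_continuous[OF cov], of "mtop M1" fst]
    by (simp add: comp_def continuous_map_fst)
  hence "section_map (mtop M1) X G"
    unfolding section_map_def retraction_maps_def using G rG by (intro exI[of _ "\<lambda>p. fst (r p)"]) simp
  thus "embedding_map (mtop M1) (mtop Q) G" using section_imp_embedding_map by simp
  have inj: "inj_on (chart_deriv U \<xi> \<psi> G x) (model M1)"
    if U: "(U, \<xi>) \<in> atlas M1" "x \<in> U" and W: "(W, \<psi>) \<in> atlas Q" "G x \<in> W" for U \<xi> W \<psi> x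
  proof (rule prod_atlasE[OF W(1)], rule inj_onI)
    fix A \<alpha> B \<beta> u v
    assume A: "(A, \<alpha>) \<in> atlas M1" and B: "(B, \<beta>) \<in> atlas M2" and \<psi>: "\<psi> = map_prod \<alpha> \<beta> \<circ> r"
      and in_W: "\<And>p. p \<in> W \<Longrightarrow> p \<in> topspace X \<and> fst (r p) \<in> A \<and> snd (r p) \<in> B"
      and u: "u \<in> model M1" and v: "v \<in> model M1" and eq: "chart_deriv U \<xi> \<psi> G x u = chart_deriv U \<xi> \<psi> G x v"
    have x: "x \<in> A" "\<phi> x \<in> B" using in_W[OF W(2)] rG[of x] chart_subset[OF M1 U(1)] U(2) by auto
    note gd = graph_deriv[OF U A x(1) B x(2), folded \<psi>]
    have *: "chart_deriv U \<xi> \<alpha> (\<lambda>x. x) x u = chart_deriv U \<xi> \<alpha> (\<lambda>x. x) x v" using eq gd[OF u] gd[OF v] by simp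
    have "w = chart_deriv A \<alpha> \<xi> (\<lambda>x. x) x (chart_deriv U \<xi> \<alpha> (\<lambda>x. x) x w)" if w: "w \<in> model M1" for w
      using chart_deriv_chain(2)[OF M1 M1 M1 smooth_map_id[OF M1] smooth_map_id[OF M1] U(1) A U(1) U(2) x(1) U(2) w]
        chart_deriv_ident[OF M1 U w] by simp
    from this[OF u] this[OF v] show "u = v" using * by simp
  qed
  show "case c of (U, \<xi>) \<Rightarrow> \<forall>(W, \<psi>)\<in>atlas Q. \<forall>x\<in>U. G x \<in> W \<longrightarrow> inj_on (chart_deriv U \<xi> \<psi> G x) (model M1)"
    if "c \<in> atlas M1" for c
    unfolding split_beta
  proof (intro ballI impI)
    fix d x assume "d \<in> atlas Q" "x \<in> fst c" "G x \<in> fst d"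
    thus "inj_on (chart_deriv (fst c) (snd c) (snd d) G x) (model M1)" by (intro inj) (use that in simp_all)
  qed
qed

end

lemma graph_liftD:
  assumes "graph_lift M1 Q r \<phi> G"
  shows "continuous_map (mtop M1) X G" "x \<in> mspc M1 \<Longrightarrow> r (G x) = (x, \<phi> x)"
proof -
  have e: "smooth_map M1 Q G" and g: "\<forall>x\<in>mspc M1. r (G x) = (x, \<phi> x)"
    using assms unfolding graph_lift_def smooth_embedding_def immersion_def by blast+
  show "continuous_map (mtop M1) X G" using smooth_mapD(1)[OF e] by simp
  show "x \<in> mspc M1 \<Longrightarrow> r (G x) = (x, \<phi> x)" using g by blast
qed

lemma smooth_map_lift:
  assumes h: "smooth_map M2 M2 h" and f: "continuous_map X X f"
    and rf: "\<And>p. p \<in> topspace X \<Longrightarrow> r (f p) = map_prod id h (r p)"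
  shows "smooth_map Q Q f"
proof (rule smooth_map_into)
  show "continuous_map (mtop Q) X f" using f by simp
  show "smooth_map Q (prod_mfd M1 M2) (\<lambda>p. r (f p))"
  proof (rule smooth_map_cong[OF smooth_manifoldD(4)[OF smooth_manifold_Q]
        smooth_map_from[OF smooth_map_prod_chart[OF M1 M2 smooth_map_id[OF M1] h]]])
    fix p assume "p \<in> mspc Q"
    thus "map_prod (\<lambda>x. x) h (r p) = r (f p)" using rf by (simp add: id_def)
  qed
qed

text \<open>The inverse \<open>g\<close> lies over the identity times the inverse of
  \<open>h\<close>, so \<open>smooth_map_lift\<close> applies to it as well.\<close>

lemma diffeo_lift:
  assumes h: "diffeo M2 M2 h" and f: "continuous_map X X f" and g: "continuous_map X X g"
    and gf: "\<And>p. p \<in> topspace X \<Longrightarrow> g (f p) = p" and fg: "\<And>p. p \<in> topspace X \<Longrightarrow> f (g p) = p"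
    and rf: "\<And>p. p \<in> topspace X \<Longrightarrow> r (f p) = map_prod id h (r p)"
  shows "diffeo Q Q f"
proof -
  obtain k where k: "smooth_map M2 M2 h" "smooth_map M2 M2 k" "\<forall>x\<in>mspc M2. k (h x) = x"
    using h unfolding diffeo_def by (elim exE conjE)
  have "r (g p) = map_prod id k (r p)" if p: "p \<in> topspace X" for p
  proof -
    have gp: "g p \<in> topspace X" using g p by (simp add: continuous_map_def Pi_iff)
    have "r p = map_prod id h (r (g p))" using rf[OF gp] fg[OF p] by simp
    thus ?thesis using k(3) r_in[OF gp] by (cases "r (g p)") simp
  qed
  hence "smooth_map Q Q g" by (rule smooth_map_lift[OF k(2) g])
  thus ?thesis unfolding diffeo_def using smooth_map_lift[OF k(1) f rf] gf fg by auto
qed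

text \<open>In coordinates \<open>\<psi>\<close> consists of a coordinate change of
  \<open>M1\<close> and the coordinate expression of \<open>\<phi>\<close>, each composed with a
  linear projection.\<close>

lemma smooth_family_lift:
  assumes \<phi>: "smooth_family M2 M2 \<phi>"
    and \<psi>: "continuous_map (prod_topology I01 X) X (\<lambda>(t, p). \<psi> t p)"
    and r\<psi>: "\<And>t p. t \<in> {0..1} \<Longrightarrow> p \<in> topspace X \<Longrightarrow> r (\<psi> t p) = map_prod id (\<phi> t) (r p)"
  shows "smooth_family Q Q \<psi>"
proof -
  have "smooth_on (UNIV \<times> model Q) {(t, u). t \<in> {0..1} \<and> u \<in> \<kappa> ` V \<and> \<psi> t (inv_into V \<kappa> u) \<in> V'}
      (\<lambda>(t, u). \<kappa>' (\<psi> t (inv_into V \<kappa> u)))" (is "smooth_on _ ?S _")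
    if V: "(V, \<kappa>) \<in> atlas Q" and V': "(V', \<kappa>') \<in> atlas Q" for V \<kappa> V' \<kappa>'
  proof (rule prod_atlasE[OF V], rule prod_atlasE[OF V'])
    fix A \<alpha> B \<beta> A' \<alpha>' B' \<beta>'
    assume A: "(A, \<alpha>) \<in> atlas M1" and B: "(B, \<beta>) \<in> atlas M2" and \<kappa>: "\<kappa> = map_prod \<alpha> \<beta> \<circ> r"
      and in_V: "\<And>p. p \<in> V \<Longrightarrow> p \<in> topspace X \<and> fst (r p) \<in> A \<and> snd (r p) \<in> B"
      and A': "(A', \<alpha>') \<in> atlas M1" and B': "(B', \<beta>') \<in> atlas M2" and \<kappa>': "\<kappa>' = map_prod \<alpha>' \<beta>' \<circ> r"
      and in_V': "\<And>p. p \<in> V' \<Longrightarrow> p \<in> topspace X \<and> fst (r p) \<in> A' \<and> snd (r p) \<in> B'"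
    have pt: "\<exists>p. t \<in> {0..1} \<and> p \<in> V \<and> \<psi> t p \<in> V' \<and> inv_into V \<kappa> u = p \<and> u = (\<alpha> (fst (r p)), \<beta> (snd (r p))) \<and>
        r (\<psi> t p) = (fst (r p), \<phi> t (snd (r p)))" if "(t, u) \<in> ?S" for t u
    proof -
      have tu: "t \<in> {0..1}" "u \<in> \<kappa> ` V" "\<psi> t (inv_into V \<kappa> u) \<in> V'" using that by auto
      obtain p where p: "p \<in> V" "u = \<kappa> p" using tu(2) by (elim imageE)
      have i: "inv_into V \<kappa> u = p" unfolding p(2) by (rule chart_inv[OF smooth_manifold_Q V p(1)])
      have "r (\<psi> t p) = (fst (r p), \<phi> t (snd (r p)))"
        using r\<psi>[OF tu(1), of p] in_V[OF p(1)] by (simp add: map_prod_def case_prod_unfold)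
      moreover have "u = (\<alpha> (fst (r p)), \<beta> (snd (r p)))" unfolding p(2) \<kappa> by (simp add: map_prod_def case_prod_unfold)
      ultimately show ?thesis using tu i p(1) by auto
    qed
    let ?f = "\<lambda>x. (\<alpha>' \<circ> (\<lambda>x. x) \<circ> inv_into A \<alpha>) (fst (snd x))"
    let ?g = "\<lambda>x. (\<lambda>(t, u). \<beta>' (\<phi> t (inv_into B \<beta> u))) (fst x, snd (snd x))"
    have id: "smooth_on (model M1) (\<alpha> ` {x\<in>A. x \<in> A'}) (\<alpha>' \<circ> (\<lambda>x. x) \<circ> inv_into A \<alpha>)"
      by (rule smooth_mapD(2)[OF smooth_map_id[OF M1] A A'])
    have f: "smooth_on (UNIV \<times> model Q) ?S ?f"
    proof (rule smooth_on_linear[OF _ _ id])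
      show "bounded_linear (\<lambda>x. fst (snd x))"
        by (rule bounded_linear_compose[OF bounded_linear_fst bounded_linear_snd])
      show "(\<lambda>x. fst (snd x)) ` (UNIV \<times> model Q) \<subseteq> model M1" by auto
      show "(\<lambda>x. fst (snd x)) ` ?S \<subseteq> \<alpha> ` {x\<in>A. x \<in> A'}"
      proof (rule image_subsetI)
        fix x assume x: "x \<in> ?S"
        obtain t u where tu: "x = (t, u)" by (cases x)
        obtain p where p: "p \<in> V" "\<psi> t p \<in> V'" "u = (\<alpha> (fst (r p)), \<beta> (snd (r p)))"
            "r (\<psi> t p) = (fst (r p), \<phi> t (snd (r p)))"
          using pt[OF x[unfolded tu]] by (elim exE conjE)
        show "fst (snd x) \<in> \<alpha> ` {x\<in>A. x \<in> A'}"
          unfolding tu p(3) using in_V[OF p(1)] in_V'[OF p(2)] p(4) by simp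
      qed
    qed
    have fam: "smooth_on (UNIV \<times> model M2) {(t, u). t \<in> {0..1} \<and> u \<in> \<beta> ` B \<and> \<phi> t (inv_into B \<beta> u) \<in> B'}
        (\<lambda>(t, u). \<beta>' (\<phi> t (inv_into B \<beta> u)))"
    proof -
      have "\<forall>(U, \<xi>)\<in>atlas M2. \<forall>(W, \<psi>)\<in>atlas M2. smooth_on (UNIV \<times> model M2)
          {(t, u). t \<in> {0..1} \<and> u \<in> \<xi> ` U \<and> \<phi> t (inv_into U \<xi> u) \<in> W} (\<lambda>(t, u). \<psi> (\<phi> t (inv_into U \<xi> u)))"
        using \<phi> unfolding smooth_family_def by (elim conjE)
      from bspec[OF this B] show ?thesis using B' by auto
    qed
    have g: "smooth_on (UNIV \<times> model Q) ?S ?g"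
    proof (rule smooth_on_linear[OF _ _ fam])
      show "bounded_linear (\<lambda>x :: real \<times> 'e \<times> 'f. (fst x, snd (snd x)))"
        by (intro bounded_linear_Pair bounded_linear_fst bounded_linear_compose[OF bounded_linear_snd bounded_linear_snd])
      show "(\<lambda>x. (fst x, snd (snd x))) ` (UNIV \<times> model Q) \<subseteq> UNIV \<times> model M2" by auto
      show "(\<lambda>x. (fst x, snd (snd x))) ` ?S \<subseteq> {(t, u). t \<in> {0..1} \<and> u \<in> \<beta> ` B \<and> \<phi> t (inv_into B \<beta> u) \<in> B'}"
      proof (rule image_subsetI)
        fix x assume x: "x \<in> ?S"
        obtain t u where tu: "x = (t, u)" by (cases x)
        obtain p where p: "t \<in> {0..1}" "p \<in> V" "\<psi> t p \<in> V'" "u = (\<alpha> (fst (r p)), \<beta> (snd (r p)))"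
            "r (\<psi> t p) = (fst (r p), \<phi> t (snd (r p)))"
          using pt[OF x[unfolded tu]] by (elim exE conjE)
        show "(fst x, snd (snd x)) \<in> {(t, u). t \<in> {0..1} \<and> u \<in> \<beta> ` B \<and> \<phi> t (inv_into B \<beta> u) \<in> B'}"
          unfolding tu p(4) using in_V[OF p(2)] in_V'[OF p(3)] p(1,5) chart_inv[OF M2 B] by simp
      qed
    qed
    show "smooth_on (UNIV \<times> model Q) ?S (\<lambda>(t, u). \<kappa>' (\<psi> t (inv_into V \<kappa> u)))"
    proof (rule smooth_on_cong[OF smooth_on_Pair[OF f g]])
      fix x assume x: "x \<in> ?S"
      obtain t u where tu: "x = (t, u)" by (cases x)
      obtain p where p: "p \<in> V" "inv_into V \<kappa> u = p" "u = (\<alpha> (fst (r p)), \<beta> (snd (r p)))"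
          "r (\<psi> t p) = (fst (r p), \<phi> t (snd (r p)))"
        using pt[OF x[unfolded tu]] by (elim exE conjE)
      have "\<kappa>' (\<psi> t (inv_into V \<kappa> u)) = (\<alpha>' (fst (r p)), \<beta>' (\<phi> t (snd (r p))))" unfolding p(2) \<kappa>' using p(4) by simp
      moreover have "inv_into A \<alpha> (fst u) = fst (r p)" "inv_into B \<beta> (snd u) = snd (r p)"
        unfolding p(3) using chart_inv[OF M1 A] chart_inv[OF M2 B] in_V[OF p(1)] by simp_all
      ultimately show "(?f x, ?g x) = (case x of (t, u) \<Rightarrow> \<kappa>' (\<psi> t (inv_into V \<kappa> u)))" unfolding tu by simp
    qed
  qed
  thus ?thesis unfolding smooth_family_def using \<psi> by auto
qed

end

text \<open>Every chart of \<open>Q\<close> is \<open>r\<close> followed by a product of two charts,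
  so \<open>graph_deriv\<close> turns the two tangent spaces into those of
  \<open>graphs_span_iff\<close>.\<close>

lemma transverse_iff_nondegenerate:
  assumes "pullback_prod M M X r" and \<phi>: "smooth_map M M \<phi>"
    and D: "continuous_map (mtop M) X D" "\<And>x. x \<in> mspc M \<Longrightarrow> r (D x) = (x, x)"
    and G: "continuous_map (mtop M) X G" "\<And>x. x \<in> mspc M \<Longrightarrow> r (G x) = (x, \<phi> x)"
    and x: "x \<in> mspc M" "\<phi> x = x" "G x = D x"
  shows "transverse_at M M (pullback_mfd X r (prod_mfd M M)) D G (D x) \<longleftrightarrow> nondegenerate_at M \<phi> x"
proof -
  interpret pullback_prod M M X r by (rule assms(1))
  note id = smooth_map_id[OF M1]
  have key: "{chart_deriv U \<xi> \<psi> D x u + chart_deriv U' \<xi>' \<psi> G x v | u v. u \<in> model M \<and> v \<in> model M} = model Q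
      \<longleftrightarrow> \<not> (\<exists>v\<in>model M. v \<noteq> 0 \<and> chart_deriv A \<alpha> \<alpha> \<phi> x v = v)"
    if U: "(U, \<xi>) \<in> atlas M" "x \<in> U" and U': "(U', \<xi>') \<in> atlas M" "x \<in> U'"
      and A: "(A, \<alpha>) \<in> atlas M" "x \<in> A" and B: "(B, \<beta>) \<in> atlas M" "x \<in> B" and \<psi>: "\<psi> = map_prod \<alpha> \<beta> \<circ> r"
    for U \<xi> U' \<xi>' A \<alpha> B \<beta> \<psi>
  proof -
    have fx: "\<phi> x \<in> B" using x(2) B(2) by simp
    have d1: "chart_deriv U \<xi> \<psi> D x u = (chart_deriv U \<xi> \<alpha> (\<lambda>x. x) x u, chart_deriv U \<xi> \<beta> (\<lambda>x. x) x u)" if "u \<in> model M" for u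
      unfolding \<psi> by (rule graph_deriv[OF id D(1) D(2) U A B that])
    have d2: "chart_deriv U' \<xi>' \<psi> G x u = (chart_deriv U' \<xi>' \<alpha> (\<lambda>x. x) x u, chart_deriv U' \<xi>' \<beta> \<phi> x u)" if "u \<in> model M" for u
      unfolding \<psi> by (rule graph_deriv[OF \<phi> G(1) G(2) U' A B(1) fx that])
    have "{chart_deriv U \<xi> \<psi> D x u + chart_deriv U' \<xi>' \<psi> G x v | u v. u \<in> model M \<and> v \<in> model M} =
      {(chart_deriv U \<xi> \<alpha> (\<lambda>x. x) x u, chart_deriv U \<xi> \<beta> (\<lambda>x. x) x u) +
        (chart_deriv U' \<xi>' \<alpha> (\<lambda>x. x) x v, chart_deriv U' \<xi>' \<beta> \<phi> x v) | u v. u \<in> model M \<and> v \<in> model M}"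
      by (rule Collect_cong, intro ex_cong1) (auto simp: d1 d2)
    thus ?thesis using graphs_span_iff[OF M1 \<phi> x(1,2) U U' A B] by simp
  qed
  show ?thesis
  proof
    assume t: "transverse_at M M Q D G (D x)"
    show "nondegenerate_at M \<phi> x"
      unfolding nondegenerate_at_def
    proof (intro ballI, clarify)
      fix U \<xi> v assume U: "(U, \<xi>) \<in> atlas M" "x \<in> U" and v: "v \<in> model M" "v \<noteq> 0" "chart_deriv U \<xi> \<xi> \<phi> x v = v"
      \<comment> \<open>Transversality is tested with one chart \<open>\<xi>\<close> for both
        sources and both factors.\<close>
      have UU: "(U \<times> U, map_prod \<xi> \<xi>) \<in> atlas (prod_mfd M M)" unfolding prod_mfd_atlas using U(1) by blast
      have DX: "D x \<in> topspace X" using D(1) x(1) by (simp add: continuous_map_def Pi_iff)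
      have "r (D x) \<in> U \<times> U" using D(2)[OF x(1)] U(2) by simp
      from chart_at[OF openin_topspace DX UU this]
      obtain W where W: "(W, map_prod \<xi> \<xi> \<circ> r) \<in> atlas Q" "D x \<in> W" by blast
      have "\<forall>(U, \<xi>)\<in>atlas M. \<forall>(U', \<xi>')\<in>atlas M. \<forall>(W, \<psi>)\<in>atlas Q. x \<in> U \<and> x \<in> U' \<and> D x \<in> W \<longrightarrow>
          {chart_deriv U \<xi> \<psi> D x u + chart_deriv U' \<xi>' \<psi> G x v | u v. u \<in> model M \<and> v \<in> model M} = model Q"
        using t x(1,3) unfolding transverse_at_def by simp
      from bspec[OF this U(1)] have "\<forall>(U', \<xi>')\<in>atlas M. \<forall>(W, \<psi>)\<in>atlas Q. x \<in> U \<and> x \<in> U' \<and> D x \<in> W \<longrightarrow>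
          {chart_deriv U \<xi> \<psi> D x u + chart_deriv U' \<xi>' \<psi> G x v | u v. u \<in> model M \<and> v \<in> model M} = model Q" by simp
      from bspec[OF this U(1)] have "\<forall>(W, \<psi>)\<in>atlas Q. x \<in> U \<and> x \<in> U \<and> D x \<in> W \<longrightarrow>
          {chart_deriv U \<xi> \<psi> D x u + chart_deriv U \<xi> \<psi> G x v | u v. u \<in> model M \<and> v \<in> model M} = model Q" by simp
      from bspec[OF this W(1)] have sp: "{chart_deriv U \<xi> (map_prod \<xi> \<xi> \<circ> r) D x u + chart_deriv U \<xi> (map_prod \<xi> \<xi> \<circ> r) G x v | u v.
          u \<in> model M \<and> v \<in> model M} = model Q" using U(2) W(2) by simp
      have "\<not> (\<exists>v\<in>model M. v \<noteq> 0 \<and> chart_deriv U \<xi> \<xi> \<phi> x v = v)" by (rule iffD1[OF key[OF U U U U refl] sp])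
      thus False using v by blast
    qed
  next
    assume n: "nondegenerate_at M \<phi> x"
    have *: "{chart_deriv U \<xi> \<psi> D x u + chart_deriv U' \<xi>' \<psi> G x v | u v. u \<in> model M \<and> v \<in> model M} = model Q"
      if U: "(U, \<xi>) \<in> atlas M" "x \<in> U" and U': "(U', \<xi>') \<in> atlas M" "x \<in> U'" and W: "(W, \<psi>) \<in> atlas Q" "D x \<in> W"
      for U \<xi> U' \<xi>' W \<psi>
    proof (rule prod_atlasE[OF W(1)])
      fix A \<alpha> B \<beta>
      assume A: "(A, \<alpha>) \<in> atlas M" and B: "(B, \<beta>) \<in> atlas M" and \<psi>: "\<psi> = map_prod \<alpha> \<beta> \<circ> r"
        and in_W: "\<And>p. p \<in> W \<Longrightarrow> p \<in> topspace X \<and> fst (r p) \<in> A \<and> snd (r p) \<in> B"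
      have xA: "x \<in> A" "x \<in> B" using in_W[OF W(2)] D(2)[OF x(1)] by simp_all
      have "\<not> (\<exists>v\<in>model M. v \<noteq> 0 \<and> chart_deriv A \<alpha> \<alpha> \<phi> x v = v)"
        using bspec[OF n[unfolded nondegenerate_at_def] A] xA(1) by simp
      thus ?thesis by (rule iffD2[OF key[OF U U' A xA(1) B xA(2) \<psi>]])
    qed
    \<comment> \<open>First components show that \<open>x\<close> is the only point that
      \<open>D\<close> or \<open>G\<close> maps to \<open>D x\<close>.\<close>
    have r1: "fst (r (D x')) = x'" "fst (r (G x')) = x'" if "x' \<in> mspc M" for x'
      using D(2)[OF that] G(2)[OF that] by simp_all
    have "x' = x" if "x' \<in> mspc M" "D x' = D x" for x'
      using r1(1)[OF that(1)] r1(1)[OF x(1)] unfolding that(2) by (rule trans[OF sym])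
    moreover have "y' = x" if "y' \<in> mspc M" "G y' = D x" for y'
      using r1(2)[OF that(1)] r1(1)[OF x(1)] unfolding that(2) by (rule trans[OF sym])
    ultimately show "transverse_at M M Q D G (D x)"
      unfolding transverse_at_def split_beta
    proof (intro ballI impI)
      fix x' y' c c' d
      assume e: "\<And>x'. x' \<in> mspc M \<Longrightarrow> D x' = D x \<Longrightarrow> x' = x" "\<And>y'. y' \<in> mspc M \<Longrightarrow> G y' = D x \<Longrightarrow> y' = x"
        and xy: "x' \<in> mspc M" "y' \<in> mspc M" "D x' = D x \<and> G y' = D x"
        and c: "c \<in> atlas M" "c' \<in> atlas M" "d \<in> atlas Q" "x' \<in> fst c \<and> y' \<in> fst c' \<and> D x \<in> fst d"
      have x': "x' = x" "y' = x" using e xy by simp_all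
      show "{chart_deriv (fst c) (snd c) (snd d) D x' u + chart_deriv (fst c') (snd c') (snd d) G y' v | u v.
          u \<in> model M \<and> v \<in> model M} = model Q"
        unfolding x' by (rule *[of "fst c" _ "fst c'" _ "fst d"]) (use c x' in simp_all)
    qed
  qed
qed

section \<open>Existence of trivializing covers\<close>

locale local_primitives =
  fixes X :: "'a topology" and z :: "'a cochain"
  assumes lpc: "locally_path_connected_space X" and z: "cocycle X z"
    and small: "openin X N \<Longrightarrow> x \<in> N \<Longrightarrow> \<exists>W. openin X W \<and> x \<in> W \<and> W \<subseteq> N \<and> path_connectedin X W \<and>
      (\<forall>c. pathin X c \<longrightarrow> c ` {0..1} \<subseteq> W \<longrightarrow> c 0 = c 1 \<longrightarrow> path_value z c = 0)"
begin

text \<open>The points over \<open>x\<close> are the classes of paths from the base point of the component to \<open>x\<close>, where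
  paths on which \<open>z\<close> takes the same value are identified.\<close>

definition cls :: "(real \<Rightarrow> 'a) \<Rightarrow> (real \<Rightarrow> 'a) set" where
  "cls g = {h. pathin X h \<and> h 0 = g 0 \<and> h 1 = g 1 \<and> path_value z h = path_value z g}"

text \<open>The choice is constant on path components, since it depends on \<open>x\<close> only
  through the predicate \<open>path_component_of X x\<close>.\<close>

definition base :: "'a \<Rightarrow> 'a" where
  "base x = (SOME b. path_component_of X x b)"

definition based :: "(real \<Rightarrow> 'a) \<Rightarrow> bool" where
  "based g \<longleftrightarrow> pathin X g \<and> g 0 = base (g 0)"

definition path_in :: "'a set \<Rightarrow> (real \<Rightarrow> 'a) \<Rightarrow> bool" where
  "path_in W d \<longleftrightarrow> pathin X d \<and> d ` {0..1} \<subseteq> W"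

text \<open>Neighbourhoods as in the path construction of a universal covering: continuations of
  \<open>g\<close> inside a neighbourhood \<open>W\<close> of its end.\<close>

definition spread :: "(real \<Rightarrow> 'a) set set \<Rightarrow> (real \<Rightarrow> 'a) \<Rightarrow> 'a set \<Rightarrow> bool" where
  "spread S g W \<longleftrightarrow> openin X W \<and> g 1 \<in> W \<and> (\<forall>d. path_in W d \<and> d 0 = g 1 \<longrightarrow> cls (path_join g d) \<in> S)"

abbreviation "wide S \<equiv> S \<subseteq> cls ` Collect based \<and> (\<forall>g. based g \<longrightarrow> cls g \<in> S \<longrightarrow> (\<exists>W. spread S g W))"

definition T :: "(real \<Rightarrow> 'a) set topology" where
  "T = topology wide"

definition q :: "(real \<Rightarrow> 'a) set \<Rightarrow> 'a" where
  "q s = (SOME g. g \<in> s) 1"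

text \<open>The prospective sheet over \<open>U\<close> through \<open>s\<close>.\<close>

definition V :: "'a set \<Rightarrow> (real \<Rightarrow> 'a) set \<Rightarrow> (real \<Rightarrow> 'a) set set" where
  "V U s = {cls (path_join g d) | g d. based g \<and> cls g = s \<and> path_in U d \<and> d 0 = g 1}"

section \<open>Classes of paths and based paths\<close>

lemma cls_self: "pathin X g \<Longrightarrow> g \<in> cls g"
  unfolding cls_def by simp

lemma cls_eqI: "g 0 = h 0 \<Longrightarrow> g 1 = h 1 \<Longrightarrow> path_value z g = path_value z h \<Longrightarrow> cls g = cls h"
  unfolding cls_def by simp

lemma cls_eqD:
  assumes "cls g = cls h" "pathin X g"
  shows "g 0 = h 0" "g 1 = h 1" "path_value z g = path_value z h"
proof -
  have "g \<in> cls h" unfolding assms(1)[symmetric] by (rule cls_self[OF assms(2)])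
  thus "g 0 = h 0" "g 1 = h 1" "path_value z g = path_value z h" unfolding cls_def by simp_all
qed

lemma q_cls:
  assumes "pathin X g"
  shows "q (cls g) = g 1"
proof -
  have "(SOME h. h \<in> cls g) \<in> cls g" by (rule someI[of "\<lambda>h. h \<in> cls g", OF cls_self[OF assms]])
  thus ?thesis unfolding q_def by (simp add: cls_def)
qed

lemma base_cong:
  assumes "path_component_of X x y"
  shows "base x = base y"
proof -
  have "path_component_of X x = path_component_of X y"
  proof (rule ext)
    show "path_component_of X x b = path_component_of X y b" for b
      using assms path_component_of_sym path_component_of_trans by metis
  qed
  thus ?thesis unfolding base_def by (rule arg_cong)
qed

lemma base_component:
  assumes "x \<in> topspace X"
  shows "path_component_of X x (base x)"
  unfolding base_def by (rule someI[of "path_component_of X x" x]) (simp add: path_component_of_refl assms)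

lemma basedD: "based g \<Longrightarrow> pathin X g"
  unfolding based_def by (rule conjunct1)

lemma based_exists:
  assumes "x \<in> topspace X"
  shows "\<exists>g. based g \<and> g 1 = x"
proof -
  have pc: "path_component_of X (base x) x" using path_component_of_sym[of X] base_component[OF assms] by blast
  obtain g where g: "pathin X g" "g 0 = base x" "g 1 = x" using pc unfolding path_component_of_def by (elim exE conjE)
  have "base (base x) = base x" by (rule base_cong[OF pc])
  thus ?thesis using g unfolding based_def by (intro exI[of _ g]) simp
qed

lemma based_join:
  assumes "based g" "pathin X d" "d 0 = g 1"
  shows "based (path_join g d)"
  using assms pathin_path_join[of X g d] unfolding based_def by simp

lemma value_join: "based g \<Longrightarrow> pathin X d \<Longrightarrow> d 0 = g 1 \<Longrightarrow> path_value z (path_join g d) = path_value z g + path_value z d"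
  using path_value_join[OF z basedD, of g d] by simp

lemma path_inD: "path_in W d \<Longrightarrow> pathin X d" "path_in W d \<Longrightarrow> t \<in> {0..1} \<Longrightarrow> d t \<in> W"
  unfolding path_in_def by blast+

lemma path_in_join:
  assumes "path_in W d" "path_in W e" "d 1 = e 0"
  shows "path_in W (path_join d e)"
proof -
  have "path_join d e t \<in> W" if "t \<in> {0..1}" for t
    using path_inD(2)[OF assms(1), of "2 * t"] path_inD(2)[OF assms(2), of "2 * t - 1"] that by (auto simp: path_join_def)
  thus ?thesis using pathin_path_join[OF path_inD(1) path_inD(1)] assms unfolding path_in_def by blast
qed

section \<open>The topology on the classes and its sheets\<close>

lemma istopology: "istopology wide"
  unfolding istopology_def
proof (intro conjI allI impI)
  fix S S' g
  assume S: "wide S"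
    and S': "wide S'"
  show "S \<inter> S' \<subseteq> cls ` Collect based" using S by blast
  assume g: "based g" "cls g \<in> S \<inter> S'"
  obtain W where W: "spread S g W" using S g by blast
  obtain W' where W': "spread S' g W'" using S' g by blast
  have "spread (S \<inter> S') g (W \<inter> W')"
    using W W' unfolding spread_def path_in_def by (auto intro!: openin_Int)
  thus "\<exists>W. spread (S \<inter> S') g W" by (rule exI)
next
  fix K
  assume K: "\<forall>S\<in>K. wide S"
  show "\<Union>K \<subseteq> cls ` Collect based" using K by blast
  fix g assume g: "based g" "cls g \<in> \<Union>K"
  obtain S where S: "S \<in> K" "cls g \<in> S" using g(2) by (elim UnionE)
  obtain W where "spread S g W" using bspec[OF K S(1)] g(1) S(2) by blast
  hence "spread (\<Union>K) g W" unfolding spread_def using S(1) by blast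
  thus "\<exists>W. spread (\<Union>K) g W" by (rule exI)
qed

lemma openin_T: "openin T S \<longleftrightarrow> wide S"
  unfolding T_def topology_inverse'[OF istopology] ..

lemma topspace_T: "topspace T = cls ` Collect based"
proof -
  have "openin T (cls ` Collect based)"
    unfolding openin_T
  proof (intro conjI allI impI subset_refl)
    fix g assume g: "based g"
    have "spread (cls ` Collect based) g (topspace X)"
      unfolding spread_def using g pathin_subset[OF basedD[OF g], of 1]
      by (auto intro!: imageI based_join path_inD(1))
    thus "\<exists>W. spread (cls ` Collect based) g W" by (rule exI)
  qed
  moreover have "topspace T \<subseteq> cls ` Collect based" using openin_topspace[of T] unfolding openin_T by (rule conjunct1)
  ultimately show ?thesis using openin_subset[of T] by blast
qed

lemma in_TE:
  assumes "s \<in> topspace T"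
  obtains g where "based g" "s = cls g" "q s = g 1"
proof -
  obtain g where g: "based g" "s = cls g" using assms unfolding topspace_T by blast
  show thesis by (rule that[OF g]) (simp add: g(2) q_cls[OF basedD[OF g(1)]])
qed

lemma continuous_q: "continuous_map T X q"
  unfolding continuous_map_def
proof (intro conjI allI impI)
  show "q \<in> topspace T \<rightarrow> topspace X"
  proof
    fix s assume "s \<in> topspace T"
    then obtain g where g: "based g" "q s = g 1" by (rule in_TE)
    show "q s \<in> topspace X" unfolding g(2) by (rule pathin_subset[OF basedD[OF g(1)]]) simp
  qed
  fix U assume U: "openin X U"
  show "openin T {s \<in> topspace T. q s \<in> U}"
    unfolding openin_T
  proof (intro conjI allI impI)
    show "{s \<in> topspace T. q s \<in> U} \<subseteq> cls ` Collect based" unfolding topspace_T by blast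
    fix g assume g: "based g" "cls g \<in> {s \<in> topspace T. q s \<in> U}"
    have "spread {s \<in> topspace T. q s \<in> U} g U"
      unfolding spread_def
    proof (intro conjI allI impI U)
      show "g 1 \<in> U" using g(2) q_cls[OF basedD[OF g(1)]] by simp
      fix d assume d: "path_in U d \<and> d 0 = g 1"
      have b: "based (path_join g d)" using based_join[OF g(1) path_inD(1)] d by blast
      have "d 1 \<in> U" using path_inD(2)[of U d 1] d by simp
      thus "cls (path_join g d) \<in> {s \<in> topspace T. q s \<in> U}"
        using b q_cls[OF basedD[OF b]] unfolding topspace_T by simp
    qed
    thus "\<exists>W. spread {s \<in> topspace T. q s \<in> U} g W" by (rule exI)
  qed
qed

lemma open_map_q: "open_map T X q"
  unfolding open_map_def
proof (intro allI impI)
  fix S assume S: "openin T S"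
  show "openin X (q ` S)"
  proof (subst openin_subopen, rule ballI)
    fix x assume "x \<in> q ` S"
    then obtain s where s: "s \<in> S" "x = q s" by (elim imageE)
    have "s \<in> topspace T" using openin_subset[OF S] s(1) by blast
    then obtain g where g: "based g" "s = cls g" "q s = g 1" by (rule in_TE)
    obtain W where W: "spread S g W" using S s(1) g(1,2) unfolding openin_T by blast
    hence "openin X W" "g 1 \<in> W" unfolding spread_def by blast+
    from small[OF this] obtain W' where W': "openin X W'" "g 1 \<in> W'" "W' \<subseteq> W" "path_connectedin X W'" by blast
    have "W' \<subseteq> q ` S"
    proof
      fix y assume y: "y \<in> W'"
      obtain d where d: "pathin X d" "d \<in> {0..1} \<rightarrow> W'" "d 0 = g 1" "d 1 = y"
        using W'(4) W'(2) y unfolding path_connectedin by blast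
      have "path_in W d" using d(1,2) W'(3) unfolding path_in_def by blast
      hence "cls (path_join g d) \<in> S" using W d(3) unfolding spread_def by blast
      moreover have "q (cls (path_join g d)) = y"
        using q_cls[OF basedD[OF based_join[OF g(1) d(1,3)]]] d(4) by simp
      ultimately show "y \<in> q ` S" by blast
    qed
    thus "\<exists>W. openin X W \<and> x \<in> W \<and> W \<subseteq> q ` S" using W'(1,2) s(2) g(3) by (intro exI[of _ W']) simp
  qed
qed

text \<open>One representative of a class describes the whole sheet, since the value of a joined
  path depends only on the values of its parts.\<close>

lemma V_cls:
  assumes g: "based g"
  shows "s \<in> V U (cls g) \<longleftrightarrow> (\<exists>d. path_in U d \<and> d 0 = g 1 \<and> s = cls (path_join g d))"
proof
  assume "s \<in> V U (cls g)"
  then obtain h d where h: "s = cls (path_join h d)" "based h" "cls h = cls g" "path_in U d" "d 0 = h 1"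
    unfolding V_def mem_Collect_eq by (elim exE conjE)
  note e = cls_eqD[OF h(3) basedD[OF h(2)]]
  have "cls (path_join h d) = cls (path_join g d)"
    by (rule cls_eqI) (use e h(2,4,5) g value_join path_inD(1) in simp_all)
  thus "\<exists>d. path_in U d \<and> d 0 = g 1 \<and> s = cls (path_join g d)" using h e by (intro exI[of _ d]) simp
next
  assume "\<exists>d. path_in U d \<and> d 0 = g 1 \<and> s = cls (path_join g d)"
  thus "s \<in> V U (cls g)" unfolding V_def using g by blast
qed

lemma V_sub: "V U s \<subseteq> topspace T"
  unfolding V_def topspace_T using based_join path_inD(1) by blast

lemma V_trans:
  assumes g: "based g" and s: "s \<in> V U (cls g)"
  shows "V U s \<subseteq> V U (cls g)"
proof
  obtain d where d: "path_in U d" "d 0 = g 1" "s = cls (path_join g d)" using s unfolding V_cls[OF g] by (elim exE conjE)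
  have b: "based (path_join g d)" by (rule based_join[OF g path_inD(1)[OF d(1)] d(2)])
  fix u assume "u \<in> V U s"
  then obtain e where e: "path_in U e" "e 0 = path_join g d 1" "u = cls (path_join (path_join g d) e)"
    unfolding d(3) V_cls[OF b] by (elim exE conjE)
  have e0: "d 1 = e 0" using e(2) by simp
  have w: "path_in U (path_join d e)" by (rule path_in_join[OF d(1) e(1) e0])
  have "u = cls (path_join g (path_join d e))"
    unfolding e(3)
  proof (rule cls_eqI)
    show "path_value z (path_join (path_join g d) e) = path_value z (path_join g (path_join d e))"
      using value_join[OF b path_inD(1)[OF e(1)] e(2)] value_join[OF g path_inD(1)[OF d(1)] d(2)]
        value_join[OF g path_inD(1)[OF w]] path_value_join[OF z path_inD(1)[OF d(1)] path_inD(1)[OF e(1)] e0] d(2) by simp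
  qed simp_all
  thus "u \<in> V U (cls g)" unfolding V_cls[OF g] using w d(2) by (intro exI[of _ "path_join d e"]) simp
qed

lemma V_sym:
  assumes g: "based g" and s: "s \<in> V U (cls g)"
  shows "cls g \<in> V U s"
proof -
  obtain d where d: "path_in U d" "d 0 = g 1" "s = cls (path_join g d)" using s unfolding V_cls[OF g] by (elim exE conjE)
  have b: "based (path_join g d)" by (rule based_join[OF g path_inD(1)[OF d(1)] d(2)])
  have w: "path_in U (\<lambda>t. d (1 - t))"
    unfolding path_in_def using pathin_reverse[OF path_inD(1)[OF d(1)]] path_inD(2)[OF d(1)] by auto
  have "cls g = cls (path_join (path_join g d) (\<lambda>t. d (1 - t)))"
  proof (rule cls_eqI)
    show "path_value z g = path_value z (path_join (path_join g d) (\<lambda>t. d (1 - t)))"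
      using value_join[OF b path_inD(1)[OF w]] value_join[OF g path_inD(1)[OF d(1)] d(2)]
        path_value_reverse[OF z path_inD(1)[OF d(1)]] by simp
  qed (simp_all add: d(2))
  thus ?thesis unfolding d(3) V_cls[OF b] using w by (intro exI[of _ "\<lambda>t. d (1 - t)"]) simp
qed

text \<open>Path connectedness of \<open>U\<close> makes \<open>q\<close> map the sheet onto
  \<open>U\<close>. Vanishing on loops in \<open>U\<close> makes it injective there: two
  continuations with the same end form a loop of value 0, so they define the same class.\<close>

lemma sheets_V:
  assumes U: "openin X U" "path_connectedin X U"
    and loops: "\<And>c. pathin X c \<Longrightarrow> c ` {0..1} \<subseteq> U \<Longrightarrow> c 0 = c 1 \<Longrightarrow> path_value z c = 0"
  shows "sheets T X q U (V U)"
  unfolding sheets_def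
proof (intro conjI ballI impI U)
  fix s assume s: "s \<in> topspace T" and sU: "q s \<in> U"
  obtain g where g: "based g" "s = cls g" "q s = g 1" using s by (rule in_TE)
  have gU: "g 1 \<in> U" using sU g(3) by simp
  have wc: "path_in U (\<lambda>_. g 1)"
    unfolding path_in_def using gU openin_subset[OF U(1)] by (auto simp: pathin_const)
  have "cls g = cls (path_join g (\<lambda>_. g 1))"
    by (rule cls_eqI) (use value_join[OF g(1) path_inD(1)[OF wc]] path_value_const[OF z, of "g 1"] pathin_subset[OF path_inD(1)[OF wc], of 1] in simp_all)
  thus ss: "s \<in> V U s" unfolding g(2) V_cls[OF g(1)] using wc by (intro exI[of _ "\<lambda>_. g 1"]) simp
  show oV: "openin T (V U s)"
    unfolding openin_T
  proof (intro conjI allI impI)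
    show "V U s \<subseteq> cls ` Collect based" using V_sub unfolding topspace_T .
    fix h assume h: "based h" "cls h \<in> V U s"
    have "h 1 \<in> U"
    proof -
      obtain d where d: "path_in U d" "d 0 = g 1" "cls h = cls (path_join g d)"
        using h(2) unfolding g(2) V_cls[OF g(1)] by (elim exE conjE)
      show ?thesis using cls_eqD(2)[OF d(3) basedD[OF h(1)]] path_inD(2)[OF d(1), of 1] by simp
    qed
    moreover have "cls (path_join h d) \<in> V U s" if "path_in U d \<and> d 0 = h 1" for d
    proof -
      have "cls (path_join h d) \<in> V U (cls h)" unfolding V_cls[OF h(1)] using that by blast
      thus ?thesis using V_trans[OF g(1), of "cls h" U] h(2) unfolding g(2) by blast
    qed
    ultimately have "spread (V U s) h U" unfolding spread_def using U(1) by blast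
    thus "\<exists>W. spread (V U s) h W" by (rule exI)
  qed
  have qV: "q ` V U s = U"
  proof (rule subset_antisym; rule subsetI)
    fix y assume "y \<in> q ` V U s"
    then obtain u where u: "u \<in> V U s" "y = q u" by (elim imageE)
    obtain d where d: "path_in U d" "d 0 = g 1" "u = cls (path_join g d)"
      using u(1) unfolding g(2) V_cls[OF g(1)] by (elim exE conjE)
    show "y \<in> U" unfolding u(2) d(3) q_cls[OF basedD[OF based_join[OF g(1) path_inD(1)[OF d(1)] d(2)]]]
      using path_inD(2)[OF d(1), of 1] by simp
  next
    fix y assume y: "y \<in> U"
    obtain d where d: "pathin X d" "d \<in> {0..1} \<rightarrow> U" "d 0 = g 1" "d 1 = y"
      using U(2) gU y unfolding path_connectedin by blast
    have "path_in U d" using d(1,2) unfolding path_in_def by blast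
    hence "cls (path_join g d) \<in> V U s" unfolding g(2) V_cls[OF g(1)] using d(3) by blast
    moreover have "y = q (cls (path_join g d))"
      using q_cls[OF basedD[OF based_join[OF g(1) d(1,3)]]] d(4) by simp
    ultimately show "y \<in> q ` V U s" by (rule rev_image_eqI)
  qed
  have "inj_on q (V U s)"
  proof (rule inj_onI)
    fix u u' assume u: "u \<in> V U s" and u': "u' \<in> V U s" and eq: "q u = q u'"
    obtain d where d: "path_in U d" "d 0 = g 1" "u = cls (path_join g d)"
      using u unfolding g(2) V_cls[OF g(1)] by (elim exE conjE)
    obtain e where e: "path_in U e" "e 0 = g 1" "u' = cls (path_join g e)"
      using u' unfolding g(2) V_cls[OF g(1)] by (elim exE conjE)
    note bd = based_join[OF g(1) path_inD(1)[OF d(1)] d(2)] and be = based_join[OF g(1) path_inD(1)[OF e(1)] e(2)]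
    have 1: "d 1 = e 1" using eq unfolding d(3) e(3) q_cls[OF basedD[OF bd]] q_cls[OF basedD[OF be]] by simp
    have r: "path_in U (\<lambda>t. e (1 - t))"
      unfolding path_in_def using pathin_reverse[OF path_inD(1)[OF e(1)]] path_inD(2)[OF e(1)] by auto
    have w: "path_in U (path_join d (\<lambda>t. e (1 - t)))" by (rule path_in_join[OF d(1) r]) (simp add: 1)
    have "path_value z (path_join d (\<lambda>t. e (1 - t))) = 0"
      using w d(2) e(2) unfolding path_in_def by (intro loops) simp_all
    hence "path_value z d = path_value z e"
      using path_value_join[OF z path_inD(1)[OF d(1)] path_inD(1)[OF r]] path_value_reverse[OF z path_inD(1)[OF e(1)]] 1 by simp
    thus "u = u'"
      unfolding d(3) e(3) using 1 value_join[OF g(1) path_inD(1)[OF d(1)] d(2)] value_join[OF g(1) path_inD(1)[OF e(1)] e(2)]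
      by (intro cls_eqI) simp_all
  qed
  thus "homeomorphic_map (subtopology T (V U s)) (subtopology X U) q"
  proof (intro bijective_open_imp_homeomorphic_map)
    show "continuous_map (subtopology T (V U s)) (subtopology X U) q"
      using continuous_map_from_subtopology[OF continuous_q] qV by (auto simp: continuous_map_in_subtopology)
    show "open_map (subtopology T (V U s)) (subtopology X U) q"
      unfolding open_map_def openin_open_subtopology[OF oV] openin_open_subtopology[OF U(1)]
      using open_map_q qV unfolding open_map_def by blast
    show "q ` topspace (subtopology T (V U s)) = topspace (subtopology X U)"
      using V_sub openin_subset[OF U(1)] qV by (simp add: Int_absorb1)
    show "inj_on q (V U s) \<Longrightarrow> inj_on q (topspace (subtopology T (V U s)))"
      using V_sub by (simp add: Int_absorb1)
  qed
  fix u assume u: "u \<in> V U s"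
  have "u \<in> topspace T" using V_sub u by blast
  then obtain h where h: "based h" "u = cls h" by (rule in_TE)
  show "V U u = V U s"
    using V_trans[OF g(1), of u U] V_trans[OF h(1), of s U] V_sym[OF g(1), of u U] u unfolding g(2) h(2) by blast
qed

lemma covering_q: "covering_map T X q"
  unfolding covering_map_sheets
proof (intro conjI ballI continuous_q)
  show "q ` topspace T = topspace X"
  proof (rule subset_antisym)
    show "q ` topspace T \<subseteq> topspace X" using continuous_q by (rule continuous_map_image_subset_topspace)
    show "topspace X \<subseteq> q ` topspace T"
    proof
      fix x assume "x \<in> topspace X"
      then obtain g where g: "based g" "g 1 = x" using based_exists by blast
      show "x \<in> q ` topspace T"
        unfolding topspace_T by (rule rev_image_eqI[of "cls g"]) (use g q_cls[OF basedD[OF g(1)]] in simp_all)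
    qed
  qed
  fix x assume "x \<in> topspace X"
  from small[OF openin_topspace this] obtain W where W: "openin X W" "x \<in> W" "path_connectedin X W"
    "\<And>c. pathin X c \<Longrightarrow> c ` {0..1} \<subseteq> W \<Longrightarrow> c 0 = c 1 \<Longrightarrow> path_value z c = 0" by blast
  show "\<exists>U V. x \<in> U \<and> sheets T X q U V" using W(2) sheets_V[OF W(1,3,4)] by blast
qed

text \<open>From the affine triangle with vertices at the parameters 0, \<open>s\<close>,
  \<open>t\<close>. Either of \<open>s\<close> and \<open>t\<close> may be the larger one, which
  continuity on both sides of \<open>s\<close> requires later.\<close>

lemma value_segment:
  assumes c: "pathin X c" and s: "s \<in> {0..1}" and t: "t \<in> {0..1}"
  shows "path_value z (\<lambda>u. c (t * u)) = path_value z (\<lambda>u. c (s * u)) + path_value z (\<lambda>u. c (s + u * (t - s)))"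
proof -
  have "continuous_map (top_of_set triangle) X (\<lambda>p. c (fst p * s + snd p * t))"
  proof (rule continuous_map_euclidean_compose[OF c[unfolded pathin_def]])
    fix p assume p: "p \<in> triangle"
    have "fst p * s \<le> fst p * 1" "snd p * t \<le> snd p * 1"
      using p s t by (auto simp: triangle_def intro!: mult_left_le)
    thus "fst p * s + snd p * t \<in> {0..1}" using p s t by (auto simp: triangle_def)
  qed (intro continuous_intros)
  from path_value_triangle[OF z this] show ?thesis by (simp add: algebra_simps)
qed

lemma pathin_segment:
  assumes c: "pathin X c" and "s \<in> {0..1}" "t \<in> {0..1}"
  shows "pathin X (\<lambda>u. c (s + u * (t - s)))"
proof (rule pathin_reparam[OF c])
  show "(\<lambda>u. s + u * (t - s)) ` {0..1} \<subseteq> {0..1}"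
  proof (rule image_subsetI)
    fix u :: real assume "u \<in> {0..1}"
    thus "s + u * (t - s) \<in> {0..1}" using convexD[OF convex_real_interval(5)[of 0 1], of s t "1 - u" u] assms(2,3)
      by (simp add: algebra_simps)
  qed
qed (intro continuous_intros)

text \<open>The lift of \<open>c\<close> is explicit: append the initial segments of
  \<open>c\<close> to \<open>g\<close>. Nearby times differ by a short segment of \<open>c\<close>
  inside a neighbourhood given by \<open>spread\<close>, whence continuity.\<close>

lemma track:
  assumes g: "based g" and c: "pathin X c" and gc: "g 1 = c 0"
  defines "v \<equiv> \<lambda>t. cls (path_join g (\<lambda>u. c (t * u)))"
  shows "pathin T v" "t \<in> {0..1} \<Longrightarrow> q (v t) = c t"
proof -
  have ct: "pathin X (\<lambda>u. c (t * u))" if "t \<in> {0..1}" for t using pathin_initial_segment[OF c] that by simp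
  have b: "based (path_join g (\<lambda>u. c (t * u)))" if "t \<in> {0..1}" for t by (rule based_join[OF g ct[OF that]]) (simp add: gc)
  show "q (v t) = c t" if "t \<in> {0..1}" for t unfolding v_def q_cls[OF basedD[OF b[OF that]]] by simp
  show "pathin T v"
    unfolding pathin_def continuous_map_def
  proof (intro conjI allI impI)
    show "v \<in> topspace I01 \<rightarrow> topspace T" unfolding topspace_T v_def using b by auto
    fix S assume S: "openin T S"
    show "openin I01 {t \<in> topspace I01. v t \<in> S}"
    proof (subst openin_subopen, rule ballI)
      fix s assume "s \<in> {t \<in> topspace I01. v t \<in> S}"
      hence s: "s \<in> {0..1}" "v s \<in> S" by simp_all
      obtain W where W: "spread S (path_join g (\<lambda>u. c (s * u))) W" using S b[OF s(1)] s(2) unfolding openin_T v_def by blast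
      have oW: "openin X W" and sW: "c s \<in> W" using W unfolding spread_def by simp_all
      have "openin I01 {t \<in> topspace I01. c t \<in> W}"
        by (rule openin_continuous_map_preimage[OF c[unfolded pathin_def] oW])
      hence "openin I01 {t \<in> {0..1}. c t \<in> W}" by simp
      then obtain e where e: "e > 0" "ball s e \<inter> {0..1} \<subseteq> {t \<in> {0..1}. c t \<in> W}"
        unfolding openin_contains_ball using s(1) sW by blast
      have "v t \<in> S" if t: "t \<in> ball s e \<inter> {0..1}" for t
      proof -
        let ?d = "\<lambda>u. c (s + u * (t - s))"
        have tI: "t \<in> {0..1}" using t by simp
        have "path_in W ?d"
          unfolding path_in_def
        proof (intro conjI image_subsetI pathin_segment[OF c s(1) tI])
          fix u :: real assume u: "u \<in> {0..1}"
          have "s \<in> ball s e \<inter> {0..1}" using e(1) s(1) by simp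
          hence "(1 - u) *\<^sub>R s + u *\<^sub>R t \<in> ball s e \<inter> {0..1}"
            using convexD[OF convex_Int[OF convex_ball convex_real_interval(5)], of s s e 0 1 t "1 - u" u] t u by simp
          hence "s + u * (t - s) \<in> ball s e \<inter> {0..1}" by (simp only: scaleR_conv_of_real) (simp add: algebra_simps)
          thus "?d u \<in> W" using e(2) by blast
        qed
        moreover have "?d 0 = path_join g (\<lambda>u. c (s * u)) 1" by simp
        ultimately have "cls (path_join (path_join g (\<lambda>u. c (s * u))) ?d) \<in> S" using W unfolding spread_def by blast
        moreover have "cls (path_join (path_join g (\<lambda>u. c (s * u))) ?d) = v t"
          unfolding v_def
        proof (rule cls_eqI)
          show "path_value z (path_join (path_join g (\<lambda>u. c (s * u))) ?d) = path_value z (path_join g (\<lambda>u. c (t * u)))"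
            using value_join[OF b[OF s(1)] pathin_segment[OF c s(1) tI]] value_join[OF g ct[OF s(1)]]
              value_join[OF g ct[OF tI]] value_segment[OF c s(1) tI] gc by simp
        qed simp_all
        ultimately show ?thesis by simp
      qed
      thus "\<exists>A. openin I01 A \<and> s \<in> A \<and> A \<subseteq> {t \<in> topspace I01. v t \<in> S}"
        using e(1) s(1) by (intro exI[of _ "ball s e \<inter> {0..1}"]) (auto simp: openin_open)
    qed
  qed
qed

text \<open>All based paths that end in \<open>A\<close> start at one point \<open>k\<close>, and
  the track of such a path joins the class of the constant path at \<open>k\<close> to its own
  class.\<close>

lemma connected_over:
  assumes A: "A \<in> connected_components_of X"
  shows "connectedin T {s \<in> topspace T. q s \<in> A}"
proof (rule path_connectedin_imp_connectedin)
  let ?S = "{s \<in> topspace T. q s \<in> A}"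
  obtain x0 where x0: "x0 \<in> topspace X" "A = connected_component_of_set X x0"
    using A unfolding connected_components_of_def by (elim imageE)
  define k where "k = base x0"
  have kX: "path_component_of X x0 k" unfolding k_def by (rule base_component[OF x0(1)])
  have k: "k \<in> topspace X" "base k = k"
    using path_component_in_topspace[OF kX] base_cong[OF kX] unfolding k_def by simp_all
  have bk: "based (\<lambda>_. k)" unfolding based_def using k by (simp add: pathin_const)
  have *: "path_component_of (subtopology T ?S) (cls (\<lambda>_. k)) s" if s: "s \<in> ?S" for s
  proof -
    obtain g where g: "based g" "s = cls g" "q s = g 1" by (rule in_TE) (use s in blast)
    have gA: "g t \<in> A" if "t \<in> {0..1}" for t
      by (rule pathin_in_component[OF A basedD[OF g(1)] _ _ that, of 1]) (use s g(3) in simp_all)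
    have "g 0 \<in> connected_component_of_set X x0" using gA[of 0] unfolding x0(2) by simp
    hence "g 0 \<in> path_component_of_set X x0" unfolding path_component_eq_connected_component_of[OF lpc] .
    hence "path_component_of X x0 (g 0)" by simp
    hence "g 0 = k" using base_cong[of x0 "g 0"] g(1) unfolding based_def k_def by simp
    note tr = track[OF bk basedD[OF g(1)], unfolded \<open>g 0 = k\<close>, OF refl]
    let ?v = "\<lambda>t. cls (path_join (\<lambda>_. k) (\<lambda>u. g (t * u)))"
    have v: "pathin (subtopology T ?S) ?v"
      unfolding pathin_subtopology using tr gA pathin_subset[OF tr(1)] by auto
    have v0: "?v 0 = cls (\<lambda>_. k)"
      by (rule cls_eqI) (use value_join[OF bk, of "\<lambda>_. k"] k(1) path_value_const[OF z k(1)] \<open>g 0 = k\<close> in \<open>simp_all add: pathin_const\<close>)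
    have v1: "?v 1 = s"
      unfolding g(2) by (rule cls_eqI) (use value_join[OF bk basedD[OF g(1)]] path_value_const[OF z k(1)] \<open>g 0 = k\<close> in simp_all)
    show ?thesis unfolding path_component_of_def by (rule exI[of _ ?v], rule conjI[OF v conjI[OF v0 v1]])
  qed
  have "path_connected_space (subtopology T ?S)"
    unfolding path_connected_space_iff_path_component
  proof (intro ballI)
    fix s s' assume "s \<in> topspace (subtopology T ?S)" "s' \<in> topspace (subtopology T ?S)"
    hence S: "s \<in> ?S" "s' \<in> ?S" unfolding topspace_subtopology by blast+
    have "path_component_of (subtopology T ?S) s (cls (\<lambda>_. k))" by (rule path_component_of_sym[OF *[OF S(1)]])
    from path_component_of_trans[OF this *[OF S(2)]] show "path_component_of (subtopology T ?S) s s'" .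
  qed
  thus "path_connectedin T ?S" unfolding path_connectedin_def by blast
qed

text \<open>By unique lifting \<open>w\<close> is the track of its projection, so \<open>w 1\<close>
  is the class of \<open>g\<close> joined with that projection. It equals the class of
  \<open>g\<close> iff ends and values agree.\<close>

lemma closed_path_iff:
  assumes w: "pathin T w"
  shows "w 0 = w 1 \<longleftrightarrow> q (w 0) = q (w 1) \<and> path_value z (\<lambda>t. q (w t)) = 0"
proof -
  define c where "c = (\<lambda>t. q (w t))"
  have c: "pathin X c" unfolding c_def using pathin_compose[OF w continuous_q] by (simp add: comp_def)
  have "w 0 \<in> topspace T" by (rule pathin_subset[OF w]) simp
  then obtain g where g: "based g" "w 0 = cls g" "q (w 0) = g 1" by (rule in_TE)
  have gc: "g 1 = c 0" using g(3) unfolding c_def by simp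
  have c0: "c 0 \<in> topspace X" by (rule pathin_subset[OF c]) simp
  note tr = track[OF g(1) c gc]
  have "w 1 = cls (path_join g (\<lambda>u. c (1 * u)))"
  proof (rule path_lift_unique[OF covering_q w tr(1)])
    show "q (w t) = q (cls (path_join g (\<lambda>u. c (t * u))))" if "t \<in> {0..1}" for t
      unfolding tr(2)[OF that] by (simp only: c_def)
    have pv: "path_value z (path_join g (\<lambda>_. c 0)) = path_value z g"
      using value_join[OF g(1), of "\<lambda>_. c 0"] gc[symmetric] c0 path_value_const[OF z c0] by (simp only: pathin_const add_0_right)
    have "cls (path_join g (\<lambda>u. c (0 * u))) = cls g"
      unfolding mult_zero_left by (rule cls_eqI) (use pv gc[symmetric] in simp_all)
    thus "w 0 = cls (path_join g (\<lambda>u. c (0 * u)))" unfolding g(2) by (rule sym)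
    show "(1::real) \<in> {0..1}" "(0::real) \<in> {0..1}" by simp_all
  qed
  hence w1: "w 1 = cls (path_join g c)" by (simp only: mult_1_left)
  have v: "path_value z (path_join g c) = path_value z g + path_value z c" by (rule value_join[OF g(1) c gc[symmetric]])
  have *: "cls g = cls (path_join g c) \<longleftrightarrow> c 0 = c 1 \<and> path_value z c = 0"
  proof
    assume "cls g = cls (path_join g c)"
    from cls_eqD[OF this basedD[OF g(1)]] show "c 0 = c 1 \<and> path_value z c = 0" using v gc by simp
  next
    assume "c 0 = c 1 \<and> path_value z c = 0"
    thus "cls g = cls (path_join g c)" using v gc by (intro cls_eqI) simp_all
  qed
  have "w 0 = w 1 \<longleftrightarrow> c 0 = c 1 \<and> path_value z c = 0" unfolding w1 g(2) by (rule *)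
  thus ?thesis unfolding c_def .
qed

end

lemma trivializing_cover_exists:
  fixes M :: "('a, 'e::euclidean_space) mfd"
  assumes M: "smooth_manifold M" and l: "l \<in> H1 (mtop M)"
  shows "\<exists>(T :: (real \<Rightarrow> 'a) set topology) q. trivializing_cover (mtop M) l T q"
proof -
  obtain z where rep: "cocycle (mtop M) z" "l = H1_class (mtop M) z" "z \<in> l" by (rule H1_rep[OF l])
  interpret local_primitives "mtop M" z
  proof
    show "locally_path_connected_space (mtop M)" by (rule manifold_locally_path_connected[OF M])
    show "cocycle (mtop M) z" by (rule rep(1))
    fix N x assume N: "openin (mtop M) N" "x \<in> N"
    show "\<exists>W. openin (mtop M) W \<and> x \<in> W \<and> W \<subseteq> N \<and> path_connectedin (mtop M) W \<and>
        (\<forall>c. pathin (mtop M) c \<longrightarrow> c ` {0..1} \<subseteq> W \<longrightarrow> c 0 = c 1 \<longrightarrow> path_value z c = 0)"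
      by (rule chart_ball[OF M N]) (use rep(1) in blast)
  qed
  have "trivializing_cover (mtop M) l T q"
    by (rule trivializing_coverI[OF l rep(3) covering_q connected_over closed_path_iff])
  thus ?thesis by blast
qed

section \<open>The box sum\<close>

lemma box_coveringD:
  assumes "box_covering X1 z1 X2 z2 X r"
  shows "covering_map X (prod_topology X1 X2) r"
    "C \<in> connected_components_of (prod_topology X1 X2) \<Longrightarrow> connectedin X {y \<in> topspace X. r y \<in> C}"
    "pathin X w \<Longrightarrow> w 0 = w 1 \<longleftrightarrow> r (w 0) = r (w 1) \<and>
        path_value z1 (\<lambda>t. fst (r (w t))) = path_value z2 (\<lambda>t. snd (r (w t)))"
proof -
  note * = assms[unfolded box_covering_def]
  show "covering_map X (prod_topology X1 X2) r" by (rule conjunct1[OF *])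
  show "C \<in> connected_components_of (prod_topology X1 X2) \<Longrightarrow> connectedin X {y \<in> topspace X. r y \<in> C}"
    by (rule bspec[OF conjunct1[OF conjunct2[OF *]]])
  show "pathin X w \<Longrightarrow> w 0 = w 1 \<longleftrightarrow> r (w 0) = r (w 1) \<and>
        path_value z1 (\<lambda>t. fst (r (w t))) = path_value z2 (\<lambda>t. snd (r (w t)))"
    by (rule spec[OF conjunct2[OF conjunct2[OF *]], THEN mp])
qed

lemma equalizes_iff:
  assumes "l1 \<in> H1 X1" "z1 \<in> l1" "l2 \<in> H1 X2" "z2 \<in> l2" and p: "continuous_map N (prod_topology X1 X2) p"
  shows "equalizes l1 l2 N p \<longleftrightarrow> (\<forall>g. pathin N g \<and> g 0 = g 1 \<longrightarrow>
    path_value z1 (\<lambda>t. fst (p (g t))) = path_value z2 (\<lambda>t. snd (p (g t))))"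
  using H1_pullback_eq_iff[OF assms(1,2) continuous_map_compose[OF p continuous_map_fst] assms(3,4)
      continuous_map_compose[OF p continuous_map_snd]]
  unfolding equalizes_def comp_def .

locale boxed =
  fixes M1 :: "('a, 'e::euclidean_space) mfd" and l1 z1 and M2 :: "('b, 'f::euclidean_space) mfd" and l2 z2
    and X :: "'x topology" and r
  assumes mf1: "smooth_manifold M1" and l1: "l1 \<in> H1 (mtop M1)" "z1 \<in> l1"
    and mf2: "smooth_manifold M2" and l2: "l2 \<in> H1 (mtop M2)" "z2 \<in> l2"
    and bc: "box_covering (mtop M1) z1 (mtop M2) z2 X r"
begin

abbreviation "Q' X' r' \<equiv> pullback_mfd X' r' (prod_mfd M1 M2)"
abbreviation "B \<equiv> prod_topology (mtop M1) (mtop M2)"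

lemmas rcov = box_coveringD(1)[OF bc]
lemmas rconn = box_coveringD(2)[OF bc]
lemmas rclosed = box_coveringD(3)[OF bc]

lemma lpc_B: "locally_path_connected_space B"
  using manifold_locally_path_connected[OF mf1] manifold_locally_path_connected[OF mf2]
  by (simp add: locally_path_connected_space_prod_topology)

text \<open>Separation and countability pass from the base to the covering, so that the pulled back
  charts make \<open>X\<close> a manifold.\<close>

sublocale pullback_prod M1 M2 X r
proof
  show "smooth_manifold (prod_mfd M1 M2)" by (rule smooth_manifold_prod_mfd[OF mf1 mf2])
  show "covering_map X (mtop (prod_mfd M1 M2)) r" using rcov by simp
  show "Hausdorff_space X" by (rule covering_map_Hausdorff_space[OF rcov])
      (simp add: Hausdorff_space_prod_topology smooth_manifoldD(1)[OF mf1] smooth_manifoldD(1)[OF mf2])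
  show "second_countable X" by (rule covering_map_second_countable[OF rcov
        second_countable_prod_topology[OF smooth_manifoldD(2)[OF mf1] smooth_manifoldD(2)[OF mf2]] lpc_B rconn])
qed (rule mf1 mf2)+

lemma r_cont: "continuous_map X B r" by (rule covering_map_continuous[OF rcov])

lemma r_equalizes: "equalizes l1 l2 X r"
  unfolding equalizes_iff[OF l1 l2 r_cont] using rclosed by blast

lemma covering_component: "covering_map (subtopology X {y \<in> topspace X. r y \<in> C}) (subtopology B C) r"
  by (rule covering_map_restrict[OF rcov])

text \<open>A closed path in an equalizing covering \<open>N\<close> has equal values on both
  components, hence lifts to a closed path in \<open>X\<close>. The lifting criterion gives the map,
  and \<open>covering_factor\<close> makes it a covering.\<close>

lemma r_minimal: "minimal_equalizing TYPE('n) (mtop M1) l1 (mtop M2) l2 X r"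
  unfolding minimal_equalizing_def
proof (intro conjI ballI allI impI rconn)
  fix C and N :: "'n topology" and p
  assume C: "C \<in> connected_components_of B"
    and "connected_space N \<and> covering_map N (subtopology B C) p \<and> equalizes l1 l2 N p"
  hence N: "connected_space N" and p: "covering_map N (subtopology B C) p" and e: "equalizes l1 l2 N p" by simp_all
  let ?S = "{y \<in> topspace X. r y \<in> C}"
  have lC: "locally_path_connected_space (subtopology B C)"
    by (rule locally_path_connected_space_open_subset[OF lpc_B
        openin_connected_components_of_locally_connected_space[OF locally_path_connected_imp_locally_connected_space[OF lpc_B] C]])
  have pc: "continuous_map N (subtopology B C) p" by (rule covering_map_continuous[OF p])
  hence pB: "continuous_map N B p" unfolding continuous_map_in_subtopology by (rule conjunct1)
  \<comment> \<open>No values are prescribed, so the set \<open>S\<close> of the criterion is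
    empty.\<close>
  have "\<exists>f. continuous_map N (subtopology X ?S) f \<and> (\<forall>n\<in>topspace N. r (f n) = p n) \<and>
    (\<forall>n. (\<exists>s\<in>{}. path_component_of N n s) \<longrightarrow> (\<exists>s\<in>{}. path_component_of N n s \<and> f s = undefined s))"
  proof (rule lift_criterion[OF covering_component covering_map_locally_path_connected_space[OF p lC] pc])
    fix c w assume c: "pathin N c" "c 0 = c 1" and w: "pathin (subtopology X ?S) w" and wc: "\<forall>t\<in>{0..1}. r (w t) = p (c t)"
    have wX: "pathin X w" using w unfolding pathin_subtopology by (rule conjunct1)
    have "path_value z1 (\<lambda>t. fst (r (w t))) = path_value z1 (\<lambda>t. fst (p (c t)))"
      by (rule path_value_cong) (simp add: wc)
    also have "\<dots> = path_value z2 (\<lambda>t. snd (p (c t)))" using e c unfolding equalizes_iff[OF l1 l2 pB] by blast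
    also have "\<dots> = path_value z2 (\<lambda>t. snd (r (w t)))" by (rule path_value_cong) (simp add: wc)
    finally show "w 0 = w 1" unfolding rclosed[OF wX] using wc c(2) by simp
  qed simp
  then obtain f where f: "continuous_map N (subtopology X ?S) f" "\<forall>n\<in>topspace N. r (f n) = p n" by (elim exE conjE)
  have "C \<noteq> {}" using nonempty_connected_components_of[OF C] .
  moreover have "topspace (subtopology B C) = C" using connected_components_of_subset[OF C] by (rule topspace_subtopology_subset)
  ultimately have "topspace N \<noteq> {}" using covering_map_surj[OF p] by auto
  moreover have "path_connected_space (subtopology X ?S)"
    using path_connected_eq_connected_space[OF covering_map_locally_path_connected_space[OF covering_component lC]]
      rconn[OF C] unfolding connectedin_def by blast
  ultimately have "covering_map N (subtopology X ?S) f"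
    by (intro covering_factor[OF p covering_component lC f(1) bspec[OF f(2)]])
  thus "\<exists>f. covering_map N (subtopology X ?S) f \<and> (\<forall>n\<in>topspace N. r (f n) = p n)" using f(2) by blast
qed

text \<open>A closed path downstairs on which the two values agree lifts to a closed path in \<open>X\<close>, hence in every minimal
  covering, as the latter is covered by a component of \<open>X\<close>.\<close>

lemma minimal_box_covering:
  assumes cov': "covering_map X' B r'" and e: "equalizes l1 l2 X' r'"
    and min: "minimal_equalizing TYPE('x) (mtop M1) l1 (mtop M2) l2 X' r'"
  shows "box_covering (mtop M1) z1 (mtop M2) z2 X' r'"
  unfolding box_covering_def
proof (intro conjI ballI allI impI cov')
  show "connectedin X' {y \<in> topspace X'. r' y \<in> C}" if "C \<in> connected_components_of B" for C
    using min that unfolding minimal_equalizing_def by blast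
  fix w assume w: "pathin X' w"
  note rc' = covering_map_continuous[OF cov']
  show "w 0 = w 1 \<longleftrightarrow> r' (w 0) = r' (w 1) \<and> path_value z1 (\<lambda>t. fst (r' (w t))) = path_value z2 (\<lambda>t. snd (r' (w t)))"
  proof
    assume "w 0 = w 1"
    thus "r' (w 0) = r' (w 1) \<and> path_value z1 (\<lambda>t. fst (r' (w t))) = path_value z2 (\<lambda>t. snd (r' (w t)))"
      using e w unfolding equalizes_iff[OF l1 l2 rc'] by simp
  next
    assume cl: "r' (w 0) = r' (w 1) \<and> path_value z1 (\<lambda>t. fst (r' (w t))) = path_value z2 (\<lambda>t. snd (r' (w t)))"
    define C where "C = connected_component_of_set B (r' (w 0))"
    have w0: "w 0 \<in> topspace X'" by (rule pathin_subset[OF w]) simp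
    have rw0: "r' (w 0) \<in> topspace B" by (rule covering_map_in[OF cov' w0])
    have C: "C \<in> connected_components_of B" unfolding C_def connected_components_of_def using rw0 by blast
    have r0C: "r' (w 0) \<in> C" unfolding C_def using rw0 by (simp add: connected_component_of_refl)
    let ?S = "{y \<in> topspace X. r y \<in> C}" and ?S' = "{y \<in> topspace X'. r' y \<in> C}"
    \<comment> \<open>The part of \<open>X\<close> over \<open>C\<close> is itself a connected
      equalizing covering, so minimality makes it a covering of the part of \<open>X'\<close> over
      \<open>C\<close>.\<close>
    have "continuous_map (subtopology X ?S) B r" by (rule continuous_map_from_subtopology[OF r_cont])
    hence "equalizes l1 l2 (subtopology X ?S) r"
      using r_equalizes unfolding equalizes_iff[OF l1 l2 r_cont] by (simp add: equalizes_iff[OF l1 l2] pathin_subtopology)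
    moreover have "connected_space (subtopology X ?S)" using rconn[OF C] unfolding connectedin_def by blast
    ultimately have "\<exists>f. covering_map (subtopology X ?S) (subtopology X' ?S') f \<and>
        (\<forall>n\<in>topspace (subtopology X ?S). r' (f n) = r n)"
      using min C covering_component[of C] unfolding minimal_equalizing_def by blast
    then obtain f where f: "covering_map (subtopology X ?S) (subtopology X' ?S') f"
      "\<forall>n\<in>topspace (subtopology X ?S). r' (f n) = r n" by (elim exE conjE)
    have "w 0 \<in> topspace (subtopology X' ?S')" using w0 r0C by simp
    hence "w 0 \<in> f ` topspace (subtopology X ?S)" unfolding covering_map_surj[OF f(1)] .
    then obtain n where n: "n \<in> topspace (subtopology X ?S)" "w 0 = f n" by (elim imageE)
    have nX: "n \<in> topspace X" "r n = r' (w 0)" using n f(2) by auto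
    have rw: "pathin B (\<lambda>t. r' (w t))" using pathin_compose[OF w rc'] by (simp add: comp_def)
    obtain v where v: "pathin X v" "v 0 = n" "\<And>t. t \<in> {0..1} \<Longrightarrow> r (v t) = r' (w t)"
      by (rule path_lift[OF rcov rw nX]) blast
    have vC: "v t \<in> ?S" if "t \<in> {0..1}" for t
      using pathin_in_component[OF C rw r0C _ that] v(3)[OF that] pathin_subset[OF v(1) that] by simp
    have vS: "pathin (subtopology X ?S) v" unfolding pathin_subtopology using v(1) vC by blast
    have fv: "pathin X' (\<lambda>t. f (v t))"
      using pathin_compose[OF vS covering_map_continuous[OF f(1)]] by (simp add: comp_def pathin_subtopology)
    have "f (v t) = w t" if t: "t \<in> {0..1}" for t
    proof (rule path_lift_unique[OF cov' fv w _ _ _ t, of 0])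
      show "r' (f (v t)) = r' (w t)" if t: "t \<in> {0..1}" for t using f(2) vC[OF t] v(3)[OF t] by simp
    qed (use v(2) n(2) in simp_all)
    moreover have "v 0 = v 1"
    proof -
      have "path_value z1 (\<lambda>t. fst (r (v t))) = path_value z1 (\<lambda>t. fst (r' (w t)))"
        "path_value z2 (\<lambda>t. snd (r (v t))) = path_value z2 (\<lambda>t. snd (r' (w t)))"
        by (rule path_value_cong, simp add: v(3))+
      thus ?thesis unfolding rclosed[OF v(1)] using cl v(3)[of 0] v(3)[of 1] by simp
    qed
    ultimately show "w 0 = w 1" using atLeastAtMost_iff[of 0 0 1] by (metis atLeastAtMost_iff order_refl zero_le_one)
  qed
qed

text \<open>In both coverings a path is closed under the same condition on its projection, as
  \<open>covering_iso\<close> requires.\<close>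

lemma homeo_exists:
  assumes bc': "box_covering (mtop M1) z1 (mtop M2) z2 X' r'"
    and S: "\<And>s. s \<in> S \<Longrightarrow> b s \<in> topspace X' \<and> r' (b s) = r s"
  shows "\<exists>f. homeomorphic_map X X' f \<and> (\<forall>x\<in>topspace X. r' (f x) = r x) \<and>
    (\<forall>x. (\<exists>s\<in>S. path_component_of X x s) \<longrightarrow> (\<exists>s\<in>S. path_component_of X x s \<and> f s = b s))"
proof (rule covering_iso[OF rcov box_coveringD(1)[OF bc'] lpc_B rconn box_coveringD(2)[OF bc'] S])
  fix w w' assume w: "pathin X w" and w': "pathin X' w'" and eq: "\<forall>t\<in>{0..1}. r (w t) = r' (w' t)"
  have "path_value z1 (\<lambda>t. fst (r (w t))) = path_value z1 (\<lambda>t. fst (r' (w' t)))"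
    "path_value z2 (\<lambda>t. snd (r (w t))) = path_value z2 (\<lambda>t. snd (r' (w' t)))"
    by (rule path_value_cong, simp add: eq)+
  thus "w 0 = w 1 \<longleftrightarrow> w' 0 = w' 1" unfolding rclosed[OF w] box_coveringD(3)[OF bc' w'] using eq by simp
qed

text \<open>\<open>homeo_exists\<close> matches the two sections only at one point of each path
  component that they meet. From there the agreement spreads along the sections by unique
  lifting.\<close>

lemma homeo_section:
  assumes bc': "box_covering (mtop M1) z1 (mtop M2) z2 X' r'"
    and G: "continuous_map (mtop M1) X G" "\<And>x. x \<in> mspc M1 \<Longrightarrow> r (G x) = (x, \<phi> x)"
    and G': "continuous_map (mtop M1) X' G'" "\<And>x. x \<in> mspc M1 \<Longrightarrow> r' (G' x) = (x, \<phi> x)"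
  shows "\<exists>f. homeomorphic_map X X' f \<and> (\<forall>x\<in>topspace X. r' (f x) = r x) \<and> (\<forall>x\<in>mspc M1. f (G x) = G' x)"
proof -
  have GX: "G x \<in> topspace X" "G' x \<in> topspace X'" if "x \<in> mspc M1" for x
    using G(1) G'(1) that by (simp_all add: continuous_map_def Pi_iff)
  have "\<exists>f. homeomorphic_map X X' f \<and> (\<forall>x\<in>topspace X. r' (f x) = r x) \<and>
    (\<forall>x. (\<exists>s\<in>G ` mspc M1. path_component_of X x s) \<longrightarrow>
      (\<exists>s\<in>G ` mspc M1. path_component_of X x s \<and> f s = G' (fst (r s))))"
    by (rule homeo_exists[OF bc']) (use GX G(2) G'(2) in auto)
  then obtain f where f: "homeomorphic_map X X' f" "\<forall>x\<in>topspace X. r' (f x) = r x"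
    "\<forall>x. (\<exists>s\<in>G ` mspc M1. path_component_of X x s) \<longrightarrow>
      (\<exists>s\<in>G ` mspc M1. path_component_of X x s \<and> f s = G' (fst (r s)))" by (elim exE conjE)
  have "f (G x) = G' x" if x: "x \<in> mspc M1" for x
  proof -
    have "path_component_of X (G x) (G x)" using GX(1)[OF x] by (simp add: path_component_of_refl)
    hence "\<exists>s\<in>G ` mspc M1. path_component_of X (G x) s" using x by blast
    then obtain s where s: "s \<in> G ` mspc M1" "path_component_of X (G x) s" "f s = G' (fst (r s))"
      using spec[OF f(3), of "G x"] by blast
    obtain y where y: "y \<in> mspc M1" "s = G y" using s(1) by blast
    obtain w where w: "pathin X w" "w 0 = G x" "w 1 = s" using s(2) unfolding path_component_of_def by (elim exE conjE)
    \<comment> \<open>The path \<open>w\<close> may leave the section; applying \<open>G\<close> to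
      its first component gives a path within it that joins the same ends.\<close>
    let ?c = "\<lambda>t. fst (r (w t))"
    have c: "pathin (mtop M1) ?c"
      using pathin_compose[OF pathin_compose[OF w(1) r_cont] continuous_map_fst] by (simp add: comp_def)
    have c01: "?c 0 = x" "?c 1 = y" using w(2,3) y G(2) x by simp_all
    have p: "pathin X' (\<lambda>t. f (G (?c t)))" "pathin X' (\<lambda>t. G' (?c t))"
      using pathin_compose[OF pathin_compose[OF c G(1)] homeomorphic_imp_continuous_map[OF f(1)]]
        pathin_compose[OF c G'(1)] by (simp_all add: comp_def)
    have "f (G (?c 0)) = G' (?c 0)"
    proof (rule path_lift_unique[OF box_coveringD(1)[OF bc'] p, where s = 1])
      show "r' (f (G (?c t))) = r' (G' (?c t))" if "t \<in> {0..1}" for t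
        using f(2) GX(1) G(2) G'(2) pathin_subset[OF c that] by simp
      have "f s = G' y" unfolding s(3) unfolding y(2) using G(2)[OF y(1)] by simp
      thus "f (G (?c 1)) = G' (?c 1)" unfolding c01 y(2) .
    qed simp_all
    thus ?thesis unfolding c01 .
  qed
  thus ?thesis using f(1,2) by blast
qed

lemma cover_isoI:
  assumes "boxed M1 l1 z1 M2 l2 z2 X' r'" and "homeomorphic_map X X' f" and "\<And>x. x \<in> topspace X \<Longrightarrow> r' (f x) = r x"
  shows "cover_iso Q r (Q' X' r') r' f"
proof -
  interpret X': boxed M1 l1 z1 M2 l2 z2 X' r' by (rule assms(1))
  show ?thesis by (rule cover_iso_smooth_covering[OF X'.smooth_manifold_Q X'.smooth_covering_Q])
    (use assms(2,3) in simp_all)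
qed

lemma cover_iso_exists:
  assumes "boxed M1 l1 z1 M2 l2 z2 X' r'"
  shows "\<exists>f. cover_iso Q r (Q' X' r') r' f"
proof -
  interpret X': boxed M1 l1 z1 M2 l2 z2 X' r' by (rule assms)
  obtain f where "homeomorphic_map X X' f" "\<forall>x\<in>topspace X. r' (f x) = r x"
    using homeo_exists[OF X'.bc, of "{}"] by blast
  thus ?thesis using cover_isoI[OF assms] by blast
qed

lemma cover_isoD:
  assumes "cover_iso Q r (Q' X' r') r' f"
  shows "homeomorphic_map X X' f" "x \<in> topspace X \<Longrightarrow> r' (f x) = r x"
  using assms diffeo_homeomorphic_map[of Q "Q' X' r'" f] unfolding cover_iso_def by simp_all

text \<open>The deck transformation is \<open>g\<close> followed by the inverse of
  \<open>f\<close>.\<close>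

lemma cover_iso_deck:
  assumes f: "cover_iso Q r (Q' X' r') r' f"
    and g: "cover_iso Q r (Q' X' r') r' g"
  shows "\<exists>d. cover_iso Q r Q r d \<and> (\<forall>p\<in>topspace X. g p = f (d p))"
proof -
  note f = cover_isoD[OF f] and g = cover_isoD[OF g]
  obtain k where k: "homeomorphic_maps X X' f k" using f(1) unfolding homeomorphic_map_maps by (elim exE)
  have kh: "homeomorphic_map X' X k" using k by (rule homeomorphic_maps_imp_map[OF homeomorphic_maps_sym[THEN iffD1]])
  have fk: "f (k y) = y" "k y \<in> topspace X" if "y \<in> topspace X'" for y
    using k that unfolding homeomorphic_maps_def continuous_map_def Pi_iff by blast+
  have gX: "g p \<in> topspace X'" if "p \<in> topspace X" for p
    using homeomorphic_imp_continuous_map[OF g(1)] that by (simp add: continuous_map_def Pi_iff)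
  have "cover_iso Q r Q r (k \<circ> g)"
  proof (rule cover_isoI[OF boxed_axioms homeomorphic_map_compose[OF g(1) kh]])
    fix p assume p: "p \<in> topspace X"
    show "r ((k \<circ> g) p) = r p" using f(2)[OF fk(2)[OF gX[OF p]]] fk(1)[OF gX[OF p]] g(2)[OF p] by simp
  qed
  thus ?thesis using fk(1)[OF gX] by (intro exI[of _ "k \<circ> g"]) simp
qed

lemma cover_iso_minimal:
  assumes X': "smooth_manifold X'" and r': "smooth_covering X' (prod_mfd M1 M2) r'" and e: "equalizes l1 l2 (mtop X') r'"
    and min: "minimal_equalizing TYPE('x) (mtop M1) l1 (mtop M2) l2 (mtop X') r'"
  shows "\<exists>f. cover_iso Q r X' r' f"
proof -
  have "covering_map (mtop X') B r'" using smooth_covering_covering_map[OF r'] by simp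
  from minimal_box_covering[OF this e min] obtain f where "homeomorphic_map X (mtop X') f" "\<forall>x\<in>topspace X. r' (f x) = r x"
    using homeo_exists[of "mtop X'" r' "{}"] by blast
  thus ?thesis using cover_iso_smooth_covering[OF X' r'] by blast
qed

text \<open>The pullback condition says that \<open>z1\<close> on a loop equals \<open>z2\<close> on
  its image under \<open>\<phi>\<close>, so the graph map satisfies the lifting criterion.\<close>

lemma graph_lift_exists:
  assumes \<phi>: "smooth_map M1 M2 \<phi>" and pull: "H1_pullback (mtop M1) \<phi> l2 = l1"
  shows "\<exists>G. graph_lift M1 Q r \<phi> G"
proof -
  note \<phi>c = smooth_mapD(1)[OF \<phi>]
  have "cochain_pullback (mtop M1) \<phi> z2 \<in> l1"
    unfolding pull[symmetric] H1_pullback_eq[OF l2 \<phi>c] by (rule H1_class_self)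
  hence loops: "path_value z2 (\<lambda>t. \<phi> (c t)) = path_value z1 c" if "pathin (mtop M1) c" "c 0 = c 1" for c
    using H1_memD(2)[OF l1(1,2) _ that] path_value_pullback[OF that(1), of \<phi> z2] by simp
  have p: "continuous_map (mtop M1) B (\<lambda>x. (x, \<phi> x))"
    using continuous_map_pairedI[OF smooth_mapD(1)[OF smooth_map_id[OF mf1]] \<phi>c] .
  have "\<exists>G. continuous_map (mtop M1) X G \<and> (\<forall>x\<in>mspc M1. r (G x) = (x, \<phi> x)) \<and>
    (\<forall>n. (\<exists>s\<in>{}. path_component_of (mtop M1) n s) \<longrightarrow> (\<exists>s\<in>{}. path_component_of (mtop M1) n s \<and> G s = undefined s))"
  proof (rule lift_criterion[OF rcov manifold_locally_path_connected[OF mf1] p])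
    fix c w assume c: "pathin (mtop M1) c" "c 0 = c 1" and w: "pathin X w" and wc: "\<forall>t\<in>{0..1}. r (w t) = (c t, \<phi> (c t))"
    have "path_value z1 (\<lambda>t. fst (r (w t))) = path_value z1 c" "path_value z2 (\<lambda>t. snd (r (w t))) = path_value z2 (\<lambda>t. \<phi> (c t))"
      by (rule path_value_cong, simp add: wc)+
    thus "w 0 = w 1" unfolding rclosed[OF w] using wc c(2) loops[OF c] by simp
  qed simp
  thus ?thesis using graph_lift[OF \<phi>] by blast
qed

lemma graph_lift_section:
  assumes X': "boxed M1 l1 z1 M2 l2 z2 X' r'"
    and G: "graph_lift M1 Q r \<phi> G" and G': "graph_lift M1 (Q' X' r') r' \<phi> G'"
  shows "\<exists>f. cover_iso Q r (Q' X' r') r' f \<and> (\<forall>x\<in>mspc M1. f (G x) = G' x)"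
proof -
  interpret X': boxed M1 l1 z1 M2 l2 z2 X' r' by (rule X')
  obtain f where "homeomorphic_map X X' f" "\<forall>x\<in>topspace X. r' (f x) = r x" "\<forall>x\<in>mspc M1. f (G x) = G' x"
    using homeo_section[OF X'.bc graph_liftD[OF G] X'.graph_liftD[OF G']] by blast
  thus ?thesis using cover_isoI[OF X'] by blast
qed

lemma cover_iso_unique:
  assumes f: "cover_iso Q r (Q' X' r') r' f"
    and g: "cover_iso Q r (Q' X' r') r' g"
    and X': "boxed M1 l1 z1 M2 l2 z2 X' r'"
    and B: "connected_space B" and s: "s \<in> topspace X" "f s = g s" and p: "p \<in> topspace X"
  shows "f p = g p"
proof -
  interpret X': boxed M1 l1 z1 M2 l2 z2 X' r' by (rule X')
  note f = cover_isoD[OF f] and g = cover_isoD[OF g]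
  have "connected_component_of B (r s) (r p)"
    using B covering_map_in[OF rcov s(1)] covering_map_in[OF rcov p] unfolding connected_space_iff_connected_component by blast
  then obtain w where w: "pathin X w" "w 0 = s" "w 1 = p"
    using covering_map_path_component[OF rcov lpc_B rconn s(1) p] unfolding path_component_of_def by blast
  have "f (w 1) = g (w 1)"
  proof (rule path_lift_unique[OF X'.rcov, where s = 0 and f = "\<lambda>t. f (w t)" and g = "\<lambda>t. g (w t)"])
    show "pathin X' (\<lambda>t. f (w t))" "pathin X' (\<lambda>t. g (w t))"
      using pathin_compose[OF w(1) homeomorphic_imp_continuous_map[OF f(1)]]
        pathin_compose[OF w(1) homeomorphic_imp_continuous_map[OF g(1)]] by (simp_all add: comp_def)
    show "r' (f (w t)) = r' (g (w t))" if "t \<in> {0..1}" for t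
      using f(2) g(2) pathin_subset[OF w(1) that] by simp
  qed (use w s in simp_all)
  thus ?thesis unfolding w(3) .
qed

end

section \<open>The concrete box sum and its diagonal\<close>

lemma boxed_boxplus:
  assumes "smooth_manifold M1" "l1 \<in> H1 (mtop M1)" "z1 \<in> l1" "smooth_manifold M2" "l2 \<in> H1 (mtop M2)" "z2 \<in> l2"
    and "trivializing_cover (mtop M1) l1 T1 q1" "trivializing_cover (mtop M2) l2 T2 q2"
  shows "boxed M1 l1 z1 M2 l2 z2
    (quotient_topology (prod_topology T1 T2) (box_orbit (mtop M1) l1 T1 q1 (mtop M2) l2 T2 q2)) (box_proj q1 q2)"
proof -
  interpret box "mtop M1" l1 T1 q1 z1 "mtop M2" l2 T2 q2 z2
    by (unfold_locales; fact assms manifold_locally_path_connected[OF assms(1)] manifold_locally_path_connected[OF assms(4)])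
  show ?thesis by (unfold_locales; fact assms box_covering)
qed

text \<open>Two points of \<open>T\<close> over one point are joined by a path \<open>w\<close>, and
  \<open>dv\<close> vanishes along \<open>(w, w)\<close> because both factors carry the same
  cocycle; so the orbit of \<open>(y, y)\<close> depends only on \<open>q y\<close>. Continuity
  descends to \<open>M\<close> because \<open>q\<close> is open.\<close>

lemma diag_lift:
  assumes M: "smooth_manifold M" and l: "l \<in> H1 (mtop M)" and T: "trivializing_cover (mtop M) l T q"
  defines "X \<equiv> quotient_topology (prod_topology T T) (box_orbit (mtop M) l T q (mtop M) l T q)"
  shows "y \<in> topspace T \<Longrightarrow> diag_lift M l T q (q y) = box_orbit (mtop M) l T q (mtop M) l T q (y, y)"
    and "continuous_map (mtop M) X (diag_lift M l T q)"
    and "x \<in> mspc M \<Longrightarrow> box_proj q q (diag_lift M l T q x) = (x, x)"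
proof -
  obtain z where z: "z \<in> l" by (rule H1_rep[OF l])
  interpret b: box "mtop M" l T q z "mtop M" l T q z
    by (unfold_locales; fact T l z manifold_locally_path_connected[OF M])
  note cov = b.t1.cov
  have D: "diag_lift M l T q (q y) = b.orb (y, y)" if y: "y \<in> topspace T" for y
  proof -
    define y0 where "y0 = (SOME y'. y' \<in> topspace T \<and> q y' = q y)"
    have y0: "y0 \<in> topspace T \<and> q y0 = q y"
      unfolding y0_def by (rule someI[of "\<lambda>y'. y' \<in> topspace T \<and> q y' = q y" y]) (simp add: y)
    obtain w where w: "pathin T w" "w 0 = y0" "w 1 = y"
      using b.t1.path_component_fibre[of y0 y] y y0 unfolding path_component_of_def by blast
    have "b.orb (y0, y0) = b.orb (y, y)"
      using b.orb_path_iff[OF b.pathin_pair[OF w(1) w(1)]] w y0 unfolding b.dv_def by simp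
    thus ?thesis unfolding diag_lift_def Let_def y0_def .
  qed
  thus "y \<in> topspace T \<Longrightarrow> diag_lift M l T q (q y) = b.orb (y, y)" for y .
  have XO: "X = b.X" unfolding X_def ..
  show "continuous_map (mtop M) X (diag_lift M l T q)"
    unfolding continuous_map_def XO
  proof (intro conjI allI impI)
    show "diag_lift M l T q \<in> mspc M \<rightarrow> topspace b.X"
    proof
      fix x assume "x \<in> mspc M"
      then obtain y where y: "y \<in> topspace T" "x = q y" using covering_map_surj[OF cov] by blast
      show "diag_lift M l T q x \<in> topspace b.X" unfolding y(2) D[OF y(1)] b.topspace_X by (rule imageI) (simp add: y(1))
    qed
    fix O' assume O': "openin b.X O'"
    have "continuous_map T b.P (\<lambda>y. (y, y))" by (intro continuous_map_pairedI) (simp_all add: continuous_map_id[unfolded id_def])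
    from openin_continuous_map_preimage[OF continuous_map_compose[OF this b.continuous_orb] O']
    have "openin T {y \<in> topspace T. b.orb (y, y) \<in> O'}" by simp
    hence "openin (mtop M) (q ` {y \<in> topspace T. b.orb (y, y) \<in> O'})"
      using covering_map_open_map[OF cov] unfolding open_map_def by blast
    moreover have "q ` {y \<in> topspace T. b.orb (y, y) \<in> O'} = {x \<in> mspc M. diag_lift M l T q x \<in> O'}"
    proof (rule subset_antisym; rule subsetI)
      fix x assume "x \<in> q ` {y \<in> topspace T. b.orb (y, y) \<in> O'}"
      then obtain y where y: "y \<in> topspace T" "b.orb (y, y) \<in> O'" "x = q y" by blast
      show "x \<in> {x \<in> mspc M. diag_lift M l T q x \<in> O'}"
        unfolding y(3) mem_Collect_eq D[OF y(1)] using y(2) covering_map_in[OF cov y(1)] by (rule conjI[rotated])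
    next
      fix x assume x: "x \<in> {x \<in> mspc M. diag_lift M l T q x \<in> O'}"
      then obtain y where y: "y \<in> topspace T" "x = q y" using covering_map_surj[OF cov] by blast
      have "b.orb (y, y) \<in> O'" using x unfolding y(2) mem_Collect_eq D[OF y(1)] by (rule conjunct2)
      thus "x \<in> q ` {y \<in> topspace T. b.orb (y, y) \<in> O'}" using y by blast
    qed
    ultimately show "openin (mtop M) {x \<in> mspc M. diag_lift M l T q x \<in> O'}" by simp
  qed
  show "box_proj q q (diag_lift M l T q x) = (x, x)" if "x \<in> mspc M"
  proof -
    have "x \<in> q ` topspace T" using that unfolding covering_map_surj[OF cov] .
    then obtain y where y: "y \<in> topspace T" "x = q y" by (elim imageE) blast
    show ?thesis unfolding y(2) D[OF y(1)] by (subst b.proj_orb) (simp_all add: y(1))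
  qed
qed

lemma pathin_slice:
  assumes "continuous_map (prod_topology I01 X) Y F" "p \<in> topspace X"
  shows "pathin Y (\<lambda>t. F (t, p))"
proof -
  have "continuous_map I01 (prod_topology I01 X) (\<lambda>t. (t, p))"
    using assms(2) by (intro continuous_map_pairedI) (simp_all add: continuous_map_id[unfolded id_def])
  from continuous_map_compose[OF this assms(1)] show ?thesis unfolding pathin_def comp_def .
qed

lemma continuous_slice:
  assumes "continuous_map (prod_topology I01 X) Y F" "t \<in> {0..1::real}"
  shows "continuous_map X Y (\<lambda>p. F (t, p))"
proof -
  have "continuous_map X (prod_topology I01 X) (\<lambda>p. (t, p))"
    using assms(2) by (intro continuous_map_pairedI) (simp_all add: continuous_map_id[unfolded id_def])
  from continuous_map_compose[OF this assms(1)] show ?thesis unfolding comp_def .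
qed

section \<open>Lifted families of diffeomorphisms and fixed points\<close>

locale self_boxed = boxed M l z M l z X r
  for M :: "('a, 'e::euclidean_space) mfd" and l z and X :: "'x topology" and r +
  fixes D
  assumes D: "continuous_map (mtop M) X D" "\<And>x. x \<in> mspc M \<Longrightarrow> r (D x) = (x, x)"
begin

text \<open>The homotopy \<open>(t, p) \<mapsto> (id \<times> \<phi>\<^sub>t)(r p)\<close> is lifted
  from the identity. To invert \<open>\<psi>\<close> at time \<open>t0\<close>, the family is run
  from \<open>t0\<close> back to 0 after applying the inverse \<open>k\<close> of
  \<open>\<phi> t0\<close>; the lift of this second homotopy ends in the inverse.\<close>

lemma family:
  assumes sf: "smooth_family M M \<phi>" and dif: "\<And>t. t \<in> {0..1} \<Longrightarrow> diffeo M M (\<phi> t)"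
    and \<phi>0: "\<And>x. x \<in> mspc M \<Longrightarrow> \<phi> 0 x = x"
  obtains \<psi> where "family_lift Q r \<phi> \<psi>" "\<And>t. t \<in> {0..1} \<Longrightarrow> diffeo Q Q (\<psi> t)"
proof -
  let ?I = I01
  let ?Y = "prod_topology ?I X"
  have \<Phi>: "continuous_map (prod_topology ?I (mtop M)) (mtop M) (\<lambda>(t, x). \<phi> t x)"
    using sf unfolding smooth_family_def by (rule conjunct1)
  have rs: "continuous_map ?Y B (\<lambda>y. r (snd y))"
    using continuous_map_compose[OF continuous_map_snd r_cont] by (simp add: comp_def)
  have r1: "continuous_map ?Y (mtop M) (\<lambda>y. fst (r (snd y)))" and r2: "continuous_map ?Y (mtop M) (\<lambda>y. snd (r (snd y)))"
    using continuous_map_compose[OF rs continuous_map_fst] continuous_map_compose[OF rs continuous_map_snd]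
    by (simp_all add: comp_def)
  \<comment> \<open>Covers both homotopies to be lifted: forwards with \<open>a\<close> and
    \<open>k\<close> the identity, backwards with reversed time and \<open>k\<close> the inverse of
    \<open>\<phi> t0\<close>.\<close>
  have cK: "continuous_map ?Y B (\<lambda>y. (fst (r (snd y)), \<phi> (a (fst y)) (k (snd (r (snd y))))))"
    if a: "continuous_map ?I ?I a" and k: "continuous_map (mtop M) (mtop M) k" for a k
  proof -
    have "continuous_map ?Y (prod_topology ?I (mtop M)) (\<lambda>y. (a (fst y), k (snd (r (snd y)))))"
      using continuous_map_compose[OF continuous_map_fst a] continuous_map_compose[OF r2 k]
      by (intro continuous_map_pairedI) (simp_all add: comp_def)
    from continuous_map_compose[OF this \<Phi>] show ?thesis using r1 by (intro continuous_map_pairedI) (simp_all add: comp_def)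
  qed
  have idX: "continuous_map X X (\<lambda>p. p)" by (simp add: continuous_map_id[unfolded id_def])
  have idI: "continuous_map ?I ?I (\<lambda>t. t)" and idM: "continuous_map (mtop M) (mtop M) (\<lambda>x. x)"
    by (simp_all add: continuous_map_id[unfolded id_def])
  have f0: "r p = (fst (r (snd (0, p))), \<phi> (fst (0, p)) (snd (r (snd (0, p)))))" if "p \<in> topspace X" for p
    using \<phi>0 r_in[OF that] by simp
  obtain \<Psi> where \<Psi>: "continuous_map ?Y X \<Psi>" "\<And>p. p \<in> topspace X \<Longrightarrow> \<Psi> (0, p) = p"
    "\<And>t p. t \<in> {0..1} \<Longrightarrow> p \<in> topspace X \<Longrightarrow>
      r (\<Psi> (t, p)) = (fst (r (snd (t, p))), \<phi> (fst (t, p)) (snd (r (snd (t, p)))))"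
    by (rule homotopy_lift[OF rcov cK[OF idI idM] idX f0]; (assumption | (rule that; simp)))
  define \<psi> where "\<psi> = (\<lambda>t p. \<Psi> (t, p))"
  have r\<psi>: "r (\<psi> t p) = (fst (r p), \<phi> t (snd (r p)))" if "t \<in> {0..1}" "p \<in> topspace X" for t p
    unfolding \<psi>_def using \<Psi>(3)[OF that] by simp
  have r\<psi>': "r (\<psi> t p) = map_prod id (\<phi> t) (r p)" if "t \<in> {0..1}" "p \<in> topspace X" for t p
    unfolding r\<psi>[OF that] by (simp add: map_prod_def case_prod_unfold)
  have \<psi>c: "continuous_map ?Y X (\<lambda>(t, p). \<psi> t p)" unfolding \<psi>_def using \<Psi>(1) by simp
  have \<psi>X: "\<psi> t p \<in> topspace X" if "t \<in> {0..1}" "p \<in> topspace X" for t p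
    using continuous_slice[OF \<Psi>(1) that(1)] that(2) unfolding \<psi>_def by (simp add: continuous_map_def Pi_iff)
  have \<psi>p: "pathin X (\<lambda>t. \<psi> t p)" if "p \<in> topspace X" for p unfolding \<psi>_def by (rule pathin_slice[OF \<Psi>(1) that])
  have fl: "family_lift Q r \<phi> \<psi>"
    unfolding family_lift_def using smooth_family_lift[OF sf \<psi>c r\<psi>'] \<Psi>(2) r\<psi>' by (simp add: \<psi>_def)
  have "diffeo Q Q (\<psi> t0)" if t0: "t0 \<in> {0..1}" for t0
  proof -
    obtain k where k: "smooth_map M M k" "\<forall>x\<in>mspc M. k (\<phi> t0 x) = x" "\<forall>x\<in>mspc M. \<phi> t0 (k x) = x"
      using dif[OF t0] unfolding diffeo_def by (elim exE conjE)
    have kM: "k x \<in> mspc M" if "x \<in> mspc M" for x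
      using smooth_mapD(1)[OF k(1)] that by (simp add: continuous_map_def Pi_iff)
    \<comment> \<open>At the start \<open>\<phi> t0 \<circ> k\<close> is the identity, so the lift
      can begin with the identity of \<open>X\<close>. At the end \<open>\<phi> 0 \<circ> k\<close>
      is \<open>k\<close>, so the lift then lies over the identity times the inverse.\<close>
    let ?a = "\<lambda>s. t0 * (1 - s)"
    have aI: "?a s \<in> {0..1}" if "s \<in> {0..1}" for s using t0 that by (auto intro!: mult_le_one)
    have ac: "continuous_map ?I ?I ?a"
      using aI by (auto simp: continuous_map_in_subtopology intro!: continuous_intros)
    have f1: "r p = (fst (r (snd (0, p))), \<phi> (?a (fst (0, p))) (k (snd (r (snd (0, p))))))" if "p \<in> topspace X" for p
      using k(3) r_in[OF that] by simp
    obtain \<kappa>' where \<kappa>': "continuous_map ?Y X \<kappa>'" "\<And>p. p \<in> topspace X \<Longrightarrow> \<kappa>' (0, p) = p"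
      "\<And>t p. t \<in> {0..1} \<Longrightarrow> p \<in> topspace X \<Longrightarrow>
        r (\<kappa>' (t, p)) = (fst (r (snd (t, p))), \<phi> (?a (fst (t, p))) (k (snd (r (snd (t, p))))))"
      by (rule homotopy_lift[OF rcov cK[OF ac smooth_mapD(1)[OF k(1)]] idX f1]; (assumption | (rule that; simp)))
    define g where "g = (\<lambda>p. \<kappa>' (1, p))"
    have gc: "continuous_map X X g" unfolding g_def by (rule continuous_slice[OF \<kappa>'(1)]) simp
    have gX: "g p \<in> topspace X" if "p \<in> topspace X" for p using gc that by (simp add: continuous_map_def Pi_iff)
    have rg: "r (g p) = (fst (r p), k (snd (r p)))" if p: "p \<in> topspace X" for p
      unfolding g_def using \<kappa>'(3)[OF _ p, of 1] \<phi>0 kM r_in[OF p] by simp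
    have \<psi>a: "pathin X (\<lambda>s. \<psi> (?a s) p)" if "p \<in> topspace X" for p
      by (rule pathin_reparam[OF \<psi>p[OF that]]) (use aI in \<open>auto intro!: continuous_intros\<close>)
    have \<psi>0: "\<psi> (?a 1) p = p" "\<psi> (?a 0) p = \<psi> t0 p" if "p \<in> topspace X" for p
      using \<Psi>(2)[OF that] unfolding \<psi>_def by simp_all
    have \<psi>t0: "continuous_map X X (\<psi> t0)" unfolding \<psi>_def by (rule continuous_slice[OF \<Psi>(1) t0])
    have g\<psi>: "g (\<psi> t0 p) = p" if p: "p \<in> topspace X" for p
    proof -
      \<comment> \<open>With a variable time in place of 1, both sides lift the same path and start
        at \<open>\<psi> t0 p\<close>.\<close>
      have "\<kappa>' (1, \<psi> t0 p) = \<psi> (?a 1) p"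
      proof (rule path_lift_unique[OF rcov pathin_slice[OF \<kappa>'(1) \<psi>X[OF t0 p]] \<psi>a[OF p], where s = 0])
        show "r (\<kappa>' (t, \<psi> t0 p)) = r (\<psi> (?a t) p)" if t: "t \<in> {0..1}" for t
          unfolding \<kappa>'(3)[OF t \<psi>X[OF t0 p]] r\<psi>[OF aI[OF t] p] snd_conv fst_conv r\<psi>[OF t0 p] using k(2) r_in[OF p] by simp
        show "\<kappa>' (0, \<psi> t0 p) = \<psi> (?a 0) p" unfolding \<psi>0(2)[OF p] by (rule \<kappa>'(2)[OF \<psi>X[OF t0 p]])
      qed simp_all
      thus ?thesis unfolding \<psi>0(1)[OF p] g_def .
    qed
    have \<psi>g: "\<psi> t0 (g p) = p" if p: "p \<in> topspace X" for p
    proof -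
      \<comment> \<open>Here the two lifts are known to agree at time 1, and uniqueness carries the
        agreement back to time 0.\<close>
      have "\<psi> (?a 0) (g p) = \<kappa>' (0, p)"
      proof (rule path_lift_unique[OF rcov \<psi>a[OF gX[OF p]] pathin_slice[OF \<kappa>'(1) p], where s = 1])
        show "r (\<psi> (?a t) (g p)) = r (\<kappa>' (t, p))" if t: "t \<in> {0..1}" for t
          unfolding \<kappa>'(3)[OF t p] r\<psi>[OF aI[OF t] gX[OF p]] rg[OF p] by simp
        show "\<psi> (?a 1) (g p) = \<kappa>' (1, p)" using \<psi>0(1)[OF gX[OF p]] by (simp only: g_def)
      qed simp_all
      thus ?thesis unfolding \<psi>0(2)[OF gX[OF p]] \<kappa>'(2)[OF p] .
    qed
    show ?thesis by (rule diffeo_lift[OF dif[OF t0] \<psi>t0 gc g\<psi> \<psi>g r\<psi>'[OF t0]])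
  qed
  thus thesis using that fl by blast
qed

context
  fixes \<phi> \<psi>
  assumes \<phi>0: "\<And>x. x \<in> mspc M \<Longrightarrow> \<phi> 0 x = x" and \<psi>: "family_lift Q r \<phi> \<psi>"
    and \<phi>s: "\<And>t. t \<in> {0..1} \<Longrightarrow> smooth_map M M (\<phi> t)"
begin

lemma family_liftD:
  assumes "family_lift Q r \<phi> \<psi>'"
  shows "p \<in> topspace X \<Longrightarrow> pathin X (\<lambda>t. \<psi>' t p)" "t \<in> {0..1} \<Longrightarrow> continuous_map X X (\<psi>' t)"
    "p \<in> topspace X \<Longrightarrow> \<psi>' 0 p = p"
    "t \<in> {0..1} \<Longrightarrow> p \<in> topspace X \<Longrightarrow> r (\<psi>' t p) = (fst (r p), \<phi> t (snd (r p)))"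
proof -
  have s: "smooth_family Q Q \<psi>'" and 0: "\<forall>p\<in>topspace X. \<psi>' 0 p = p"
    and r: "\<forall>t\<in>{0..1}. \<forall>p\<in>topspace X. r (\<psi>' t p) = map_prod id (\<phi> t) (r p)"
    using assms unfolding family_lift_def by simp_all
  have c: "continuous_map (prod_topology I01 X) X (\<lambda>(t, p). \<psi>' t p)"
    using s unfolding smooth_family_def by simp
  show "p \<in> topspace X \<Longrightarrow> pathin X (\<lambda>t. \<psi>' t p)" using pathin_slice[OF c] by simp
  show "t \<in> {0..1} \<Longrightarrow> continuous_map X X (\<psi>' t)" using continuous_slice[OF c] by simp
  show "p \<in> topspace X \<Longrightarrow> \<psi>' 0 p = p" using 0 by blast
  show "t \<in> {0..1} \<Longrightarrow> p \<in> topspace X \<Longrightarrow> r (\<psi>' t p) = (fst (r p), \<phi> t (snd (r p)))"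
    using r by (simp add: map_prod_def case_prod_unfold)
qed

lemma family_lift_unique:
  assumes \<psi>': "family_lift Q r \<phi> \<psi>'" and t: "t \<in> {0..1}" and p: "p \<in> topspace X"
  shows "\<psi>' t p = \<psi> t p"
proof (rule path_lift_unique[OF rcov family_liftD(1)[OF \<psi>' p] family_liftD(1)[OF \<psi> p] _ _ _ t, where s = 0])
  show "r (\<psi>' t p) = r (\<psi> t p)" if "t \<in> {0..1}" for t
    unfolding family_liftD(4)[OF \<psi>' that p] family_liftD(4)[OF \<psi> that p] ..
  show "\<psi>' 0 p = \<psi> 0 p" unfolding family_liftD(3)[OF \<psi>' p] family_liftD(3)[OF \<psi> p] ..
qed simp

lemma DX: "x \<in> mspc M \<Longrightarrow> D x \<in> topspace X"
  using D(1) by (simp add: continuous_map_def Pi_iff)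

lemma translate:
  assumes t: "t \<in> {0..1}"
  shows "continuous_map (mtop M) X (\<lambda>x. \<psi> t (D x))" "x \<in> mspc M \<Longrightarrow> r (\<psi> t (D x)) = (x, \<phi> t x)"
    "graph_lift M Q r (\<phi> t) (\<lambda>x. \<psi> t (D x))"
proof -
  show c: "continuous_map (mtop M) X (\<lambda>x. \<psi> t (D x))"
    using continuous_map_compose[OF D(1) family_liftD(2)[OF \<psi> t]] by (simp add: comp_def)
  show r: "r (\<psi> t (D x)) = (x, \<phi> t x)" if "x \<in> mspc M" for x
    unfolding family_liftD(4)[OF \<psi> t DX[OF that]] D(2)[OF that] by simp
  show "graph_lift M Q r (\<phi> t) (\<lambda>x. \<psi> t (D x))" by (rule graph_lift[OF \<phi>s[OF t] c r])
qed

text \<open>The path \<open>t \<mapsto> \<psi>\<^sub>t(D x)\<close> starts at \<open>D x\<close>; it is closed iff its image is closed and the values of the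
  class on its two components, of which the first is constant, agree.\<close>

lemma returns_iff:
  assumes x: "x \<in> mspc M"
  shows "D x = \<psi> 1 (D x) \<longleftrightarrow> \<phi> 1 x = x \<and> H1_eval l (\<lambda>t. \<phi> t x) = 0"
proof -
  let ?w = "\<lambda>t. \<psi> t (D x)"
  have w: "pathin X ?w" by (rule family_liftD(1)[OF \<psi> DX[OF x]])
  have rw: "r (?w t) = (x, \<phi> t x)" if "t \<in> {0..1}" for t by (rule translate(2)[OF that x])
  have v1: "path_value z (\<lambda>t. fst (r (?w t))) = 0"
    using path_value_cong[of "\<lambda>t. fst (r (?w t))" "\<lambda>_. x" z] rw path_value_const[OF H1_memD(1)[OF l1] x] by simp
  have v2: "path_value z (\<lambda>t. snd (r (?w t))) = path_value z (\<lambda>t. \<phi> t x)" by (rule path_value_cong) (simp add: rw)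
  have "pathin (mtop M) (\<lambda>t. snd (r (?w t)))"
    using pathin_compose[OF pathin_compose[OF w r_cont] continuous_map_snd] by (simp add: comp_def)
  hence p: "pathin (mtop M) (\<lambda>t. \<phi> t x)" using pathin_cong[of "\<lambda>t. snd (r (?w t))" "\<lambda>t. \<phi> t x" "mtop M"] rw by simp
  have "D x = \<psi> 1 (D x) \<longleftrightarrow> ?w 0 = ?w 1" unfolding family_liftD(3)[OF \<psi> DX[OF x]] ..
  also have "\<dots> \<longleftrightarrow> \<phi> 1 x = x \<and> path_value z (\<lambda>t. \<phi> t x) = 0"
    unfolding rclosed[OF w] v1 v2 using rw[of 0] rw[of 1] \<phi>0[OF x] by auto
  also have "\<dots> \<longleftrightarrow> \<phi> 1 x = x \<and> H1_eval l (\<lambda>t. \<phi> t x) = 0"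
  proof (rule conj_cong[OF refl])
    assume "\<phi> 1 x = x"
    hence "H1_eval l (\<lambda>t. \<phi> t x) = path_value z (\<lambda>t. \<phi> t x)" using H1_eval_eq[OF l1 p] \<phi>0[OF x] by simp
    thus "(path_value z (\<lambda>t. \<phi> t x) = 0) = (H1_eval l (\<lambda>t. \<phi> t x) = 0)" by simp
  qed
  finally show ?thesis .
qed

text \<open>An intersection point \<open>D x = \<psi> 1 (D y)\<close> has first component
  \<open>x\<close> on one side and \<open>y\<close> on the other. Hence \<open>x = y\<close>, and
  \<open>returns_iff\<close> describes which points \<open>x\<close> occur.\<close>

lemma fixed_points:
  defines "F \<equiv> {x\<in>mspc M. \<phi> 1 x = x \<and> H1_eval l (\<lambda>t. \<phi> t x) = 0}"
  shows "bij_betw D F (D ` mspc M \<inter> (\<lambda>x. \<psi> 1 (D x)) ` mspc M)"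
    "x \<in> F \<Longrightarrow> transverse_at M M Q D (\<lambda>x. \<psi> 1 (D x)) (D x) \<longleftrightarrow> nondegenerate_at M (\<phi> 1) x"
proof -
  have rD: "fst (r (D x)) = x" if "x \<in> mspc M" for x using D(2)[OF that] by simp
  have FM: "x \<in> mspc M" "D x = \<psi> 1 (D x)" "\<phi> 1 x = x" if "x \<in> F" for x
    using that returns_iff[of x] unfolding F_def by simp_all
  show "bij_betw D F (D ` mspc M \<inter> (\<lambda>x. \<psi> 1 (D x)) ` mspc M)"
    unfolding bij_betw_def
  proof (intro conjI subset_antisym subsetI)
    show "inj_on D F" by (rule inj_on_inverseI[of _ "\<lambda>p. fst (r p)"]) (rule rD[OF FM(1)])
    show "p \<in> D ` mspc M \<inter> (\<lambda>x. \<psi> 1 (D x)) ` mspc M" if "p \<in> D ` F" for p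
    proof -
      obtain x where x: "x \<in> F" "p = D x" using \<open>p \<in> D ` F\<close> by (elim imageE)
      have "p \<in> (\<lambda>x. \<psi> 1 (D x)) ` mspc M" unfolding x(2) using FM(1)[OF x(1)] FM(2)[OF x(1)] by (rule rev_image_eqI)
      thus ?thesis unfolding x(2) using FM(1)[OF x(1)] by blast
    qed
    show "p \<in> D ` F" if "p \<in> D ` mspc M \<inter> (\<lambda>x. \<psi> 1 (D x)) ` mspc M" for p
    proof -
      obtain x where x: "x \<in> mspc M" "p = D x" using IntD1[OF \<open>p \<in> D ` mspc M \<inter> _\<close>] by (elim imageE)
      obtain y where y: "y \<in> mspc M" "p = \<psi> 1 (D y)" using IntD2[OF \<open>p \<in> D ` mspc M \<inter> _\<close>] by (elim imageE)
      have "fst (r p) = y" unfolding y(2) translate(2)[OF _ y(1), of 1, simplified] by simp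
      hence "y = x" using rD[OF x(1)] unfolding x(2) by simp
      have "D x = \<psi> 1 (D x)" using x(2) y(2) unfolding \<open>y = x\<close> by (rule trans[OF sym])
      hence "x \<in> F" unfolding F_def mem_Collect_eq returns_iff[OF x(1), symmetric] using x(1) by (rule conjI[rotated])
      thus ?thesis unfolding x(2) by (rule imageI)
    qed
  qed
  show "transverse_at M M Q D (\<lambda>x. \<psi> 1 (D x)) (D x) \<longleftrightarrow> nondegenerate_at M (\<phi> 1) x" if x: "x \<in> F"
  proof (rule transverse_iff_nondegenerate[OF pullback_prod_axioms \<phi>s D translate(1)])
    show "r (\<psi> 1 (D y)) = (y, \<phi> 1 y)" if "y \<in> mspc M" for y by (rule translate(2)) (simp_all add: that)
    show "\<psi> 1 (D x) = D x" by (rule FM(2)[OF x, symmetric])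
  qed (use FM(1,3)[OF x] in simp_all)
qed

end

end


section \<open>Transfer of the results to \<open>boxplus\<close>\<close>

lemma boxplus_pullback:
  "pullback_mfd (mtop (boxplus M1 l1 T1 q1 M2 l2 T2 q2)) (box_proj q1 q2) (prod_mfd M1 M2) = boxplus M1 l1 T1 q1 M2 l2 T2 q2"
  by (simp add: boxplus_def)

context
  fixes M1 :: "('a, 'e::euclidean_space) mfd" and l1 and M2 :: "('b, 'f::euclidean_space) mfd" and l2
    and T1 :: "'t1 topology" and q1 and T2 :: "'t2 topology" and q2
  assumes M1: "smooth_manifold M1" "l1 \<in> H1 (mtop M1)" and M2: "smooth_manifold M2" "l2 \<in> H1 (mtop M2)"
    and T: "trivializing_cover (mtop M1) l1 T1 q1" "trivializing_cover (mtop M2) l2 T2 q2"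
begin

abbreviation "bsum \<equiv> boxplus M1 l1 T1 q1 M2 l2 T2 q2"
abbreviation "bproj \<equiv> box_proj q1 q2"


text \<open>The same two cocycles serve for every pair of trivializing covers, also of other types,
  so that two box sums can be compared within one instance of the locale.\<close>

lemma boxed_exists:
  obtains z1 z2 where "boxed M1 l1 z1 M2 l2 z2 (mtop bsum) bproj"
    "\<And>(T1' :: 'u1 topology) q1' (T2' :: 'u2 topology) q2'. trivializing_cover (mtop M1) l1 T1' q1' \<Longrightarrow> trivializing_cover (mtop M2) l2 T2' q2' \<Longrightarrow>
      boxed M1 l1 z1 M2 l2 z2 (mtop (boxplus M1 l1 T1' q1' M2 l2 T2' q2')) (box_proj q1' q2')"
proof -
  obtain z1 where z1: "z1 \<in> l1" by (rule H1_rep[OF M1(2)])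
  obtain z2 where z2: "z2 \<in> l2" by (rule H1_rep[OF M2(2)])
  note * = boxed_boxplus[OF M1 z1 M2 z2]
  show thesis by (rule that[of z1 z2]) (simp_all add: boxplus_def * T)
qed

lemma boxplus_properties:
  "smooth_manifold bsum"
  "smooth_covering bsum (prod_mfd M1 M2) bproj"
  "equalizes l1 l2 (mtop bsum) bproj"
  "minimal_equalizing TYPE('n) (mtop M1) l1 (mtop M2) l2 (mtop bsum) bproj"
  "smooth_map M1 M2 \<phi> \<Longrightarrow> H1_pullback (mtop M1) \<phi> l2 = l1 \<Longrightarrow> \<exists>G. graph_lift M1 bsum bproj \<phi> G"
  "graph_lift M1 bsum bproj \<phi> G \<Longrightarrow> graph_lift M1 bsum bproj \<phi> G' \<Longrightarrow>
    \<exists>d. cover_iso bsum bproj bsum bproj d \<and> (\<forall>x\<in>mspc M1. G' x = d (G x))"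
proof -
  obtain z1 z2 where bx: "boxed M1 l1 z1 M2 l2 z2 (mtop bsum) bproj" by (rule boxed_exists)
  interpret b: boxed M1 l1 z1 M2 l2 z2 "mtop bsum" "bproj" by (rule bx)
  show "smooth_manifold bsum" "smooth_covering bsum (prod_mfd M1 M2) bproj"
    using b.smooth_manifold_Q b.smooth_covering_Q unfolding boxplus_pullback .
  show "equalizes l1 l2 (mtop bsum) bproj"
    "minimal_equalizing TYPE('n) (mtop M1) l1 (mtop M2) l2 (mtop bsum) bproj" by (rule b.r_equalizes b.r_minimal)+
  show "smooth_map M1 M2 \<phi> \<Longrightarrow> H1_pullback (mtop M1) \<phi> l2 = l1 \<Longrightarrow> \<exists>G. graph_lift M1 bsum bproj \<phi> G"
    by (rule b.graph_lift_exists[unfolded boxplus_pullback])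
  show "\<exists>d. cover_iso bsum bproj bsum bproj d \<and> (\<forall>x\<in>mspc M1. G' x = d (G x))"
    if "graph_lift M1 bsum bproj \<phi> G" "graph_lift M1 bsum bproj \<phi> G'"
    using b.graph_lift_section[OF bx, unfolded boxplus_pullback, OF that] by (elim exE conjE) (intro exI conjI, assumption, simp)
qed

lemma boxplus_cover_iso:
  assumes "trivializing_cover (mtop M1) l1 T1' q1'" "trivializing_cover (mtop M2) l2 T2' q2'"
  shows "\<exists>f. cover_iso bsum bproj (boxplus M1 l1 T1' q1' M2 l2 T2' q2') (box_proj q1' q2') f"
    and "cover_iso bsum bproj (boxplus M1 l1 T1' q1' M2 l2 T2' q2') (box_proj q1' q2') f \<Longrightarrow>
      cover_iso bsum bproj (boxplus M1 l1 T1' q1' M2 l2 T2' q2') (box_proj q1' q2') g \<Longrightarrow>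
      \<exists>d. cover_iso bsum bproj bsum bproj d \<and> (\<forall>p\<in>mspc bsum. g p = f (d p))"
proof -
  obtain z1 z2 where bx: "boxed M1 l1 z1 M2 l2 z2 (mtop bsum) bproj"
    and bx': "boxed M1 l1 z1 M2 l2 z2 (mtop (boxplus M1 l1 T1' q1' M2 l2 T2' q2')) (box_proj q1' q2')"
    by (rule boxed_exists) (use assms in blast)
  interpret b: boxed M1 l1 z1 M2 l2 z2 "mtop bsum" "bproj" by (rule bx)
  show "\<exists>f. cover_iso bsum bproj (boxplus M1 l1 T1' q1' M2 l2 T2' q2') (box_proj q1' q2') f"
    by (rule b.cover_iso_exists[OF bx', unfolded boxplus_pullback])
  show "cover_iso bsum bproj (boxplus M1 l1 T1' q1' M2 l2 T2' q2') (box_proj q1' q2') f \<Longrightarrow>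
      cover_iso bsum bproj (boxplus M1 l1 T1' q1' M2 l2 T2' q2') (box_proj q1' q2') g \<Longrightarrow>
      \<exists>d. cover_iso bsum bproj bsum bproj d \<and> (\<forall>p\<in>mspc bsum. g p = f (d p))"
    by (rule b.cover_iso_deck[where r' = "box_proj q1' q2'" and X' = "mtop (boxplus M1 l1 T1' q1' M2 l2 T2' q2')", unfolded boxplus_pullback])
qed

lemma boxplus_cover_iso_minimal:
  assumes "smooth_manifold X'" "smooth_covering X' (prod_mfd M1 M2) r'" "equalizes l1 l2 (mtop X') r'"
    "minimal_equalizing TYPE(('t1 \<times> 't2) set) (mtop M1) l1 (mtop M2) l2 (mtop X') r'"
  shows "\<exists>f. cover_iso bsum bproj X' r' f"
proof -
  obtain z1 z2 where bx: "boxed M1 l1 z1 M2 l2 z2 (mtop bsum) bproj" by (rule boxed_exists)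
  show ?thesis using boxed.cover_iso_minimal[OF bx assms] unfolding boxplus_pullback .
qed

end

abbreviation "sum2 M l T q \<equiv> boxplus M l T q M l T q"

context
  fixes M :: "('a, 'e::euclidean_space) mfd" and l and T :: "'t topology" and q
  assumes M: "smooth_manifold M" "l \<in> H1 (mtop M)" and T: "trivializing_cover (mtop M) l T q"
begin

lemma self_boxed_exists:
  obtains z where "self_boxed M l z (mtop (sum2 M l T q)) (box_proj q q) (diag_lift M l T q)"
proof -
  obtain z where z: "z \<in> l" by (rule H1_rep[OF M(2)])
  note * = boxed_boxplus[OF M z M z T T]
  have "self_boxed M l z (mtop (sum2 M l T q)) (box_proj q q) (diag_lift M l T q)"
    using * diag_lift(2,3)[OF M T] by (intro self_boxed.intro self_boxed_axioms.intro) (simp_all add: boxplus_def)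
  thus thesis by (rule that)
qed

lemma diag_lift_graph: "graph_lift M (sum2 M l T q) (box_proj q q) id (diag_lift M l T q)"
proof -
  obtain z where bx: "self_boxed M l z (mtop (sum2 M l T q)) (box_proj q q) (diag_lift M l T q)" by (rule self_boxed_exists)
  interpret b: self_boxed M l z "mtop (sum2 M l T q)" "box_proj q q" "diag_lift M l T q" by (rule bx)
  show ?thesis using b.graph_lift[OF smooth_map_id[OF M(1)] b.D] unfolding boxplus_pullback id_def .
qed

lemma family_lift_exists:
  assumes sf: "smooth_family M M \<phi>" and dif: "\<forall>t\<in>{0..1}. diffeo M M (\<phi> t)" and \<phi>0: "\<forall>x\<in>mspc M. \<phi> 0 x = x"
  shows "\<exists>\<psi> G.
    family_lift (sum2 M l T q) (box_proj q q) \<phi> \<psi> \<and> (\<forall>t\<in>{0..1}. diffeo (sum2 M l T q) (sum2 M l T q) (\<psi> t)) \<and>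
    (\<forall>\<psi>'. family_lift (sum2 M l T q) (box_proj q q) \<phi> \<psi>' \<longrightarrow> (\<forall>t\<in>{0..1}. \<forall>p\<in>mspc (sum2 M l T q). \<psi>' t p = \<psi> t p)) \<and>
    (\<forall>t\<in>{0..1}. graph_lift M (sum2 M l T q) (box_proj q q) (\<phi> t) (G t)) \<and>
    (\<forall>t\<in>{0..1}. \<forall>x\<in>mspc M. G t x = \<psi> t (diag_lift M l T q x)) \<and>
    bij_betw (diag_lift M l T q) {x\<in>mspc M. \<phi> 1 x = x \<and> H1_eval l (\<lambda>t. \<phi> t x) = 0}
      (diag_lift M l T q ` mspc M \<inter> G 1 ` mspc M) \<and>
    (\<forall>x\<in>{x\<in>mspc M. \<phi> 1 x = x \<and> H1_eval l (\<lambda>t. \<phi> t x) = 0}.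
      transverse_at M M (sum2 M l T q) (diag_lift M l T q) (G 1) (diag_lift M l T q x) \<longleftrightarrow> nondegenerate_at M (\<phi> 1) x)"
proof -
  obtain z where bx: "self_boxed M l z (mtop (sum2 M l T q)) (box_proj q q) (diag_lift M l T q)" by (rule self_boxed_exists)
  interpret b: self_boxed M l z "mtop (sum2 M l T q)" "box_proj q q" "diag_lift M l T q" by (rule bx)
  obtain \<psi> where \<psi>: "family_lift b.Q (box_proj q q) \<phi> \<psi>" "\<And>t. t \<in> {0..1} \<Longrightarrow> diffeo b.Q b.Q (\<psi> t)"
    by (rule b.family[OF sf bspec[OF dif] bspec[OF \<phi>0]]; (assumption | (rule that; blast)))
  have \<phi>s: "smooth_map M M (\<phi> t)" if "t \<in> {0..1}" for t using bspec[OF dif that] unfolding diffeo_def by (rule conjunct1)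
  note c = bspec[OF \<phi>0] \<psi>(1) \<phi>s
  show ?thesis
    using \<psi> b.family_lift_unique[OF c] b.translate(3)[OF c] b.fixed_points[OF c] unfolding boxplus_pullback
    by (intro exI[of _ \<psi>] exI[of _ "\<lambda>t x. \<psi> t (diag_lift M l T q x)"] conjI ballI allI impI) (assumption | rule refl | simp only:)+
qed

end

context
  fixes M :: "('a, 'e::euclidean_space) mfd" and l and T :: "'t topology" and q
  assumes M: "smooth_manifold M" "l \<in> H1 (mtop M)" and T: "trivializing_cover (mtop M) l T q"
begin

text \<open>Both diagonals lift the graph of the identity, so \<open>graph_lift_section\<close>
  gives existence. For connected \<open>M\<close> the product is connected, and agreement at one
  diagonal point determines the isomorphism. The context is reopened because
  \<open>diag_lift_graph\<close> is applied to covers of two types.\<close>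

lemma diag_lift_cover_iso:
  assumes T': "trivializing_cover (mtop M) l T' q'"
  shows "\<exists>f. cover_iso (sum2 M l T q) (box_proj q q) (sum2 M l T' q') (box_proj q' q') f \<and> (\<forall>x\<in>mspc M. f (diag_lift M l T q x) = diag_lift M l T' q' x)"
    and "connected_space (mtop M) \<Longrightarrow> cover_iso (sum2 M l T q) (box_proj q q) (sum2 M l T' q') (box_proj q' q') f \<Longrightarrow>
      \<forall>x\<in>mspc M. f (diag_lift M l T q x) = diag_lift M l T' q' x \<Longrightarrow>
      cover_iso (sum2 M l T q) (box_proj q q) (sum2 M l T' q') (box_proj q' q') g \<Longrightarrow>
      \<forall>x\<in>mspc M. g (diag_lift M l T q x) = diag_lift M l T' q' x \<Longrightarrow> \<forall>p\<in>mspc (sum2 M l T q). f p = g p"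
proof -
  obtain z where z: "z \<in> l" by (rule H1_rep[OF M(2)])
  have bx: "boxed M l z M l z (mtop (sum2 M l T q)) (box_proj q q)" and bx': "boxed M l z M l z (mtop (sum2 M l T' q')) (box_proj q' q')"
    using boxed_boxplus[OF M z M z T T] boxed_boxplus[OF M z M z T' T'] by (simp_all add: boxplus_def)
  interpret b: boxed M l z M l z "mtop (sum2 M l T q)" "box_proj q q" by (rule bx)
  show "\<exists>f. cover_iso (sum2 M l T q) (box_proj q q) (sum2 M l T' q') (box_proj q' q') f \<and> (\<forall>x\<in>mspc M. f (diag_lift M l T q x) = diag_lift M l T' q' x)"
    by (rule b.graph_lift_section[OF bx', unfolded boxplus_pullback, OF diag_lift_graph[OF M T] diag_lift_graph[OF M T']])
  assume conn: "connected_space (mtop M)" and f: "cover_iso (sum2 M l T q) (box_proj q q) (sum2 M l T' q') (box_proj q' q') f"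
    and fD: "\<forall>x\<in>mspc M. f (diag_lift M l T q x) = diag_lift M l T' q' x"
    and g: "cover_iso (sum2 M l T q) (box_proj q q) (sum2 M l T' q') (box_proj q' q') g"
    and gD: "\<forall>x\<in>mspc M. g (diag_lift M l T q x) = diag_lift M l T' q' x"
  show "\<forall>p\<in>mspc (sum2 M l T q). f p = g p"
  proof
    fix p assume p: "p \<in> mspc (sum2 M l T q)"
    have x: "fst (box_proj q q p) \<in> mspc M" using b.r_in[OF p] by (rule conjunct1)
    have s: "diag_lift M l T q (fst (box_proj q q p)) \<in> mspc (sum2 M l T q)"
      using diag_lift(2)[OF M T] x by (simp add: boxplus_def continuous_map_def Pi_iff)
    have "connected_space (prod_topology (mtop M) (mtop M))" using conn by (simp add: connected_space_prod_topology)
    thus "f p = g p"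
      using b.cover_iso_unique[where X' = "mtop (sum2 M l T' q')" and r' = "box_proj q' q'", unfolded boxplus_pullback, OF f g bx' _ s _ p]
        bspec[OF fD x] bspec[OF gD x] by simp
  qed
qed

end

theorem theorem1p5:
  fixes M1 :: "('a, 'e::euclidean_space) mfd" and l1 :: "'a cochain set"
    and M2 :: "('b, 'f::euclidean_space) mfd" and l2 :: "'b cochain set"
  assumes "smooth_manifold M1" and "l1 \<in> H1 (mtop M1)"
    and "smooth_manifold M2" and "l2 \<in> H1 (mtop M2)"
  shows
    "(\<exists>(T1 :: (real \<Rightarrow> 'a) set topology) q1. trivializing_cover (mtop M1) l1 T1 q1) \<and>
     (\<exists>(T2 :: (real \<Rightarrow> 'b) set topology) q2. trivializing_cover (mtop M2) l2 T2 q2) \<and>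
     (\<forall>(T1 :: 't1 topology) q1 (T2 :: 't2 topology) q2.
        trivializing_cover (mtop M1) l1 T1 q1 \<and> trivializing_cover (mtop M2) l2 T2 q2 \<longrightarrow>
        (let X = boxplus M1 l1 T1 q1 M2 l2 T2 q2; r = box_proj q1 q2 in
         smooth_manifold X \<and> smooth_covering X (prod_mfd M1 M2) r \<and>
         \<comment> \<open>canonical up to deck transformations\<close>
         (\<forall>(T1' :: 'u1 topology) q1' (T2' :: 'u2 topology) q2'.
            trivializing_cover (mtop M1) l1 T1' q1' \<and> trivializing_cover (mtop M2) l2 T2' q2' \<longrightarrow>
            (let X' = boxplus M1 l1 T1' q1' M2 l2 T2' q2'; r' = box_proj q1' q2' in
             (\<exists>f. cover_iso X r X' r' f) \<and>
             (\<forall>f g. cover_iso X r X' r' f \<and> cover_iso X r X' r' g \<longrightarrow>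
                (\<exists>d. cover_iso X r X r d \<and> (\<forall>p\<in>mspc X. g p = f (d p)))))) \<and>
         (\<forall>(X' :: ('x, 'g::euclidean_space) mfd) r'.
            smooth_manifold X' \<and> smooth_covering X' (prod_mfd M1 M2) r' \<and>
            equalizes l1 l2 (mtop X') r' \<and>
            minimal_equalizing TYPE(('t1 \<times> 't2) set) (mtop M1) l1 (mtop M2) l2 (mtop X') r' \<longrightarrow>
            (\<exists>f. cover_iso X r X' r' f)) \<and>
         \<comment> \<open>(1)\<close>
         equalizes l1 l2 (mtop X) r \<and>
         minimal_equalizing TYPE('n) (mtop M1) l1 (mtop M2) l2 (mtop X) r \<and>
         \<comment> \<open>(2)\<close>
         (\<forall>\<phi>. smooth_map M1 M2 \<phi> \<and> H1_pullback (mtop M1) \<phi> l2 = l1 \<longrightarrow>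
            (\<exists>G. graph_lift M1 X r \<phi> G) \<and>
            (\<forall>G G'. graph_lift M1 X r \<phi> G \<and> graph_lift M1 X r \<phi> G' \<longrightarrow>
               (\<exists>d. cover_iso X r X r d \<and> (\<forall>x\<in>mspc M1. G' x = d (G x))))))) \<and>
     \<comment> \<open>(3)\<close>
     (\<forall>(M :: ('a, 'e) mfd) l (T :: 't1 topology) q.
        smooth_manifold M \<and> l \<in> H1 (mtop M) \<and> trivializing_cover (mtop M) l T q \<longrightarrow>
        (let X = boxplus M l T q M l T q; r = box_proj q q; D = diag_lift M l T q in
         (\<forall>y\<in>topspace T. D (q y) = box_orbit (mtop M) l T q (mtop M) l T q (y, y)) \<and>
         graph_lift M X r id D \<and>
         \<comment> \<open>canonical\<close>
         (\<forall>(T' :: 'u1 topology) q'. trivializing_cover (mtop M) l T' q' \<longrightarrow>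
            (let X' = boxplus M l T' q' M l T' q'; r' = box_proj q' q'; D' = diag_lift M l T' q' in
             (\<exists>f. cover_iso X r X' r' f \<and> (\<forall>x\<in>mspc M. f (D x) = D' x)) \<and>
             (connected_space (mtop M) \<longrightarrow>
                (\<forall>f g. cover_iso X r X' r' f \<and> (\<forall>x\<in>mspc M. f (D x) = D' x) \<and>
                       cover_iso X r X' r' g \<and> (\<forall>x\<in>mspc M. g (D x) = D' x) \<longrightarrow>
                       (\<forall>p\<in>mspc X. f p = g p))))) \<and>
         (\<forall>\<phi>. smooth_family M M \<phi> \<and> (\<forall>t\<in>{0..1}. diffeo M M (\<phi> t)) \<and> (\<forall>x\<in>mspc M. \<phi> 0 x = x) \<longrightarrow>
            (\<exists>\<psi> G.
               family_lift X r \<phi> \<psi> \<and> (\<forall>t\<in>{0..1}. diffeo X X (\<psi> t)) \<and>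
               (\<forall>\<psi>'. family_lift X r \<phi> \<psi>' \<longrightarrow> (\<forall>t\<in>{0..1}. \<forall>p\<in>mspc X. \<psi>' t p = \<psi> t p)) \<and>
               (\<forall>t\<in>{0..1}. graph_lift M X r (\<phi> t) (G t)) \<and>
               (\<forall>t\<in>{0..1}. \<forall>x\<in>mspc M. G t x = \<psi> t (D x)) \<and>
               (let F = {x\<in>mspc M. \<phi> 1 x = x \<and> H1_eval l (\<lambda>t. \<phi> t x) = 0} in
                bij_betw D F (D ` mspc M \<inter> G 1 ` mspc M) \<and>
                (\<forall>x\<in>F. transverse_at M M X D (G 1) (D x) \<longleftrightarrow> nondegenerate_at M (\<phi> 1) x))))))"
proof (unfold Let_def, intro conjI allI impI; (elim conjE)?)
  show "\<exists>(T1 :: (real \<Rightarrow> 'a) set topology) q1. trivializing_cover (mtop M1) l1 T1 q1"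
    by (rule trivializing_cover_exists[OF assms(1,2)])
  show "\<exists>(T2 :: (real \<Rightarrow> 'b) set topology) q2. trivializing_cover (mtop M2) l2 T2 q2"
    by (rule trivializing_cover_exists[OF assms(3,4)])
qed (rule boxplus_properties[OF assms] boxplus_cover_iso[OF assms] boxplus_cover_iso_minimal[OF assms]
    ballI[OF diag_lift(1)] diag_lift_graph diag_lift_cover_iso family_lift_exists; assumption)+

end
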